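(* Let $A$ be an $R$-algebra, $\omega\in\mathrm{DR}^2_RA$ a bi-symplectic 2-form, $\mathbf w\in A$ a representative of the class $\mu_{\mathrm{nc}}(\omega)\in A/R$, $A_{\mathbf w}:=A/A\mathbf wA$, and let $\omega_{\mathbf w}\in\mathrm{DR}^2_RA_{\mathbf w}$ be the image of $\omega$. Then: (i) The bi-symplectic form $\omega$ gives rise, canonically, to a Hamilton operator $\mathsf H_{\mathbf w}:K^1_R(A_{\mathbf w})\to HH^1_R(A_{\mathbf w})$ for the $HH^1_R(A_{\mathbf w})$-equivariant complex $K^\bullet_R(A_{\mathbf w})$, such that $i_{\mathsf H_{\mathbf w}(\alpha)}\omega_{\mathbf w}=\alpha$ for any $\alpha\in K^1_R(A_{\mathbf w})$. (ii) With the Lie bracket on $(A_{\mathbf w})_\natural=K^0_R(A_{\mathbf w})$ induced by the Hamilton operator $\mathsf H_{\mathbf w}$ from (i), the natural projection $A_\natural\to(A_{\mathbf w})_\natural$ becomes a Lie algebra morphism. (iii) If the algebra $A$ is smooth then the maps $\mathbf i:HH^1_R(A_{\mathbf w})\to K^1_R(A_{\mathbf w})$, $\theta\mapsto i_\theta\omega_{\mathbf w}$, and $\mathsf H_{\mathbf w}$ are mutually inverse bijections.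
   Context: $\Bbbk$ is a field of characteristic $0$, $\otimes=\otimes_\Bbbk$, and $R$ is a finite dimensional semisimple $\Bbbk$-algebra with a fixed symmetric separability element $\mathbf e=\mathbf e'\otimes\mathbf e''=\sum_i e_i\otimes e^i\in R\otimes R$ (that is, $r\mathbf e=\mathbf e r$ for $r\in R$, $\sum_i e_ie^i=1$, and $\mathbf e$ is flip-invariant). An $R$-algebra is a unital associative $\Bbbk$-algebra $A$ with a unit preserving embedding $R\hookrightarrow A$ (for the quotient $A_{\mathbf w}$ the map from $R$ need not be injective). $A^e=A\otimes A^{\mathrm{op}}$; for an $A$-bimodule $M$, $M_\natural:=M/[A,M]$. Forms: $\Omega^1_RA=\ker(A\otimes_RA\to A)$, $da=a\otimes1-1\otimes a$; $\Omega^\bullet_RA=T_A^\bullet(\Omega^1_RA)$ with its DG algebra structure; $\mathrm{DR}^\bullet_RA=\Omega^\bullet_RA/[\Omega^\bullet_RA,\Omega^\bullet_RA]_{\mathrm{super}}$ with induced differential $d$; $\mathrm{DR}^0_RA=A_\natural$, $\mathrm{DR}^1_RA=(\Omega^1_RA)_\natural$. $A$ is smooth if it is finitely generated as a $\Bbbk$-algebra and $\Omega^1_\Bbbk A$ is a projective left $A^e$-module. $\mathrm{Der}_RA$ is the Lie algebra of derivations $A\to A$ vanishing on $R$, $\mathrm{Inn}_RA$ its ideal of inner derivations, $HH^1_R(A)=\mathrm{Der}_RA/\mathrm{Inn}_RA$. For $\theta\in\mathrm{Der}_RA$, $i_\theta$ is the degree $-1$ super-derivation of $\Omega^\bullet_RA$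 with $i_\theta(u\,dv)=u\theta(v)$ and $L_\theta=di_\theta+i_\theta d$; both act on $\mathrm{DR}^\bullet_RA$. Double derivations: $\mathbb{D}\mathrm{er}_RA$ is the space of derivations $\Theta:A\to A\otimes A$, $\Theta(a)=\Theta'(a)\otimes\Theta''(a)$, with $\Theta(R)=0$, for the outer bimodule structure $b(a'\otimes a'')c=ba'\otimes a''c$; it is an $A$-bimodule via the inner structure $b(a'\otimes a'')c=a'c\otimes ba''$. Let $i_\Theta:\Omega^\bullet_RA\to\Omega^\bullet_RA\otimes\Omega^\bullet_RA$ (outer bimodule) be the degree $-1$ super-derivation with $i_\Theta(u\,dv)=u\Theta(v)$ and $\iota_\Theta\alpha=(i_\Theta\alpha)^\diamond$, $(\alpha\otimes\beta)^\diamond=(-1)^{kl}\beta\alpha$ for $\alpha\in\Omega^k,\beta\in\Omega^l$; it descends to $\iota_\Theta:\mathrm{DR}^n_RA\to\Omega^{n-1}_RA$. $\omega\in\mathrm{DR}^2_RA$ is bi-symplectic if $d\omega=0$ and $\iota(\omega):\mathbb{D}\mathrm{er}_RA\to\Omega^1_RA$, $\Theta\mapsto\iota_\Theta\omega$, is a bijection. Then $\mathsf H_\omega:\mathrm{DR}^1_RA\to\mathrm{Der}_RA$ is the composite of the inverse of the induced bijection $(\mathbb{D}\mathrm{er}_RA)_\natural\to\mathrm{DR}^1_RA$ with the map $(\mathbb{D}\mathrm{er}_RA)_\natural\to\mathrm{Der}_RA$ induced by $\Theta\mapsto(a\mapsto\Theta'(a)\Theta''(a))$. The Lie bracket on $A_\natural$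 is $\{p,q\}=\theta_p(q)\bmod[A,A]$, where $\theta_p=\mathsf H_\omega(dp)$. For any such algebra $A$, put $\Delta\in\mathbb{D}\mathrm{er}_RA$, $\Delta(a)=a\mathbf e'\otimes\mathbf e''-\mathbf e'\otimes\mathbf e''a$. For closed $\omega\in\mathrm{DR}^2_RA$, $\mu_{\mathrm{nc}}(\omega)\in(A/R)^R$ is the unique class with $d\mu_{\mathrm{nc}}(\omega)=\iota_\Delta\omega$ in $\Omega^1_RA$. The complex $K$: for an $R$-algebra $B$, $K^\bullet_RB:=\ker[\iota_\Delta:\mathrm{DR}^\bullet_RB\to\Omega^{\bullet-1}_RB]$. It is stable under $d$, $L_\theta$, $i_\theta$, and on it $i_\theta,L_\theta$ depend only on the class of $\theta$ in $HH^1_R(B)$, so $K^\bullet_RB$ is an $HH^1_R(B)$-equivariant complex; $K^0_RB=B_\natural$. For $B=A_{\mathbf w}$ the form $i_\theta\omega_{\mathbf w}$ lies in $K^1_RA_{\mathbf w}$ and vanishes for inner $\theta$, so the map $\mathbf i$ is well-defined. Equivariant complexes and Hamilton operators: for a Lie algebra $\mathfrak G$, a $\mathfrak G$-equivariant complex is a complex $(C^\bullet,d)$ with linear maps $x\mapsto L_x$ (degree $0$) and $x\mapsto i_x$ (degree $-1$) such that $[L_x,L_y]=L_{[x,y]}$, $L_x=di_x+i_xd$, $i_xi_y+i_yi_x=0$, $[L_x,i_y]=i_{[x,y]}$. A linear map $\mathsf H:C^1\to\mathfrak G$ is skew-symmetric if $i_{\mathsf H(\alpha_1)}\alpha_2+i_{\mathsf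 H(\alpha_2)}\alpha_1=0$ for all $\alpha_1,\alpha_2\in C^1$; a skew-symmetric $\mathsf H$ is a Hamilton operator if $i_{\mathsf H(\alpha_3)}L_{\mathsf H(\alpha_1)}\alpha_2+(\text{cyclic permutations of }1,2,3)=0$ for all $\alpha_1,\alpha_2,\alpha_3\in C^1$. A Hamilton operator induces a Lie bracket on $C^0$ by $\{p,q\}=i_{\mathsf H(dp)}dq$. *)

theory Defs
  imports "HOL-Algebra.Module" "HOL-Algebra.QuotRing" "HOL-Algebra.Subrings" "HOL-Library.FuncSet"
begin

section \<open>Linear algebra over a ring of scalars\<close>

definition linear_map ::
    "('k, 'z) ring_scheme \<Rightarrow> ('k, 'm) module \<Rightarrow> ('k, 'n) module \<Rightarrow> ('m \<Rightarrow> 'n) \<Rightarrow> bool" where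
  "linear_map K M N f \<longleftrightarrow>
     f \<in> carrier M \<rightarrow> carrier N \<and>
     (\<forall>x\<in>carrier M. \<forall>y\<in>carrier M. f (x \<oplus>\<^bsub>M\<^esub> y) = f x \<oplus>\<^bsub>N\<^esub> f y) \<and>
     (\<forall>c\<in>carrier K. \<forall>x\<in>carrier M. f (c \<odot>\<^bsub>M\<^esub> x) = c \<odot>\<^bsub>N\<^esub> f x)"

definition lin_span :: "('k, 'z) ring_scheme \<Rightarrow> ('k, 'm) module \<Rightarrow> 'm set \<Rightarrow> 'm set" where
  "lin_span K M H = \<Inter>{N. submodule N K M \<and> H \<subseteq> N}"

text \<open>
  The quotient by a submodule \<open>N\<close>; its elements are the cosets \<open>N +> x\<close>. The multiplication and
  the unit of the record are those of \<^const>\<open>FactRing\<close>. They are meaningful when \<open>N\<close> is an ideal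
  for the multiplication of \<open>M\<close> (an associative product, or a Lie bracket) and junk otherwise.
\<close>

definition quot_mod :: "('k, 'm) module \<Rightarrow> 'm set \<Rightarrow> ('k, 'm set) module" where
  "quot_mod M N =
     \<lparr>carrier = carrier (M Quot N), mult = mult (M Quot N), one = one (M Quot N),
      zero = zero (M Quot N), add = add (M Quot N),
      smult = (\<lambda>c X. \<Union>x\<in>X. N +>\<^bsub>M\<^esub> (c \<odot>\<^bsub>M\<^esub> x))\<rparr>"

definition rep :: "'x set \<Rightarrow> 'x" where
  "rep X = (SOME x. x \<in> X)"

definition single :: "('k, 'z) ring_scheme \<Rightarrow> 'x \<Rightarrow> 'x \<Rightarrow> 'k" where
  "single K x = (\<lambda>y. if y = x then \<one>\<^bsub>K\<^esub> else \<zero>\<^bsub>K\<^esub>)"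

text \<open>The free left \<open>K\<close>-module on \<open>X\<close>; here \<open>K\<close> need not be commutative.\<close>

definition free_mod :: "('k, 'z) ring_scheme \<Rightarrow> 'x set \<Rightarrow> ('k, 'x \<Rightarrow> 'k) module" where
  "free_mod K X =
     \<lparr>carrier = {f. (\<forall>x. f x \<in> carrier K) \<and> (\<forall>x. x \<notin> X \<longrightarrow> f x = \<zero>\<^bsub>K\<^esub>) \<and>
                    finite {x. f x \<noteq> \<zero>\<^bsub>K\<^esub>}},
      mult = undefined, one = undefined,
      zero = (\<lambda>_. \<zero>\<^bsub>K\<^esub>), add = (\<lambda>f g x. f x \<oplus>\<^bsub>K\<^esub> g x),
      smult = (\<lambda>c f x. c \<otimes>\<^bsub>K\<^esub> f x)\<rparr>"

text \<open>The free associative unital \<open>K\<close>-algebra on the set of letters \<open>L\<close>.\<close>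

definition free_alg :: "('k, 'z) ring_scheme \<Rightarrow> 'l set \<Rightarrow> ('k, 'l list \<Rightarrow> 'k) module" where
  "free_alg K L =
     (free_mod K (lists L))
       \<lparr>mult := (\<lambda>f g u. \<Oplus>\<^bsub>K\<^esub>i\<in>{..length u}. f (take i u) \<otimes>\<^bsub>K\<^esub> g (drop i u)),
        one := single K []\<rparr>"

definition signed :: "('k, 'm) module \<Rightarrow> nat \<Rightarrow> 'm \<Rightarrow> 'm" where
  "signed M n x = (if even n then x else \<ominus>\<^bsub>M\<^esub> x)"


section \<open>Associative algebras\<close>

locale assoc_algebra = module K A + ring A for K :: "'k ring" and A :: "('k, 'a) module" +
  assumes smult_mult_left:
    "\<lbrakk>c \<in> carrier K; x \<in> carrier A; y \<in> carrier A\<rbrakk>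
      \<Longrightarrow> (c \<odot>\<^bsub>A\<^esub> x) \<otimes>\<^bsub>A\<^esub> y = c \<odot>\<^bsub>A\<^esub> (x \<otimes>\<^bsub>A\<^esub> y)"
  and smult_mult_right:
    "\<lbrakk>c \<in> carrier K; x \<in> carrier A; y \<in> carrier A\<rbrakk>
      \<Longrightarrow> x \<otimes>\<^bsub>A\<^esub> (c \<odot>\<^bsub>A\<^esub> y) = c \<odot>\<^bsub>A\<^esub> (x \<otimes>\<^bsub>A\<^esub> y)"

definition finite_dimensional :: "'k ring \<Rightarrow> ('k, 'm) module \<Rightarrow> bool" where
  "finite_dimensional K M \<longleftrightarrow>
     (\<exists>X. finite X \<and> X \<subseteq> carrier M \<and> lin_span K M X = carrier M)"

definition left_ideal :: "('a, 'z) ring_scheme \<Rightarrow> 'a set \<Rightarrow> bool" where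
  "left_ideal R I \<longleftrightarrow>
     additive_subgroup I R \<and> (\<forall>r\<in>carrier R. \<forall>x\<in>I. r \<otimes>\<^bsub>R\<^esub> x \<in> I)"

text \<open>Semisimple as a left module over itself: every submodule is a direct summand.\<close>

definition semisimple_ring :: "('a, 'z) ring_scheme \<Rightarrow> bool" where
  "semisimple_ring R \<longleftrightarrow>
     (\<forall>I. left_ideal R I \<longrightarrow>
        (\<exists>J. left_ideal R J \<and> I \<inter> J = {\<zero>\<^bsub>R\<^esub>} \<and> I <+>\<^bsub>R\<^esub> J = carrier R))"

definition r_algebra ::
    "'k ring \<Rightarrow> ('k, 'r) module \<Rightarrow> ('k, 'a) module \<Rightarrow> ('r \<Rightarrow> 'a) \<Rightarrow> bool" where
  "r_algebra K R A \<eta> \<longleftrightarrow>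
     assoc_algebra K A \<and> \<eta> \<in> ring_hom R A \<and> linear_map K R A \<eta> \<and> inj_on \<eta> (carrier R)"


section \<open>The tensor square of an algebra\<close>

text \<open>
  Below, \<open>S\<close> is a subset of the algebra \<open>A\<close>, always the image of the base algebra in \<open>A\<close>.
  The balancing relations for \<open>A \<otimes>\<^sub>R A\<close> involve \<open>R\<close> only through its image, so this covers
  base maps that are not injective. With \<open>S = {}\<close> one gets the tensor product over the field.
\<close>

context
  fixes K :: "'k ring" and A :: "('k, 'a) module" and S :: "'a set"
begin

definition tsq_rels :: "('a \<times> 'a \<Rightarrow> 'k) set" where
  "tsq_rels = (let F = free_mod K (carrier A \<times> carrier A) in
     {single K (x \<oplus>\<^bsub>A\<^esub> y, z) \<ominus>\<^bsub>F\<^esub> (single K (x, z) \<oplus>\<^bsub>F\<^esub> single K (y, z)) | x y z.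
        x \<in> carrier A \<and> y \<in> carrier A \<and> z \<in> carrier A} \<union>
     {single K (z, x \<oplus>\<^bsub>A\<^esub> y) \<ominus>\<^bsub>F\<^esub> (single K (z, x) \<oplus>\<^bsub>F\<^esub> single K (z, y)) | x y z.
        x \<in> carrier A \<and> y \<in> carrier A \<and> z \<in> carrier A} \<union>
     {single K (c \<odot>\<^bsub>A\<^esub> x, y) \<ominus>\<^bsub>F\<^esub> c \<odot>\<^bsub>F\<^esub> single K (x, y) | c x y.
        c \<in> carrier K \<and> x \<in> carrier A \<and> y \<in> carrier A} \<union>
     {single K (x, c \<odot>\<^bsub>A\<^esub> y) \<ominus>\<^bsub>F\<^esub> c \<odot>\<^bsub>F\<^esub> single K (x, y) | c x y.
        c \<in> carrier K \<and> x \<in> carrier A \<and> y \<in> carrier A} \<union>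
     {single K (x \<otimes>\<^bsub>A\<^esub> s, y) \<ominus>\<^bsub>F\<^esub> single K (x, s \<otimes>\<^bsub>A\<^esub> y) | s x y.
        s \<in> S \<and> x \<in> carrier A \<and> y \<in> carrier A})"

definition tsq_null :: "('a \<times> 'a \<Rightarrow> 'k) set" where
  "tsq_null = lin_span K (free_mod K (carrier A \<times> carrier A)) tsq_rels"

definition tsq :: "('k, ('a \<times> 'a \<Rightarrow> 'k) set) module" where
  "tsq = quot_mod (free_mod K (carrier A \<times> carrier A)) tsq_null"

definition tens :: "'a \<Rightarrow> 'a \<Rightarrow> ('a \<times> 'a \<Rightarrow> 'k) set" where
  "tens x y = tsq_null +>\<^bsub>free_mod K (carrier A \<times> carrier A)\<^esub> single K (x, y)"

text \<open>The linear map on the tensor square given on pure tensors by a balanced bilinear map.\<close>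

definition tlift ::
    "('k, 'm) module \<Rightarrow> ('a \<Rightarrow> 'a \<Rightarrow> 'm) \<Rightarrow> ('a \<times> 'a \<Rightarrow> 'k) set \<Rightarrow> 'm" where
  "tlift W f = (THE g. g \<in> extensional (carrier tsq) \<and> linear_map K tsq W g \<and>
                  (\<forall>x\<in>carrier A. \<forall>y\<in>carrier A. g (tens x y) = f x y))"

definition tmul :: "('a \<times> 'a \<Rightarrow> 'k) set \<Rightarrow> 'a" where
  "tmul = tlift A (\<lambda>x y. x \<otimes>\<^bsub>A\<^esub> y)"

text \<open>The outer bimodule structure \<open>b (x \<otimes> y) c = b x \<otimes> y c\<close>.\<close>

definition lact :: "'a \<Rightarrow> ('a \<times> 'a \<Rightarrow> 'k) set \<Rightarrow> ('a \<times> 'a \<Rightarrow> 'k) set" where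
  "lact b = tlift tsq (\<lambda>x y. tens (b \<otimes>\<^bsub>A\<^esub> x) y)"

definition ract :: "('a \<times> 'a \<Rightarrow> 'k) set \<Rightarrow> 'a \<Rightarrow> ('a \<times> 'a \<Rightarrow> 'k) set" where
  "ract \<xi> c = tlift tsq (\<lambda>x y. tens x (y \<otimes>\<^bsub>A\<^esub> c)) \<xi>"

definition Omega1 :: "('k, ('a \<times> 'a \<Rightarrow> 'k) set) module" where
  "Omega1 = tsq\<lparr>carrier := {\<xi> \<in> carrier tsq. tmul \<xi> = \<zero>\<^bsub>A\<^esub>}\<rparr>"

definition univ_der :: "'a \<Rightarrow> ('a \<times> 'a \<Rightarrow> 'k) set" where
  "univ_der a = tens a \<one>\<^bsub>A\<^esub> \<ominus>\<^bsub>tsq\<^esub> tens \<one>\<^bsub>A\<^esub> a"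

end

definition tmap ::
    "'k ring \<Rightarrow> ('k, 'a) module \<Rightarrow> 'a set \<Rightarrow> ('k, 'b) module \<Rightarrow> 'b set \<Rightarrow> ('a \<Rightarrow> 'b)
      \<Rightarrow> ('a \<times> 'a \<Rightarrow> 'k) set \<Rightarrow> ('b \<times> 'b \<Rightarrow> 'k) set" where
  "tmap K A S B T f = tlift K A S (tsq K B T) (\<lambda>x y. tens K B T (f x) (f y))"

definition symmetric_separability_element ::
    "'k ring \<Rightarrow> ('k, 'r) module \<Rightarrow> ('r \<times> 'r \<Rightarrow> 'k) set \<Rightarrow> bool" where
  "symmetric_separability_element K R e \<longleftrightarrow>
     e \<in> carrier (tsq K R {}) \<and>
     (\<forall>r\<in>carrier R. lact K R {} r e = ract K R {} e r) \<and>
     tmul K R {} e = \<one>\<^bsub>R\<^esub> \<and>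
     tlift K R {} (tsq K R {}) (\<lambda>x y. tens K R {} y x) e = e"


section \<open>Smooth algebras\<close>

definition fin_gen_algebra :: "'k ring \<Rightarrow> ('k, 'a) module \<Rightarrow> bool" where
  "fin_gen_algebra K A \<longleftrightarrow>
     (\<exists>X. finite X \<and> X \<subseteq> carrier A \<and>
        (\<forall>B. subring B A \<and> submodule B K A \<and> X \<subseteq> B \<longrightarrow> B = carrier A))"

text \<open>The algebra \<open>A \<otimes> A\<^sup>o\<^sup>p\<close>: the product is \<open>(x \<otimes> y) (u \<otimes> v) = x u \<otimes> v y\<close>.\<close>

definition enveloping :: "'k ring \<Rightarrow> ('k, 'a) module \<Rightarrow> ('k, ('a \<times> 'a \<Rightarrow> 'k) set) module" where
  "enveloping K A =
     (tsq K A {})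
       \<lparr>mult := (\<lambda>\<xi> \<zeta>. tlift K A {} (tsq K A {})
           (\<lambda>x y. tlift K A {} (tsq K A {})
              (\<lambda>u v. tens K A {} (x \<otimes>\<^bsub>A\<^esub> u) (v \<otimes>\<^bsub>A\<^esub> y)) \<zeta>) \<xi>),
        one := tens K A {} \<one>\<^bsub>A\<^esub> \<one>\<^bsub>A\<^esub>\<rparr>"

text \<open>An \<open>A\<close>-bimodule \<open>M\<close> with actions \<open>l\<close>, \<open>r\<close> as a left module over the enveloping algebra.\<close>

definition env_module ::
    "'k ring \<Rightarrow> ('k, 'a) module \<Rightarrow> ('k, 'm) module \<Rightarrow> ('a \<Rightarrow> 'm \<Rightarrow> 'm) \<Rightarrow> ('m \<Rightarrow> 'a \<Rightarrow> 'm)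
      \<Rightarrow> (('a \<times> 'a \<Rightarrow> 'k) set, 'm) module" where
  "env_module K A M l r =
     \<lparr>carrier = carrier M, mult = undefined, one = undefined, zero = zero M, add = add M,
      smult = (\<lambda>\<xi> m. tlift K A {} M (\<lambda>x y. r (l x m) y) \<xi>)\<rparr>"

text \<open>
  Projective: a direct summand of a free left module. A projective module is a summand of the free
  module on its own elements, so taking the basis \<open>X\<close> inside the type \<open>'m\<close> loses nothing.
\<close>

definition projective_module :: "('e, 'z) ring_scheme \<Rightarrow> ('e, 'm) module \<Rightarrow> bool" where
  "projective_module E M \<longleftrightarrow>
     (\<exists>(X :: 'm set) s p. linear_map E M (free_mod E X) s \<and> linear_map E (free_mod E X) M p \<and>
        (\<forall>m\<in>carrier M. p (s m) = m))"

definition smooth_algebra :: "'k ring \<Rightarrow> ('k, 'a) module \<Rightarrow> bool" where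
  "smooth_algebra K A \<longleftrightarrow>
     fin_gen_algebra K A \<and>
     (let S = (\<lambda>c. c \<odot>\<^bsub>A\<^esub> \<one>\<^bsub>A\<^esub>) ` carrier K in
        projective_module (enveloping K A)
          (env_module K A (Omega1 K A S) (lact K A S) (ract K A S)))"


section \<open>The tensor algebra of a bimodule\<close>

text \<open>
  \<open>T\<^sub>A(M)\<close> for an \<open>A\<close>-bimodule \<open>M\<close> with actions \<open>l\<close>, \<open>r\<close> is generated by letters \<open>Inl a\<close>
  (\<open>a \<in> A\<close>) and \<open>Inr m\<close> (\<open>m \<in> M\<close>). The relations make \<open>a \<mapsto> Inl a\<close> a unital algebra map and
  \<open>m \<mapsto> Inr m\<close> a bimodule map. Its component of degree \<open>n\<close>, spanned by the words with \<open>n\<close>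
  letters from \<open>M\<close>, is the \<open>n\<close>-fold tensor power of \<open>M\<close> over \<open>A\<close>.
\<close>

context
  fixes K :: "'k ring" and A :: "('k, 'a) module" and M :: "('k, 'm) module"
    and l :: "'a \<Rightarrow> 'm \<Rightarrow> 'm" and r :: "'m \<Rightarrow> 'a \<Rightarrow> 'm"
begin

definition tensor_alg_rels :: "(('a + 'm) list \<Rightarrow> 'k) set" where
  "tensor_alg_rels = (let F = free_alg K (carrier A <+> carrier M) in
     {single K [Inl (a \<oplus>\<^bsub>A\<^esub> b)] \<ominus>\<^bsub>F\<^esub> (single K [Inl a] \<oplus>\<^bsub>F\<^esub> single K [Inl b]) | a b.
        a \<in> carrier A \<and> b \<in> carrier A} \<union>
     {single K [Inl (c \<odot>\<^bsub>A\<^esub> a)] \<ominus>\<^bsub>F\<^esub> c \<odot>\<^bsub>F\<^esub> single K [Inl a] | c a.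
        c \<in> carrier K \<and> a \<in> carrier A} \<union>
     {single K [Inr (m \<oplus>\<^bsub>M\<^esub> n)] \<ominus>\<^bsub>F\<^esub> (single K [Inr m] \<oplus>\<^bsub>F\<^esub> single K [Inr n]) | m n.
        m \<in> carrier M \<and> n \<in> carrier M} \<union>
     {single K [Inr (c \<odot>\<^bsub>M\<^esub> m)] \<ominus>\<^bsub>F\<^esub> c \<odot>\<^bsub>F\<^esub> single K [Inr m] | c m.
        c \<in> carrier K \<and> m \<in> carrier M} \<union>
     {single K [Inl \<one>\<^bsub>A\<^esub>] \<ominus>\<^bsub>F\<^esub> \<one>\<^bsub>F\<^esub>} \<union>
     {single K [Inl a, Inl b] \<ominus>\<^bsub>F\<^esub> single K [Inl (a \<otimes>\<^bsub>A\<^esub> b)] | a b.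
        a \<in> carrier A \<and> b \<in> carrier A} \<union>
     {single K [Inl a, Inr m] \<ominus>\<^bsub>F\<^esub> single K [Inr (l a m)] | a m.
        a \<in> carrier A \<and> m \<in> carrier M} \<union>
     {single K [Inr m, Inl a] \<ominus>\<^bsub>F\<^esub> single K [Inr (r m a)] | a m.
        a \<in> carrier A \<and> m \<in> carrier M})"

definition tensor_alg_null :: "(('a + 'm) list \<Rightarrow> 'k) set" where
  "tensor_alg_null = Idl\<^bsub>free_alg K (carrier A <+> carrier M)\<^esub> tensor_alg_rels"

definition tensor_alg :: "('k, (('a + 'm) list \<Rightarrow> 'k) set) module" where
  "tensor_alg = quot_mod (free_alg K (carrier A <+> carrier M)) tensor_alg_null"

definition tensor_word :: "('a + 'm) list \<Rightarrow> (('a + 'm) list \<Rightarrow> 'k) set" where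
  "tensor_word u = tensor_alg_null +>\<^bsub>free_alg K (carrier A <+> carrier M)\<^esub> single K u"

definition tensor_deg :: "nat \<Rightarrow> (('a + 'm) list \<Rightarrow> 'k) set set" where
  "tensor_deg n = lin_span K tensor_alg
     (tensor_word ` {u \<in> lists (carrier A <+> carrier M). length (filter (Not \<circ> isl) u) = n})"

end


section \<open>Noncommutative differential forms\<close>

type_synonym ('k, 'a) form = "(('a + ('a \<times> 'a \<Rightarrow> 'k) set) list \<Rightarrow> 'k) set"

context
  fixes K :: "'k ring" and A :: "('k, 'a) module" and S :: "'a set"
begin

definition Omega :: "('k, ('k, 'a) form) module" where
  "Omega = tensor_alg K A (Omega1 K A S) (lact K A S) (ract K A S)"

definition Omega_deg :: "nat \<Rightarrow> ('k, 'a) form set" where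
  "Omega_deg = tensor_deg K A (Omega1 K A S) (lact K A S) (ract K A S)"

text \<open>The inclusions of \<open>A\<close> and of \<open>\<Omega>\<^sup>1 \<subseteq> A \<otimes>\<^sub>R A\<close> into the algebra of forms.\<close>

definition fn :: "'a \<Rightarrow> ('k, 'a) form" where
  "fn a = tensor_word K A (Omega1 K A S) (lact K A S) (ract K A S) [Inl a]"

definition one_form :: "('a \<times> 'a \<Rightarrow> 'k) set \<Rightarrow> ('k, 'a) form" where
  "one_form \<xi> = tensor_word K A (Omega1 K A S) (lact K A S) (ract K A S) [Inr \<xi>]"

text \<open>The Leibniz rule for super-derivations of odd degree on forms, with values in a bimodule.\<close>

definition odd_leibniz ::
    "('k, 'm) module \<Rightarrow> (('k, 'a) form \<Rightarrow> 'm \<Rightarrow> 'm) \<Rightarrow> ('m \<Rightarrow> ('k, 'a) form \<Rightarrow> 'm)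
      \<Rightarrow> (('k, 'a) form \<Rightarrow> 'm) \<Rightarrow> bool" where
  "odd_leibniz M l r D \<longleftrightarrow>
     (\<forall>n. \<forall>x\<in>Omega_deg n. \<forall>y\<in>carrier Omega.
        D (x \<otimes>\<^bsub>Omega\<^esub> y) = r (D x) y \<oplus>\<^bsub>M\<^esub> signed M n (l x (D y)))"

definition Omega_d :: "('k, 'a) form \<Rightarrow> ('k, 'a) form" where
  "Omega_d = (THE D. D \<in> extensional (carrier Omega) \<and> linear_map K Omega Omega D \<and>
     (\<forall>n. D ` Omega_deg n \<subseteq> Omega_deg (Suc n)) \<and>
     odd_leibniz Omega (mult Omega) (mult Omega) D \<and>
     (\<forall>x\<in>carrier Omega. D (D x) = \<zero>\<^bsub>Omega\<^esub>) \<and>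
     (\<forall>a\<in>carrier A. D (fn a) = one_form (univ_der K A S a)))"


subsection \<open>Derivations\<close>

text \<open>
  The Lie algebra of derivations over \<open>R\<close>. In this and in all further Lie algebras the
  multiplication of the record is the Lie bracket.
\<close>

definition Der :: "('k, 'a \<Rightarrow> 'a) module" where
  "Der =
     \<lparr>carrier = {\<theta> \<in> extensional (carrier A). linear_map K A A \<theta> \<and>
        (\<forall>a\<in>carrier A. \<forall>b\<in>carrier A.
           \<theta> (a \<otimes>\<^bsub>A\<^esub> b) = (\<theta> a \<otimes>\<^bsub>A\<^esub> b) \<oplus>\<^bsub>A\<^esub> (a \<otimes>\<^bsub>A\<^esub> \<theta> b)) \<and>
        (\<forall>s\<in>S. \<theta> s = \<zero>\<^bsub>A\<^esub>)},
      mult = (\<lambda>\<theta> \<phi>. \<lambda>a\<in>carrier A. \<theta> (\<phi> a) \<ominus>\<^bsub>A\<^esub> \<phi> (\<theta> a)),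
      one = undefined,
      zero = (\<lambda>a\<in>carrier A. \<zero>\<^bsub>A\<^esub>),
      add = (\<lambda>\<theta> \<phi>. \<lambda>a\<in>carrier A. \<theta> a \<oplus>\<^bsub>A\<^esub> \<phi> a),
      smult = (\<lambda>c \<theta>. \<lambda>a\<in>carrier A. c \<odot>\<^bsub>A\<^esub> \<theta> a)\<rparr>"

definition Inn :: "('a \<Rightarrow> 'a) set" where
  "Inn = {\<theta> \<in> carrier Der.
     \<exists>b\<in>carrier A. \<forall>a\<in>carrier A. \<theta> a = (b \<otimes>\<^bsub>A\<^esub> a) \<ominus>\<^bsub>A\<^esub> (a \<otimes>\<^bsub>A\<^esub> b)}"

definition HH1 :: "('k, ('a \<Rightarrow> 'a) set) module" where
  "HH1 = quot_mod Der Inn"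

definition contr :: "('a \<Rightarrow> 'a) \<Rightarrow> ('k, 'a) form \<Rightarrow> ('k, 'a) form" where
  "contr \<theta> = (THE D. D \<in> extensional (carrier Omega) \<and> linear_map K Omega Omega D \<and>
     (\<forall>x\<in>Omega_deg 0. D x = \<zero>\<^bsub>Omega\<^esub>) \<and> (\<forall>n. D ` Omega_deg (Suc n) \<subseteq> Omega_deg n) \<and>
     odd_leibniz Omega (mult Omega) (mult Omega) D \<and>
     (\<forall>u\<in>carrier A. \<forall>v\<in>carrier A. D (fn u \<otimes>\<^bsub>Omega\<^esub> Omega_d (fn v)) = fn (u \<otimes>\<^bsub>A\<^esub> \<theta> v)))"


subsection \<open>Double derivations\<close>

definition DDer :: "('k, 'a \<Rightarrow> ('a \<times> 'a \<Rightarrow> 'k) set) module" where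
  "DDer = (let T = tsq K A {} in
     \<lparr>carrier = {\<Theta> \<in> extensional (carrier A). linear_map K A T \<Theta> \<and>
        (\<forall>a\<in>carrier A. \<forall>b\<in>carrier A.
           \<Theta> (a \<otimes>\<^bsub>A\<^esub> b) = ract K A {} (\<Theta> a) b \<oplus>\<^bsub>T\<^esub> lact K A {} a (\<Theta> b)) \<and>
        (\<forall>s\<in>S. \<Theta> s = \<zero>\<^bsub>T\<^esub>)},
      mult = undefined,
      one = undefined,
      zero = (\<lambda>a\<in>carrier A. \<zero>\<^bsub>T\<^esub>),
      add = (\<lambda>\<Theta> \<Phi>. \<lambda>a\<in>carrier A. \<Theta> a \<oplus>\<^bsub>T\<^esub> \<Phi> a),
      smult = (\<lambda>c \<Theta>. \<lambda>a\<in>carrier A. c \<odot>\<^bsub>T\<^esub> \<Theta> a)\<rparr>)"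

text \<open>The bimodule structure coming from the inner structure \<open>b (x \<otimes> y) c = x c \<otimes> b y\<close>.\<close>

definition DDer_lact ::
    "'a \<Rightarrow> ('a \<Rightarrow> ('a \<times> 'a \<Rightarrow> 'k) set) \<Rightarrow> 'a \<Rightarrow> ('a \<times> 'a \<Rightarrow> 'k) set" where
  "DDer_lact b \<Theta> =
     (\<lambda>a\<in>carrier A. tlift K A {} (tsq K A {}) (\<lambda>x y. tens K A {} x (b \<otimes>\<^bsub>A\<^esub> y)) (\<Theta> a))"

definition DDer_ract ::
    "('a \<Rightarrow> ('a \<times> 'a \<Rightarrow> 'k) set) \<Rightarrow> 'a \<Rightarrow> 'a \<Rightarrow> ('a \<times> 'a \<Rightarrow> 'k) set" where
  "DDer_ract \<Theta> c =
     (\<lambda>a\<in>carrier A. tlift K A {} (tsq K A {}) (\<lambda>x y. tens K A {} (x \<otimes>\<^bsub>A\<^esub> c) y) (\<Theta> a))"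

definition DDer_nat :: "('k, ('a \<Rightarrow> ('a \<times> 'a \<Rightarrow> 'k) set) set) module" where
  "DDer_nat = quot_mod DDer (lin_span K DDer
     {DDer_lact a \<Theta> \<ominus>\<^bsub>DDer\<^esub> DDer_ract \<Theta> a | a \<Theta>. a \<in> carrier A \<and> \<Theta> \<in> carrier DDer})"

text \<open>\<open>a \<mapsto> \<Theta>' (a) \<Theta>'' (a)\<close>\<close>

definition DDer_mul :: "('a \<Rightarrow> ('a \<times> 'a \<Rightarrow> 'k) set) \<Rightarrow> 'a \<Rightarrow> 'a" where
  "DDer_mul \<Theta> = (\<lambda>a\<in>carrier A. tmul K A {} (\<Theta> a))"

text \<open>\<open>e\<close> is the image in \<open>A \<otimes> A\<close> of the separability element, and \<open>\<Delta> (a) = a e - e a\<close>.\<close>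

definition Delta :: "('a \<times> 'a \<Rightarrow> 'k) set \<Rightarrow> 'a \<Rightarrow> ('a \<times> 'a \<Rightarrow> 'k) set" where
  "Delta e = (\<lambda>a\<in>carrier A. lact K A {} a e \<ominus>\<^bsub>tsq K A {}\<^esub> ract K A {} e a)"

definition dbl_contr ::
    "('a \<Rightarrow> ('a \<times> 'a \<Rightarrow> 'k) set) \<Rightarrow> ('k, 'a) form
      \<Rightarrow> (('k, 'a) form \<times> ('k, 'a) form \<Rightarrow> 'k) set" where
  "dbl_contr \<Theta> = (let T = tsq K Omega {} in
     THE D. D \<in> extensional (carrier Omega) \<and> linear_map K Omega T D \<and>
     (\<forall>x\<in>Omega_deg 0. D x = \<zero>\<^bsub>T\<^esub>) \<and>
     (\<forall>n. D ` Omega_deg (Suc n) \<subseteq> lin_span K T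
        {tens K Omega {} x y | x y k m. k + m = n \<and> x \<in> Omega_deg k \<and> y \<in> Omega_deg m}) \<and>
     odd_leibniz T (lact K Omega {}) (ract K Omega {}) D \<and>
     (\<forall>u\<in>carrier A. \<forall>v\<in>carrier A. D (fn u \<otimes>\<^bsub>Omega\<^esub> Omega_d (fn v)) =
        lact K Omega {} (fn u) (tmap K A {} Omega {} fn (\<Theta> v))))"

definition diamond :: "(('k, 'a) form \<times> ('k, 'a) form \<Rightarrow> 'k) set \<Rightarrow> ('k, 'a) form" where
  "diamond = (let T = tsq K Omega {} in
     THE g. g \<in> extensional (carrier T) \<and> linear_map K T Omega g \<and>
     (\<forall>k m. \<forall>x\<in>Omega_deg k. \<forall>y\<in>Omega_deg m.
        g (tens K Omega {} x y) = signed Omega (k * m) (y \<otimes>\<^bsub>Omega\<^esub> x)))"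

definition iota_dd :: "('a \<Rightarrow> ('a \<times> 'a \<Rightarrow> 'k) set) \<Rightarrow> ('k, 'a) form \<Rightarrow> ('k, 'a) form" where
  "iota_dd \<Theta> x = diamond (dbl_contr \<Theta> x)"


subsection \<open>The Karoubi-de Rham complex\<close>

definition super_comm :: "('k, 'a) form set" where
  "super_comm = lin_span K Omega
     {(x \<otimes>\<^bsub>Omega\<^esub> y) \<ominus>\<^bsub>Omega\<^esub> signed Omega (k * m) (y \<otimes>\<^bsub>Omega\<^esub> x) | x y k m.
        x \<in> Omega_deg k \<and> y \<in> Omega_deg m}"

definition DR :: "('k, ('k, 'a) form set) module" where
  "DR = quot_mod Omega super_comm"

definition DR_class :: "('k, 'a) form \<Rightarrow> ('k, 'a) form set" where
  "DR_class x = super_comm +>\<^bsub>Omega\<^esub> x"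

definition DR_deg :: "nat \<Rightarrow> ('k, 'a) form set set" where
  "DR_deg n = DR_class ` Omega_deg n"

definition DR_d :: "('k, 'a) form set \<Rightarrow> ('k, 'a) form set" where
  "DR_d X = DR_class (Omega_d (rep X))"

definition DR_contr :: "('a \<Rightarrow> 'a) \<Rightarrow> ('k, 'a) form set \<Rightarrow> ('k, 'a) form set" where
  "DR_contr \<theta> X = DR_class (contr \<theta> (rep X))"

definition DR_Lie :: "('a \<Rightarrow> 'a) \<Rightarrow> ('k, 'a) form set \<Rightarrow> ('k, 'a) form set" where
  "DR_Lie \<theta> X = DR_d (DR_contr \<theta> X) \<oplus>\<^bsub>DR\<^esub> DR_contr \<theta> (DR_d X)"

definition DR_iota :: "('a \<Rightarrow> ('a \<times> 'a \<Rightarrow> 'k) set) \<Rightarrow> ('k, 'a) form set \<Rightarrow> ('k, 'a) form" where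
  "DR_iota \<Theta> X = iota_dd \<Theta> (rep X)"


subsection \<open>The space \<open>A / [A, A]\<close>\<close>

definition nat_alg :: "('k, 'a set) module" where
  "nat_alg = quot_mod A (lin_span K A
     {(a \<otimes>\<^bsub>A\<^esub> b) \<ominus>\<^bsub>A\<^esub> (b \<otimes>\<^bsub>A\<^esub> a) | a b. a \<in> carrier A \<and> b \<in> carrier A})"

definition nat_class :: "'a \<Rightarrow> 'a set" where
  "nat_class a = lin_span K A
     {(a \<otimes>\<^bsub>A\<^esub> b) \<ominus>\<^bsub>A\<^esub> (b \<otimes>\<^bsub>A\<^esub> a) | a b. a \<in> carrier A \<and> b \<in> carrier A} +>\<^bsub>A\<^esub> a"

text \<open>The identification of \<open>A / [A, A]\<close> with the degree zero part of the Karoubi-de Rham complex.\<close>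

definition nat_to_DR :: "'a set \<Rightarrow> ('k, 'a) form set" where
  "nat_to_DR p = DR_class (fn (rep p))"


subsection \<open>Bi-symplectic forms\<close>

definition bisymplectic :: "('k, 'a) form set \<Rightarrow> bool" where
  "bisymplectic \<omega> \<longleftrightarrow>
     \<omega> \<in> DR_deg 2 \<and> DR_d \<omega> = \<zero>\<^bsub>DR\<^esub> \<and>
     bij_betw (\<lambda>\<Theta>. DR_iota \<Theta> \<omega>) (carrier DDer) (Omega_deg 1)"

text \<open>The map from \<open>DR\<^sup>1\<close> to \<open>Der\<close> attached to a bi-symplectic form.\<close>

definition Ham :: "('k, 'a) form set \<Rightarrow> ('k, 'a) form set \<Rightarrow> 'a \<Rightarrow> 'a" where
  "Ham \<omega> \<alpha> =
     DDer_mul (rep (inv_into (carrier DDer_nat) (\<lambda>X. DR_class (DR_iota (rep X) \<omega>)) \<alpha>))"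

definition nat_lie :: "('k, 'a) form set \<Rightarrow> ('k, 'a set) module" where
  "nat_lie \<omega> = nat_alg\<lparr>mult := (\<lambda>p q. nat_class (Ham \<omega> (DR_d (nat_to_DR p)) (rep q)))\<rparr>"

text \<open>
  The defining property of the class \<open>\<mu>\<^sub>n\<^sub>c(\<omega>)\<close>, an \<open>R\<close>-invariant element of \<open>A / R\<close>; the differential
  of a form of degree zero only depends on its class modulo \<open>R\<close>.
\<close>

definition is_moment_class ::
    "('a \<times> 'a \<Rightarrow> 'k) set \<Rightarrow> ('k, 'a) form set \<Rightarrow> 'a set \<Rightarrow> bool" where
  "is_moment_class e \<omega> \<mu> \<longleftrightarrow>
     \<mu> \<in> carrier (quot_mod A S) \<and>
     (\<forall>s\<in>S. \<forall>x\<in>\<mu>. (s \<otimes>\<^bsub>A\<^esub> x) \<ominus>\<^bsub>A\<^esub> (x \<otimes>\<^bsub>A\<^esub> s) \<in> S) \<and>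
     (\<forall>x\<in>\<mu>. Omega_d (fn x) = DR_iota (Delta e) \<omega>)"


subsection \<open>The kernel of the contraction with \<open>\<Delta>\<close>\<close>

definition Kcx :: "('a \<times> 'a \<Rightarrow> 'k) set \<Rightarrow> nat \<Rightarrow> ('k, ('k, 'a) form set) module" where
  "Kcx e n = DR\<lparr>carrier := {X \<in> DR_deg n. DR_iota (Delta e) X = \<zero>\<^bsub>Omega\<^esub>}\<rparr>"

definition Kcx_Lie :: "('a \<Rightarrow> 'a) set \<Rightarrow> ('k, 'a) form set \<Rightarrow> ('k, 'a) form set" where
  "Kcx_Lie x = DR_Lie (rep x)"

definition Kcx_contr :: "('a \<Rightarrow> 'a) set \<Rightarrow> ('k, 'a) form set \<Rightarrow> ('k, 'a) form set" where
  "Kcx_contr x = DR_contr (rep x)"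

end


subsection \<open>Functoriality\<close>

context
  fixes K :: "'k ring" and A :: "('k, 'a) module" and S :: "'a set"
    and B :: "('k, 'b) module" and T :: "'b set" and f :: "'a \<Rightarrow> 'b"
begin

definition Omega_map :: "('k, 'a) form \<Rightarrow> ('k, 'b) form" where
  "Omega_map = (THE g. g \<in> extensional (carrier (Omega K A S)) \<and>
     g \<in> ring_hom (Omega K A S) (Omega K B T) \<and>
     linear_map K (Omega K A S) (Omega K B T) g \<and>
     (\<forall>a\<in>carrier A. g (fn K A S a) = fn K B T (f a) \<and>
        g (Omega_d K A S (fn K A S a)) = Omega_d K B T (fn K B T (f a))))"

definition DR_map :: "('k, 'a) form set \<Rightarrow> ('k, 'b) form set" where
  "DR_map X = DR_class K B T (Omega_map (rep X))"

end

definition nat_map ::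
    "'k ring \<Rightarrow> ('k, 'b) module \<Rightarrow> ('a \<Rightarrow> 'b) \<Rightarrow> 'a set \<Rightarrow> 'b set" where
  "nat_map K B f p = nat_class K B (f (rep p))"


section \<open>Lie algebras, equivariant complexes and Hamilton operators\<close>

locale lie_algebra = module K G for K :: "'k ring" and G :: "('k, 'g) module" +
  assumes bracket_linear_left:
    "y \<in> carrier G \<Longrightarrow> linear_map K G G (\<lambda>x. x \<otimes>\<^bsub>G\<^esub> y)"
  and bracket_linear_right:
    "x \<in> carrier G \<Longrightarrow> linear_map K G G (\<lambda>y. x \<otimes>\<^bsub>G\<^esub> y)"
  and bracket_alternating: "x \<in> carrier G \<Longrightarrow> x \<otimes>\<^bsub>G\<^esub> x = \<zero>\<^bsub>G\<^esub>"
  and jacobi: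
    "\<lbrakk>x \<in> carrier G; y \<in> carrier G; z \<in> carrier G\<rbrakk> \<Longrightarrow>
      (x \<otimes>\<^bsub>G\<^esub> (y \<otimes>\<^bsub>G\<^esub> z)) \<oplus>\<^bsub>G\<^esub> (y \<otimes>\<^bsub>G\<^esub> (z \<otimes>\<^bsub>G\<^esub> x)) \<oplus>\<^bsub>G\<^esub> (z \<otimes>\<^bsub>G\<^esub> (x \<otimes>\<^bsub>G\<^esub> y)) = \<zero>\<^bsub>G\<^esub>"

definition lie_morphism ::
    "'k ring \<Rightarrow> ('k, 'g) module \<Rightarrow> ('k, 'h) module \<Rightarrow> ('g \<Rightarrow> 'h) \<Rightarrow> bool" where
  "lie_morphism K G G' f \<longleftrightarrow>
     lie_algebra K G \<and> lie_algebra K G' \<and> linear_map K G G' f \<and>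
     (\<forall>x\<in>carrier G. \<forall>y\<in>carrier G. f (x \<otimes>\<^bsub>G\<^esub> y) = f x \<otimes>\<^bsub>G'\<^esub> f y)"

text \<open>
  Complexes live in degrees \<open>n \<ge> 0\<close>: \<open>d n\<close> maps \<open>C n\<close> to \<open>C (n + 1)\<close>, \<open>L x n\<close> acts on \<open>C n\<close>, and
  \<open>i x n\<close> maps \<open>C n\<close> to \<open>C (n - 1)\<close>. On \<open>C 0\<close> contractions vanish, so that \<open>i x 0\<close> is never used.
\<close>

locale equivariant_complex = G: lie_algebra K G for K :: "'k ring" and G :: "('k, 'g) module" +
  fixes C :: "nat \<Rightarrow> ('k, 'c) module"
    and d :: "nat \<Rightarrow> 'c \<Rightarrow> 'c"
    and L :: "'g \<Rightarrow> nat \<Rightarrow> 'c \<Rightarrow> 'c"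
    and i :: "'g \<Rightarrow> nat \<Rightarrow> 'c \<Rightarrow> 'c"
  assumes C_module: "module K (C n)"
    and d_linear: "linear_map K (C n) (C (Suc n)) (d n)"
    and d_d: "c \<in> carrier (C n) \<Longrightarrow> d (Suc n) (d n c) = \<zero>\<^bsub>C (Suc (Suc n))\<^esub>"
    and L_linear: "x \<in> carrier G \<Longrightarrow> linear_map K (C n) (C n) (L x n)"
    and i_linear: "x \<in> carrier G \<Longrightarrow> linear_map K (C (Suc n)) (C n) (i x (Suc n))"
    and L_linear_arg: "c \<in> carrier (C n) \<Longrightarrow> linear_map K G (C n) (\<lambda>x. L x n c)"
    and i_linear_arg: "c \<in> carrier (C (Suc n)) \<Longrightarrow> linear_map K G (C n) (\<lambda>x. i x (Suc n) c)"
    and L_bracket: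
      "\<lbrakk>x \<in> carrier G; y \<in> carrier G; c \<in> carrier (C n)\<rbrakk> \<Longrightarrow>
        L x n (L y n c) \<ominus>\<^bsub>C n\<^esub> L y n (L x n c) = L (x \<otimes>\<^bsub>G\<^esub> y) n c"
    and cartan_0:
      "\<lbrakk>x \<in> carrier G; c \<in> carrier (C 0)\<rbrakk> \<Longrightarrow> L x 0 c = i x 1 (d 0 c)"
    and cartan_Suc:
      "\<lbrakk>x \<in> carrier G; c \<in> carrier (C (Suc n))\<rbrakk> \<Longrightarrow>
        L x (Suc n) c = d n (i x (Suc n) c) \<oplus>\<^bsub>C (Suc n)\<^esub> i x (Suc (Suc n)) (d (Suc n) c)"
    and i_i:
      "\<lbrakk>x \<in> carrier G; y \<in> carrier G; c \<in> carrier (C (Suc (Suc n)))\<rbrakk> \<Longrightarrow>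
        i x (Suc n) (i y (Suc (Suc n)) c) \<oplus>\<^bsub>C n\<^esub> i y (Suc n) (i x (Suc (Suc n)) c) = \<zero>\<^bsub>C n\<^esub>"
    and L_i:
      "\<lbrakk>x \<in> carrier G; y \<in> carrier G; c \<in> carrier (C (Suc n))\<rbrakk> \<Longrightarrow>
        L x n (i y (Suc n) c) \<ominus>\<^bsub>C n\<^esub> i y (Suc n) (L x (Suc n) c) = i (x \<otimes>\<^bsub>G\<^esub> y) (Suc n) c"

locale hamilton_operator = equivariant_complex K G C d L i
  for K :: "'k ring" and G :: "('k, 'g) module" and C :: "nat \<Rightarrow> ('k, 'c) module" and d L i +
  fixes H :: "'c \<Rightarrow> 'g"
  assumes H_linear: "linear_map K (C 1) G H"
    and H_skew:
      "\<lbrakk>\<alpha> \<in> carrier (C 1); \<beta> \<in> carrier (C 1)\<rbrakk> \<Longrightarrow>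
        i (H \<alpha>) 1 \<beta> \<oplus>\<^bsub>C 0\<^esub> i (H \<beta>) 1 \<alpha> = \<zero>\<^bsub>C 0\<^esub>"
    and H_cyclic:
      "\<lbrakk>\<alpha> \<in> carrier (C 1); \<beta> \<in> carrier (C 1); \<gamma> \<in> carrier (C 1)\<rbrakk> \<Longrightarrow>
        i (H \<gamma>) 1 (L (H \<alpha>) 1 \<beta>) \<oplus>\<^bsub>C 0\<^esub> i (H \<alpha>) 1 (L (H \<beta>) 1 \<gamma>)
          \<oplus>\<^bsub>C 0\<^esub> i (H \<beta>) 1 (L (H \<gamma>) 1 \<alpha>) = \<zero>\<^bsub>C 0\<^esub>"


section \<open>Reduction\<close>

text \<open>
  The operator induced by \<^const>\<open>Ham\<close> on the quotient algebra \<open>B\<close>: if the image of \<open>\<beta>\<close> lies in the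
  kernel complex of \<open>B\<close>, then \<open>Ham \<omega> \<beta>\<close> descends along \<open>\<pi>\<close> to a derivation of \<open>B\<close> over \<open>R\<close>, and
  \<open>H\<close> sends the image of \<open>\<beta>\<close> to the class of this derivation.
\<close>

definition induced_by_Ham ::
    "'k ring \<Rightarrow> ('k, 'a) module \<Rightarrow> 'a set \<Rightarrow> ('k, 'a) form set \<Rightarrow>
     ('k, 'b) module \<Rightarrow> 'b set \<Rightarrow> ('b \<times> 'b \<Rightarrow> 'k) set \<Rightarrow> ('a \<Rightarrow> 'b) \<Rightarrow>
     (('k, 'b) form set \<Rightarrow> ('b \<Rightarrow> 'b) set) \<Rightarrow> bool" where
  "induced_by_Ham K A S \<omega> B T e \<pi> H \<longleftrightarrow>
     H \<in> carrier (Kcx K B T e 1) \<rightarrow> carrier (HH1 K B T) \<and>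
     (\<forall>\<beta>\<in>DR_deg K A S 1. DR_map K A S B T \<pi> \<beta> \<in> carrier (Kcx K B T e 1) \<longrightarrow>
        (\<exists>\<theta>\<in>H (DR_map K A S B T \<pi> \<beta>). \<forall>a\<in>carrier A. \<theta> (\<pi> a) = \<pi> (Ham K A S \<omega> \<beta> a)))"

text \<open>
  The bracket \<open>{p, q} = i\<^bsub>H(dp)\<^esub> dq\<close> on the degree zero part of the kernel complex, transported
  to \<open>B / [B, B]\<close>.
\<close>

definition reduced_nat_lie ::
    "'k ring \<Rightarrow> ('k, 'b) module \<Rightarrow> 'b set \<Rightarrow> (('k, 'b) form set \<Rightarrow> ('b \<Rightarrow> 'b) set)
      \<Rightarrow> ('k, 'b set) module" where
  "reduced_nat_lie K B T H =
     (nat_alg K B)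
       \<lparr>mult := (\<lambda>p q. inv_into (carrier (nat_alg K B)) (nat_to_DR K B T)
          (Kcx_contr K B T (H (DR_d K B T (nat_to_DR K B T p)))
             (DR_d K B T (nat_to_DR K B T q))))\<rparr>"

end

theory Submission
  imports Defs
begin

text \<open>
 The Hamiltonian derivation of the class of \<open>\<iota>\<^bsub>\<Theta>\<^esub> \<omega>\<close> is \<open>\<Theta>\<close> followed by the product of \<open>A\<close>. Let \<open>\<beta>\<close> be
 a one-form on \<open>A\<close> with Hamiltonian derivation \<open>\<theta>\<close> whose image in the reduced algebra \<open>B\<close> is killed
 by \<open>\<iota>\<^bsub>\<Delta>\<^esub>\<close>. Since \<open>\<iota>\<^bsub>\<Delta>\<^esub> \<omega> = dw\<close>, contraction with \<open>\<theta>\<close> gives \<open>\<theta>(w) = 0\<close> in \<open>B\<close>, so \<open>\<theta>\<close> descends.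
 A one-form whose image vanishes is, modulo commutators, a sum of terms \<open>u dv\<close> with \<open>u\<close> or \<open>v\<close> in the ideal
 of \<open>w\<close>, hence a sum of terms \<open>u dv\<close> with \<open>u\<close> in the ideal and terms \<open>u dw\<close>. The former have Hamiltonian
 derivations that vanish in \<open>B\<close>; the latter are \<open>\<iota>\<^bsub>u\<Delta>\<^esub> \<omega>\<close> and have inner ones. So the class of
 the descended derivation depends only on the image of \<open>\<beta>\<close>. The Hamilton identity is \<open>d\<omega> = 0\<close> read
 through the Cartan formulas. If \<open>A\<close> is smooth, every derivation of \<open>B\<close> lifts to a double derivation of \<open>A\<close>,
 which inverts the construction.
\<close>

\<comment> \<open>Forms are cosets in a free algebra and the operators on them are definite
  descriptions, so each operator must be constructed and shown unique before it can be used. Maps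
  out of the algebra of forms are available only as algebra maps; odd derivations are therefore
  built inside triangular matrices and compared on the generators a and da. The sign rules of the
  definitions speak of homogeneous forms only; the grading involution \<sigma> and, with one half in
  \<open>K\<close>, the even and odd parts of a form turn them into identities for all forms, which
  is what permits induction over generators. Two facts carry the symplectic part. The product map
  and \<open>diamond\<close>, applied to the same double contraction, differ by a super commutator,
  so contraction with a derivation and reduced contraction with a double derivation agree in the de
  Rham quotient. And super commutators of low degree are as small as possible: in degree zero they
  come from commutators of \<open>A\<close>, in degree one from commutators of \<open>A\<close> with
  one-forms. The latter makes \<open>Ham\<close> well defined and controls which forms die in
  \<open>B\<close>.\<close>
syntax (input) "_index" :: "logic \<Rightarrow> index" (\<open>(\<^sub>_)\<close> [1000])

abbreviation (input) in_carrier (infix \<open>\<in>.\<close> 50) where "x \<in>. M \<equiv> x \<in> carrier M"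

section \<open>Linear algebra\<close>

text \<open>Modules have no product, so identities in them are normalised with the laws of sums and
  negatives alone.\<close>

lemmas (in abelian_group) group_simprules
 [algebra abelian_group "zero G" "add G" "a_inv G" "a_minus G"] =
 a_closed zero_closed a_inv_closed minus_closed
 a_assoc l_zero l_neg a_comm minus_eq r_zero r_neg r_neg2 r_neg1
 minus_add minus_minus minus_zero a_lcomm

lemma module_abelian_group: "module K M ==> abelian_group M"
 by (simp add: module_def)

lemma (in abelian_group) minus_eq_zero_iff:
 assumes "x \<in>. G" "y \<in>. G"
 shows "x \<ominus> y = \<zero> \<longleftrightarrow> x = y"
proof
 assume *: "x \<ominus> y = \<zero>"
 have "x = (x \<ominus> y) \<oplus> y" using assms by algebra
 then show "x = y" using * assms by simp
qed (use assms in \<open>algebra\<close>)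

lemma (in abelian_group) minus_eq_trans:
 assumes "a \<in>. G" "b \<in>. G" "c \<in>. G"
 shows "(a \<ominus> b) \<oplus> (b \<ominus> c) = a \<ominus> c"
 using assms by algebra

lemma (in abelian_group) swap_minus:
 assumes "a \<in>. G" "b \<in>. G" "c \<in>. G" "d \<in>. G"
 shows "(a \<oplus> b) \<ominus> (c \<oplus> d) = (a \<ominus> c) \<oplus> (b \<ominus> d)"
 using assms by algebra

lemma linear_mapI:
 assumes "\<And>x. x \<in>. M ==> f x \<in>. N"
  and "\<And>x y. x \<in>. M ==> y \<in>. M ==> f (x \<oplus>\<^sub>M y) = f x \<oplus>\<^sub>N f y"
  and "\<And>c x. c \<in>. K ==> x \<in>. M ==> f (c \<odot>\<^sub>M x) = c \<odot>\<^sub>N f x"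
 shows "linear_map K M N f"
 using assms by (auto simp: linear_map_def)

lemma lin_closed: "linear_map K M N f ==> x \<in>. M ==> f x \<in>. N"
 by (auto simp: linear_map_def)

lemma lin_add:
 "linear_map K M N f ==> x \<in>. M ==> y \<in>. M ==> f (x \<oplus>\<^sub>M y) = f x \<oplus>\<^sub>N f y"
 by (auto simp: linear_map_def)

lemma lin_smult:
 "linear_map K M N f ==> c \<in>. K ==> x \<in>. M ==> f (c \<odot>\<^sub>M x) = c \<odot>\<^sub>N f x"
 by (auto simp: linear_map_def)

lemma lin_hom:
 assumes "linear_map K M N f" "module K M" "module K N"
 shows "abelian_group_hom M N f"
 using assms
 by (intro abelian_group_homI module_abelian_group)
   (auto simp: linear_map_def intro!: group_hom.intro group_hom_axioms.intro homI
    dest: module_abelian_group abelian_group.a_group)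

lemma lin_zero:
 "linear_map K M N f ==> module K M ==> module K N ==> f \<zero>\<^sub>M = \<zero>\<^sub>N"
 using abelian_group_hom.hom_zero[OF lin_hom] by blast

lemma lin_neg:
 "linear_map K M N f ==> module K M ==> module K N ==> x \<in>. M ==>
  f (\<ominus>\<^sub>M x) = \<ominus>\<^sub>N f x"
 by (rule abelian_group_hom.hom_a_inv[OF lin_hom])

lemma lin_minus:
 assumes "linear_map K M N f" "module K M" "module K N" "x \<in>. M" "y \<in>. M"
 shows "f (x \<ominus>\<^sub>M y) = f x \<ominus>\<^sub>N f y"
proof -
 interpret M: module K M by fact
 show ?thesis
  using assms(4,5) by (simp add: a_minus_def lin_add[OF assms(1)] lin_neg[OF assms(1-3)])
qed

lemmas lin_simps = lin_closed lin_add lin_smult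
lemmas lin_mod_simps = lin_zero lin_neg lin_minus

lemma lin_comp:
 "linear_map K L M f ==> linear_map K M N g ==> linear_map K L N (\<lambda>x. g (f x))"
 by (auto simp: linear_map_def Pi_iff)

lemma lin_id: "linear_map K M M (\<lambda>x. x)"
 by (auto simp: linear_map_def)

lemma lin_const_zero:
 assumes "module K N" shows "linear_map K M N (\<lambda>x. \<zero>\<^sub>N)"
proof -
 interpret module K N by fact
 show ?thesis by (rule linear_mapI) auto
qed

lemma lin_plus:
 assumes "linear_map K M N f" "linear_map K M N g" "module K N"
 shows "linear_map K M N (\<lambda>x. f x \<oplus>\<^sub>N g x)"
proof -
 interpret N: module K N by fact
 note [simp] = lin_closed[OF assms(1)] lin_closed[OF assms(2)]
  lin_add[OF assms(1)] lin_add[OF assms(2)] lin_smult[OF assms(1)] lin_smult[OF assms(2)]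
 show ?thesis
  by (rule linear_mapI) (auto simp: N.smult_r_distr N.a_ac)
qed

lemma lin_uminus:
 assumes "linear_map K M N f" "module K N"
 shows "linear_map K M N (\<lambda>x. \<ominus>\<^sub>N f x)"
proof -
 interpret N: module K N by fact
 note [simp] = lin_closed[OF assms(1)] lin_add[OF assms(1)] lin_smult[OF assms(1)]
 show ?thesis
  by (rule linear_mapI) (auto simp: N.smult_r_minus N.minus_add)
qed

lemma lin_diff:
 assumes "linear_map K M N f" "linear_map K M N g" "module K N"
 shows "linear_map K M N (\<lambda>x. f x \<ominus>\<^sub>N g x)"
 unfolding a_minus_def by (intro lin_plus lin_uminus assms)

lemma lin_scale:
 assumes "linear_map K M N f" "module K N" "c \<in>. K"
 shows "linear_map K M N (\<lambda>x. c \<odot>\<^sub>N f x)"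
proof -
 interpret N: module K N by fact
 note [simp] = lin_closed[OF assms(1)] lin_add[OF assms(1)] lin_smult[OF assms(1)]
 show ?thesis
  using assms(3)
  by (intro linear_mapI)
    (auto simp: N.smult_r_distr N.smult_assoc1[symmetric] N.R.m_comm)
qed

lemma lin_cong:
 assumes "linear_map K M N f" "\<And>x. x \<in>. M ==> g x = f x" "module K M"
 shows "linear_map K M N g"
proof -
 interpret M: module K M by fact
 show ?thesis using assms(1,2) by (auto simp: linear_map_def)
qed

lemma lin_restrict:
 "linear_map K M N f ==> module K M ==> linear_map K M N (restrict f (carrier M))"
 by (rule lin_cong) auto

lemma lin_into:
 assumes "linear_map K M N f" "\<And>x. x \<in>. M ==> f x \<in> H"
 shows "linear_map K M (N\<lparr>carrier := H\<rparr>) f"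
 using assms by (auto simp: linear_map_def)

lemma lin_from:
 assumes "linear_map K M N f" "H \<subseteq> carrier M"
 shows "linear_map K (M\<lparr>carrier := H\<rparr>) N f"
 using assms by (intro linear_mapI) (auto simp: subset_iff simp: lin_simps[OF assms(1)])


subsection \<open>Spans\<close>

lemma (in module) submodule_zero: "submodule N R M ==> \<zero>\<^sub>M \<in> N"
 using subgroup.one_closed[OF submodule.axioms(1)] by fastforce

lemma (in module) submodule_Inter:
 assumes "\<F> \<noteq> {}" "\<And>N. N \<in> \<F> ==> submodule N R M"
 shows "submodule (\<Inter>\<F>) R M"
proof (rule submoduleI)
 obtain N where "N \<in> \<F>" using assms(1) by auto
 then show "\<Inter>\<F> \<subseteq> carrier M" using submoduleE(1)[OF assms(2)] by blast
qed (simp_all add: submodule_zero submoduleE(3-5) assms(2))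

lemma submodule_module:
 "module K M ==> submodule N K M ==> module K (M\<lparr>carrier := N\<rparr>)"
 by (rule submodule.submodule_is_module)

lemma lin_span_submodule:
 assumes "module K M" "H \<subseteq> carrier M"
 shows "submodule (lin_span K M H) K M"
proof -
 interpret module K M by fact
 show ?thesis unfolding lin_span_def
  by (rule submodule_Inter) (use assms(2) carrier_is_submodule in auto)
qed

lemma lin_span_least: "submodule N K M ==> H \<subseteq> N ==> lin_span K M H \<subseteq> N"
 by (auto simp: lin_span_def)

lemma lin_span_base: "x \<in> H ==> x \<in> lin_span K M H"
 by (auto simp: lin_span_def)

lemma lin_span_closed:
 assumes "module K M" "H \<subseteq> carrier M" "x \<in> lin_span K M H"
 shows "x \<in>. M"
 using module.submoduleE(1)[OF assms(1) lin_span_submodule[OF assms(1,2)]] assms(3) by auto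

lemma lin_span_mono:
 "H \<subseteq> H' ==> lin_span K M H \<subseteq> lin_span K M H'"
 by (auto simp: lin_span_def)

text \<open>The elements of the span that satisfy \<open>P\<close> form a submodule containing
  \<open>H\<close>. Closure under negation comes from scaling by minus one.\<close>

lemma lin_span_induct [consumes 3, case_names base zero add smult]:
 assumes x: "x \<in> lin_span K M H" and M: "module K M" and H: "H \<subseteq> carrier M"
  and base: "\<And>h. h \<in> H ==> P h" and zero: "P \<zero>\<^sub>M"
  and add: "\<And>x y. x \<in> lin_span K M H ==> y \<in> lin_span K M H ==> P x ==> P y ==> P (x \<oplus>\<^sub>M y)"
  and smult: "\<And>c x. c \<in>. K ==> x \<in> lin_span K M H ==> P x ==> P (c \<odot>\<^sub>M x)"
 shows "P x"
proof -
 interpret module K M by fact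
 note sub = lin_span_submodule[OF M H]
 let ?N = "{x \<in> lin_span K M H. P x}"
 have "submodule ?N K M"
 proof (rule submoduleI)
  fix a assume a: "a \<in> ?N"
  then have "a \<in>. M" using lin_span_closed[OF M H] by auto
  then have "\<ominus>\<^sub>M a = (\<ominus>\<^sub>K \<one>\<^sub>K) \<odot>\<^sub>M a" by (simp add: smult_l_minus)
  then show "\<ominus>\<^sub>M a \<in> ?N" using a smult submoduleE(4)[OF sub] by auto
 qed (use zero add smult submoduleE[OF sub] submodule_zero[OF sub] in auto)
 then have "lin_span K M H \<subseteq> ?N"
  by (rule lin_span_least) (use base lin_span_base in auto)
 then show ?thesis using x by auto
qed

lemma lin_span_vanish:
 assumes "linear_map K M N f" "module K M" "module K N" "H \<subseteq> carrier M"
  and "\<And>h. h \<in> H ==> f h = \<zero>\<^sub>N" and x: "x \<in> lin_span K M H"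
 shows "f x = \<zero>\<^sub>N"
proof -
 interpret N: module K N by fact
 note [simp] = lin_simps[OF assms(1)] lin_span_closed[OF assms(2,4)]
 show ?thesis using x assms(2,4)
  by (induction rule: lin_span_induct) (simp_all add: assms(2-5) lin_zero[OF assms(1-3)])
qed

text \<open>Apply \<open>lin_span_vanish\<close> to the difference. Most later identities are
  reduced to generators in this way.\<close>

lemma lin_span_eq:
 assumes "linear_map K M N f" "linear_map K M N g" "module K M" "module K N" "H \<subseteq> carrier M"
  and "\<And>h. h \<in> H ==> f h = g h" and "x \<in> lin_span K M H"
 shows "f x = g x"
proof -
 interpret N: module K N by fact
 have "f x \<ominus>\<^sub>N g x = \<zero>\<^sub>N"
  using assms(5) lin_closed[OF assms(1)] lin_closed[OF assms(2)]
  by (intro lin_span_vanish[OF lin_diff[OF assms(1,2,4)] assms(3,4,5) _ assms(7)])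
    (auto simp: assms(6) N.minus_eq_zero_iff subset_iff)
 then show ?thesis
  using lin_closed[OF assms(1)] lin_closed[OF assms(2)] lin_span_closed[OF assms(3,5,7)]
  by (simp add: N.minus_eq_zero_iff)
qed

lemma lin_span_map_into:
 assumes "linear_map K M N f" "module K M" "module K N" "H \<subseteq> carrier M" "submodule U K N"
  and "\<And>h. h \<in> H ==> f h \<in> U" and x: "x \<in> lin_span K M H"
 shows "f x \<in> U"
proof -
 interpret N: module K N by fact
 note [simp] = lin_simps[OF assms(1)] lin_span_closed[OF assms(2,4)]
 show ?thesis using x assms(2,4)
  by (induction rule: lin_span_induct)
    (simp_all add: assms lin_zero[OF assms(1-3)] N.submodule_zero N.submoduleE)
qed

lemma lin_image_submodule:
 assumes "linear_map K M N f" "module K M" "module K N" "submodule U K M"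
 shows "submodule (f ` U) K N"
proof -
 interpret M: module K M by fact
 interpret N: module K N by fact
 note U = M.submoduleE[OF assms(4)]
 have car: "x \<in>. M" if "x \<in> U" for x using U(1) that by auto
 show ?thesis
 proof (rule N.submoduleI)
  show "f ` U \<subseteq> carrier N" using car lin_closed[OF assms(1)] by auto
  show "\<zero>\<^sub>N \<in> f ` U"
   using M.submodule_zero[OF assms(4)] lin_zero[OF assms(1,2,3)] by force
  show "\<ominus>\<^sub>N a \<in> f ` U" if a: "a \<in> f ` U" for a
  proof -
   obtain x where x: "x \<in> U" "a = f x" using a by auto
   have "\<ominus>\<^sub>N a = f (\<ominus>\<^sub>M x)" using lin_neg[OF assms(1-3) car[OF x(1)]] x(2) by simp
   then show ?thesis using U(3)[OF x(1)] by simp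
  qed
  show "a \<oplus>\<^sub>N b \<in> f ` U" if ab: "a \<in> f ` U" "b \<in> f ` U" for a b
  proof -
   obtain x y where x: "x \<in> U" "a = f x" "y \<in> U" "b = f y" using ab by auto
   have "a \<oplus>\<^sub>N b = f (x \<oplus>\<^sub>M y)" using lin_add[OF assms(1) car[OF x(1)] car[OF x(3)]] x(2,4) by simp
   then show ?thesis using U(5)[OF x(1,3)] by simp
  qed
  show "c \<odot>\<^sub>N b \<in> f ` U" if cb: "c \<in>. K" "b \<in> f ` U" for c b
  proof -
   obtain x where x: "x \<in> U" "b = f x" using cb by auto
   have "c \<odot>\<^sub>N b = f (c \<odot>\<^sub>M x)" using lin_smult[OF assms(1) cb(1) car[OF x(1)]] x(2) by simp
   then show ?thesis using U(4)[OF cb(1) x(1)] by simp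
  qed
 qed
qed

lemma lin_kernel_submodule:
 assumes "linear_map K M N f" "module K M" "module K N"
 shows "submodule {x \<in> carrier M. f x = \<zero>\<^sub>N} K M"
proof -
 interpret M: module K M by fact
 interpret N: module K N by fact
 note [simp] = lin_mod_simps[OF assms(1,2,3)] lin_simps[OF assms(1)]
 show ?thesis by (rule M.submoduleI) auto
qed


subsection \<open>Bilinear maps\<close>

definition bilinear where
 "bilinear K M N P f \<longleftrightarrow>
   (\<forall>x\<in>carrier M. linear_map K N P (f x)) \<and> (\<forall>y\<in>carrier N. linear_map K M P (\<lambda>x. f x y))"

lemma bilinearI:
 assumes "\<And>x. x \<in>. M ==> linear_map K N P (f x)"
  and "\<And>y. y \<in>. N ==> linear_map K M P (\<lambda>x. f x y)"
 shows "bilinear K M N P f"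
 using assms by (simp add: bilinear_def)

lemma bilinear1: "bilinear K M N P f ==> y \<in>. N ==> linear_map K M P (\<lambda>x. f x y)"
 and bilinear2: "bilinear K M N P f ==> x \<in>. M ==> linear_map K N P (f x)"
 by (simp_all add: bilinear_def)

lemma bilinear_comp:
 "bilinear K M N P f ==> linear_map K P Q g ==> bilinear K M N Q (\<lambda>x y. g (f x y))"
 by (auto simp: bilinear_def intro: lin_comp)

lemma bilinear_comp2:
 assumes "bilinear K M N P f" "linear_map K M' M g" "linear_map K N' N h"
 shows "bilinear K M' N' P (\<lambda>x y. f (g x) (h y))"
proof (rule bilinearI)
 show "linear_map K N' P (\<lambda>y. f (g x) (h y))" if "x \<in>. M'" for x
  using lin_comp[OF assms(3) bilinear2[OF assms(1)]] lin_closed[OF assms(2) that] by simp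
 show "linear_map K M' P (\<lambda>x. f (g x) (h y))" if "y \<in>. N'" for y
  using lin_comp[OF assms(2) bilinear1[OF assms(1)]] lin_closed[OF assms(3) that] by simp
qed

lemma bilinear_swap: "bilinear K M N P f ==> bilinear K N M P (\<lambda>x y. f y x)"
 by (simp add: bilinear_def)

lemma bilinear_plus:
 assumes "bilinear K M N P f" "bilinear K M N P g" "module K P"
 shows "bilinear K M N P (\<lambda>x y. f x y \<oplus>\<^sub>P g x y)"
 using assms unfolding bilinear_def by (auto intro!: lin_plus)

lemma bilinear_diff:
 assumes "bilinear K M N P f" "bilinear K M N P g" "module K P"
 shows "bilinear K M N P (\<lambda>x y. f x y \<ominus>\<^sub>P g x y)"
 using assms unfolding bilinear_def by (auto intro!: lin_diff)

lemma bilinear_span_eq: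
 assumes "bilinear K M N P f" "bilinear K M N P g" "module K M" "module K N" "module K P"
  and "H \<subseteq> carrier M" "G \<subseteq> carrier N"
  and "\<And>h k. h \<in> H ==> k \<in> G ==> f h k = g h k"
  and "x \<in> lin_span K M H" "y \<in> lin_span K N G"
 shows "f x y = g x y"
proof -
 have "f h y = g h y" if "h \<in> H" for h
  using assms(6,8) that
  by (intro lin_span_eq[OF bilinear2[OF assms(1)] bilinear2[OF assms(2)] assms(4,5,7) _ assms(10)])
    auto
 then show ?thesis
  using lin_span_closed[OF assms(4,7,10)]
  by (intro lin_span_eq[OF bilinear1[OF assms(1)] bilinear1[OF assms(2)] assms(3,5,6) _ assms(9)])
    auto
qed

lemma bilinear_span_into:
 assumes "bilinear K M N P f" "module K M" "module K N" "module K P" "submodule U K P"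
  and "H \<subseteq> carrier M" "G \<subseteq> carrier N"
  and "\<And>h k. h \<in> H ==> k \<in> G ==> f h k \<in> U"
  and "x \<in> lin_span K M H" "y \<in> lin_span K N G"
 shows "f x y \<in> U"
proof -
 have "f h y \<in> U" if "h \<in> H" for h
  using assms(6,8) that
  by (intro lin_span_map_into[OF bilinear2[OF assms(1)] assms(3,4,7,5) _ assms(10)]) auto
 then show ?thesis
  using lin_span_closed[OF assms(3,7,10)]
  by (intro lin_span_map_into[OF bilinear1[OF assms(1)] assms(2,4,6,5) _ assms(9)]) auto
qed

lemma assoc_algebra_module: "assoc_algebra K A ==> module K A"
 by (simp add: assoc_algebra_def)

lemma assoc_algebra_ring: "assoc_algebra K A ==> ring A"
 by (simp add: assoc_algebra_def)

lemma (in assoc_algebra) bilinear_mult: "bilinear K A A A (\<lambda>x y. x \<otimes>\<^sub>A y)"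
 by (intro bilinearI linear_mapI) (auto simp: l_distr r_distr smult_mult_left smult_mult_right)


subsection \<open>Images of modules and algebras\<close>

text \<open>The laws are transported along a map \<open>p\<close> onto \<open>Q\<close> that
  respects the operations, so no coset has to be opened. With \<open>p\<close> the identity it
  serves for records that differ only in their multiplication.\<close>

lemma module_image:
 assumes M: "module K M" and car: "carrier Q = p ` carrier M" and zero: "\<zero>\<^sub>Q = p \<zero>\<^sub>M"
  and add: "\<And>x y. x \<in>. M ==> y \<in>. M ==> p x \<oplus>\<^sub>Q p y = p (x \<oplus>\<^sub>M y)"
  and smult: "\<And>c x. c \<in>. K ==> x \<in>. M ==> c \<odot>\<^sub>Q p x = p (c \<odot>\<^sub>M x)"
 shows "module K Q"
proof -
 interpret M: module K M by fact
 show ?thesis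
 proof (rule moduleI)
  show "abelian_group Q"
  proof (rule abelian_groupI)
   show "\<exists>y\<in>carrier Q. y \<oplus>\<^sub>Q x = \<zero>\<^sub>Q" if "x \<in>. Q" for x
   proof -
    obtain u where u: "u \<in>. M" "x = p u" using \<open>x \<in>. Q\<close> car by auto
    then have "p (\<ominus>\<^sub>M u) \<oplus>\<^sub>Q x = \<zero>\<^sub>Q" by (simp add: add zero M.l_neg)
    then show ?thesis using u car by auto
   qed
  qed (auto simp: car zero add M.a_ac)
 qed (use M.R.cring_axioms in \<open>auto simp: car add smult M.smult_l_distr M.smult_r_distr M.smult_assoc1\<close>)
qed

lemma assoc_algebraI:
 assumes "module K A"
  and "\<And>x y. x \<in>. A ==> y \<in>. A ==> x \<otimes>\<^sub>A y \<in>. A"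
  and "\<one>\<^sub>A \<in>. A"
  and "\<And>x y z. x \<in>. A ==> y \<in>. A ==> z \<in>. A ==>
   (x \<otimes>\<^sub>A y) \<otimes>\<^sub>A z = x \<otimes>\<^sub>A (y \<otimes>\<^sub>A z)"
  and "\<And>x. x \<in>. A ==> \<one>\<^sub>A \<otimes>\<^sub>A x = x" "\<And>x. x \<in>. A ==> x \<otimes>\<^sub>A \<one>\<^sub>A = x"
  and bil: "bilinear K A A A (\<lambda>x y. x \<otimes>\<^sub>A y)"
 shows "assoc_algebra K A"
proof -
 interpret module K A by fact
 note [simp] = lin_add[OF bilinear1[OF bil]] lin_add[OF bilinear2[OF bil]]
  lin_smult[OF bilinear1[OF bil]] lin_smult[OF bilinear2[OF bil]]
 have "ring A"
  by (intro ringI monoidI) (use assms abelian_group_axioms in auto)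
 then show ?thesis
  by (auto intro!: assoc_algebra.intro assms(1) assoc_algebra_axioms.intro)
qed

lemma assoc_algebra_image:
 assumes A: "assoc_algebra K A" and car: "carrier Q = p ` carrier A" and zero: "\<zero>\<^sub>Q = p \<zero>\<^sub>A"
  and add: "\<And>x y. x \<in>. A ==> y \<in>. A ==> p x \<oplus>\<^sub>Q p y = p (x \<oplus>\<^sub>A y)"
  and smult: "\<And>c x. c \<in>. K ==> x \<in>. A ==> c \<odot>\<^sub>Q p x = p (c \<odot>\<^sub>A x)"
  and mult: "\<And>x y. x \<in>. A ==> y \<in>. A ==> p x \<otimes>\<^sub>Q p y = p (x \<otimes>\<^sub>A y)"
  and one: "\<one>\<^sub>Q = p \<one>\<^sub>A"
 shows "assoc_algebra K Q"
proof -
 interpret A: assoc_algebra K A by fact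
 show ?thesis
  by (intro assoc_algebraI module_image[OF A.module_axioms car zero add smult] bilinearI linear_mapI)
    (auto simp: car one mult add smult A.m_assoc A.l_distr A.r_distr A.smult_mult_left A.smult_mult_right)
qed


subsection \<open>Quotient modules\<close>

lemma submodule_abelian_subgroup:
 assumes "module K M" "submodule N K M" shows "abelian_subgroup N M"
 using assms
 by (intro abelian_subgroupI3 additive_subgroupI submodule.axioms(1) module_abelian_group)

context
 fixes K :: "'k ring" and M :: "('k, 'm) module" and N
 assumes M: "module K M" and N: "submodule N K M"
begin

interpretation M: module K M by (rule M)
interpretation N: abelian_subgroup N M by (rule submodule_abelian_subgroup[OF M N])

lemma coset_eq_iff:
 assumes "x \<in>. M" "y \<in>. M"
 shows "N +>\<^sub>M x = N +>\<^sub>M y \<longleftrightarrow> x \<ominus>\<^sub>M y \<in> N"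
proof
 assume "N +>\<^sub>M x = N +>\<^sub>M y"
 then have "x \<in> N +>\<^sub>M y" using N.a_rcos_self[OF assms(1)] by simp
 then show "x \<ominus>\<^sub>M y \<in> N" using assms N.a_rcos_module_imp by (simp add: a_minus_def)
next
 assume "x \<ominus>\<^sub>M y \<in> N"
 then have "x \<in> N +>\<^sub>M y" using assms N.a_rcos_module_rev by (simp add: a_minus_def)
 then show "N +>\<^sub>M x = N +>\<^sub>M y"
  using assms N.a_subgroup M.a_repr_independence by metis
qed

lemma coset_memD:
 assumes "x \<in>. M" "y \<in> N +>\<^sub>M x"
 shows "y \<in>. M" "N +>\<^sub>M y = N +>\<^sub>M x"
proof -
 show "y \<in>. M"
  using assms N.a_subset M.a_r_coset_subset_G by blast
 show "N +>\<^sub>M y = N +>\<^sub>M x"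
  using assms N.a_subgroup M.a_repr_independence by metis
qed

lemma coset_self: "x \<in>. M ==> x \<in> N +>\<^sub>M x"
 by (rule N.a_rcos_self)

lemma coset_zero: "N +>\<^sub>M \<zero>\<^sub>M = N"
 by (simp add: M.a_coset_add_zero N.a_subset)

lemma quot_carrier: "carrier (quot_mod M N) = (\<lambda>x. N +>\<^sub>M x) ` carrier M"
 by (auto simp: quot_mod_def FactRing_simps)

lemma quot_zero: "\<zero>\<^bsub>quot_mod M N\<^esub> = N +>\<^sub>M \<zero>\<^sub>M"
 by (simp add: quot_mod_def FactRing_def coset_zero)

lemma quot_add:
 "x \<in>. M ==> y \<in>. M ==>
  (N +>\<^sub>M x) \<oplus>\<^bsub>quot_mod M N\<^esub> (N +>\<^sub>M y) = N +>\<^sub>M (x \<oplus>\<^sub>M y)"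
 by (simp add: quot_mod_def FactRing_def N.a_rcos_sum)

lemma quot_smult:
 assumes "c \<in>. K" "x \<in>. M"
 shows "c \<odot>\<^bsub>quot_mod M N\<^esub> (N +>\<^sub>M x) = N +>\<^sub>M (c \<odot>\<^sub>M x)"
proof -
 \<comment> \<open>Scalar multiplication of a coset is a union over all its representatives; each of
   them has to yield the same coset.\<close>
 have *: "N +>\<^sub>M (c \<odot>\<^sub>M y) = N +>\<^sub>M (c \<odot>\<^sub>M x)" if "y \<in> N +>\<^sub>M x" for y
 proof -
  have y: "y \<in>. M" "y \<ominus>\<^sub>M x \<in> N"
   using coset_memD[OF assms(2) that] coset_eq_iff assms(2) by auto
  have "c \<odot>\<^sub>M y \<ominus>\<^sub>M c \<odot>\<^sub>M x = c \<odot>\<^sub>M (y \<ominus>\<^sub>M x)"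
   using assms y by (simp add: a_minus_def M.smult_r_distr M.smult_r_minus)
  then show ?thesis
   using assms y M.submoduleE(4)[OF N] by (simp add: coset_eq_iff)
 qed
 have "(\<Union>y\<in>N +>\<^sub>M x. N +>\<^sub>M (c \<odot>\<^sub>M y)) = (\<Union>y\<in>N +>\<^sub>M x. N +>\<^sub>M (c \<odot>\<^sub>M x))"
  by (rule SUP_cong[OF refl *])
 moreover have "N +>\<^sub>M x \<noteq> {}" using coset_self[OF assms(2)] by auto
 ultimately show ?thesis by (simp add: quot_mod_def)
qed

text \<open>Independence of representatives is u v - x y = (u - x) v + x (v - y). Only bilinearity
  and the ideal property enter, so the lemma serves associative quotients and the Lie algebra
  \<open>HH1\<close> alike.\<close>

lemma quot_mult:
 assumes bil: "bilinear K M M M (\<lambda>x y. x \<otimes>\<^sub>M y)"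
  and abs: "\<And>n x. n \<in> N ==> x \<in>. M ==> n \<otimes>\<^sub>M x \<in> N \<and> x \<otimes>\<^sub>M n \<in> N"
  and x: "x \<in>. M" and y: "y \<in>. M"
 shows "(N +>\<^sub>M x) \<otimes>\<^bsub>quot_mod M N\<^esub> (N +>\<^sub>M y) = N +>\<^sub>M (x \<otimes>\<^sub>M y)"
proof -
 have *: "N +>\<^sub>M (u \<otimes>\<^sub>M v) = N +>\<^sub>M (x \<otimes>\<^sub>M y)"
  if "u \<in> N +>\<^sub>M x" "v \<in> N +>\<^sub>M y" for u v
 proof -
  have u: "u \<in>. M" "u \<ominus>\<^sub>M x \<in> N"
   using coset_memD[OF x that(1)] coset_eq_iff x by auto
  have v: "v \<in>. M" "v \<ominus>\<^sub>M y \<in> N"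
   using coset_memD[OF y that(2)] coset_eq_iff y by auto
  note [simp] = lin_closed[OF bilinear2[OF bil]]
  have "u \<otimes>\<^sub>M v \<in>. M" "x \<otimes>\<^sub>M v \<in>. M" "x \<otimes>\<^sub>M y \<in>. M"
   using u v x y by simp_all
  then have "(u \<otimes>\<^sub>M v) \<ominus>\<^sub>M (x \<otimes>\<^sub>M y) = (u \<ominus>\<^sub>M x) \<otimes>\<^sub>M v \<oplus>\<^sub>M x \<otimes>\<^sub>M (v \<ominus>\<^sub>M y)"
   using u v x y lin_minus[OF bilinear1[OF bil] M M] lin_minus[OF bilinear2[OF bil] M M]
   by (simp add: M.minus_eq_trans)
  also have "\<dots> \<in> N"
   using abs[OF u(2) v(1)] abs[OF v(2) x] M.submoduleE(5)[OF N] by auto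
  finally show ?thesis using u v x y by (simp add: coset_eq_iff)
 qed
 have "(\<Union>u\<in>N +>\<^sub>M x. \<Union>v\<in>N +>\<^sub>M y. N +>\<^sub>M (u \<otimes>\<^sub>M v)) =
   (\<Union>u\<in>N +>\<^sub>M x. \<Union>v\<in>N +>\<^sub>M y. N +>\<^sub>M (x \<otimes>\<^sub>M y))"
  by (intro SUP_cong[OF refl] *)
 moreover have "N +>\<^sub>M x \<noteq> {}" "N +>\<^sub>M y \<noteq> {}"
  using coset_self[OF x] coset_self[OF y] by auto
 ultimately show ?thesis
  by (simp add: quot_mod_def FactRing_def rcoset_mult_def)
qed

lemma quot_module: "module K (quot_mod M N)"
 by (rule module_image[OF M, where p = "\<lambda>x. N +>\<^sub>M x"])
   (simp_all add: quot_carrier quot_zero quot_add quot_smult)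

lemma quot_proj_linear: "linear_map K M (quot_mod M N) (\<lambda>x. N +>\<^sub>M x)"
 by (rule linear_mapI) (auto simp: quot_carrier quot_add quot_smult)

lemma quot_one: "\<one>\<^bsub>quot_mod M N\<^esub> = N +>\<^sub>M \<one>\<^sub>M"
 by (simp add: quot_mod_def FactRing_def)

lemma quot_rep:
 assumes "X \<in>. quot_mod M N"
 shows "rep X \<in>. M" "N +>\<^sub>M rep X = X"
proof -
 obtain x where x: "x \<in>. M" "X = N +>\<^sub>M x" using assms quot_carrier by auto
 then have "rep X \<in> X" unfolding rep_def using coset_self by (metis someI)
 then show "rep X \<in>. M" "N +>\<^sub>M rep X = X"
  using coset_memD[OF x(1), of "rep X"] x(2) by simp_all
qed

lemma quot_rep_coset:
 assumes "x \<in>. M"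
 shows "rep (N +>\<^sub>M x) \<in>. M" "rep (N +>\<^sub>M x) \<ominus>\<^sub>M x \<in> N"
proof -
 have "N +>\<^sub>M x \<in>. quot_mod M N" using assms by (auto simp: quot_carrier)
 note r = quot_rep[OF this]
 show "rep (N +>\<^sub>M x) \<in>. M" by (rule r(1))
 show "rep (N +>\<^sub>M x) \<ominus>\<^sub>M x \<in> N" using coset_eq_iff[OF r(1) assms] r(2) by simp
qed

lemma quot_algebra:
 assumes "assoc_algebra K M"
  and "\<And>n x. n \<in> N ==> x \<in>. M ==> n \<otimes>\<^sub>M x \<in> N \<and> x \<otimes>\<^sub>M n \<in> N"
 shows "assoc_algebra K (quot_mod M N)"
 by (rule assoc_algebra_image[OF assms(1), where p = "\<lambda>x. N +>\<^sub>M x"])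
   (simp_all add: quot_carrier quot_zero quot_add quot_smult quot_one
    quot_mult[OF assoc_algebra.bilinear_mult[OF assms(1)] assms(2)])

text \<open>The factored map is \<open>f\<close> after a choice of representative;
  \<open>kill\<close> makes the choice immaterial.\<close>

lemma quot_factor:
 assumes f: "linear_map K M W f" and W: "module K W" and kill: "\<And>n. n \<in> N ==> f n = \<zero>\<^sub>W"
 shows "\<exists>g. linear_map K (quot_mod M N) W g \<and> (\<forall>x\<in>carrier M. g (N +>\<^sub>M x) = f x)"
proof -
 interpret W: module K W by fact
 have fg: "f (rep (N +>\<^sub>M x)) = f x" if "x \<in>. M" for x
 proof -
  have "f (rep (N +>\<^sub>M x)) \<ominus>\<^sub>W f x = \<zero>\<^sub>W"
   using kill[OF quot_rep_coset(2)[OF that]] quot_rep_coset(1)[OF that] that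
   by (simp add: lin_minus[OF f M W])
  then show ?thesis
   using quot_rep_coset(1)[OF that] that lin_closed[OF f] by (simp add: W.minus_eq_zero_iff)
 qed
 have "linear_map K (quot_mod M N) W (\<lambda>X. f (rep X))"
  by (rule linear_mapI)
    (auto simp: quot_carrier quot_add quot_smult fg lin_simps[OF f])
 then show ?thesis using fg by blast
qed

end



subsection \<open>Free modules\<close>

lemma free_mod_simps:
 "f \<in>. free_mod K X \<longleftrightarrow>
   (\<forall>x. f x \<in>. K) \<and> (\<forall>x. x \<notin> X \<longrightarrow> f x = \<zero>\<^sub>K) \<and> finite {x. f x \<noteq> \<zero>\<^sub>K}"
 "\<zero>\<^bsub>free_mod K X\<^esub> = (\<lambda>_. \<zero>\<^sub>K)"
 "f \<oplus>\<^bsub>free_mod K X\<^esub> g = (\<lambda>x. f x \<oplus>\<^sub>K g x)"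
 "c \<odot>\<^bsub>free_mod K X\<^esub> f = (\<lambda>x. c \<otimes>\<^sub>K f x)"
 by (simp_all add: free_mod_def)

lemma free_mod_module:
 assumes "cring K" shows "module K (free_mod K X)"
proof -
 interpret cring K by fact
 have add: "f \<oplus>\<^bsub>free_mod K X\<^esub> g \<in>. free_mod K X"
  if "f \<in>. free_mod K X" "g \<in>. free_mod K X" for f g
 proof -
  have "{x. f x \<oplus>\<^sub>K g x \<noteq> \<zero>\<^sub>K} \<subseteq> {x. f x \<noteq> \<zero>\<^sub>K} \<union> {x. g x \<noteq> \<zero>\<^sub>K}" by auto
  then show ?thesis using that by (auto simp: free_mod_simps intro: finite_subset)
 qed
 have neg: "\<exists>g\<in>carrier (free_mod K X). g \<oplus>\<^bsub>free_mod K X\<^esub> f = \<zero>\<^bsub>free_mod K X\<^esub>"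
  if "f \<in>. free_mod K X" for f
 proof -
  have "{x. \<ominus>\<^sub>K f x \<noteq> \<zero>\<^sub>K} \<subseteq> {x. f x \<noteq> \<zero>\<^sub>K}" by auto
  then show ?thesis using that
   by (intro bexI[of _ "\<lambda>x. \<ominus>\<^sub>K f x"]) (auto simp: free_mod_simps l_neg intro: finite_subset)
 qed
 have smult: "c \<odot>\<^bsub>free_mod K X\<^esub> f \<in>. free_mod K X"
  if "c \<in>. K" "f \<in>. free_mod K X" for c f
 proof -
  have "{x. c \<otimes>\<^sub>K f x \<noteq> \<zero>\<^sub>K} \<subseteq> {x. f x \<noteq> \<zero>\<^sub>K}" using that by auto
  then show ?thesis using that by (auto simp: free_mod_simps intro: finite_subset)
 qed
 have "abelian_group (free_mod K X)"
  by (rule abelian_groupI) (use add neg in \<open>auto simp: free_mod_simps a_ac\<close>)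
 then show ?thesis
  by (intro moduleI cring_axioms smult)
    (auto simp: free_mod_simps l_distr r_distr m_assoc)
qed

lemma single_closed:
 assumes "cring K" "x \<in> X" shows "single K x \<in>. free_mod K X"
proof -
 interpret cring K by fact
 have "{y. single K x y \<noteq> \<zero>\<^sub>K} \<subseteq> {x}" by (auto simp: single_def)
 then show ?thesis using assms(2)
  by (auto simp: free_mod_simps single_def intro: finite_subset)
qed

text \<open>Induction on a finite set that contains the support, splitting off one basis vector at a
  time.\<close>

lemma free_mod_span:
 assumes "cring K" "f \<in>. free_mod K X"
 shows "f \<in> lin_span K (free_mod K X) (single K ` X)"
proof -
 interpret cring K by fact
 interpret F: module K "free_mod K X" by (rule free_mod_module[OF assms(1)])
 have sub: "submodule (lin_span K (free_mod K X) (single K ` X)) K (free_mod K X)"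
  using single_closed[OF assms(1)] by (intro lin_span_submodule F.module_axioms) auto
 have "finite Z ==> f \<in>. free_mod K X ==> {x. f x \<noteq> \<zero>\<^sub>K} \<subseteq> Z ==>
   f \<in> lin_span K (free_mod K X) (single K ` X)" for Z f
 proof (induction Z arbitrary: f rule: finite_induct)
  case empty
  then have "f = \<zero>\<^bsub>free_mod K X\<^esub>" by (auto simp: free_mod_simps)
  then show ?case using F.submodule_zero[OF sub] by simp
 next
  case (insert z Z)
  let ?g = "\<lambda>x. if x = z then \<zero>\<^sub>K else f x"
  have g: "?g \<in>. free_mod K X"
  proof -
   have "{x. ?g x \<noteq> \<zero>\<^sub>K} \<subseteq> {x. f x \<noteq> \<zero>\<^sub>K}" by auto
   then show ?thesis using insert.prems(1) by (auto simp: free_mod_simps intro: finite_subset)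
  qed
  have IH: "?g \<in> lin_span K (free_mod K X) (single K ` X)"
   by (rule insert.IH[OF g]) (use insert.prems(2) in auto)
  show ?case
  proof (cases "z \<in> X")
   case True
   have fK: "f x \<in>. K" for x using insert.prems(1) by (simp add: free_mod_simps)
   have "f = f z \<odot>\<^bsub>free_mod K X\<^esub> single K z \<oplus>\<^bsub>free_mod K X\<^esub> ?g"
    using fK by (auto simp: free_mod_simps single_def)
   moreover have "f z \<odot>\<^bsub>free_mod K X\<^esub> single K z \<in> lin_span K (free_mod K X) (single K ` X)"
    using fK True by (intro F.submoduleE(4)[OF sub] lin_span_base) auto
   ultimately show ?thesis using F.submoduleE(5)[OF sub _ IH] by metis
  next
   case False
   then have "f = ?g" using insert.prems(1) by (auto simp: free_mod_simps)
   then show ?thesis using IH by metis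
  qed
 qed
 then show ?thesis using assms(2) by (auto simp: free_mod_simps)
qed

lemma free_mod_ext:
 assumes K: "cring K" and N: "module K N" and \<phi>: "\<And>x. x \<in> X ==> \<phi> x \<in>. N"
 shows "\<exists>L. linear_map K (free_mod K X) N L \<and> (\<forall>x\<in>X. L (single K x) = \<phi> x)"
proof -
 interpret N: module K N by fact
 \<comment> \<open>Extension by zero outside \<open>X\<close>, so that the sums below are defined
   over any index set.\<close>
 define \<psi> where "\<psi> x = (if x \<in> X then \<phi> x else \<zero>\<^sub>N)" for x
 have \<psi> [simp]: "\<psi> x \<in>. N" for x using \<phi> by (auto simp: \<psi>_def)
 define L where "L f = (\<Oplus>\<^sub>N x\<in>{x. f x \<noteq> \<zero>\<^sub>K}. f x \<odot>\<^sub>N \<psi> x)" for f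
 \<comment> \<open>The sum over the support may be taken over any larger finite set; additivity
   compares three sums over the union of two supports.\<close>
 have L: "L f = (\<Oplus>\<^sub>N x\<in>Z. f x \<odot>\<^sub>N \<psi> x)"
  if "f \<in>. free_mod K X" "finite Z" "{x. f x \<noteq> \<zero>\<^sub>K} \<subseteq> Z" for f Z
  unfolding L_def using that
  by (intro N.add.finprod_mono_neutral_cong_left) (auto simp: free_mod_simps)
 have "linear_map K (free_mod K X) N L"
 proof (rule linear_mapI)
  fix f assume f: "f \<in>. free_mod K X"
  then show "L f \<in>. N" unfolding L_def
   by (intro N.finsum_closed) (auto simp: free_mod_simps)
  fix c assume c: "c \<in>. K"
  have "{x. c \<otimes>\<^sub>K f x \<noteq> \<zero>\<^sub>K} \<subseteq> {x. f x \<noteq> \<zero>\<^sub>K}" using c by auto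
  then have "L (c \<odot>\<^bsub>free_mod K X\<^esub> f) = (\<Oplus>\<^sub>N x\<in>{x. f x \<noteq> \<zero>\<^sub>K}. (c \<odot>\<^bsub>free_mod K X\<^esub> f) x \<odot>\<^sub>N \<psi> x)"
   using f c module.smult_closed[OF free_mod_module[OF K] c f]
   by (intro L) (auto simp: free_mod_simps)
  also have "\<dots> = (\<Oplus>\<^sub>N x\<in>{x. f x \<noteq> \<zero>\<^sub>K}. c \<odot>\<^sub>N (f x \<odot>\<^sub>N \<psi> x))"
   using f c by (intro N.finsum_cong') (auto simp: free_mod_simps N.smult_assoc1)
  also have "\<dots> = c \<odot>\<^sub>N L f" unfolding L_def
   using f c by (intro N.finsum_smult_ldistr[symmetric]) (auto simp: free_mod_simps)
  finally show "L (c \<odot>\<^bsub>free_mod K X\<^esub> f) = c \<odot>\<^sub>N L f" .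
 next
  fix f g assume f: "f \<in>. free_mod K X" and g: "g \<in>. free_mod K X"
  let ?Z = "{x. f x \<noteq> \<zero>\<^sub>K} \<union> {x. g x \<noteq> \<zero>\<^sub>K}"
  have Z: "finite ?Z" using f g by (auto simp: free_mod_simps)
  interpret F: module K "free_mod K X" by (rule free_mod_module[OF K])
  have "L (f \<oplus>\<^bsub>free_mod K X\<^esub> g) = (\<Oplus>\<^sub>N x\<in>?Z. (f \<oplus>\<^bsub>free_mod K X\<^esub> g) x \<odot>\<^sub>N \<psi> x)"
   by (rule L[OF F.a_closed[OF f g] Z]) (auto simp: free_mod_simps)
  also have "\<dots> = (\<Oplus>\<^sub>N x\<in>?Z. f x \<odot>\<^sub>N \<psi> x \<oplus>\<^sub>N g x \<odot>\<^sub>N \<psi> x)"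
   using f g by (intro N.finsum_cong') (auto simp: free_mod_simps N.smult_l_distr)
  also have "\<dots> = (\<Oplus>\<^sub>N x\<in>?Z. f x \<odot>\<^sub>N \<psi> x) \<oplus>\<^sub>N (\<Oplus>\<^sub>N x\<in>?Z. g x \<odot>\<^sub>N \<psi> x)"
   using f g by (intro N.finsum_addf) (auto simp: free_mod_simps)
  also have "\<dots> = L f \<oplus>\<^sub>N L g" using L[OF f Z] L[OF g Z] by auto
  finally show "L (f \<oplus>\<^bsub>free_mod K X\<^esub> g) = L f \<oplus>\<^sub>N L g" .
 qed
 moreover have "L (single K x) = \<phi> x" if "x \<in> X" for x
 proof -
  have "L (single K x) = (\<Oplus>\<^sub>N y\<in>{x}. single K x y \<odot>\<^sub>N \<psi> y)"
   by (rule L[OF single_closed[OF K that]]) (auto simp: single_def)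
  also have "\<dots> = \<phi> x" using that by (simp add: single_def \<psi>_def \<phi>)
  finally show ?thesis .
 qed
 ultimately show ?thesis by blast
qed


section \<open>Tensor squares\<close>

locale tensor_square = assoc_algebra K A for K :: "'k ring" and A :: "('k, 'a) module" +
 fixes S :: "'a set"
 assumes S_sub: "S \<subseteq> carrier A"
begin

abbreviation "T \<equiv> tsq K A S"
abbreviation ten (infixl \<open>\<diamondop>\<close> 75) where "ten x y \<equiv> tens K A S x y"

abbreviation (input) "F \<equiv> free_mod K (carrier A \<times> carrier A)"

lemma K_cring: "cring K" by (rule R.cring_axioms)

lemma F_module: "module K F" by (rule free_mod_module[OF K_cring])

lemma single_pair: "x \<in>. A ==> y \<in>. A ==> single K (x, y) \<in>. F"
 by (intro single_closed K_cring) auto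

lemma tsq_rels_closed: "tsq_rels K A S \<subseteq> carrier F"
proof -
 interpret F: module K F by (rule F_module)
 have [simp]: "s \<in>. A" if "s \<in> S" for s using that S_sub by auto
 show ?thesis
  unfolding tsq_rels_def Let_def
  by (intro Un_least) (auto intro!: F.minus_closed F.a_closed F.smult_closed single_pair)
qed

lemma tsq_null_submodule: "submodule (tsq_null K A S) K F"
 unfolding tsq_null_def by (rule lin_span_submodule[OF F_module tsq_rels_closed])

lemma tsq_module: "module K T"
 unfolding tsq_def by (rule quot_module[OF F_module tsq_null_submodule])

lemma tens_closed [simp]: "x \<in>. A ==> y \<in>. A ==> x \<diamondop> y \<in>. T"
 unfolding tsq_def tens_def using single_pair by (simp add: quot_carrier[OF F_module tsq_null_submodule])

lemma tsq_relsI: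
 assumes "x \<in>. A" "y \<in>. A"
 shows "z \<in>. A ==> single K (x \<oplus>\<^sub>A z, y) \<ominus>\<^sub>F (single K (x, y) \<oplus>\<^sub>F single K (z, y)) \<in> tsq_rels K A S"
  and "z \<in>. A ==> single K (x, y \<oplus>\<^sub>A z) \<ominus>\<^sub>F (single K (x, y) \<oplus>\<^sub>F single K (x, z)) \<in> tsq_rels K A S"
  and "c \<in>. K ==> single K (c \<odot>\<^sub>A x, y) \<ominus>\<^sub>F c \<odot>\<^sub>F single K (x, y) \<in> tsq_rels K A S"
  and "c \<in>. K ==> single K (x, c \<odot>\<^sub>A y) \<ominus>\<^sub>F c \<odot>\<^sub>F single K (x, y) \<in> tsq_rels K A S"
  and "s \<in> S ==> single K (x \<otimes>\<^sub>A s, y) \<ominus>\<^sub>F single K (x, s \<otimes>\<^sub>A y) \<in> tsq_rels K A S"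
 using assms unfolding tsq_rels_def Let_def by blast+

lemma tens_relI:
 assumes "f \<ominus>\<^sub>F g \<in> tsq_rels K A S" "f \<in>. F" "g \<in>. F"
 shows "tsq_null K A S +>\<^sub>F f = tsq_null K A S +>\<^sub>F g"
 unfolding coset_eq_iff[OF F_module tsq_null_submodule assms(2,3)]
 using assms(1) by (simp add: tsq_null_def lin_span_base)

lemma tens_bilinear: "bilinear K A A T (ten)"
proof -
 interpret F: module K F by (rule F_module)
 note q = quot_add[OF F_module tsq_null_submodule] quot_smult[OF F_module tsq_null_submodule]
 show ?thesis
 proof (intro bilinearI linear_mapI)
  fix x y z assume [simp]: "x \<in>. A" "y \<in>. A" "z \<in>. A"
  show "(y \<oplus>\<^sub>A z) \<diamondop> x = y \<diamondop> x \<oplus>\<^sub>T z \<diamondop> x"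
   unfolding tens_def tsq_def q(1)[OF single_pair single_pair, OF \<open>y \<in> _\<close> \<open>x \<in> _\<close> \<open>z \<in> _\<close> \<open>x \<in> _\<close>]
   by (rule tens_relI[OF tsq_relsI(1)]) (simp_all add: single_pair)
  show "x \<diamondop> (y \<oplus>\<^sub>A z) = x \<diamondop> y \<oplus>\<^sub>T x \<diamondop> z"
   unfolding tens_def tsq_def q(1)[OF single_pair single_pair, OF \<open>x \<in> _\<close> \<open>y \<in> _\<close> \<open>x \<in> _\<close> \<open>z \<in> _\<close>]
   by (rule tens_relI[OF tsq_relsI(2)]) (simp_all add: single_pair)
  fix c assume [simp]: "c \<in>. K"
  show "(c \<odot>\<^sub>A y) \<diamondop> x = c \<odot>\<^sub>T (y \<diamondop> x)"
   unfolding tens_def tsq_def q(2)[OF \<open>c \<in> _\<close> single_pair, OF \<open>y \<in> _\<close> \<open>x \<in> _\<close>]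
   by (rule tens_relI[OF tsq_relsI(3)]) (simp_all add: single_pair)
  show "x \<diamondop> (c \<odot>\<^sub>A y) = c \<odot>\<^sub>T (x \<diamondop> y)"
   unfolding tens_def tsq_def q(2)[OF \<open>c \<in> _\<close> single_pair, OF \<open>x \<in> _\<close> \<open>y \<in> _\<close>]
   by (rule tens_relI[OF tsq_relsI(4)]) (simp_all add: single_pair)
 qed simp_all
qed

lemma tens_balanced:
 assumes "s \<in> S" "x \<in>. A" "y \<in>. A"
 shows "(x \<otimes>\<^sub>A s) \<diamondop> y = x \<diamondop> (s \<otimes>\<^sub>A y)"
 unfolding tens_def
 using assms S_sub
 by (intro tens_relI tsq_relsI(5)) (auto intro!: single_pair)

lemma tsq_span: "carrier T = lin_span K T {x \<diamondop> y | x y. x \<in>. A \<and> y \<in>. A}"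
proof
 show "lin_span K T {x \<diamondop> y | x y. x \<in>. A \<and> y \<in>. A} \<subseteq> carrier T"
  using module.carrier_is_submodule[OF tsq_module] by (rule lin_span_least) auto
 have sub: "submodule (lin_span K T {x \<diamondop> y | x y. x \<in>. A \<and> y \<in>. A}) K T"
  by (rule lin_span_submodule[OF tsq_module]) auto
 show "carrier T \<subseteq> lin_span K T {x \<diamondop> y | x y. x \<in>. A \<and> y \<in>. A}"
 proof
  fix \<xi> assume "\<xi> \<in>. T"
  then obtain f where f: "f \<in>. F" "\<xi> = tsq_null K A S +>\<^sub>F f"
   unfolding tsq_def by (auto simp: quot_carrier[OF F_module tsq_null_submodule])
  have p: "linear_map K F T (\<lambda>f. tsq_null K A S +>\<^sub>F f)"
   unfolding tsq_def by (rule quot_proj_linear[OF F_module tsq_null_submodule])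
  show "\<xi> \<in> lin_span K T {x \<diamondop> y | x y. x \<in>. A \<and> y \<in>. A}"
   unfolding f(2)
  proof (rule lin_span_map_into[OF p F_module tsq_module _ sub _ free_mod_span[OF K_cring f(1)]])
   show "single K ` (carrier A \<times> carrier A) \<subseteq> carrier F" by (auto intro: single_pair)
  qed (auto simp: tens_def intro!: lin_span_base)
 qed
qed

lemma tsq_ext:
 assumes "linear_map K T W f" "linear_map K T W g" "module K W"
  and "\<And>x y. x \<in>. A ==> y \<in>. A ==> f (x \<diamondop> y) = g (x \<diamondop> y)"
  and "\<xi> \<in>. T"
 shows "f \<xi> = g \<xi>"
 by (rule lin_span_eq[OF assms(1,2) tsq_module assms(3), of "{x \<diamondop> y | x y. x \<in>. A \<and> y \<in>. A}"])
   (use assms(4,5) tsq_span in auto)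

lemma tsq_into:
 assumes "linear_map K T W f" "module K W" "submodule U K W"
  and "\<And>x y. x \<in>. A ==> y \<in>. A ==> f (x \<diamondop> y) \<in> U"
  and "\<xi> \<in>. T"
 shows "f \<xi> \<in> U"
 by (rule lin_span_map_into[OF assms(1) tsq_module assms(2) _ assms(3), of "{x \<diamondop> y | x y. x \<in>. A \<and> y \<in>. A}"])
   (use assms(4,5) tsq_span in auto)

text \<open>The extension of \<open>f\<close> to the free module kills the five families of
  relations, the last one by \<open>bal\<close>, and so factors through the quotient. Pure tensors
  span, hence its restriction to the carrier is the only candidate for the definite description in
  \<open>tlift\<close>.\<close>

lemma
 assumes W: "module K W" and f: "bilinear K A A W f"
  and bal: "\<And>s x y. s \<in> S ==> x \<in>. A ==> y \<in>. A ==> f (x \<otimes>\<^sub>A s) y = f x (s \<otimes>\<^sub>A y)"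
 shows tlift_linear: "linear_map K T W (tlift K A S W f)"
  and tlift_tens: "x \<in>. A ==> y \<in>. A ==> tlift K A S W f (x \<diamondop> y) = f x y"
proof -
 interpret F: module K F by (rule F_module)
 interpret W: module K W by (rule W)
 note f1 = lin_simps[OF bilinear1[OF f]] and f2 = lin_simps[OF bilinear2[OF f]]
 have SA: "s \<in>. A" if "s \<in> S" for s using that S_sub by auto
 obtain L where L: "linear_map K F W L" "\<And>x y. x \<in>. A ==> y \<in>. A ==> L (single K (x, y)) = f x y"
  using free_mod_ext[OF K_cring W, of "carrier A \<times> carrier A" "\<lambda>(x, y). f x y"] f1(1) by fastforce
 note Ls = lin_simps[OF L(1)] lin_mod_simps[OF L(1) F_module W]
 have kill: "L n = \<zero>\<^sub>W" if "n \<in> tsq_null K A S" for n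
 proof (rule lin_span_vanish[OF L(1) F_module W tsq_rels_closed _ that[unfolded tsq_null_def]])
  fix h assume "h \<in> tsq_rels K A S"
  then show "L h = \<zero>\<^sub>W" unfolding tsq_rels_def Let_def
   by (elim UnE)
     (auto simp: Ls L(2) single_pair F.a_closed F.smult_closed f1 f2 bal SA W.minus_eq_zero_iff)
 qed
 obtain g where g: "linear_map K T W g" "\<And>x. x \<in>. F ==> g (tsq_null K A S +>\<^sub>F x) = L x"
  using quot_factor[OF F_module tsq_null_submodule L(1) W kill] unfolding tsq_def by auto
 have gt: "g (x \<diamondop> y) = f x y" if "x \<in>. A" "y \<in>. A" for x y
  using that g(2) L(2) single_pair by (simp add: tens_def)
 let ?P = "\<lambda>g. g \<in> extensional (carrier T) \<and> linear_map K T W g \<and>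
         (\<forall>x\<in>carrier A. \<forall>y\<in>carrier A. g (x \<diamondop> y) = f x y)"
 have ex: "?P (restrict g (carrier T))"
  using gt lin_restrict[OF g(1) tsq_module] by (simp del: restrict_apply add: restrict_apply')
 have uniq: "h = restrict g (carrier T)" if "?P h" for h
 proof (rule extensionalityI[of _ "carrier T"])
  fix \<xi> assume \<xi>: "\<xi> \<in>. T"
  show "h \<xi> = restrict g (carrier T) \<xi>"
   by (rule tsq_ext[OF _ _ W _ \<xi>, of h "restrict g (carrier T)"]) (use that ex in simp_all)
 qed (use that in auto)
 have "?P (tlift K A S W f)"
  unfolding tlift_def by (rule theI[of ?P, OF ex uniq])
 then show "linear_map K T W (tlift K A S W f)"
  and "x \<in>. A ==> y \<in>. A ==> tlift K A S W f (x \<diamondop> y) = f x y"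
  by auto
qed

lemma
 shows tmul_linear: "linear_map K T A (tmul K A S)"
  and tmul_tens: "x \<in>. A ==> y \<in>. A ==> tmul K A S (x \<diamondop> y) = x \<otimes>\<^sub>A y"
 unfolding tmul_def
 using S_sub by (auto intro!: tlift_linear tlift_tens module_axioms bilinear_mult m_assoc)

lemma mult_left_linear: "b \<in>. A ==> linear_map K A A (\<lambda>x. b \<otimes>\<^sub>A x)"
 by (rule bilinear2[OF bilinear_mult])

lemma mult_right_linear: "b \<in>. A ==> linear_map K A A (\<lambda>x. x \<otimes>\<^sub>A b)"
 by (rule bilinear1[OF bilinear_mult])

lemma tens_left_bilinear: "b \<in>. A ==> bilinear K A A T (\<lambda>x y. (b \<otimes>\<^sub>A x) \<diamondop> y)"
 by (rule bilinear_comp2[OF tens_bilinear mult_left_linear lin_id])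

lemma tens_right_bilinear: "b \<in>. A ==> bilinear K A A T (\<lambda>x y. x \<diamondop> (y \<otimes>\<^sub>A b))"
 by (rule bilinear_comp2[OF tens_bilinear lin_id mult_right_linear])

lemma
 assumes b: "b \<in>. A"
 shows lact_linear: "linear_map K T T (lact K A S b)"
  and lact_tens: "x \<in>. A ==> y \<in>. A ==> lact K A S b (x \<diamondop> y) = (b \<otimes>\<^sub>A x) \<diamondop> y"
proof -
 have "(b \<otimes>\<^sub>A (x \<otimes>\<^sub>A s)) \<diamondop> y = (b \<otimes>\<^sub>A x) \<diamondop> (s \<otimes>\<^sub>A y)" if "s \<in> S" "x \<in>. A" "y \<in>. A" for s x y
  using that b S_sub tens_balanced[of s "b \<otimes>\<^sub>A x" y] by (auto simp: m_assoc subset_iff)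
 note * = tens_left_bilinear[OF b] this
 show "linear_map K T T (lact K A S b)"
  and "x \<in>. A ==> y \<in>. A ==> lact K A S b (x \<diamondop> y) = (b \<otimes>\<^sub>A x) \<diamondop> y"
  unfolding lact_def
  by (rule tlift_linear[OF tsq_module *], assumption+, rule tlift_tens[OF tsq_module *], assumption+)
qed

lemma
 assumes b: "b \<in>. A"
 shows ract_linear: "linear_map K T T (\<lambda>\<xi>. ract K A S \<xi> b)"
  and ract_tens: "x \<in>. A ==> y \<in>. A ==> ract K A S (x \<diamondop> y) b = x \<diamondop> (y \<otimes>\<^sub>A b)"
proof -
 have "(x \<otimes>\<^sub>A s) \<diamondop> (y \<otimes>\<^sub>A b) = x \<diamondop> ((s \<otimes>\<^sub>A y) \<otimes>\<^sub>A b)" if "s \<in> S" "x \<in>. A" "y \<in>. A" for s x y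
  using that b S_sub tens_balanced[of s x "y \<otimes>\<^sub>A b"] by (auto simp: m_assoc subset_iff)
 note * = tens_right_bilinear[OF b] this
 show "linear_map K T T (\<lambda>\<xi>. ract K A S \<xi> b)"
  and "x \<in>. A ==> y \<in>. A ==> ract K A S (x \<diamondop> y) b = x \<diamondop> (y \<otimes>\<^sub>A b)"
  unfolding ract_def
  by (rule tlift_linear[OF tsq_module *], assumption+, rule tlift_tens[OF tsq_module *], assumption+)
qed

end

section \<open>Bimodules over an algebra\<close>

locale bimodule = A: assoc_algebra K A + M: module K M
 for K :: "'k ring" and A :: "('k, 'a) module" and M :: "('k, 'm) module" +
 fixes l :: "'a \<Rightarrow> 'm \<Rightarrow> 'm" and r :: "'m \<Rightarrow> 'a \<Rightarrow> 'm"
 assumes l_bilinear: "bilinear K A M M l" and r_bilinear: "bilinear K M A M r"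
  and l_one: "m \<in>. M ==> l \<one>\<^sub>A m = m"
  and r_one: "m \<in>. M ==> r m \<one>\<^sub>A = m"
  and l_mult: "a \<in>. A ==> b \<in>. A ==> m \<in>. M ==> l (a \<otimes>\<^sub>A b) m = l a (l b m)"
  and r_mult: "a \<in>. A ==> b \<in>. A ==> m \<in>. M ==> r m (a \<otimes>\<^sub>A b) = r (r m a) b"
  and l_r: "a \<in>. A ==> b \<in>. A ==> m \<in>. M ==> l a (r m b) = r (l a m) b"
begin

lemmas l1 = lin_simps[OF bilinear1[OF l_bilinear]]
lemmas l2 = lin_simps[OF bilinear2[OF l_bilinear]]
lemmas r1 = lin_simps[OF bilinear1[OF r_bilinear]]
lemmas r2 = lin_simps[OF bilinear2[OF r_bilinear]]
lemmas l1m = lin_mod_simps[OF bilinear1[OF l_bilinear] A.module_axioms M.module_axioms]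
lemmas l2m = lin_mod_simps[OF bilinear2[OF l_bilinear] M.module_axioms M.module_axioms]
lemmas r1m = lin_mod_simps[OF bilinear1[OF r_bilinear] M.module_axioms M.module_axioms]
lemmas r2m = lin_mod_simps[OF bilinear2[OF r_bilinear] A.module_axioms M.module_axioms]

end

lemma (in assoc_algebra) bimodule_self: "bimodule K A A (mult A) (mult A)"
 using bilinear_mult
 by (intro bimodule.intro bimodule_axioms.intro assoc_algebra_axioms module_axioms) (simp_all add: m_assoc)

context tensor_square
begin

lemma tsq_bimodule: "bimodule K A T (lact K A S) (ract K A S)"
proof (intro bimodule.intro bimodule_axioms.intro assoc_algebra_axioms tsq_module)
 interpret T: module K T by (rule tsq_module)
 note [simp] = lact_tens ract_tens lin_simps[OF lact_linear] lin_simps[OF ract_linear]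
  lin_simps[OF bilinear1[OF tens_bilinear], simplified] lin_simps[OF bilinear2[OF tens_bilinear], simplified]
 note lins = lin_id lact_linear ract_linear lin_plus lin_scale lin_comp[of K T T "lact K A S b" for b]
   lin_comp[of K T T "\<lambda>\<xi>. ract K A S \<xi> b" for b] tsq_module
 show "bilinear K A T T (lact K A S)"
 proof (intro bilinearI lact_linear linear_mapI)
  fix \<xi> x y assume [simp]: "\<xi> \<in>. T" "x \<in>. A" "y \<in>. A"
  show "lact K A S (x \<oplus>\<^sub>A y) \<xi> = lact K A S x \<xi> \<oplus>\<^sub>T lact K A S y \<xi>"
   by (rule tsq_ext[where W = T and \<xi> = \<xi>]) (auto intro!: lins simp: l_distr)
  fix c assume [simp]: "c \<in>. K"
  show "lact K A S (c \<odot>\<^sub>A x) \<xi> = c \<odot>\<^sub>T lact K A S x \<xi>"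
   by (rule tsq_ext[where W = T and \<xi> = \<xi>]) (auto intro!: lins simp: smult_mult_left)
 qed auto
 show "bilinear K T A T (ract K A S)"
 proof (intro bilinearI ract_linear linear_mapI)
  fix \<xi> x y assume [simp]: "\<xi> \<in>. T" "x \<in>. A" "y \<in>. A"
  show "ract K A S \<xi> (x \<oplus>\<^sub>A y) = ract K A S \<xi> x \<oplus>\<^sub>T ract K A S \<xi> y"
   by (rule tsq_ext[where W = T and \<xi> = \<xi>]) (auto intro!: lins simp: r_distr)
  fix c assume [simp]: "c \<in>. K"
  show "ract K A S \<xi> (c \<odot>\<^sub>A x) = c \<odot>\<^sub>T ract K A S \<xi> x"
   by (rule tsq_ext[where W = T and \<xi> = \<xi>]) (auto intro!: lins simp: smult_mult_right)
 qed auto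
 show "lact K A S \<one>\<^sub>A \<xi> = \<xi>" if "\<xi> \<in>. T" for \<xi>
  using that by (rule tsq_ext[where W = T and \<xi> = \<xi>, rotated -1]) (auto intro!: lins)
 show "ract K A S \<xi> \<one>\<^sub>A = \<xi>" if "\<xi> \<in>. T" for \<xi>
  using that by (rule tsq_ext[where W = T and \<xi> = \<xi>, rotated -1]) (auto intro!: lins)
 fix a b \<xi> assume ab [simp]: "a \<in>. A" "b \<in>. A" and \<xi>: "\<xi> \<in>. T"
 show "lact K A S (a \<otimes>\<^sub>A b) \<xi> = lact K A S a (lact K A S b \<xi>)"
  using \<xi> by (rule tsq_ext[where W = T and \<xi> = \<xi>, rotated -1]) (auto intro!: lins simp: m_assoc)
 show "ract K A S \<xi> (a \<otimes>\<^sub>A b) = ract K A S (ract K A S \<xi> a) b"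
  using \<xi> by (rule tsq_ext[where W = T and \<xi> = \<xi>, rotated -1]) (auto intro!: lins simp: m_assoc)
 show "lact K A S a (ract K A S \<xi> b) = ract K A S (lact K A S a \<xi>) b"
  using \<xi> by (rule tsq_ext[where W = T and \<xi> = \<xi>, rotated -1]) (auto intro!: lins)
qed

lemma tmul_lact: "b \<in>. A ==> \<xi> \<in>. T ==> tmul K A S (lact K A S b \<xi>) = b \<otimes>\<^sub>A tmul K A S \<xi>"
 by (rule tsq_ext[OF lin_comp[OF lact_linear tmul_linear] lin_comp[OF tmul_linear mult_left_linear] module_axioms])
   (simp_all add: lact_tens tmul_tens m_assoc)

lemma tmul_ract: "b \<in>. A ==> \<xi> \<in>. T ==> tmul K A S (ract K A S \<xi> b) = tmul K A S \<xi> \<otimes>\<^sub>A b"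
 by (rule tsq_ext[OF lin_comp[OF ract_linear tmul_linear] lin_comp[OF tmul_linear mult_right_linear] module_axioms])
   (simp_all add: ract_tens tmul_tens m_assoc)

end

text \<open>The alternative in the last hypothesis covers two uses. Over the scalars any linear map
  is allowed, such as the grading involution or the inclusion of functions into forms; over a base
  the map must be multiplicative to respect the balancing relation.\<close>

lemma (in tensor_square)
 assumes B: "tensor_square K B U" and f: "linear_map K A B f"
  and S: "S = {} \<or> (f ` S \<subseteq> U \<and> (\<forall>x\<in>carrier A. \<forall>y\<in>carrier A. f (x \<otimes>\<^sub>A y) = f x \<otimes>\<^sub>B f y))"
 shows tmap_linear: "linear_map K T (tsq K B U) (tmap K A S B U f)"
  and tmap_tens: "x \<in>. A ==> y \<in>. A ==> tmap K A S B U f (x \<diamondop> y) = tens K B U (f x) (f y)"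
proof -
 interpret B: tensor_square K B U by (rule B)
 have bil: "bilinear K A A (tsq K B U) (\<lambda>x y. tens K B U (f x) (f y))"
  by (rule bilinear_comp2[OF B.tens_bilinear f f])
 have bal: "tens K B U (f (x \<otimes>\<^sub>A s)) (f y) = tens K B U (f x) (f (s \<otimes>\<^sub>A y))"
  if "s \<in> S" "x \<in>. A" "y \<in>. A" for s x y
  using S that B.tens_balanced[of "f s" "f x" "f y"] lin_closed[OF f] S_sub by (auto simp: subset_iff)
 show "linear_map K T (tsq K B U) (tmap K A S B U f)"
  and "x \<in>. A ==> y \<in>. A ==> tmap K A S B U f (x \<diamondop> y) = tens K B U (f x) (f y)"
  unfolding tmap_def
  by (rule tlift_linear[OF B.tsq_module bil bal], assumption+)
    (rule tlift_tens[OF B.tsq_module bil bal], assumption+)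
qed



section \<open>Free algebras\<close>

lemma free_alg_simps:
 "carrier (free_alg K L) = carrier (free_mod K (lists L))"
 "\<zero>\<^bsub>free_alg K L\<^esub> = \<zero>\<^bsub>free_mod K (lists L)\<^esub>"
 "f \<oplus>\<^bsub>free_alg K L\<^esub> g = f \<oplus>\<^bsub>free_mod K (lists L)\<^esub> g"
 "c \<odot>\<^bsub>free_alg K L\<^esub> f = c \<odot>\<^bsub>free_mod K (lists L)\<^esub> f"
 "f \<otimes>\<^bsub>free_alg K L\<^esub> g = (\<lambda>u. \<Oplus>\<^sub>K i\<in>{..length u}. f (take i u) \<otimes>\<^sub>K g (drop i u))"
 "\<one>\<^bsub>free_alg K L\<^esub> = single K []"
 by (simp_all add: free_alg_def free_mod_def)

lemma free_alg_module:
 assumes "cring K" shows "module K (free_alg K L)"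
 by (rule module_image[OF free_mod_module[OF assms, of "lists L"], where p = "\<lambda>x. x"])
   (simp_all add: free_alg_simps(1-4))

lemma free_alg_span:
 assumes "cring K" "f \<in>. free_alg K L"
 shows "f \<in> lin_span K (free_alg K L) (single K ` lists L)"
proof -
 note F = free_alg_module[OF assms(1)]
 have sub: "single K ` lists L \<subseteq> carrier (free_alg K L)"
  using single_closed[OF assms(1), of _ "lists L"] unfolding free_alg_simps(1) by blast
 have id: "linear_map K (free_mod K (lists L)) (free_alg K L) (\<lambda>x. x)"
  by (auto simp: linear_map_def free_alg_simps(1-4))
 have "f \<in> lin_span K (free_mod K (lists L)) (single K ` lists L)"
  using assms free_mod_span[OF assms(1)] by (simp add: free_alg_simps)
 from lin_span_map_into[OF id free_mod_module[OF assms(1)] F _ lin_span_submodule[OF F sub] _ this]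
 show ?thesis using sub by (auto simp: free_alg_simps(1) intro: lin_span_base)
qed

lemma free_alg_bilinear:
 assumes "cring K"
 shows "bilinear K (free_alg K L) (free_alg K L) (free_alg K L) (\<lambda>f g. f \<otimes>\<^bsub>free_alg K L\<^esub> g)"
proof -
 interpret cring K by fact
 have K: "f u \<in>. K" if "f \<in>. free_alg K L" for f u
  using that by (simp add: free_alg_simps free_mod_simps)
 have closed: "f \<otimes>\<^bsub>free_alg K L\<^esub> g \<in>. free_alg K L"
  if f: "f \<in>. free_alg K L" and g: "g \<in>. free_alg K L" for f g
 proof -
  \<comment> \<open>A word in the support of the product splits into a prefix from the support of
    \<open>f\<close> and a suffix from that of \<open>g\<close>. This gives finiteness of the
    support and shows that its words use letters from \<open>L\<close> only.\<close>
  have nz: "\<exists>i. f (take i u) \<noteq> \<zero>\<^sub>K \<and> g (drop i u) \<noteq> \<zero>\<^sub>K"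
   if "(f \<otimes>\<^bsub>free_alg K L\<^esub> g) u \<noteq> \<zero>\<^sub>K" for u
  proof (rule ccontr)
   assume "\<not> ?thesis"
   then have "f (take i u) \<otimes>\<^sub>K g (drop i u) = \<zero>\<^sub>K" for i
    using K[OF f] K[OF g] by (metis l_null r_null)
   then show False using that by (simp add: free_alg_simps)
  qed
  have "{u. (f \<otimes>\<^bsub>free_alg K L\<^esub> g) u \<noteq> \<zero>\<^sub>K} \<subseteq>
    (\<lambda>(u, v). u @ v) ` ({u. f u \<noteq> \<zero>\<^sub>K} \<times> {u. g u \<noteq> \<zero>\<^sub>K})"
  proof
   fix u assume "u \<in> {u. (f \<otimes>\<^bsub>free_alg K L\<^esub> g) u \<noteq> \<zero>\<^sub>K}"
   then obtain i where "f (take i u) \<noteq> \<zero>\<^sub>K" "g (drop i u) \<noteq> \<zero>\<^sub>K" using nz by auto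
   then show "u \<in> (\<lambda>(u, v). u @ v) ` ({u. f u \<noteq> \<zero>\<^sub>K} \<times> {u. g u \<noteq> \<zero>\<^sub>K})"
    by (intro image_eqI[of _ _ "(take i u, drop i u)"]) auto
  qed
  moreover have "finite ({u. f u \<noteq> \<zero>\<^sub>K} \<times> {u. g u \<noteq> \<zero>\<^sub>K})"
   using f g by (simp add: free_alg_simps free_mod_simps)
  ultimately have fin: "finite {u. (f \<otimes>\<^bsub>free_alg K L\<^esub> g) u \<noteq> \<zero>\<^sub>K}"
   using finite_subset finite_imageI by blast
  have "(f \<otimes>\<^bsub>free_alg K L\<^esub> g) u = \<zero>\<^sub>K" if "u \<notin> lists L" for u
  proof (rule ccontr)
   assume "(f \<otimes>\<^bsub>free_alg K L\<^esub> g) u \<noteq> \<zero>\<^sub>K"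
   then obtain i where "f (take i u) \<noteq> \<zero>\<^sub>K" "g (drop i u) \<noteq> \<zero>\<^sub>K" using nz by auto
   then have "take i u \<in> lists L" "drop i u \<in> lists L"
    using f g unfolding free_alg_simps free_mod_simps by blast+
   then have "take i u @ drop i u \<in> lists L" by (simp only: append_in_lists_conv)
   then show False using that by simp
  qed
  then show ?thesis using fin K[OF f] K[OF g]
   by (auto simp: free_alg_simps(1) free_mod_simps(1)) (auto simp: free_alg_simps(5))
 qed
 have addf: "(f \<oplus>\<^bsub>free_alg K L\<^esub> g) u = f u \<oplus>\<^sub>K g u" for f g u
  by (simp add: free_alg_simps free_mod_simps)
 have smf: "(c \<odot>\<^bsub>free_alg K L\<^esub> g) u = c \<otimes>\<^sub>K g u" for c g u
  by (simp add: free_alg_simps free_mod_simps)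
 have mf: "(f \<otimes>\<^bsub>free_alg K L\<^esub> g) u = (\<Oplus>\<^sub>K i\<in>{..length u}. f (take i u) \<otimes>\<^sub>K g (drop i u))" for f g u
  by (simp add: free_alg_simps)
 show ?thesis
 proof (intro bilinearI linear_mapI closed)
  fix f g h assume fgh: "f \<in>. free_alg K L" "g \<in>. free_alg K L" "h \<in>. free_alg K L"
  note [simp] = fgh[THEN K]
  show "f \<otimes>\<^bsub>free_alg K L\<^esub> (g \<oplus>\<^bsub>free_alg K L\<^esub> h) = f \<otimes>\<^bsub>free_alg K L\<^esub> g \<oplus>\<^bsub>free_alg K L\<^esub> f \<otimes>\<^bsub>free_alg K L\<^esub> h"
  proof
   fix u
   have "(f \<otimes>\<^bsub>free_alg K L\<^esub> (g \<oplus>\<^bsub>free_alg K L\<^esub> h)) u = (\<Oplus>\<^sub>K i\<in>{..length u}. f (take i u) \<otimes>\<^sub>K g (drop i u) \<oplus>\<^sub>K f (take i u) \<otimes>\<^sub>K h (drop i u))"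
    unfolding mf addf by (rule finsum_cong') (auto simp: r_distr)
   also have "\<dots> = (\<Oplus>\<^sub>K i\<in>{..length u}. f (take i u) \<otimes>\<^sub>K g (drop i u)) \<oplus>\<^sub>K (\<Oplus>\<^sub>K i\<in>{..length u}. f (take i u) \<otimes>\<^sub>K h (drop i u))"
    by (rule finsum_addf) auto
   finally show "(f \<otimes>\<^bsub>free_alg K L\<^esub> (g \<oplus>\<^bsub>free_alg K L\<^esub> h)) u = (f \<otimes>\<^bsub>free_alg K L\<^esub> g \<oplus>\<^bsub>free_alg K L\<^esub> f \<otimes>\<^bsub>free_alg K L\<^esub> h) u"
    unfolding addf mf .
  qed
  show "(g \<oplus>\<^bsub>free_alg K L\<^esub> h) \<otimes>\<^bsub>free_alg K L\<^esub> f = g \<otimes>\<^bsub>free_alg K L\<^esub> f \<oplus>\<^bsub>free_alg K L\<^esub> h \<otimes>\<^bsub>free_alg K L\<^esub> f"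
  proof
   fix u
   have "((g \<oplus>\<^bsub>free_alg K L\<^esub> h) \<otimes>\<^bsub>free_alg K L\<^esub> f) u = (\<Oplus>\<^sub>K i\<in>{..length u}. g (take i u) \<otimes>\<^sub>K f (drop i u) \<oplus>\<^sub>K h (take i u) \<otimes>\<^sub>K f (drop i u))"
    unfolding mf addf by (rule finsum_cong') (auto simp: l_distr)
   also have "\<dots> = (\<Oplus>\<^sub>K i\<in>{..length u}. g (take i u) \<otimes>\<^sub>K f (drop i u)) \<oplus>\<^sub>K (\<Oplus>\<^sub>K i\<in>{..length u}. h (take i u) \<otimes>\<^sub>K f (drop i u))"
    by (rule finsum_addf) auto
   finally show "((g \<oplus>\<^bsub>free_alg K L\<^esub> h) \<otimes>\<^bsub>free_alg K L\<^esub> f) u = (g \<otimes>\<^bsub>free_alg K L\<^esub> f \<oplus>\<^bsub>free_alg K L\<^esub> h \<otimes>\<^bsub>free_alg K L\<^esub> f) u"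
    unfolding addf mf .
  qed
  fix c assume [simp]: "c \<in>. K"
  show "f \<otimes>\<^bsub>free_alg K L\<^esub> (c \<odot>\<^bsub>free_alg K L\<^esub> g) = c \<odot>\<^bsub>free_alg K L\<^esub> (f \<otimes>\<^bsub>free_alg K L\<^esub> g)"
  proof
   fix u
   have "(f \<otimes>\<^bsub>free_alg K L\<^esub> (c \<odot>\<^bsub>free_alg K L\<^esub> g)) u = (\<Oplus>\<^sub>K i\<in>{..length u}. c \<otimes>\<^sub>K (f (take i u) \<otimes>\<^sub>K g (drop i u)))"
    unfolding mf smf by (rule finsum_cong') (auto simp: m_lcomm)
   also have "\<dots> = c \<otimes>\<^sub>K (\<Oplus>\<^sub>K i\<in>{..length u}. f (take i u) \<otimes>\<^sub>K g (drop i u))"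
    by (rule finsum_rdistr[symmetric]) auto
   finally show "(f \<otimes>\<^bsub>free_alg K L\<^esub> (c \<odot>\<^bsub>free_alg K L\<^esub> g)) u = (c \<odot>\<^bsub>free_alg K L\<^esub> (f \<otimes>\<^bsub>free_alg K L\<^esub> g)) u"
    unfolding smf mf .
  qed
  show "(c \<odot>\<^bsub>free_alg K L\<^esub> g) \<otimes>\<^bsub>free_alg K L\<^esub> f = c \<odot>\<^bsub>free_alg K L\<^esub> (g \<otimes>\<^bsub>free_alg K L\<^esub> f)"
  proof
   fix u
   have "((c \<odot>\<^bsub>free_alg K L\<^esub> g) \<otimes>\<^bsub>free_alg K L\<^esub> f) u = (\<Oplus>\<^sub>K i\<in>{..length u}. c \<otimes>\<^sub>K (g (take i u) \<otimes>\<^sub>K f (drop i u)))"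
    unfolding mf smf by (rule finsum_cong') (auto simp: m_assoc)
   also have "\<dots> = c \<otimes>\<^sub>K (\<Oplus>\<^sub>K i\<in>{..length u}. g (take i u) \<otimes>\<^sub>K f (drop i u))"
    by (rule finsum_rdistr[symmetric]) auto
   finally show "((c \<odot>\<^bsub>free_alg K L\<^esub> g) \<otimes>\<^bsub>free_alg K L\<^esub> f) u = (c \<odot>\<^bsub>free_alg K L\<^esub> (g \<otimes>\<^bsub>free_alg K L\<^esub> f)) u"
    unfolding smf mf .
  qed
 qed
qed

text \<open>Of all cuts of a word \<open>w\<close> only the one after \<open>length u\<close>
  letters can contribute, and it does so exactly when \<open>w = u @ v\<close>.\<close>

lemma single_mult_single:
 assumes "cring K"
 shows "single K u \<otimes>\<^bsub>free_alg K L\<^esub> single K v = single K (u @ v)"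
proof
 interpret cring K by fact
 fix w
 have "(single K u \<otimes>\<^bsub>free_alg K L\<^esub> single K v) w =
   (\<Oplus>\<^sub>K i\<in>{..length w}. if length u = i then (if w = u @ v then \<one>\<^sub>K else \<zero>\<^sub>K) else \<zero>\<^sub>K)"
  unfolding free_alg_simps
 proof (rule finsum_cong')
  fix i assume i: "i \<in> {..length w}"
  show "single K u (take i w) \<otimes>\<^sub>K single K v (drop i w) =
    (if length u = i then (if w = u @ v then \<one>\<^sub>K else \<zero>\<^sub>K) else \<zero>\<^sub>K)"
  proof (cases "take i w = u \<and> drop i w = v")
   case True
   then have "w = u @ v" "length u = i" using i by (auto simp: append_take_drop_id)
   then show ?thesis by (simp add: single_def)
  next
   case False
   then have "\<not> (length u = i \<and> w = u @ v)" by auto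
   then show ?thesis using False by (auto simp: single_def)
  qed
 qed auto
 also have "\<dots> = single K (u @ v) w"
 proof (cases "length u \<le> length w")
  case True
  then show ?thesis
   using finsum_singleton[of "length u" "{..length w}" "\<lambda>_. if w = u @ v then \<one>\<^sub>K else \<zero>\<^sub>K"]
   by (simp add: single_def)
 next
  case False
  then have "(\<Oplus>\<^sub>K i\<in>{..length w}. if length u = i then (if w = u @ v then \<one>\<^sub>K else \<zero>\<^sub>K) else \<zero>\<^sub>K) =
    (\<Oplus>\<^sub>K i\<in>{..length w}. \<zero>\<^sub>K)"
   by (intro finsum_cong') auto
  then show ?thesis using False by (auto simp: single_def)
 qed
 finally show "(single K u \<otimes>\<^bsub>free_alg K L\<^esub> single K v) w = single K (u @ v) w" .
qed

text \<open>Associativity is concatenation of words. It is extended by linearity to the third factor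
  (\<open>assoc1\<close>), then by bilinearity to the other two.\<close>

lemma free_alg_algebra:
 fixes K :: "'k ring"
 assumes K: "cring K" shows "assoc_algebra K (free_alg K L)"
proof -
 let ?F = "free_alg K L"
 note F = free_alg_module[where L = L, OF K] and bil = free_alg_bilinear[where L = L, OF K]
  and span = free_alg_span[where L = L, OF K] and smm = single_mult_single[where L = L, OF K]
 note ml = bilinear2[OF bil] and mr = bilinear1[OF bil]
 have sc: "single K u \<in>. ?F" if "u \<in> lists L" for u
  using single_closed[OF K that] by (simp add: free_alg_simps)
 then have sub: "single K ` lists L \<subseteq> carrier ?F" by (intro image_subsetI)
 have assoc1: "(single K u \<otimes>\<^sub>?F single K v) \<otimes>\<^sub>?F h = single K u \<otimes>\<^sub>?F (single K v \<otimes>\<^sub>?F h)"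
  if "u \<in> lists L" "v \<in> lists L" "h \<in>. ?F" for u v h
  by (rule lin_span_eq[OF ml lin_comp[OF ml ml] F F sub _ span])
    (use that sc lin_closed[OF ml] in \<open>auto simp: smm simp del: in_lists_conv_set\<close>)
 have assoc: "(f \<otimes>\<^sub>?F g) \<otimes>\<^sub>?F h = f \<otimes>\<^sub>?F (g \<otimes>\<^sub>?F h)"
  if f: "f \<in>. ?F" and g: "g \<in>. ?F" and h: "h \<in>. ?F" for f g h
  by (rule bilinear_span_eq[OF bilinear_comp[OF bil mr[OF h]] bilinear_comp2[OF bil lin_id mr[OF h]]
      F F F sub sub _ span[OF f] span[OF g]])
    (use h assoc1 in auto)
 have one: "\<one>\<^sub>?F = single K []" by (simp add: free_alg_simps)
 have nil: "single K [] \<in>. ?F" using sc by auto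
 show ?thesis
 proof (rule assoc_algebraI[OF F _ _ assoc _ _ bil])
  show "\<one>\<^sub>?F \<otimes>\<^sub>?F x = x" if "x \<in>. ?F" for x
   unfolding one by (rule lin_span_eq[OF ml[OF nil] lin_id F F sub _ span[OF that]]) (auto simp: smm)
  show "x \<otimes>\<^sub>?F \<one>\<^sub>?F = x" if "x \<in>. ?F" for x
   unfolding one by (rule lin_span_eq[OF mr[OF nil] lin_id F F sub _ span[OF that]]) (auto simp: smm)
 qed (use nil lin_closed[OF ml] in \<open>simp_all add: one\<close>)
qed

text \<open>A scalar acts as multiplication by its multiple of the unit.\<close>

lemma (in assoc_algebra) ideal_submodule:
 assumes "ideal I A" shows "submodule I K A"
proof -
 interpret I: ideal I A by fact
 show ?thesis
 proof (rule submoduleI)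
  fix c x assume c: "c \<in>. K" and x: "x \<in> I"
  have xA: "x \<in>. A" using x I.a_subset by auto
  have "c \<odot>\<^sub>A x = (c \<odot>\<^sub>A \<one>\<^sub>A) \<otimes>\<^sub>A x" using c xA by (simp add: smult_mult_left)
  then show "c \<odot>\<^sub>A x \<in> I" using c x I.I_l_closed by simp
 qed (use I.a_subset in auto)
qed

lemma (in assoc_algebra) quot_ideal:
 assumes "ideal I A"
 shows "assoc_algebra K (quot_mod A I)"
  and "\<And>x y. x \<in>. A ==> y \<in>. A ==>
   (I +>\<^sub>A x) \<otimes>\<^bsub>quot_mod A I\<^esub> (I +>\<^sub>A y) = I +>\<^sub>A (x \<otimes>\<^sub>A y)"
proof -
 have abs: "n \<otimes>\<^sub>A x \<in> I \<and> x \<otimes>\<^sub>A n \<in> I" if "n \<in> I" "x \<in>. A" for n x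
  using ideal.I_l_closed[OF assms that] ideal.I_r_closed[OF assms that] by simp
 show "assoc_algebra K (quot_mod A I)"
  by (rule quot_algebra[OF module_axioms ideal_submodule[OF assms] assoc_algebra_axioms abs])
 show "(I +>\<^sub>A x) \<otimes>\<^bsub>quot_mod A I\<^esub> (I +>\<^sub>A y) = I +>\<^sub>A (x \<otimes>\<^sub>A y)"
  if "x \<in>. A" "y \<in>. A" for x y
  by (rule quot_mult[OF module_axioms ideal_submodule[OF assms] bilinear_mult abs that])
qed


section \<open>Tensor algebras\<close>

context bimodule
begin

abbreviation (input) "L \<equiv> carrier A <+> carrier M"
abbreviation (input) "FA \<equiv> free_alg K L"
abbreviation "TA \<equiv> tensor_alg K A M l r"
abbreviation "word \<equiv> tensor_word K A M l r"
abbreviation "inl a \<equiv> word [Inl a]"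
abbreviation "inr m \<equiv> word [Inr m]"
abbreviation "Tdeg \<equiv> tensor_deg K A M l r"

lemma K_cring: "cring K" by (rule A.R.cring_axioms)

lemma FA_algebra: "assoc_algebra K FA"
 by (rule free_alg_algebra[OF K_cring])

lemma FA_single: "u \<in> lists L ==> single K u \<in>. FA"
 using single_closed[OF K_cring] by (simp add: free_alg_simps)

lemma tensor_alg_rels_closed: "tensor_alg_rels K A M l r \<subseteq> carrier FA"
proof -
 interpret F: assoc_algebra K FA by (rule FA_algebra)
 have lr: "l a m \<in>. M" "r m a \<in>. M" if "a \<in>. A" "m \<in>. M" for a m
  using that l1(1) r1(1) by auto
 show ?thesis
  unfolding tensor_alg_rels_def Let_def
  by (intro Un_least) (auto intro!: F.minus_closed F.a_closed F.smult_closed FA_single simp: lr)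
qed

lemma tensor_alg_null_ideal: "ideal (tensor_alg_null K A M l r) FA"
 unfolding tensor_alg_null_def
 using assoc_algebra_ring[OF FA_algebra] tensor_alg_rels_closed by (simp add: ring.genideal_ideal)

lemmas tensor_alg_null_submodule = assoc_algebra.ideal_submodule[OF FA_algebra tensor_alg_null_ideal]
lemmas FA_module = assoc_algebra_module[OF FA_algebra]

lemma TA_algebra: "assoc_algebra K TA"
 unfolding tensor_alg_def by (rule assoc_algebra.quot_ideal(1)[OF FA_algebra tensor_alg_null_ideal])

lemmas TA_module = assoc_algebra_module[OF TA_algebra]

lemma word_closed: "u \<in> lists L ==> word u \<in>. TA"
 unfolding tensor_alg_def tensor_word_def quot_carrier[OF FA_module tensor_alg_null_submodule]
 using FA_single by blast

lemma word_append: "u \<in> lists L ==> v \<in> lists L ==> word u \<otimes>\<^sub>TA word v = word (u @ v)"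
 unfolding tensor_alg_def tensor_word_def
 by (simp add: assoc_algebra.quot_ideal(2)[OF FA_algebra tensor_alg_null_ideal] FA_single single_mult_single[OF K_cring])

lemma word_Nil: "word [] = \<one>\<^sub>TA"
 unfolding tensor_alg_def tensor_word_def
 by (simp add: quot_one[OF FA_module tensor_alg_null_submodule] free_alg_simps)

lemma in_Plus [simp]: "Inl a \<in> L \<longleftrightarrow> a \<in>. A" "Inr m \<in> L \<longleftrightarrow> m \<in>. M"
 by auto

lemma word_Cons: "x \<in> L ==> u \<in> lists L ==> word (x # u) = word [x] \<otimes>\<^sub>TA word u"
 using word_append[of "[x]" u] by simp

lemma inl_closed: "a \<in>. A ==> inl a \<in>. TA"
 and inr_closed: "m \<in>. M ==> inr m \<in>. TA"
 by (simp_all add: word_closed)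

lemma coset_relI:
 assumes "f \<ominus>\<^sub>FA g \<in> tensor_alg_rels K A M l r" "f \<in>. FA" "g \<in>. FA"
 shows "tensor_alg_null K A M l r +>\<^sub>FA f = tensor_alg_null K A M l r +>\<^sub>FA g"
 unfolding coset_eq_iff[OF FA_module tensor_alg_null_submodule assms(2,3)]
 using assms(1) ring.genideal_self[OF assoc_algebra_ring[OF FA_algebra] tensor_alg_rels_closed]
 by (auto simp: tensor_alg_null_def)

lemma tensor_alg_relsI:
 "\<lbrakk>a \<in>. A; b \<in>. A\<rbrakk> \<Longrightarrow>
   single K [Inl (a \<oplus>\<^sub>A b)] \<ominus>\<^sub>FA (single K [Inl a] \<oplus>\<^sub>FA single K [Inl b]) \<in> tensor_alg_rels K A M l r"
 "\<lbrakk>c \<in>. K; a \<in>. A\<rbrakk> \<Longrightarrow>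
   single K [Inl (c \<odot>\<^sub>A a)] \<ominus>\<^sub>FA c \<odot>\<^sub>FA single K [Inl a] \<in> tensor_alg_rels K A M l r"
 "\<lbrakk>m \<in>. M; n \<in>. M\<rbrakk> \<Longrightarrow>
   single K [Inr (m \<oplus>\<^sub>M n)] \<ominus>\<^sub>FA (single K [Inr m] \<oplus>\<^sub>FA single K [Inr n]) \<in> tensor_alg_rels K A M l r"
 "\<lbrakk>c \<in>. K; m \<in>. M\<rbrakk> \<Longrightarrow>
   single K [Inr (c \<odot>\<^sub>M m)] \<ominus>\<^sub>FA c \<odot>\<^sub>FA single K [Inr m] \<in> tensor_alg_rels K A M l r"
 "single K [Inl \<one>\<^sub>A] \<ominus>\<^sub>FA \<one>\<^sub>FA \<in> tensor_alg_rels K A M l r"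
 "\<lbrakk>a \<in>. A; b \<in>. A\<rbrakk> \<Longrightarrow>
   single K [Inl a, Inl b] \<ominus>\<^sub>FA single K [Inl (a \<otimes>\<^sub>A b)] \<in> tensor_alg_rels K A M l r"
 "\<lbrakk>a \<in>. A; m \<in>. M\<rbrakk> \<Longrightarrow>
   single K [Inl a, Inr m] \<ominus>\<^sub>FA single K [Inr (l a m)] \<in> tensor_alg_rels K A M l r"
 "\<lbrakk>a \<in>. A; m \<in>. M\<rbrakk> \<Longrightarrow>
   single K [Inr m, Inl a] \<ominus>\<^sub>FA single K [Inr (r m a)] \<in> tensor_alg_rels K A M l r"
 unfolding tensor_alg_rels_def Let_def by blast+

lemma lr_closed:
 assumes "a \<in>. A" "m \<in>. M"
 shows l_closed: "l a m \<in>. M" and r_closed: "r m a \<in>. M"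
 using assms l1(1) r1(1) by auto

lemma inl_linear: "linear_map K A TA inl"
 and inr_linear: "linear_map K M TA inr"
proof -
 interpret F: assoc_algebra K FA by (rule FA_algebra)
 note q = quot_add[OF FA_module tensor_alg_null_submodule] quot_smult[OF FA_module tensor_alg_null_submodule]
 show "linear_map K A TA inl"
 proof (rule linear_mapI)
  fix a b assume ab [simp]: "a \<in>. A" "b \<in>. A"
  show "inl (a \<oplus>\<^sub>A b) = inl a \<oplus>\<^sub>TA inl b"
  proof -
   have "tensor_alg_null K A M l r +>\<^sub>FA single K [Inl (a \<oplus>\<^sub>A b)] = tensor_alg_null K A M l r +>\<^sub>FA (single K [Inl a] \<oplus>\<^sub>FA single K [Inl b])"
    by (rule coset_relI[OF tensor_alg_relsI(1)]) (simp_all add: FA_single)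
   then show ?thesis unfolding tensor_alg_def tensor_word_def by (simp add: q(1) FA_single)
  qed
  fix c assume [simp]: "c \<in>. K"
  show "inl (c \<odot>\<^sub>A a) = c \<odot>\<^sub>TA inl a"
  proof -
   have "tensor_alg_null K A M l r +>\<^sub>FA single K [Inl (c \<odot>\<^sub>A a)] = tensor_alg_null K A M l r +>\<^sub>FA (c \<odot>\<^sub>FA single K [Inl a])"
    by (rule coset_relI[OF tensor_alg_relsI(2)]) (simp_all add: FA_single)
   then show ?thesis unfolding tensor_alg_def tensor_word_def by (simp add: q(2) FA_single)
  qed
 qed (rule inl_closed)
 show "linear_map K M TA inr"
 proof (rule linear_mapI)
  fix a b assume ab [simp]: "a \<in>. M" "b \<in>. M"
  show "inr (a \<oplus>\<^sub>M b) = inr a \<oplus>\<^sub>TA inr b"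
  proof -
   have "tensor_alg_null K A M l r +>\<^sub>FA single K [Inr (a \<oplus>\<^sub>M b)] = tensor_alg_null K A M l r +>\<^sub>FA (single K [Inr a] \<oplus>\<^sub>FA single K [Inr b])"
    by (rule coset_relI[OF tensor_alg_relsI(3)]) (simp_all add: FA_single)
   then show ?thesis unfolding tensor_alg_def tensor_word_def by (simp add: q(1) FA_single)
  qed
  fix c assume [simp]: "c \<in>. K"
  show "inr (c \<odot>\<^sub>M a) = c \<odot>\<^sub>TA inr a"
  proof -
   have "tensor_alg_null K A M l r +>\<^sub>FA single K [Inr (c \<odot>\<^sub>M a)] = tensor_alg_null K A M l r +>\<^sub>FA (c \<odot>\<^sub>FA single K [Inr a])"
    by (rule coset_relI[OF tensor_alg_relsI(4)]) (simp_all add: FA_single)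
   then show ?thesis unfolding tensor_alg_def tensor_word_def by (simp add: q(2) FA_single)
  qed
 qed (rule inr_closed)
qed

lemma inl_one: "inl \<one>\<^sub>A = \<one>\<^sub>TA"
 using coset_relI[OF tensor_alg_relsI(5)] FA_single monoid.one_closed[OF ring.is_monoid[OF assoc_algebra_ring[OF FA_algebra]]]
 unfolding word_Nil[symmetric] by (simp add: tensor_word_def free_alg_simps)

lemma inl_mult:
 assumes "a \<in>. A" "b \<in>. A" shows "inl (a \<otimes>\<^sub>A b) = inl a \<otimes>\<^sub>TA inl b"
 using assms word_append[of "[Inl a]" "[Inl b]"] coset_relI[OF tensor_alg_relsI(6)[OF assms]] FA_single
 by (simp add: tensor_word_def)

lemma inr_l:
 assumes "a \<in>. A" "m \<in>. M" shows "inr (l a m) = inl a \<otimes>\<^sub>TA inr m"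
 using assms word_append[of "[Inl a]" "[Inr m]"] coset_relI[OF tensor_alg_relsI(7)[OF assms]] FA_single lr_closed
 by (simp add: tensor_word_def)

lemma inr_r:
 assumes "a \<in>. A" "m \<in>. M" shows "inr (r m a) = inr m \<otimes>\<^sub>TA inl a"
 using assms word_append[of "[Inr m]" "[Inl a]"] coset_relI[OF tensor_alg_relsI(8)[OF assms]] FA_single lr_closed
 by (simp add: tensor_word_def)

lemma words_closed: "word ` lists L \<subseteq> carrier TA"
 by (intro image_subsetI word_closed)

lemma TA_span:
 assumes "x \<in>. TA" shows "x \<in> lin_span K TA (word ` lists L)"
proof -
 obtain f where f: "f \<in>. FA" "x = tensor_alg_null K A M l r +>\<^sub>FA f"
  using assms unfolding tensor_alg_def by (auto simp: quot_carrier[OF FA_module tensor_alg_null_submodule])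
 have p: "linear_map K FA TA (\<lambda>f. tensor_alg_null K A M l r +>\<^sub>FA f)"
  unfolding tensor_alg_def by (rule quot_proj_linear[OF FA_module tensor_alg_null_submodule])
 show ?thesis unfolding f(2)
 proof (rule lin_span_map_into[OF p FA_module TA_module _ lin_span_submodule[OF TA_module words_closed] _ free_alg_span[OF K_cring f(1)]])
  show "single K ` lists L \<subseteq> carrier FA" by (intro image_subsetI FA_single)
  fix h assume "h \<in> single K ` lists L"
  then obtain u where u: "h = single K u" "u \<in> lists L" by (rule imageE)
  show "tensor_alg_null K A M l r +>\<^sub>FA h \<in> lin_span K TA (word ` lists L)"
   unfolding u(1) tensor_word_def[symmetric] by (intro lin_span_base imageI u(2))
 qed
qed

text \<open>Words are products of letters. Unit and zero need no cases of their own: they are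
  \<open>inl\<close> of the unit and of zero of \<open>A\<close>.\<close>

lemma TA_induct [consumes 1, case_names inl inr mult add smult]:
 assumes x: "x \<in>. TA"
  and l: "\<And>a. a \<in>. A ==> P (inl a)" and r: "\<And>m. m \<in>. M ==> P (inr m)"
  and mult: "\<And>x y. x \<in>. TA ==> y \<in>. TA ==> P x ==> P y ==> P (x \<otimes>\<^sub>TA y)"
  and add: "\<And>x y. x \<in>. TA ==> y \<in>. TA ==> P x ==> P y ==> P (x \<oplus>\<^sub>TA y)"
  and smult: "\<And>c x. c \<in>. K ==> x \<in>. TA ==> P x ==> P (c \<odot>\<^sub>TA x)"
 shows "P x"
proof -
 have w: "P (word u)" if "u \<in> lists L" for u
  using that
 proof (induction u)
  case Nil
  then show ?case using l[OF A.one_closed] inl_one word_Nil by simp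
 next
  case (Cons x u)
  have "P (word [x])" using Cons(1) l r by (cases x) auto
  then show ?case using Cons mult[of "word [x]" "word u"] word_closed by (simp add: word_Cons[of x u])
 qed
 have z: "P \<zero>\<^sub>TA"
  using l[OF A.zero_closed] lin_zero[OF inl_linear A.module_axioms TA_module] by simp
 show ?thesis
  using TA_span[OF x] TA_module words_closed
  by (induction rule: lin_span_induct)
    (use w z add smult lin_span_closed[OF TA_module words_closed] in auto)
qed

text \<open>\<open>ev\<close> multiplies out the images of the letters. Its linear extension
  \<open>H\<close> is multiplicative, so the kernel of \<open>H\<close> is an ideal; the
  compatibility hypotheses put the relations into it, hence also the ideal that they
  generate.\<close>

lemma TA_universal:
 assumes C: "assoc_algebra K C" and f: "linear_map K A C f" and g: "linear_map K M C g"
  and f1: "f \<one>\<^sub>A = \<one>\<^sub>C"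
  and fm: "\<And>a b. a \<in>. A ==> b \<in>. A ==> f (a \<otimes>\<^sub>A b) = f a \<otimes>\<^sub>C f b"
  and gl: "\<And>a m. a \<in>. A ==> m \<in>. M ==> g (l a m) = f a \<otimes>\<^sub>C g m"
  and gr: "\<And>a m. a \<in>. A ==> m \<in>. M ==> g (r m a) = g m \<otimes>\<^sub>C f a"
 shows "\<exists>h. linear_map K TA C h \<and> h \<one>\<^sub>TA = \<one>\<^sub>C \<and>
  (\<forall>x\<in>carrier TA. \<forall>y\<in>carrier TA. h (x \<otimes>\<^sub>TA y) = h x \<otimes>\<^sub>C h y) \<and>
  (\<forall>a\<in>carrier A. h (inl a) = f a) \<and> (\<forall>m\<in>carrier M. h (inr m) = g m)"
proof -
 interpret C: assoc_algebra K C by (rule C)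
 interpret F: assoc_algebra K FA by (rule FA_algebra)
 define ev where "ev = (\<lambda>u. foldr (\<lambda>x y. case_sum f g x \<otimes>\<^sub>C y) u \<one>\<^sub>C)"
 have gen: "case_sum f g x \<in>. C" if "x \<in> L" for x
  using that lin_closed[OF f] lin_closed[OF g] by auto
 have ev [simp]: "ev u \<in>. C" if "u \<in> lists L" for u
  using that by (induction u) (auto simp: ev_def lin_closed[OF f] lin_closed[OF g])
 have evapp: "ev (u @ v) = ev u \<otimes>\<^sub>C ev v" if "u \<in> lists L" "v \<in> lists L" for u v
  using that(1)
 proof (induction u)
  case Nil then show ?case using ev[OF that(2)] by (simp add: ev_def)
 next
  case (Cons x u)
  have e: "ev (x # u @ v) = case_sum f g x \<otimes>\<^sub>C ev (u @ v)" "ev (x # u) = case_sum f g x \<otimes>\<^sub>C ev u"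
   by (simp_all add: ev_def)
  show ?case using Cons that(2) gen[of x] by (simp add: e C.m_assoc)
 qed
 obtain H where H0: "linear_map K (free_mod K (lists L)) C H" "\<And>u. u \<in> lists L ==> H (single K u) = ev u"
  using free_mod_ext[OF K_cring C.module_axioms, of "lists L" ev] ev by blast
 have H: "linear_map K FA C H"
  using H0(1) by (simp add: linear_map_def free_alg_simps(1-4))
 note Hs = lin_simps[OF H] lin_mod_simps[OF H FA_module C.module_axioms]
 have sub: "single K ` lists L \<subseteq> carrier FA" by (intro image_subsetI FA_single)
 have Hs1: "H (h \<otimes>\<^sub>FA k) = H h \<otimes>\<^sub>C H k" if hk: "h \<in> single K ` lists L" "k \<in> single K ` lists L" for h k
 proof -
  obtain u v where uv: "h = single K u" "u \<in> lists L" "k = single K v" "v \<in> lists L"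
   using hk by (elim imageE)
  have "u @ v \<in> lists L" using uv by (simp only: append_in_lists_conv)
  then show ?thesis unfolding uv(1,3) single_mult_single[OF K_cring]
   by (simp only: H0(2) uv(2,4) evapp)
 qed
 have Hm: "H (x \<otimes>\<^sub>FA y) = H x \<otimes>\<^sub>C H y" if "x \<in>. FA" "y \<in>. FA" for x y
  by (rule bilinear_span_eq[OF bilinear_comp[OF F.bilinear_mult H] bilinear_comp2[OF C.bilinear_mult H H]
     FA_module FA_module C.module_axioms sub sub Hs1 free_alg_span[OF K_cring that(1)] free_alg_span[OF K_cring that(2)]])
 have ev1: "ev [Inl a] = f a" if "a \<in>. A" for a
  using lin_closed[OF f that] by (simp add: ev_def)
 have ev2: "ev [Inr m] = g m" if "m \<in>. M" for m
  using lin_closed[OF g that] by (simp add: ev_def)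
 have ev3: "ev [x, y] = ev [x] \<otimes>\<^sub>C ev [y]" if "x \<in> L" "y \<in> L" for x y
  using evapp[of "[x]" "[y]"] that by simp
 have ker: "ideal {x \<in> carrier FA. H x = \<zero>\<^sub>C} FA"
 proof (rule idealI[OF assoc_algebra_ring[OF FA_algebra]])
  show "subgroup {x \<in> carrier FA. H x = \<zero>\<^sub>C} (add_monoid FA)"
   using lin_kernel_submodule[OF H FA_module C.module_axioms] by (rule submodule.axioms(1))
 qed (auto simp: Hm Hs(1))
 have H1: "H \<one>\<^sub>FA = \<one>\<^sub>C" by (simp add: free_alg_simps H0(2)) (simp add: ev_def)
 have "tensor_alg_rels K A M l r \<subseteq> {x \<in> carrier FA. H x = \<zero>\<^sub>C}"
 proof
  fix x assume x: "x \<in> tensor_alg_rels K A M l r"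
  note [simp] = FA_single Hs H0(2) ev1 ev2 ev3 lin_simps[OF f] lin_simps[OF g] f1 fm gl gr H1 lr_closed C.minus_eq_zero_iff
  have "H x = \<zero>\<^sub>C"
   using x unfolding tensor_alg_rels_def Let_def by (elim UnE) auto
  then show "x \<in> {x \<in> carrier FA. H x = \<zero>\<^sub>C}" using x tensor_alg_rels_closed by auto
 qed
 then have "tensor_alg_null K A M l r \<subseteq> {x \<in> carrier FA. H x = \<zero>\<^sub>C}"
  unfolding tensor_alg_null_def by (rule ring.genideal_minimal[OF assoc_algebra_ring[OF FA_algebra] ker])
 then have kill: "H n = \<zero>\<^sub>C" if "n \<in> tensor_alg_null K A M l r" for n using that by auto
 obtain h where h: "linear_map K TA C h" "\<And>x. x \<in>. FA ==> h (tensor_alg_null K A M l r +>\<^sub>FA x) = H x"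
  using quot_factor[OF FA_module tensor_alg_null_submodule H C.module_axioms kill]
  unfolding tensor_alg_def[symmetric] by blast
 have hw: "h (word u) = ev u" if "u \<in> lists L" for u
  using h(2)[OF FA_single[OF that]] H0(2)[OF that] by (simp add: tensor_word_def)
 interpret TA: assoc_algebra K TA by (rule TA_algebra)
 have hs1: "h (x \<otimes>\<^sub>TA y) = h x \<otimes>\<^sub>C h y" if xy: "x \<in> word ` lists L" "y \<in> word ` lists L" for x y
 proof -
  obtain u v where uv: "x = word u" "u \<in> lists L" "y = word v" "v \<in> lists L"
   using xy by (elim imageE)
  have "u @ v \<in> lists L" using uv by (simp only: append_in_lists_conv)
  then show ?thesis unfolding uv(1,3) word_append[OF uv(2,4)]
   by (simp only: hw uv(2,4) evapp)
 qed
 have hm: "h (x \<otimes>\<^sub>TA y) = h x \<otimes>\<^sub>C h y" if "x \<in>. TA" "y \<in>. TA" for x y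
  by (rule bilinear_span_eq[OF bilinear_comp[OF TA.bilinear_mult h(1)] bilinear_comp2[OF C.bilinear_mult h(1) h(1)]
     TA_module TA_module C.module_axioms words_closed words_closed hs1 TA_span[OF that(1)] TA_span[OF that(2)]])
 have "h \<one>\<^sub>TA = \<one>\<^sub>C" using hw[of "[]"] by (simp add: word_Nil ev_def)
 then show ?thesis using h(1) hm hw ev1 ev2 by (intro exI[of _ h]) auto
qed

end



section \<open>Signs, the grading of a tensor algebra and its odd derivations\<close>

lemma signed_simps [simp]: "signed M 0 x = x"
 by (simp add: signed_def)

lemma signed_Suc:
 assumes "module K M" "x \<in>. M"
 shows "signed M (Suc n) x = \<ominus>\<^sub>M signed M n x"
proof -
 interpret module K M by fact
 show ?thesis using assms(2) by (simp add: signed_def)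
qed

lemma signed_linear: "module K M ==> linear_map K M M (signed M n)"
 unfolding signed_def[abs_def] by (cases "even n") (auto intro: lin_id lin_uminus)

lemma lin_signed:
 assumes "linear_map K M N f" "module K M" "module K N" "x \<in>. M"
 shows "f (signed M n x) = signed N n (f x)"
 using lin_neg[OF assms] by (simp add: signed_def)

lemma signed_in:
 assumes "module K M" "submodule U K M" "x \<in> U"
 shows "signed M n x \<in> U"
 using assms module.submoduleE(3)[OF assms(1,2)] by (simp add: signed_def)

text \<open>Upper triangular matrices of size two with diagonal entries \<open>p\<close>,
  \<open>q\<close> in \<open>T\<close> and corner entry \<open>m\<close> in the bimodule
  \<open>N\<close>.\<close>

definition tri where
 "tri T N l r =
   \<lparr>carrier = carrier T \<times> carrier N \<times> carrier T,
   mult = (\<lambda>(p, m, q) (p', m', q'). (p \<otimes>\<^sub>T p', r m q' \<oplus>\<^sub>N l p m', q \<otimes>\<^sub>T q')),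
   one = (\<one>\<^sub>T, \<zero>\<^sub>N, \<one>\<^sub>T), zero = (\<zero>\<^sub>T, \<zero>\<^sub>N, \<zero>\<^sub>T),
   add = (\<lambda>(p, m, q) (p', m', q'). (p \<oplus>\<^sub>T p', m \<oplus>\<^sub>N m', q \<oplus>\<^sub>T q')),
   smult = (\<lambda>c (p, m, q). (c \<odot>\<^sub>T p, c \<odot>\<^sub>N m, c \<odot>\<^sub>T q))\<rparr>"

context bimodule
begin

lemma tri_algebra: "assoc_algebra K (tri A M l r)"
proof -
 have mod: "module K (tri A M l r)"
 proof (rule moduleI)
  show "abelian_group (tri A M l r)"
  proof (rule abelian_groupI)
   fix x assume "x \<in>. tri A M l r"
   then obtain p m q where x: "x = (p, m, q)" "p \<in>. A" "m \<in>. M" "q \<in>. A"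
    by (auto simp: tri_def)
   show "\<exists>y\<in>carrier (tri A M l r). y \<oplus>\<^bsub>tri A M l r\<^esub> x = \<zero>\<^bsub>tri A M l r\<^esub>"
    by (rule bexI[of _ "(\<ominus>\<^sub>A p, \<ominus>\<^sub>M m, \<ominus>\<^sub>A q)"]) (auto simp: x tri_def A.l_neg M.l_neg)
  qed (auto simp: tri_def A.a_ac M.a_ac)
 qed (use A.R.cring_axioms in \<open>auto simp: tri_def A.smult_l_distr A.smult_r_distr A.smult_assoc1
     M.smult_l_distr M.smult_r_distr M.smult_assoc1\<close>)
 note s = lr_closed l1 l2 r1 r2 l1m l2m r1m r2m l_one r_one l_mult r_mult l_r
 show ?thesis
 proof (rule assoc_algebraI[OF mod])
  show "bilinear K (tri A M l r) (tri A M l r) (tri A M l r) (\<lambda>x y. x \<otimes>\<^bsub>tri A M l r\<^esub> y)"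
   by (intro bilinearI linear_mapI)
     (auto simp: tri_def s A.l_distr A.r_distr A.smult_mult_left A.smult_mult_right
      M.smult_r_distr M.a_ac)
 qed (auto simp: tri_def s A.m_assoc M.a_ac)
qed

lemma Tdeg_words_closed: "word ` {u \<in> lists L. length (filter (Not \<circ> isl) u) = n} \<subseteq> carrier TA"
proof (rule image_subsetI)
 fix u assume "u \<in> {u \<in> lists L. length (filter (Not \<circ> isl) u) = n}"
 then have "u \<in> lists L" by (simp only: mem_Collect_eq)
 then show "word u \<in>. TA" by (rule word_closed)
qed

lemma Tdeg_submodule: "submodule (Tdeg n) K TA"
 unfolding tensor_deg_def by (rule lin_span_submodule[OF TA_module Tdeg_words_closed])

lemma Tdeg_closed: "x \<in> Tdeg n ==> x \<in>. TA"
 using module.submoduleE(1)[OF TA_module Tdeg_submodule] by auto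

lemma word_deg: "u \<in> lists L ==> word u \<in> Tdeg (length (filter (Not \<circ> isl) u))"
 unfolding tensor_deg_def by (rule lin_span_base) (rule imageI, simp)

lemma Tdeg_into:
 assumes f: "linear_map K TA N f" and N: "module K N" and U: "submodule U K N"
  and words: "\<And>u. u \<in> lists L ==> length (filter (Not \<circ> isl) u) = n ==> f (word u) \<in> U"
  and x: "x \<in> Tdeg n"
 shows "f x \<in> U"
proof (rule lin_span_map_into[OF f TA_module N Tdeg_words_closed U _ x[unfolded tensor_deg_def]])
 fix h assume "h \<in> word ` {u \<in> lists L. length (filter (Not \<circ> isl) u) = n}"
 then show "f h \<in> U" using words by (elim imageE) (simp only: mem_Collect_eq)
qed

lemma Tdeg_mult:
 assumes "x \<in> Tdeg n" "y \<in> Tdeg m" shows "x \<otimes>\<^sub>TA y \<in> Tdeg (n + m)"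
proof (rule bilinear_span_into[OF assoc_algebra.bilinear_mult[OF TA_algebra] TA_module TA_module TA_module
   Tdeg_submodule Tdeg_words_closed Tdeg_words_closed _ assms[unfolded tensor_deg_def]])
 fix h k assume "h \<in> word ` {u \<in> lists L. length (filter (Not \<circ> isl) u) = n}"
  "k \<in> word ` {u \<in> lists L. length (filter (Not \<circ> isl) u) = m}"
 then obtain u v where uv: "h = word u" "u \<in> lists L" "length (filter (Not \<circ> isl) u) = n"
   "k = word v" "v \<in> lists L" "length (filter (Not \<circ> isl) v) = m"
  by (elim imageE) (simp only: mem_Collect_eq)
 have "u @ v \<in> lists L" using uv by (simp only: append_in_lists_conv)
 from word_deg[OF this] show "h \<otimes>\<^sub>TA k \<in> Tdeg (n + m)"
  unfolding uv(1,4) word_append[OF uv(2,5)] using uv(3,6) by simp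
qed

lemma Tdeg_span:
 assumes "x \<in>. TA" shows "x \<in> lin_span K TA (\<Union>n. Tdeg n)"
proof -
 have "word ` lists L \<subseteq> (\<Union>n. Tdeg n)" using word_deg by (intro image_subsetI UN_I) simp_all
 then show ?thesis using TA_span[OF assms] lin_span_mono by blast
qed

lemma Tdeg_ext:
 assumes "linear_map K TA N f" "linear_map K TA N g" "module K N"
  and "\<And>n x. x \<in> Tdeg n ==> f x = g x" and "x \<in>. TA"
 shows "f x = g x"
 by (rule lin_span_eq[OF assms(1,2) TA_module assms(3) _ _ Tdeg_span[OF assms(5)]])
   (use Tdeg_closed assms(4) in auto)

text \<open>Neighbouring letters from \<open>A\<close> multiply, so such a word collapses to a
  single letter.\<close>

lemma word_deg_0:
 assumes "u \<in> lists L" "length (filter (Not \<circ> isl) u) = 0" shows "word u \<in> inl ` carrier A"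
 using assms
proof (induction u)
 case Nil
 show ?case unfolding word_Nil inl_one[symmetric] by (rule imageI) simp
next
 case (Cons x u)
 then obtain a where x: "x = Inl a" "a \<in>. A" by (cases x) auto
 have "word u \<in> inl ` carrier A" by (rule Cons(3)) (use Cons(4) x in \<open>simp add: comp_def\<close>)
 then obtain b where b: "word u = inl b" "b \<in>. A" by (rule imageE)
 have "word (x # u) = inl (a \<otimes>\<^sub>A b)"
  unfolding word_Cons[OF Cons(1,2)] using x b by (simp add: inl_mult)
 then show ?case by (rule image_eqI) (rule A.m_closed[OF x(2) b(2)])
qed

text \<open>The letters of \<open>A\<close> on both sides are absorbed into the only letter from
  \<open>M\<close> by the two actions.\<close>

lemma word_deg_1:
 assumes "u \<in> lists L" "length (filter (Not \<circ> isl) u) = 1" shows "word u \<in> inr ` carrier M"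
 using assms
proof (induction u)
 case (Cons x u)
 show ?case
 proof (cases x)
  case (Inl a)
  have "word u \<in> inr ` carrier M" by (rule Cons(3)) (use Cons(4) Inl in \<open>simp add: comp_def\<close>)
  then obtain m where m: "word u = inr m" "m \<in>. M" by (rule imageE)
  have a: "a \<in>. A" using Cons(1) Inl by simp
  have "word (x # u) = inr (l a m)"
   unfolding word_Cons[OF Cons(1,2)] using Inl a m by (simp add: inr_l)
  then show ?thesis by (rule image_eqI) (rule l_closed[OF a m(2)])
 next
  case (Inr m)
  have m: "m \<in>. M" using Cons(1) Inr by simp
  have "word u \<in> inl ` carrier A"
   by (rule word_deg_0[OF Cons(2)]) (use Cons(4) Inr in \<open>simp add: comp_def\<close>)
  then obtain a where a: "word u = inl a" "a \<in>. A" by (rule imageE)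
  have "word (x # u) = inr (r m a)"
   unfolding word_Cons[OF Cons(1,2)] using Inr a m by (simp add: inr_r)
  then show ?thesis by (rule image_eqI) (rule r_closed[OF a(2) m])
 qed
qed simp

lemma Tdeg_0: "Tdeg 0 = inl ` carrier A"
proof
 show "Tdeg 0 \<subseteq> inl ` carrier A"
  using Tdeg_into[OF lin_id TA_module lin_image_submodule[OF inl_linear A.module_axioms TA_module A.carrier_is_submodule] word_deg_0]
  by blast
 show "inl ` carrier A \<subseteq> Tdeg 0" using word_deg[of "[Inl a]" for a] by auto
qed

lemma Tdeg_1: "Tdeg (Suc 0) = inr ` carrier M"
proof
 show "Tdeg (Suc 0) \<subseteq> inr ` carrier M"
  using Tdeg_into[OF lin_id TA_module lin_image_submodule[OF inr_linear M.module_axioms TA_module M.carrier_is_submodule]]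
   word_deg_1 by auto
 show "inr ` carrier M \<subseteq> Tdeg (Suc 0)" using word_deg[of "[Inr a]" for a] by auto
qed

text \<open>The grading involution, which acts on degree n as the sign (-1)^n. It lets graded
  Leibniz rules be stated for all elements, where \<open>signed\<close> speaks of homogeneous ones
  only.\<close>

definition sgm where
 "sgm = (SOME h. linear_map K TA TA h \<and> h \<one>\<^sub>TA = \<one>\<^sub>TA \<and>
  (\<forall>x\<in>carrier TA. \<forall>y\<in>carrier TA. h (x \<otimes>\<^sub>TA y) = h x \<otimes>\<^sub>TA h y) \<and>
  (\<forall>a\<in>carrier A. h (inl a) = inl a) \<and> (\<forall>m\<in>carrier M. h (inr m) = \<ominus>\<^sub>TA inr m))"

lemma sgm_linear: "linear_map K TA TA sgm"
 and sgm_one: "sgm \<one>\<^sub>TA = \<one>\<^sub>TA"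
 and sgm_mult: "x \<in>. TA ==> y \<in>. TA ==> sgm (x \<otimes>\<^sub>TA y) = sgm x \<otimes>\<^sub>TA sgm y"
 and sgm_inl: "a \<in>. A ==> sgm (inl a) = inl a"
 and sgm_inr: "m \<in>. M ==> sgm (inr m) = \<ominus>\<^sub>TA inr m"
proof -
 interpret T: assoc_algebra K TA by (rule TA_algebra)
 have "\<exists>h. linear_map K TA TA h \<and> h \<one>\<^sub>TA = \<one>\<^sub>TA \<and>
  (\<forall>x\<in>carrier TA. \<forall>y\<in>carrier TA. h (x \<otimes>\<^sub>TA y) = h x \<otimes>\<^sub>TA h y) \<and>
  (\<forall>a\<in>carrier A. h (inl a) = inl a) \<and> (\<forall>m\<in>carrier M. h (inr m) = \<ominus>\<^sub>TA inr m)"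
  by (rule TA_universal[OF TA_algebra inl_linear lin_uminus[OF inr_linear TA_module]])
    (simp_all add: inl_one inl_mult inr_l inr_r T.l_minus T.r_minus inl_closed inr_closed)
 from someI_ex[OF this, folded sgm_def]
 show "linear_map K TA TA sgm" "sgm \<one>\<^sub>TA = \<one>\<^sub>TA"
  "x \<in>. TA ==> y \<in>. TA ==> sgm (x \<otimes>\<^sub>TA y) = sgm x \<otimes>\<^sub>TA sgm y"
  "a \<in>. A ==> sgm (inl a) = inl a" "m \<in>. M ==> sgm (inr m) = \<ominus>\<^sub>TA inr m"
  by auto
qed

lemmas sgm_simps = lin_simps[OF sgm_linear] lin_mod_simps[OF sgm_linear TA_module TA_module]

lemma sgm_sgm: "x \<in>. TA ==> sgm (sgm x) = x"
proof (induction rule: TA_induct)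
 case (inr m)
 interpret T: assoc_algebra K TA by (rule TA_algebra)
 show ?case using inr by (simp add: sgm_inr sgm_simps inr_closed)
qed (simp_all add: sgm_inl sgm_simps sgm_mult)

lemma sgm_word:
 assumes "u \<in> lists L"
 shows "sgm (word u) = signed TA (length (filter (Not \<circ> isl) u)) (word u)"
 using assms
proof (induction u)
 case Nil then show ?case by (simp add: word_Nil sgm_one)
next
 case (Cons x u)
 interpret T: assoc_algebra K TA by (rule TA_algebra)
 have cl: "word u \<in>. TA" "word [x] \<in>. TA" using Cons(1,2) by (auto intro!: word_closed)
 have "signed TA n (word u) \<in>. TA" for n using lin_closed[OF signed_linear[OF TA_module] cl(1)] .
 note c = cl this
 have sm: "word [x] \<otimes>\<^sub>TA signed TA n (word u) = signed TA n (word [x] \<otimes>\<^sub>TA word u)" for n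
  by (rule lin_signed[OF bilinear2[OF T.bilinear_mult cl(2)] TA_module TA_module cl(1)])
 note wc = word_Cons[OF Cons(1,2)]
 have IH: "sgm (word (x # u)) = sgm (word [x]) \<otimes>\<^sub>TA signed TA (length (filter (Not \<circ> isl) u)) (word u)"
  unfolding wc by (simp only: sgm_mult cl Cons(3))
 show ?case
 proof (cases x)
  case (Inl a)
  then have "a \<in>. A" using Cons(1) by simp
  then have *: "sgm (word [x]) = word [x]" using Inl by (simp add: sgm_inl)
  show ?thesis unfolding IH * sm wc[symmetric] by (simp add: Inl comp_def)
 next
  case (Inr m)
  then have "m \<in>. M" using Cons(1) by simp
  then have "sgm (word [x]) = \<ominus>\<^sub>TA word [x]" using Inr by (simp add: sgm_inr)
  then have "sgm (word (x # u)) = \<ominus>\<^sub>TA signed TA (length (filter (Not \<circ> isl) u)) (word (x # u))"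
   unfolding IH using c by (simp add: T.l_minus sm wc)
  also have "\<dots> = signed TA (Suc (length (filter (Not \<circ> isl) u))) (word (x # u))"
   using c by (simp add: signed_Suc[OF TA_module] wc)
  finally show ?thesis using Inr by (simp add: comp_def)
 qed
qed

lemma sgm_deg:
 assumes "x \<in> Tdeg n" shows "sgm x = signed TA n x"
proof (rule lin_span_eq[OF sgm_linear signed_linear[OF TA_module] TA_module TA_module Tdeg_words_closed
   _ assms[unfolded tensor_deg_def]])
 fix h assume "h \<in> word ` {u \<in> lists L. length (filter (Not \<circ> isl) u) = n}"
 then show "sgm h = signed TA n h" by (elim imageE) (simp only: mem_Collect_eq, metis sgm_word)
qed

lemma sgm_in_deg: "x \<in> Tdeg n ==> sgm x \<in> Tdeg n"
 by (simp add: sgm_deg signed_in[OF TA_module Tdeg_submodule])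

text \<open>An odd derivation is the off-diagonal entry of an algebra map into triangular matrices.\<close>

lemma odd_derivation_ex:
 assumes N: "bimodule K TA N lN rN" and D0: "linear_map K A N D0" and D1: "linear_map K M N D1"
  and D0m: "\<And>a b. a \<in>. A ==> b \<in>. A ==> D0 (a \<otimes>\<^sub>A b) = rN (D0 a) (inl b) \<oplus>\<^sub>N lN (inl a) (D0 b)"
  and D1l: "\<And>a m. a \<in>. A ==> m \<in>. M ==> D1 (l a m) = rN (D0 a) (inr m) \<oplus>\<^sub>N lN (inl a) (D1 m)"
  and D1r: "\<And>a m. a \<in>. A ==> m \<in>. M ==> D1 (r m a) = rN (D1 m) (inl a) \<ominus>\<^sub>N lN (inr m) (D0 a)"
 shows "\<exists>D. linear_map K TA N D \<and>
  (\<forall>x\<in>carrier TA. \<forall>y\<in>carrier TA. D (x \<otimes>\<^sub>TA y) = rN (D x) y \<oplus>\<^sub>N lN (sgm x) (D y)) \<and>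
  (\<forall>a\<in>carrier A. D (inl a) = D0 a) \<and> (\<forall>m\<in>carrier M. D (inr m) = D1 m)"
proof -
 interpret T: assoc_algebra K TA by (rule TA_algebra)
 interpret N: bimodule K TA N lN rN by (rule N)
 let ?C = "tri TA N lN rN"
 have C: "assoc_algebra K ?C" by (rule N.tri_algebra)
 have trilin: "linear_map K X ?C (\<lambda>x. (f x, g x, h x))"
  if "linear_map K X TA f" "linear_map K X N g" "linear_map K X TA h" for X :: "('k, 'x) module" and f g h
  using that by (auto simp: linear_map_def tri_def)
 have pr: "linear_map K ?C TA fst" "linear_map K ?C N (\<lambda>x. fst (snd x))" "linear_map K ?C TA (\<lambda>x. snd (snd x))"
  by (auto simp: linear_map_def tri_def)
 \<comment> \<open>The Leibniz rule for the product of the unit with itself. The matrix map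
   preserves units only because of this.\<close>
 have D01: "D0 \<one>\<^sub>A = \<zero>\<^sub>N"
 proof -
  have c: "D0 \<one>\<^sub>A \<in>. N" using lin_closed[OF D0] by simp
  have "D0 \<one>\<^sub>A = D0 \<one>\<^sub>A \<oplus>\<^sub>N D0 \<one>\<^sub>A"
   using D0m[of "\<one>\<^sub>A" "\<one>\<^sub>A"] c by (simp add: inl_one N.r_one N.l_one)
  then show ?thesis using c by (metis N.M.add.r_cancel_one')
 qed
 note [simp] = inl_closed inr_closed lin_closed[OF D0] lin_closed[OF D1]
 \<comment> \<open>The upper left entry follows the grading involution and the lower right entry the
   identity. Matrix multiplication then gives the corner entry the Leibniz rule twisted by
   \<open>sgm\<close>.\<close>
 obtain h where h: "linear_map K TA ?C h" "h \<one>\<^sub>TA = \<one>\<^sub>?C"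
  "\<And>x y. x \<in>. TA ==> y \<in>. TA ==> h (x \<otimes>\<^sub>TA y) = h x \<otimes>\<^sub>?C h y"
  "\<And>a. a \<in>. A ==> h (inl a) = (inl a, D0 a, inl a)"
  "\<And>m. m \<in>. M ==> h (inr m) = (\<ominus>\<^sub>TA inr m, D1 m, inr m)"
 proof -
  have "\<exists>h. linear_map K TA ?C h \<and> h \<one>\<^sub>TA = \<one>\<^sub>?C \<and>
   (\<forall>x\<in>carrier TA. \<forall>y\<in>carrier TA. h (x \<otimes>\<^sub>TA y) = h x \<otimes>\<^sub>?C h y) \<and>
   (\<forall>a\<in>carrier A. h (inl a) = (inl a, D0 a, inl a)) \<and>
   (\<forall>m\<in>carrier M. h (inr m) = (\<ominus>\<^sub>TA inr m, D1 m, inr m))"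
  proof (rule TA_universal[OF C trilin[OF inl_linear D0 inl_linear] trilin[OF lin_uminus[OF inr_linear TA_module] D1 inr_linear]])
   show "(inl \<one>\<^sub>A, D0 \<one>\<^sub>A, inl \<one>\<^sub>A) = \<one>\<^sub>?C" by (simp add: inl_one D01 tri_def)
   fix a m assume [simp]: "a \<in>. A" "m \<in>. M"
   show "(\<ominus>\<^sub>TA inr (l a m), D1 (l a m), inr (l a m)) =
     (inl a, D0 a, inl a) \<otimes>\<^sub>?C (\<ominus>\<^sub>TA inr m, D1 m, inr m)"
    by (simp add: tri_def inr_l T.r_minus D1l)
   show "(\<ominus>\<^sub>TA inr (r m a), D1 (r m a), inr (r m a)) =
     (\<ominus>\<^sub>TA inr m, D1 m, inr m) \<otimes>\<^sub>?C (inl a, D0 a, inl a)"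
    by (simp add: tri_def inr_r T.l_minus D1r N.l1m a_minus_def)
  qed (simp add: tri_def inl_mult D0m)
  then show ?thesis using that by blast
 qed
 have hc: "h x \<in>. ?C" if "x \<in>. TA" for x using lin_closed[OF h(1) that] .
 have h1: "fst (h x) = sgm x \<and> snd (snd (h x)) = x" if "x \<in>. TA" for x
  using that
 proof (induction rule: TA_induct)
  case (mult x y)
  then show ?case using h(3)[of x y] by (auto simp: tri_def sgm_mult split: prod.splits)
 next
  case (add x y)
  then show ?case using lin_add[OF h(1), of x y] by (auto simp: tri_def sgm_simps split: prod.splits)
 next
  case (smult c x)
  then show ?case using lin_smult[OF h(1), of c x] by (auto simp: tri_def sgm_simps split: prod.splits)
 qed (simp_all add: h(4,5) sgm_inl sgm_inr)
 show ?thesis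
 proof (intro exI[of _ "\<lambda>x. fst (snd (h x))"] conjI ballI)
  show "linear_map K TA N (\<lambda>x. fst (snd (h x)))" by (rule lin_comp[OF h(1) pr(2)])
  fix x y assume xy: "x \<in>. TA" "y \<in>. TA"
  show "fst (snd (h (x \<otimes>\<^sub>TA y))) = rN (fst (snd (h x))) y \<oplus>\<^sub>N lN (sgm x) (fst (snd (h y)))"
   using h(3)[OF xy] h1[OF xy(1)] h1[OF xy(2)] by (auto simp: tri_def split: prod.splits)
 qed (simp_all add: h(4,5))
qed

text \<open>\<open>G n\<close> is the place where elements of degree \<open>n\<close> have to land:
  one degree up for the differential, one degree down for contractions. The Leibniz rule splits a
  word into letters, so letters decide.\<close>

lemma odd_derivation_deg:
 assumes N: "bimodule K TA N lN rN" and D: "linear_map K TA N D"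
  and Dm: "\<And>x y. x \<in>. TA ==> y \<in>. TA ==> D (x \<otimes>\<^sub>TA y) = rN (D x) y \<oplus>\<^sub>N lN (sgm x) (D y)"
  and G: "\<And>n. submodule (G n) K N"
  and G0: "\<And>a. a \<in>. A ==> D (inl a) \<in> G 0" and G1: "\<And>m. m \<in>. M ==> D (inr m) \<in> G 1"
  and Gl: "\<And>n x j k. n \<in> G k ==> x \<in> Tdeg j ==> lN x n \<in> G (j + k)"
  and Grall: "\<And>n x k j. n \<in> G k ==> x \<in> Tdeg j ==> rN n x \<in> G (k + j)"
  and x: "x \<in> Tdeg n"
 shows "D x \<in> G n"
proof -
 interpret N: bimodule K TA N lN rN by (rule N)
 have w: "D (word u) \<in> G (length (filter (Not \<circ> isl) u))" if "u \<in> lists L" for u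
  using that
 proof (induction u)
  case Nil
  then show ?case using G0[OF A.one_closed] by (simp add: word_Nil inl_one)
 next
  case (Cons x u)
  let ?k = "length (filter (Not \<circ> isl) [x])" and ?j = "length (filter (Not \<circ> isl) u)"
  have x1: "D (word [x]) \<in> G ?k" using Cons(1) G0 G1 by (cases x) simp_all
  have x2: "word [x] \<in> Tdeg ?k" using Cons(1) by (intro word_deg) auto
  have "D (word (x # u)) = rN (D (word [x])) (word u) \<oplus>\<^sub>N lN (sgm (word [x])) (D (word u))"
   using Cons(1,2) Tdeg_closed[OF x2] word_closed[OF Cons(2)] by (simp only: word_Cons[of x u] Dm)
  also have "\<dots> \<in> G (?k + ?j)"
   using x1 x2 Cons(3) word_deg[OF Cons(2)]
   by (intro N.M.submoduleE(5)[OF G] Grall Gl sgm_in_deg) (simp_all only:)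
  also have "?k + ?j = length (filter (Not \<circ> isl) (x # u))" by simp
  finally show ?case .
 qed
 show ?thesis
  using w by (intro Tdeg_into[OF D N.M.module_axioms G _ x]) auto
qed

text \<open>Translates the sign rule of the definitions, which mentions degrees, into the rule with
  \<open>sgm\<close>. Homogeneous elements span, and on them \<open>sgm\<close> is the sign.\<close>

lemma odd_leibniz_sgm:
 assumes N: "bimodule K TA N lN rN" and D: "linear_map K TA N D"
 shows "(\<forall>n. \<forall>x\<in>Tdeg n. \<forall>y\<in>carrier TA. D (x \<otimes>\<^sub>TA y) = rN (D x) y \<oplus>\<^sub>N signed N n (lN x (D y)))
  \<longleftrightarrow> (\<forall>x\<in>carrier TA. \<forall>y\<in>carrier TA. D (x \<otimes>\<^sub>TA y) = rN (D x) y \<oplus>\<^sub>N lN (sgm x) (D y))"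
proof -
 interpret T: assoc_algebra K TA by (rule TA_algebra)
 interpret N: bimodule K TA N lN rN by (rule N)
 have s: "lN (sgm x) (D y) = signed N n (lN x (D y))" if "x \<in> Tdeg n" "y \<in>. TA" for x y n
  using that lin_closed[OF D] Tdeg_closed
  by (simp add: sgm_deg lin_signed[OF bilinear1[OF N.l_bilinear] TA_module N.M.module_axioms])
 show ?thesis
 proof (intro iffI ballI allI)
  fix x y assume *: "\<forall>n. \<forall>x\<in>Tdeg n. \<forall>y\<in>carrier TA. D (x \<otimes>\<^sub>TA y) = rN (D x) y \<oplus>\<^sub>N signed N n (lN x (D y))"
   and x: "x \<in>. TA" and y: "y \<in>. TA"
  show "D (x \<otimes>\<^sub>TA y) = rN (D x) y \<oplus>\<^sub>N lN (sgm x) (D y)"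
  proof (rule Tdeg_ext[OF _ _ N.M.module_axioms _ x])
   show "linear_map K TA N (\<lambda>x. D (x \<otimes>\<^sub>TA y))" by (rule lin_comp[OF bilinear1[OF T.bilinear_mult y] D])
   show "linear_map K TA N (\<lambda>x. rN (D x) y \<oplus>\<^sub>N lN (sgm x) (D y))"
    by (intro lin_plus lin_comp[OF D bilinear1[OF N.r_bilinear y]] N.M.module_axioms
       lin_comp[OF sgm_linear bilinear1[OF N.l_bilinear lin_closed[OF D y]]])
  qed (use * y s in auto)
 qed (use s Tdeg_closed in auto)
qed

end



section \<open>Differential forms and their derivations\<close>

lemma (in abelian_group) a_inv_zero [simp]: "\<ominus> \<zero> = \<zero>"
 by (metis l_neg r_zero a_inv_closed zero_closed)

lemma (in bimodule) sub_bimodule: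
 assumes U: "submodule U K M"
  and cl: "\<And>a u. a \<in>. A ==> u \<in> U ==> l a u \<in> U" "\<And>a u. a \<in>. A ==> u \<in> U ==> r u a \<in> U"
 shows "bimodule K A (M\<lparr>carrier := U\<rparr>) l r"
proof -
 have UM: "u \<in>. M" if "u \<in> U" for u using M.submoduleE(1)[OF U] that by auto
 show ?thesis
  by (intro bimodule.intro bimodule_axioms.intro A.assoc_algebra_axioms submodule_module[OF M.module_axioms U] bilinearI)
    (auto simp: linear_map_def UM cl l1 l2 r1 r2 l_one r_one l_mult r_mult l_r)
qed

locale nc = tensor_square K A S for K :: "'k ring" and A :: "('k, 'a) module" and S
begin

sublocale A2: tensor_square K A "{}"
 by unfold_locales simp

lemma Omega1_carrier: "carrier (Omega1 K A S) = {\<xi> \<in> carrier T. tmul K A S \<xi> = \<zero>\<^sub>A}"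
 by (simp add: Omega1_def)

lemma Omega1_submodule: "submodule (carrier (Omega1 K A S)) K T"
 unfolding Omega1_carrier by (rule lin_kernel_submodule[OF tmul_linear tsq_module module_axioms])

lemma Omega1_bimodule: "bimodule K A (Omega1 K A S) (lact K A S) (ract K A S)"
proof -
 interpret T: bimodule K A T "lact K A S" "ract K A S" by (rule tsq_bimodule)
 have "bimodule K A (T\<lparr>carrier := carrier (Omega1 K A S)\<rparr>) (lact K A S) (ract K A S)"
  by (rule T.sub_bimodule[OF Omega1_submodule])
    (auto simp: Omega1_carrier tmul_lact tmul_ract T.lr_closed)
 then show ?thesis by (simp add: Omega1_def)
qed

sublocale Om: bimodule K A "Omega1 K A S" "lact K A S" "ract K A S"
 rewrites "tensor_alg K A (Omega1 K A S) (lact K A S) (ract K A S) = Omega K A S"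
  and "tensor_deg K A (Omega1 K A S) (lact K A S) (ract K A S) = Omega_deg K A S"
  and "\<And>a. tensor_word K A (Omega1 K A S) (lact K A S) (ract K A S) [Inl a] = fn K A S a"
  and "\<And>\<xi>. tensor_word K A (Omega1 K A S) (lact K A S) (ract K A S) [Inr \<xi>] = one_form K A S \<xi>"
 by (rule Omega1_bimodule) (simp_all add: Omega_def Omega_deg_def fn_def one_form_def)

abbreviation "O1 \<equiv> Omega1 K A S"
abbreviation "Dr \<equiv> Der K A S"
abbreviation "DD \<equiv> DDer K A S"
abbreviation "Om \<equiv> Omega K A S"
abbreviation "Omd \<equiv> Omega_deg K A S"
abbreviation "\<phi> \<equiv> fn K A S"
abbreviation "\<delta> a \<equiv> one_form K A S (univ_der K A S a)"
abbreviation "\<sigma> \<equiv> Om.sgm"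

sublocale Omega: assoc_algebra K Om by (rule Om.TA_algebra)

sublocale O2: tensor_square K Om "{}" by unfold_locales simp

lemmas fn_linear = Om.inl_linear
lemmas one_form_linear = Om.inr_linear
lemmas Om_module = Omega.module_axioms

lemma univ_der_closed: "a \<in>. A ==> univ_der K A S a \<in>. O1"
proof -
 interpret T: module K T by (rule tsq_module)
 show "a \<in>. A ==> univ_der K A S a \<in>. O1"
  by (simp add: Omega1_carrier univ_der_def lin_minus[OF tmul_linear tsq_module module_axioms] tmul_tens minus_eq_zero_iff)
qed

lemma univ_der_linear: "linear_map K A O1 (univ_der K A S)"
proof -
 have "linear_map K A T (\<lambda>a. tens K A S a \<one>\<^sub>A \<ominus>\<^sub>T tens K A S \<one>\<^sub>A a)"
  by (intro lin_diff bilinear1[OF tens_bilinear] bilinear2[OF tens_bilinear] tsq_module) auto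
 then have "linear_map K A T (univ_der K A S)" by (simp add: univ_der_def[abs_def])
 then show ?thesis using univ_der_closed by (auto simp: linear_map_def Omega1_def)
qed

lemma univ_der_mult:
 assumes [simp]: "a \<in>. A" "b \<in>. A"
 shows "univ_der K A S (a \<otimes>\<^sub>A b) = ract K A S (univ_der K A S a) b \<oplus>\<^sub>T lact K A S a (univ_der K A S b)"
proof -
 interpret T: module K T by (rule tsq_module)
 note rm = lin_minus[OF ract_linear tsq_module tsq_module] and lm = lin_minus[OF lact_linear tsq_module tsq_module]
 have "ract K A S (univ_der K A S a) b \<oplus>\<^sub>T lact K A S a (univ_der K A S b) =
  (tens K A S a b \<ominus>\<^sub>T tens K A S \<one>\<^sub>A (a \<otimes>\<^sub>A b)) \<oplus>\<^sub>T (tens K A S (a \<otimes>\<^sub>A b) \<one>\<^sub>A \<ominus>\<^sub>T tens K A S a b)"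
  by (simp add: univ_der_def rm lm ract_tens lact_tens)
 also have "\<dots> = tens K A S (a \<otimes>\<^sub>A b) \<one>\<^sub>A \<ominus>\<^sub>T tens K A S \<one>\<^sub>A (a \<otimes>\<^sub>A b)"
  using tens_closed[of a b] tens_closed[of "\<one>\<^sub>A" "a \<otimes>\<^sub>A b"] tens_closed[of "a \<otimes>\<^sub>A b" "\<one>\<^sub>A"] assms
  by (subst T.a_comm) (auto simp: T.minus_eq_trans)
 finally show ?thesis by (simp add: univ_der_def)
qed

lemma univ_der_S: "s \<in> S ==> univ_der K A S s = \<zero>\<^sub>T"
proof -
 interpret T: module K T by (rule tsq_module)
 assume s: "s \<in> S"
 then have sA: "s \<in>. A" using S_sub by auto
 then show ?thesis using tens_balanced[OF s, of "\<one>\<^sub>A" "\<one>\<^sub>A"] by (simp add: univ_der_def T.minus_eq_zero_iff)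
qed

lemma Omega1_ops:
 "x \<oplus>\<^sub>O1 y = x \<oplus>\<^sub>T y" "c \<odot>\<^sub>O1 x = c \<odot>\<^sub>T x" "\<zero>\<^sub>O1 = \<zero>\<^sub>T"
 by (simp_all add: Omega1_def)

lemma Omega1_into_T: "linear_map K O1 T (\<lambda>x. x)"
 by (auto simp: linear_map_def Omega1_def)

lemma dfn_linear: "linear_map K A Om \<delta>"
 by (rule lin_comp[OF univ_der_linear one_form_linear])

lemmas fn_simps = lin_simps[OF fn_linear] lin_mod_simps[OF fn_linear module_axioms Om_module]
 Om.inl_one Om.inl_mult
lemmas dfn_simps = lin_simps[OF dfn_linear] lin_mod_simps[OF dfn_linear module_axioms Om_module]

lemma dfn_mult:
 assumes "a \<in>. A" "b \<in>. A"
 shows "\<delta> (a \<otimes>\<^sub>A b) = \<delta> a \<otimes>\<^sub>Om \<phi> b \<oplus>\<^sub>Om \<phi> a \<otimes>\<^sub>Om \<delta> b"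
 using assms univ_der_closed Om.lr_closed lin_add[OF one_form_linear, unfolded Omega1_ops]
 by (simp add: univ_der_mult Om.inr_l Om.inr_r)

lemma dfn_S: "s \<in> S ==> \<delta> s = \<zero>\<^sub>Om"
 using lin_zero[OF one_form_linear Om.M.module_axioms Om_module] by (simp add: univ_der_S Omega1_ops)

lemma dfn_one: "\<delta> \<one>\<^sub>A = \<zero>\<^sub>Om"
proof -
 have c: "\<delta> \<one>\<^sub>A \<in>. Om" by (simp add: dfn_simps)
 have "\<delta> \<one>\<^sub>A = \<delta> \<one>\<^sub>A \<oplus>\<^sub>Om \<delta> \<one>\<^sub>A"
  using dfn_mult[of "\<one>\<^sub>A" "\<one>\<^sub>A"] c by (simp add: fn_simps)
 then show ?thesis using c by (metis Omega.add.r_cancel_one')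
qed

lemma one_form_udv: "u \<in>. A ==> v \<in>. A ==>
  one_form K A S (lact K A S u (univ_der K A S v)) = \<phi> u \<otimes>\<^sub>Om \<delta> v"
 by (simp add: Om.inr_l univ_der_closed)

text \<open>The element \<open>\<xi> - \<mu>(\<xi>) \<otimes> 1\<close> is a form for every \<open>\<xi>\<close>; on \<open>u \<otimes> v\<close> it is \<open>- u dv\<close>.\<close>

lemma Omega1_value:
 assumes f: "linear_map K O1 N f" and g: "linear_map K T N g" and N: "module K N"
  and fg: "\<And>u v. u \<in>. A ==> v \<in>. A ==> g (tens K A S u v) = f (lact K A S u (univ_der K A S v))"
  and \<xi>: "\<xi> \<in>. O1"
 shows "f \<xi> = \<ominus>\<^sub>N g \<xi>"
proof -
 interpret T: module K T by (rule tsq_module)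
 interpret N: module K N by (rule N)
 let ?G = "\<lambda>\<xi>. \<xi> \<ominus>\<^sub>T tens K A S (tmul K A S \<xi>) \<one>\<^sub>A"
 have G: "linear_map K T T ?G"
  by (intro lin_diff lin_id tsq_module lin_comp[OF tmul_linear bilinear1[OF tens_bilinear]]) simp
 have "linear_map K T (T\<lparr>carrier := carrier O1\<rparr>) ?G"
  by (rule lin_into[OF G])
    (auto simp: Omega1_carrier lin_minus[OF tmul_linear tsq_module module_axioms] tmul_tens lin_closed[OF tmul_linear] r_neg a_minus_def
     lin_neg[OF tmul_linear tsq_module module_axioms] lin_add[OF tmul_linear])
 then have G1: "linear_map K T O1 ?G" by (simp add: Omega1_def)
 have c: "\<xi> \<in>. T" "tmul K A S \<xi> = \<zero>\<^sub>A" using \<xi> by (auto simp: Omega1_carrier)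
 have Gt: "?G (tens K A S u v) = \<ominus>\<^sub>O1 lact K A S u (univ_der K A S v)"
  if uv [simp]: "u \<in>. A" "v \<in>. A" for u v
 proof -
  have "lact K A S u (univ_der K A S v) = tens K A S (u \<otimes>\<^sub>A v) \<one>\<^sub>A \<ominus>\<^sub>T tens K A S u v"
   by (simp add: univ_der_def lin_minus[OF lact_linear tsq_module tsq_module] lact_tens)
  moreover have "\<ominus>\<^sub>O1 lact K A S u (univ_der K A S v) = \<ominus>\<^sub>T lact K A S u (univ_der K A S v)"
   using lin_neg[OF Omega1_into_T Om.M.module_axioms tsq_module] Om.lr_closed univ_der_closed by simp
  ultimately show ?thesis using tens_closed[OF uv] tens_closed[of "u \<otimes>\<^sub>A v" "\<one>\<^sub>A"]
   by (simp add: tmul_tens a_minus_def T.minus_add T.a_comm)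
 qed
 have "?G \<xi> = \<xi>" using c lin_zero[OF bilinear1[OF tens_bilinear] module_axioms tsq_module, of "\<one>\<^sub>A"]
  by (simp add: a_minus_def)
 moreover have "f (?G \<xi>) = \<ominus>\<^sub>N g \<xi>"
  by (rule tsq_ext[OF lin_comp[OF G1 f] lin_uminus[OF g N] N _ c(1)])
    (simp only: Gt lin_neg[OF f Om.M.module_axioms N] fg Om.lr_closed univ_der_closed)
 ultimately show ?thesis by simp
qed

text \<open>Functions and their differentials generate all forms. An arbitrary one-form is, by
  \<open>Omega1_value\<close>, minus the image of a tensor under u \<otimes> v \<mapsto> u dv, so it
  lies in the submodule of forms that satisfy \<open>P\<close>.\<close>

lemma Om_induct [consumes 1, case_names fn dfn mult add smult]:
 assumes x: "x \<in>. Om"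
  and fn: "\<And>a. a \<in>. A ==> P (\<phi> a)" and dfn: "\<And>a. a \<in>. A ==> P (\<delta> a)"
  and mult: "\<And>x y. x \<in>. Om ==> y \<in>. Om ==> P x ==> P y ==> P (x \<otimes>\<^sub>Om y)"
  and add: "\<And>x y. x \<in>. Om ==> y \<in>. Om ==> P x ==> P y ==> P (x \<oplus>\<^sub>Om y)"
  and smult: "\<And>c x. c \<in>. K ==> x \<in>. Om ==> P x ==> P (c \<odot>\<^sub>Om x)"
 shows "P x"
proof -
 let ?U = "{x \<in> carrier Om. P x}"
 have U: "submodule ?U K Om"
 proof (rule Omega.submoduleI)
  show z: "\<zero>\<^sub>Om \<in> ?U" using fn[OF zero_closed] by (simp add: fn_simps)
  fix a assume a: "a \<in> ?U"
  then have "\<ominus>\<^sub>Om a = (\<ominus>\<^sub>K \<one>\<^sub>K) \<odot>\<^sub>Om a" by (simp add: Omega.smult_l_minus)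
  then show "\<ominus>\<^sub>Om a \<in> ?U" using a smult by auto
 qed (use add smult in auto)
 have bil: "bilinear K A A Om (\<lambda>u v. \<phi> u \<otimes>\<^sub>Om \<delta> v)"
  by (rule bilinear_comp2[OF Omega.bilinear_mult fn_linear dfn_linear])
 have bal: "\<phi> (u \<otimes>\<^sub>A s) \<otimes>\<^sub>Om \<delta> v = \<phi> u \<otimes>\<^sub>Om \<delta> (s \<otimes>\<^sub>A v)"
  if "s \<in> S" "u \<in>. A" "v \<in>. A" for s u v
  using that S_sub by (auto simp: dfn_mult dfn_S fn_simps dfn_simps Omega.m_assoc subset_iff)
 have P1: "P (one_form K A S \<xi>)" if \<xi>: "\<xi> \<in>. O1" for \<xi>
 proof -
  let ?g = "tlift K A S Om (\<lambda>u v. \<phi> u \<otimes>\<^sub>Om \<delta> v)"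
  note g = tlift_linear[OF Om_module bil bal] and gt = tlift_tens[OF Om_module bil bal]
  have "one_form K A S \<xi> = \<ominus>\<^sub>Om ?g \<xi>"
   by (rule Omega1_value[OF one_form_linear g Om_module _ \<xi>]) (simp_all add: gt one_form_udv)
  moreover have "?g \<xi> \<in> ?U"
   by (rule tsq_into[OF g Om_module U]) (use \<xi> fn dfn mult in \<open>auto simp: gt Omega1_carrier fn_simps dfn_simps\<close>)
  ultimately show ?thesis using Omega.submoduleE(3)[OF U] by auto
 qed
 show ?thesis using x by (induction rule: Om.TA_induct) (use fn P1 mult add smult in auto)
qed

text \<open>The data are the values \<open>D0\<close> on functions and \<open>E\<close> on
  differentials; \<open>Em\<close> is what the Leibniz rule forces on d(ab) = da b + a db. On
  one-forms the derivation is minus \<open>B\<close>, where \<open>B\<close> sends u \<otimes> v to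
  (D0 u) dv + u (E v). Both data vanish on the base, which makes \<open>B\<close> balanced.\<close>

lemma odd_derivation_ex:
 assumes N: "bimodule K Om N lN rN" and D0: "linear_map K A N D0" and E: "linear_map K A N E"
  and D0m: "\<And>a b. a \<in>. A ==> b \<in>. A ==> D0 (a \<otimes>\<^sub>A b) = rN (D0 a) (\<phi> b) \<oplus>\<^sub>N lN (\<phi> a) (D0 b)"
  and Em: "\<And>a b. a \<in>. A ==> b \<in>. A ==>
   E (a \<otimes>\<^sub>A b) = (rN (E a) (\<phi> b) \<ominus>\<^sub>N lN (\<delta> a) (D0 b)) \<oplus>\<^sub>N (rN (D0 a) (\<delta> b) \<oplus>\<^sub>N lN (\<phi> a) (E b))"
  and S0: "\<And>s. s \<in> S ==> D0 s = \<zero>\<^sub>N" "\<And>s. s \<in> S ==> E s = \<zero>\<^sub>N"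
 shows "\<exists>D. linear_map K Om N D \<and>
  (\<forall>x\<in>carrier Om. \<forall>y\<in>carrier Om. D (x \<otimes>\<^sub>Om y) = rN (D x) y \<oplus>\<^sub>N lN (\<sigma> x) (D y)) \<and>
  (\<forall>a\<in>carrier A. D (\<phi> a) = D0 a) \<and> (\<forall>a\<in>carrier A. D (\<delta> a) = E a)"
proof -
 interpret N: bimodule K Om N lN rN by (rule N)
 interpret T: bimodule K A T "lact K A S" "ract K A S" by (rule tsq_bimodule)
 note [simp] = lin_closed[OF D0] lin_closed[OF E] lin_closed[OF fn_linear] lin_closed[OF dfn_linear] N.lr_closed
  N.M.smult_closed
 note Ns = N.l1 N.l2 N.r1 N.r2 N.l1m N.l2m N.r1m N.r2m N.l_mult N.r_mult N.l_r
 define \<beta> where "\<beta> = (\<lambda>u v. rN (D0 u) (\<delta> v) \<oplus>\<^sub>N lN (\<phi> u) (E v))"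
 have \<beta>: "bilinear K A A N \<beta>" unfolding \<beta>_def
  by (intro bilinear_plus N.M.module_axioms bilinear_comp2[OF N.r_bilinear D0 dfn_linear]
    bilinear_comp2[OF N.l_bilinear fn_linear E])
 have \<beta>bal: "\<beta> (u \<otimes>\<^sub>A s) v = \<beta> u (s \<otimes>\<^sub>A v)" if "s \<in> S" "u \<in>. A" "v \<in>. A" for s u v
  using that S_sub
  by (auto simp: \<beta>_def dfn_mult dfn_S fn_simps dfn_simps D0m Em S0 Ns subset_iff a_minus_def)
 have \<gamma>: "bilinear K A A Om (\<lambda>u v. \<phi> u \<otimes>\<^sub>Om \<delta> v)"
  by (rule bilinear_comp2[OF Omega.bilinear_mult fn_linear dfn_linear])
 have \<gamma>bal: "\<phi> (u \<otimes>\<^sub>A s) \<otimes>\<^sub>Om \<delta> v = \<phi> u \<otimes>\<^sub>Om \<delta> (s \<otimes>\<^sub>A v)"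
  if "s \<in> S" "u \<in>. A" "v \<in>. A" for s u v
  using that S_sub by (auto simp: dfn_mult dfn_S fn_simps dfn_simps Omega.m_assoc subset_iff)
 define B where "B = tlift K A S N \<beta>"
 define g where "g = tlift K A S Om (\<lambda>u v. \<phi> u \<otimes>\<^sub>Om \<delta> v)"
 note B = tlift_linear[OF N.M.module_axioms \<beta> \<beta>bal, folded B_def] and Bt = tlift_tens[OF N.M.module_axioms \<beta> \<beta>bal, folded B_def]
 note g = tlift_linear[OF Om_module \<gamma> \<gamma>bal, folded g_def] and gt = tlift_tens[OF Om_module \<gamma> \<gamma>bal, folded g_def]
 note [simp] = lin_closed[OF B] lin_closed[OF g]
 have of: "one_form K A S \<xi> = \<ominus>\<^sub>Om g \<xi>" if "\<xi> \<in>. O1" for \<xi>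
  by (rule Omega1_value[OF one_form_linear g Om_module _ that]) (simp_all add: gt one_form_udv)
 have Bl: "B (lact K A S a \<xi>) = rN (D0 a) (g \<xi>) \<oplus>\<^sub>N lN (\<phi> a) (B \<xi>)"
  if a [simp]: "a \<in>. A" and \<xi>: "\<xi> \<in>. T" for a \<xi>
  by (rule tsq_ext[OF lin_comp[OF lact_linear[OF a] B] lin_plus[OF lin_comp[OF g bilinear2[OF N.r_bilinear]]
      lin_comp[OF B bilinear2[OF N.l_bilinear]] N.M.module_axioms] N.M.module_axioms _ \<xi>])
    (simp_all add: lact_tens Bt gt \<beta>_def D0m fn_simps dfn_simps Ns N.M.a_ac)
 \<comment> \<open>The last term contains the product map, which vanishes on one-forms. It has to be
   carried along because the identity is checked on pure tensors, which are not one-forms.\<close>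
 have Br: "B (ract K A S \<xi> b) = (rN (B \<xi>) (\<phi> b) \<ominus>\<^sub>N lN (g \<xi>) (D0 b)) \<oplus>\<^sub>N \<beta> (tmul K A S \<xi>) b"
  if b [simp]: "b \<in>. A" and \<xi>: "\<xi> \<in>. T" for b \<xi>
 proof (rule tsq_ext[OF lin_comp[OF ract_linear[OF b] B] lin_plus[OF lin_diff[OF
    lin_comp[OF B bilinear1[OF N.r_bilinear]] lin_comp[OF g bilinear1[OF N.l_bilinear]] N.M.module_axioms]
    lin_comp[OF tmul_linear bilinear1[OF \<beta>]] N.M.module_axioms] N.M.module_axioms _ \<xi>])
  fix u v assume uv [simp]: "u \<in>. A" "v \<in>. A"
  define a1 a2 a3 a4 a5 a6 where a: "a1 = rN (D0 u) (\<delta> v \<otimes>\<^sub>Om \<phi> b)" "a2 = rN (D0 u) (\<phi> v \<otimes>\<^sub>Om \<delta> b)"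
   "a3 = lN (\<phi> u) (rN (E v) (\<phi> b))" "a4 = lN (\<phi> u) (lN (\<delta> v) (D0 b))"
   "a5 = lN (\<phi> u) (rN (D0 v) (\<delta> b))" "a6 = lN (\<phi> u) (lN (\<phi> v) (E b))"
  have c: "a1 \<in>. N" "a2 \<in>. N" "a3 \<in>. N" "a4 \<in>. N" "a5 \<in>. N" "a6 \<in>. N"
   by (simp_all add: a)
  have "B (ract K A S (tens K A S u v) b) = (a1 \<oplus>\<^sub>N a2) \<oplus>\<^sub>N ((a3 \<ominus>\<^sub>N a4) \<oplus>\<^sub>N (a5 \<oplus>\<^sub>N a6))"
   unfolding a by (simp add: ract_tens Bt \<beta>_def dfn_mult Em Ns(1-12) N.l2m)
  also have "\<dots> = ((a1 \<oplus>\<^sub>N a3) \<ominus>\<^sub>N a4) \<oplus>\<^sub>N ((a2 \<oplus>\<^sub>N a5) \<oplus>\<^sub>N a6)"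
   using c by (simp add: a_minus_def N.M.a_ac)
  also have "\<dots> = (rN (B (tens K A S u v)) (\<phi> b) \<ominus>\<^sub>N lN (g (tens K A S u v)) (D0 b)) \<oplus>\<^sub>N \<beta> (tmul K A S (tens K A S u v)) b"
   unfolding a by (simp add: tmul_tens Bt gt \<beta>_def D0m fn_simps Ns)
  finally show "B (ract K A S (tens K A S u v) b) =
    (rN (B (tens K A S u v)) (\<phi> b) \<ominus>\<^sub>N lN (g (tens K A S u v)) (D0 b)) \<oplus>\<^sub>N \<beta> (tmul K A S (tens K A S u v)) b" .
 qed simp_all
 have T1: "\<xi> \<in>. T" if "\<xi> \<in>. O1" for \<xi> using that by (simp add: Omega1_carrier)
 have D1: "linear_map K O1 N (\<lambda>\<xi>. \<ominus>\<^sub>N B \<xi>)"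
  using lin_comp[OF Omega1_into_T lin_uminus[OF B N.M.module_axioms]] .
 have "\<exists>D. linear_map K Om N D \<and>
  (\<forall>x\<in>carrier Om. \<forall>y\<in>carrier Om. D (x \<otimes>\<^sub>Om y) = rN (D x) y \<oplus>\<^sub>N lN (\<sigma> x) (D y)) \<and>
  (\<forall>a\<in>carrier A. D (\<phi> a) = D0 a) \<and> (\<forall>\<xi>\<in>carrier O1. D (one_form K A S \<xi>) = \<ominus>\<^sub>N B \<xi>)"
 proof (rule Om.odd_derivation_ex[OF N D0 D1 D0m])
  fix a \<xi> assume a: "a \<in>. A" and \<xi>: "\<xi> \<in>. O1"
  show "\<ominus>\<^sub>N B (lact K A S a \<xi>) = rN (D0 a) (one_form K A S \<xi>) \<oplus>\<^sub>N lN (\<phi> a) (\<ominus>\<^sub>N B \<xi>)"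
   using a T1[OF \<xi>] by (simp add: Bl of[OF \<xi>] N.r2m N.l2m N.M.minus_add)
  have "\<beta> \<zero>\<^sub>A a = \<zero>\<^sub>N" using lin_zero[OF bilinear1[OF \<beta> a] module_axioms N.M.module_axioms] .
  then show "\<ominus>\<^sub>N B (ract K A S \<xi> a) = rN (\<ominus>\<^sub>N B \<xi>) (\<phi> a) \<ominus>\<^sub>N lN (one_form K A S \<xi>) (D0 a)"
   using a T1[OF \<xi>] \<xi> by (simp add: Br of[OF \<xi>] N.r1m N.l1m N.M.minus_add Omega1_carrier a_minus_def)
 qed
 then obtain D where D: "linear_map K Om N D"
  "\<forall>x\<in>carrier Om. \<forall>y\<in>carrier Om. D (x \<otimes>\<^sub>Om y) = rN (D x) y \<oplus>\<^sub>N lN (\<sigma> x) (D y)"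
  "\<forall>a\<in>carrier A. D (\<phi> a) = D0 a" "\<forall>\<xi>\<in>carrier O1. D (one_form K A S \<xi>) = \<ominus>\<^sub>N B \<xi>" by blast
 have D01: "D0 \<one>\<^sub>A = \<zero>\<^sub>N"
 proof -
  have c: "D0 \<one>\<^sub>A \<in>. N" by simp
  have "D0 \<one>\<^sub>A = D0 \<one>\<^sub>A \<oplus>\<^sub>N D0 \<one>\<^sub>A"
   using D0m[of "\<one>\<^sub>A" "\<one>\<^sub>A"] c by (simp add: fn_simps N.r_one N.l_one)
  then show ?thesis using c by (metis N.M.add.r_cancel_one')
 qed
 have E1: "E \<one>\<^sub>A = \<zero>\<^sub>N"
 proof -
  have c: "E \<one>\<^sub>A \<in>. N" by simp
  have "E \<one>\<^sub>A = E \<one>\<^sub>A \<oplus>\<^sub>N E \<one>\<^sub>A"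
   using Em[of "\<one>\<^sub>A" "\<one>\<^sub>A"] c by (simp add: fn_simps N.r_one N.l_one D01 dfn_one N.r1m N.l2m N.r2m a_minus_def N.M.a_inv_zero)
  then show ?thesis using c by (metis N.M.add.r_cancel_one')
 qed
 have "D (\<delta> a) = E a" if a [simp]: "a \<in>. A" for a
 proof -
  have "B (univ_der K A S a) = B (tens K A S a \<one>\<^sub>A) \<ominus>\<^sub>N B (tens K A S \<one>\<^sub>A a)"
   by (simp add: univ_der_def lin_minus[OF B tsq_module N.M.module_axioms])
  also have "\<dots> = \<ominus>\<^sub>N E a"
   by (simp add: Bt \<beta>_def D01 E1 dfn_one N.r2m N.l2m N.r1m fn_simps N.l_one a_minus_def)
  finally show ?thesis using D(4) univ_der_closed[OF a] by simp
 qed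
 then show ?thesis using D(1-3) by blast
qed

text \<open>The twist and the two actions are arbitrary functions. With the identity as twist this
  compares even derivations, and with actions through an algebra map it compares derivations along
  that map.\<close>

lemma odd_derivation_unique:
 assumes "linear_map K Om N D" "linear_map K Om N D'"
  and "\<And>x y. x \<in>. Om ==> y \<in>. Om ==> D (x \<otimes>\<^sub>Om y) = rN (D x) y \<oplus>\<^sub>N lN (\<tau> x) (D y)"
  and "\<And>x y. x \<in>. Om ==> y \<in>. Om ==> D' (x \<otimes>\<^sub>Om y) = rN (D' x) y \<oplus>\<^sub>N lN (\<tau> x) (D' y)"
  and "\<And>a. a \<in>. A ==> D (\<phi> a) = D' (\<phi> a)" "\<And>a. a \<in>. A ==> D (\<delta> a) = D' (\<delta> a)"
  and "x \<in>. Om"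
 shows "D x = D' x"
 using assms(7)
 by (induction rule: Om_induct)
   (simp_all add: assms(3-6) lin_simps(2,3)[OF assms(1)] lin_simps(2,3)[OF assms(2)])

end



context nc
begin

text \<open>One-forms are sums of terms u dv: \<open>Omega1_value\<close> for the identity map shows
  that a one-form is minus its own image, read as a tensor, under u \<otimes> v \<mapsto> u
  dv.\<close>

lemma Omega1_into:
 assumes f: "linear_map K O1 N f" and N: "module K N" and U: "submodule U K N"
  and fg: "\<And>u v. u \<in>. A ==> v \<in>. A ==> f (lact K A S u (univ_der K A S v)) \<in> U"
  and \<xi>: "\<xi> \<in>. O1"
 shows "f \<xi> \<in> U"
proof -
 interpret N: module K N by (rule N)
 have \<xi>T: "\<xi> \<in>. T" using \<xi> unfolding Omega1_carrier by blast
 let ?b = "\<lambda>u v. lact K A S u (univ_der K A S v)"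
 have bil: "bilinear K A A O1 ?b"
  by (rule bilinear_comp2[OF Om.l_bilinear lin_id univ_der_linear])
 have bal: "?b (u \<otimes>\<^sub>A s) v = ?b u (s \<otimes>\<^sub>A v)" if "s \<in> S" "u \<in>. A" "v \<in>. A" for s u v
 proof -
  have sA: "s \<in>. A" using that S_sub by auto
  have T1: "univ_der K A S v \<in>. T" using univ_der_closed[OF that(3)] by (simp add: Omega1_carrier)
  interpret T: bimodule K A T "lact K A S" "ract K A S" by (rule tsq_bimodule)
  show ?thesis using that sA T1
   by (simp add: univ_der_mult univ_der_S T.r1m T.l_mult T.l2 T.lr_closed)
 qed
 let ?g = "tlift K A S O1 ?b"
 have g: "linear_map K T O1 ?g" by (rule tlift_linear[OF Om.M.module_axioms bil bal])
 have gt: "?g (tens K A S u v) = ?b u v" if "u \<in>. A" "v \<in>. A" for u v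
  by (rule tlift_tens[OF Om.M.module_axioms bil bal that])
 have "\<xi> = \<ominus>\<^sub>O1 ?g \<xi>"
  by (rule Omega1_value[OF lin_id g Om.M.module_axioms gt \<xi>])
 then have "f \<xi> = f (\<ominus>\<^sub>O1 ?g \<xi>)" by (rule arg_cong)
 moreover have "?g \<xi> \<in>. O1"
  by (rule lin_closed[OF g \<xi>T])
 ultimately have "f \<xi> = \<ominus>\<^sub>N f (?g \<xi>)"
  using lin_neg[OF f Om.M.module_axioms N] by simp
 moreover have "f (?g \<xi>) \<in> U"
 proof (rule tsq_into[OF lin_comp[OF g f] N U _ \<xi>T])
  fix u v assume uv: "u \<in>. A" "v \<in>. A"
  show "f (?g (tens K A S u v)) \<in> U"
   unfolding gt[OF uv] by (rule fg[OF uv])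
 qed
 ultimately show ?thesis using N.submoduleE(3)[OF U] by simp
qed

lemma fn_deg: "a \<in>. A ==> \<phi> a \<in> Omd 0"
 by (simp add: Om.Tdeg_0)

lemma one_form_deg: "\<xi> \<in>. O1 ==> one_form K A S \<xi> \<in> Omd (Suc 0)"
 by (simp add: Om.Tdeg_1)

lemma dfn_deg: "a \<in>. A ==> \<delta> a \<in> Omd (Suc 0)"
 by (simp add: one_form_deg univ_der_closed)

lemma sgm_dfn: "a \<in>. A ==> \<sigma> (\<delta> a) = \<ominus>\<^sub>Om \<delta> a"
 by (simp add: Om.sgm_inr univ_der_closed)

lemma odd_derivation_deg:
 assumes N: "bimodule K Om N lN rN" and D: "linear_map K Om N D"
  and Dm: "\<And>x y. x \<in>. Om ==> y \<in>. Om ==> D (x \<otimes>\<^sub>Om y) = rN (D x) y \<oplus>\<^sub>N lN (\<sigma> x) (D y)"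
  and G: "\<And>n. submodule (G n) K N"
  and G0: "\<And>a. a \<in>. A ==> D (\<phi> a) \<in> G 0" and G1: "\<And>a. a \<in>. A ==> D (\<delta> a) \<in> G (Suc 0)"
  and Gr: "\<And>n x k j. n \<in> G k ==> x \<in> Omd j ==> rN n x \<in> G (k + j)"
  and Gl: "\<And>n x j k. n \<in> G k ==> x \<in> Omd j ==> lN x n \<in> G (j + k)"
  and x: "x \<in> Omd n"
 shows "D x \<in> G n"
proof -
 interpret N: bimodule K Om N lN rN by (rule N)
 show ?thesis
 proof (rule Om.odd_derivation_deg[OF N D Dm G G0 _ Gl Gr x])
  fix \<xi> assume \<xi>: "\<xi> \<in>. O1"
  show "D (one_form K A S \<xi>) \<in> G 1"
  proof (rule Omega1_into[OF lin_comp[OF one_form_linear D] N.M.module_axioms G _ \<xi>])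
   fix u v assume uv: "u \<in>. A" "v \<in>. A"
   have "D (\<phi> u \<otimes>\<^sub>Om \<delta> v) = rN (D (\<phi> u)) (\<delta> v) \<oplus>\<^sub>N lN (\<phi> u) (D (\<delta> v))"
    using uv by (simp add: Dm fn_simps dfn_simps Om.sgm_inl)
   also have "\<dots> \<in> G (Suc 0)"
    using Gr[OF G0[OF uv(1)] dfn_deg[OF uv(2)]] Gl[OF G1[OF uv(2)] fn_deg[OF uv(1)]]
    by (intro N.M.submoduleE(5)[OF G]) simp_all
   finally show "D (one_form K A S (lact K A S u (univ_der K A S v))) \<in> G 1"
    using uv by (simp add: one_form_udv)
  qed
 qed
qed

lemma odd_leibniz_iff:
 "bimodule K Om N lN rN ==> linear_map K Om N D ==>
  odd_leibniz K A S N lN rN D \<longleftrightarrow>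
  (\<forall>x\<in>carrier Om. \<forall>y\<in>carrier Om. D (x \<otimes>\<^sub>Om y) = rN (D x) y \<oplus>\<^sub>N lN (\<sigma> x) (D y))"
 unfolding odd_leibniz_def by (rule Om.odd_leibniz_sgm)

text \<open>\<open>\<tau>\<close> is the grading involution of the target. The identity expresses
  that \<open>D\<close> has odd degree, in a form that applies to inhomogeneous elements and is
  inherited from the generators.\<close>

lemma odd_derivation_sgm:
 assumes N: "bimodule K Om N lN rN" and D: "linear_map K Om N D" and \<tau>: "linear_map K N N \<tau>"
  and Dm: "\<And>x y. x \<in>. Om ==> y \<in>. Om ==> D (x \<otimes>\<^sub>Om y) = rN (D x) y \<oplus>\<^sub>N lN (\<sigma> x) (D y)"
  and \<tau>l: "\<And>x n. x \<in>. Om ==> n \<in>. N ==> \<tau> (lN x n) = lN (\<sigma> x) (\<tau> n)"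
  and \<tau>r: "\<And>x n. x \<in>. Om ==> n \<in>. N ==> \<tau> (rN n x) = rN (\<tau> n) (\<sigma> x)"
  and D0: "\<And>a. a \<in>. A ==> \<tau> (D (\<phi> a)) = \<ominus>\<^sub>N D (\<phi> a)"
  and D1: "\<And>a. a \<in>. A ==> \<tau> (D (\<delta> a)) = D (\<delta> a)"
  and x: "x \<in>. Om"
 shows "D (\<sigma> x) = \<ominus>\<^sub>N \<tau> (D x)"
proof -
 interpret N: bimodule K Om N lN rN by (rule N)
 note [simp] = lin_closed[OF D] lin_closed[OF \<tau>] N.lr_closed fn_simps(1) dfn_simps(1) Om.sgm_simps Om.sgm_mult Om.sgm_sgm
  Om.sgm_inl sgm_dfn
 show ?thesis using x
 proof (induction rule: Om_induct)
  case (mult x y)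
  then show ?case by (simp add: Dm N.l1m N.r1m N.l2m lin_simps(2,3)[OF \<tau>] \<tau>l \<tau>r N.M.minus_add)
 qed (simp_all add: D0 D1 lin_simps(2,3)[OF D] lin_simps(2,3)[OF \<tau>] N.M.minus_add N.M.smult_r_minus
   lin_neg[OF D Om_module N.M.module_axioms])
qed

text \<open>The anticommutator of two odd derivations is an even derivation: the mixed terms
  \<open>a2\<close> and \<open>a3\<close> occur once with each sign. As \<open>D'\<close> has values
  in a bimodule, \<open>D\<close> must first be extended to that bimodule, as
  \<open>DN\<close>.\<close>

lemma supercommutator:
 assumes N: "bimodule K Om N lN rN" and D: "linear_map K Om Om D" and D': "linear_map K Om N D'" and DN: "linear_map K N N DN"
  and \<tau>: "linear_map K N N \<tau>"
  and Dm: "\<And>x y. x \<in>. Om ==> y \<in>. Om ==> D (x \<otimes>\<^sub>Om y) = D x \<otimes>\<^sub>Om y \<oplus>\<^sub>Om \<sigma> x \<otimes>\<^sub>Om D y"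
  and D'm: "\<And>x y. x \<in>. Om ==> y \<in>. Om ==> D' (x \<otimes>\<^sub>Om y) = rN (D' x) y \<oplus>\<^sub>N lN (\<sigma> x) (D' y)"
  and DNr: "\<And>n y. n \<in>. N ==> y \<in>. Om ==> DN (rN n y) = rN (DN n) y \<oplus>\<^sub>N rN (\<tau> n) (D y)"
  and DNl: "\<And>n x. n \<in>. N ==> x \<in>. Om ==> DN (lN x n) = lN (D x) n \<oplus>\<^sub>N lN (\<sigma> x) (DN n)"
  and Ds: "\<And>x. x \<in>. Om ==> D (\<sigma> x) = \<ominus>\<^sub>Om \<sigma> (D x)"
  and D's: "\<And>x. x \<in>. Om ==> D' (\<sigma> x) = \<ominus>\<^sub>N \<tau> (D' x)"
  and x: "x \<in>. Om" and y: "y \<in>. Om"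
 shows "DN (D' (x \<otimes>\<^sub>Om y)) \<oplus>\<^sub>N D' (D (x \<otimes>\<^sub>Om y)) =
  rN (DN (D' x) \<oplus>\<^sub>N D' (D x)) y \<oplus>\<^sub>N lN x (DN (D' y) \<oplus>\<^sub>N D' (D y))"
proof -
 interpret N: bimodule K Om N lN rN by (rule N)
 note [simp] = lin_closed[OF D] lin_closed[OF D'] lin_closed[OF DN] lin_closed[OF \<tau>] N.lr_closed Om.sgm_simps Om.sgm_sgm
 define a1 a2 a3 a4 a5 a8 where a: "a1 = rN (DN (D' x)) y" "a2 = rN (\<tau> (D' x)) (D y)"
  "a3 = lN (\<sigma> (D x)) (D' y)" "a4 = lN x (DN (D' y))" "a5 = rN (D' (D x)) y" "a8 = lN x (D' (D y))"
 have c: "a1 \<in>. N" "a2 \<in>. N" "a3 \<in>. N" "a4 \<in>. N" "a5 \<in>. N" "a8 \<in>. N"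
  using x y by (simp_all add: a)
 have "DN (D' (x \<otimes>\<^sub>Om y)) \<oplus>\<^sub>N D' (D (x \<otimes>\<^sub>Om y)) =
   ((a1 \<oplus>\<^sub>N a2) \<oplus>\<^sub>N (\<ominus>\<^sub>N a3 \<oplus>\<^sub>N a4)) \<oplus>\<^sub>N ((a5 \<oplus>\<^sub>N a3) \<oplus>\<^sub>N (\<ominus>\<^sub>N a2 \<oplus>\<^sub>N a8))"
  unfolding a using x y
  by (simp add: D'm Dm lin_simps(2)[OF DN] lin_simps(2)[OF D'] DNr DNl Ds D's N.l1m N.r1m)
 also have "\<dots> = (a1 \<oplus>\<^sub>N a5) \<oplus>\<^sub>N (a4 \<oplus>\<^sub>N a8)"
  using c by algebra
 also have "\<dots> = rN (DN (D' x) \<oplus>\<^sub>N D' (D x)) y \<oplus>\<^sub>N lN x (DN (D' y) \<oplus>\<^sub>N D' (D y))"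
  unfolding a using x y by (simp add: N.r1 N.l2)
 finally show ?thesis .
qed


subsection \<open>The differential\<close>

abbreviation "dOm \<equiv> Omega_d K A S"

lemma Omega_d_ex1:
 "\<exists>!D. D \<in> extensional (carrier Om) \<and> linear_map K Om Om D \<and>
   (\<forall>n. D ` Omd n \<subseteq> Omd (Suc n)) \<and> odd_leibniz K A S Om (mult Om) (mult Om) D \<and>
   (\<forall>x\<in>carrier Om. D (D x) = \<zero>\<^sub>Om) \<and> (\<forall>a\<in>carrier A. D (\<phi> a) = \<delta> a)"
  (is "\<exists>!D. ?P D")
proof -
 note N = Omega.bimodule_self
 note [simp] = fn_simps(1) dfn_simps(1)
 obtain D where D: "linear_map K Om Om D"
  "\<And>x y. x \<in>. Om ==> y \<in>. Om ==> D (x \<otimes>\<^sub>Om y) = D x \<otimes>\<^sub>Om y \<oplus>\<^sub>Om \<sigma> x \<otimes>\<^sub>Om D y"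
  "\<And>a. a \<in>. A ==> D (\<phi> a) = \<delta> a" "\<And>a. a \<in>. A ==> D (\<delta> a) = \<zero>\<^sub>Om"
  using odd_derivation_ex[OF N dfn_linear lin_const_zero[OF Om_module]]
  by (auto simp: dfn_mult dfn_S Omega.l_neg a_minus_def)
 have Dc [simp]: "D x \<in>. Om" if "x \<in>. Om" for x using lin_closed[OF D(1) that] .
 have Ds: "D (\<sigma> x) = \<ominus>\<^sub>Om \<sigma> (D x)" if "x \<in>. Om" for x
  by (rule odd_derivation_sgm[OF N D(1) Om.sgm_linear _ _ _ _ _ that])
    (simp_all add: D(2-4) Om.sgm_mult sgm_dfn Om.sgm_simps)
 have DD: "D (D x) = \<zero>\<^sub>Om" if "x \<in>. Om" for x
  using that
 proof (induction rule: Om_induct)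
  case (mult x y)
  then show ?case
   by (simp add: D(2) lin_simps(2)[OF D(1)] Ds Om.sgm_simps Om.sgm_sgm Omega.l_minus Omega.r_neg)
 qed (simp_all add: D(3,4) lin_simps(2,3)[OF D(1)] lin_zero[OF D(1) Om_module Om_module])
 have deg: "D x \<in> Omd (Suc n)" if "x \<in> Omd n" for x n
 proof (rule odd_derivation_deg[OF N D(1) _ _ _ _ _ _ that, where G = "\<lambda>n. Omd (Suc n)"])
  fix y z k j assume yz: "y \<in> Omd (Suc k)" "z \<in> Omd j"
  show "y \<otimes>\<^sub>Om z \<in> Omd (Suc (k + j))" using Om.Tdeg_mult[OF yz] by simp
  show "z \<otimes>\<^sub>Om y \<in> Omd (Suc (j + k))" using Om.Tdeg_mult[OF yz(2,1)] by simp
 qed (simp_all add: D(2-4) Om.Tdeg_submodule dfn_deg Omega.submodule_zero[OF Om.Tdeg_submodule])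
 let ?D = "restrict D (carrier Om)"
 have lin: "linear_map K Om Om ?D" by (rule lin_restrict[OF D(1) Om_module])
 have leib: "odd_leibniz K A S Om (mult Om) (mult Om) ?D"
  by (simp add: odd_leibniz_iff[OF N lin] D(2) Om.sgm_simps)
 show ?thesis
 proof (rule ex1I[of ?P ?D])
  show "?P ?D" using lin leib DD deg Om.Tdeg_closed by (auto simp: D(3))
  fix D' assume D': "?P D'"
  have lin': "linear_map K Om Om D'" using D' by blast
  have D'm: "D' (x \<otimes>\<^sub>Om y) = D' x \<otimes>\<^sub>Om y \<oplus>\<^sub>Om \<sigma> x \<otimes>\<^sub>Om D' y"
   if "x \<in>. Om" "y \<in>. Om" for x y
   using D' odd_leibniz_iff[OF N lin'] that by blast
  have D'f: "D' (\<phi> a) = \<delta> a" if "a \<in>. A" for a using D' that by blast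
  \<comment> \<open>Vanishing of the square is what fixes a competitor on differentials, and with it
    uniqueness.\<close>
  have D'd: "D' (\<delta> a) = \<zero>\<^sub>Om" if "a \<in>. A" for a
  proof -
   have "D' (D' (\<phi> a)) = \<zero>\<^sub>Om" using D' fn_simps(1)[OF that] by blast
   then show ?thesis by (simp add: D'f[OF that])
  qed
  show "D' = ?D"
  proof (rule extensionalityI[of _ "carrier Om"])
   fix x assume x: "x \<in>. Om"
   have "D' x = D x"
    by (rule odd_derivation_unique[where N = Om and rN = "mult Om" and lN = "mult Om" and \<tau> = \<sigma>, OF lin' D(1) _ _ _ _ x])
      (simp_all add: D(2-4) D'm D'f D'd)
   then show "D' x = ?D x" using x by simp
  qed (use D' in blast)+
 qed
qed

lemma Omega_d_props:
 "linear_map K Om Om dOm" "\<And>n. dOm ` Omd n \<subseteq> Omd (Suc n)"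
 "odd_leibniz K A S Om (mult Om) (mult Om) dOm"
 "\<And>x. x \<in>. Om ==> dOm (dOm x) = \<zero>\<^sub>Om" "\<And>a. a \<in>. A ==> dOm (\<phi> a) = \<delta> a"
 using theI'[OF Omega_d_ex1, folded Omega_d_def] by auto

lemmas d_linear = Omega_d_props(1)
lemmas d_d = Omega_d_props(4)
lemmas d_fn = Omega_d_props(5)
lemmas d_simps = lin_simps[OF d_linear] lin_mod_simps[OF d_linear Om_module Om_module]

lemma d_deg: "x \<in> Omd n ==> dOm x \<in> Omd (Suc n)"
 using Omega_d_props(2) by auto

lemma d_mult: "x \<in>. Om ==> y \<in>. Om ==> dOm (x \<otimes>\<^sub>Om y) = dOm x \<otimes>\<^sub>Om y \<oplus>\<^sub>Om \<sigma> x \<otimes>\<^sub>Om dOm y"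
 using Omega_d_props(3) odd_leibniz_iff[OF Omega.bimodule_self d_linear] by auto

lemma d_dfn: "a \<in>. A ==> dOm (\<delta> a) = \<zero>\<^sub>Om"
 using d_d[of "\<phi> a"] by (simp add: d_fn fn_simps)

lemma d_sgm: "x \<in>. Om ==> dOm (\<sigma> x) = \<ominus>\<^sub>Om \<sigma> (dOm x)"
 by (rule odd_derivation_sgm[OF Omega.bimodule_self d_linear Om.sgm_linear])
   (simp_all add: d_mult Om.sgm_mult d_fn d_dfn sgm_dfn Om.sgm_simps)


subsection \<open>Contractions\<close>

text \<open>A grading shifted by one with zero in front. Contractions lower the degree and kill
  functions, and both statements become one about \<open>pred_deg\<close>.\<close>

definition pred_deg :: "('k, 'n) module \<Rightarrow> (nat \<Rightarrow> 'n set) \<Rightarrow> nat \<Rightarrow> 'n set" where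
 "pred_deg N G n = (case n of 0 \<Rightarrow> {\<zero>\<^sub>N} | Suc m \<Rightarrow> G m)"

lemma pred_deg_submodule: "module K N ==> (\<And>n. submodule (G n) K N) ==> submodule (pred_deg N G n) K N"
proof -
 assume N: "module K N" and G: "\<And>n. submodule (G n) K N"
 interpret N: module K N by (rule N)
 have "submodule {\<zero>\<^sub>N} K N" by (rule N.submoduleI) auto
 then show ?thesis using G by (cases n) (simp_all add: pred_deg_def)
qed

lemma contraction_deg:
 assumes N: "bimodule K Om N lN rN" and D: "linear_map K Om N D"
  and Dm: "\<And>x y. x \<in>. Om ==> y \<in>. Om ==> D (x \<otimes>\<^sub>Om y) = rN (D x) y \<oplus>\<^sub>N lN (\<sigma> x) (D y)"
  and G: "\<And>n. submodule (G n) K N"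
  and D0: "\<And>a. a \<in>. A ==> D (\<phi> a) = \<zero>\<^sub>N" and D1: "\<And>a. a \<in>. A ==> D (\<delta> a) \<in> G 0"
  and Gr: "\<And>n x k j. n \<in> G k ==> x \<in> Omd j ==> rN n x \<in> G (k + j)"
  and Gl: "\<And>n x j k. n \<in> G k ==> x \<in> Omd j ==> lN x n \<in> G (j + k)"
  and x: "x \<in> Omd n"
 shows "D x \<in> pred_deg N G n"
proof -
 interpret N: bimodule K Om N lN rN by (rule N)
 have z: "\<zero>\<^sub>N \<in> pred_deg N G n" for n
  by (rule N.M.submodule_zero[OF pred_deg_submodule[OF N.M.module_axioms G]])
 have "rN m x \<in> pred_deg N G (k + j)" if "m \<in> pred_deg N G k" "x \<in> Omd j" for m x k j
  using that Gr z by (cases k) (simp_all add: pred_deg_def N.r1m Om.Tdeg_closed)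
 moreover have "lN x m \<in> pred_deg N G (j + k)" if "m \<in> pred_deg N G k" "x \<in> Omd j" for m x k j
  using that Gl z by (cases k) (simp_all add: pred_deg_def N.l2m Om.Tdeg_closed)
 note cl = calculation this
 have "D (\<delta> a) \<in> pred_deg N G (Suc 0)" if "a \<in>. A" for a
  using D1[OF that] by (simp add: pred_deg_def)
 then show ?thesis
  by (intro odd_derivation_deg[OF N D _ pred_deg_submodule[OF N.M.module_axioms G] _ _ _ _ x])
    (simp_all add: Dm D0 z cl)
qed

lemma DerD:
 assumes "\<theta> \<in>. Dr"
 shows "linear_map K A A \<theta>" "\<And>a b. a \<in>. A ==> b \<in>. A ==> \<theta> (a \<otimes>\<^sub>A b) = \<theta> a \<otimes>\<^sub>A b \<oplus>\<^sub>A a \<otimes>\<^sub>A \<theta> b"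
  "\<And>s. s \<in> S ==> \<theta> s = \<zero>\<^sub>A" "\<theta> \<in> extensional (carrier A)"
 using assms by (auto simp: Der_def)

text \<open>In \<open>odd_derivation_ex\<close> take zero on functions and \<theta>(a) on da; the
  compatibility condition is then the Leibniz rule for \<theta>.\<close>

lemma contr_ex1:
 assumes \<theta>: "\<theta> \<in>. Dr"
 shows "\<exists>!D. D \<in> extensional (carrier Om) \<and> linear_map K Om Om D \<and>
   (\<forall>x\<in>Omd 0. D x = \<zero>\<^sub>Om) \<and> (\<forall>n. D ` Omd (Suc n) \<subseteq> Omd n) \<and>
   odd_leibniz K A S Om (mult Om) (mult Om) D \<and>
   (\<forall>u\<in>carrier A. \<forall>v\<in>carrier A. D (\<phi> u \<otimes>\<^sub>Om dOm (\<phi> v)) = \<phi> (u \<otimes>\<^sub>A \<theta> v))"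
  (is "\<exists>!D. ?P D")
proof -
 note N = Omega.bimodule_self
 note \<theta>D = DerD[OF \<theta>]
 note [simp] = fn_simps(1) dfn_simps(1) lin_closed[OF \<theta>D(1)]
 obtain D where D: "linear_map K Om Om D"
  "\<And>x y. x \<in>. Om ==> y \<in>. Om ==> D (x \<otimes>\<^sub>Om y) = D x \<otimes>\<^sub>Om y \<oplus>\<^sub>Om \<sigma> x \<otimes>\<^sub>Om D y"
  "\<And>a. a \<in>. A ==> D (\<phi> a) = \<zero>\<^sub>Om" "\<And>a. a \<in>. A ==> D (\<delta> a) = \<phi> (\<theta> a)"
  using odd_derivation_ex[OF N lin_const_zero[OF Om_module] lin_comp[OF \<theta>D(1) fn_linear]]
  by (auto simp: \<theta>D(2,3) fn_simps a_minus_def)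
 have deg: "D x \<in> pred_deg Om Omd n" if "x \<in> Omd n" for x n
  by (rule contraction_deg[OF N D(1) _ Om.Tdeg_submodule _ _ _ _ that])
    (simp_all add: D(2-4) fn_deg Om.Tdeg_mult)
 let ?D = "restrict D (carrier Om)"
 have lin: "linear_map K Om Om ?D" by (rule lin_restrict[OF D(1) Om_module])
 have leib: "odd_leibniz K A S Om (mult Om) (mult Om) ?D"
  by (simp add: odd_leibniz_iff[OF N lin] D(2) Om.sgm_simps)
 show ?thesis
 proof (rule ex1I[of ?P ?D])
  have deg0: "?D x = \<zero>\<^sub>Om" if "x \<in> Omd 0" for x
   using deg[OF that] Om.Tdeg_closed[OF that] by (simp add: pred_deg_def)
  have degS: "?D x \<in> Omd n" if "x \<in> Omd (Suc n)" for x n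
   using deg[OF that] Om.Tdeg_closed[OF that] by (simp add: pred_deg_def)
  have val: "?D (\<phi> u \<otimes>\<^sub>Om dOm (\<phi> v)) = \<phi> (u \<otimes>\<^sub>A \<theta> v)" if "u \<in>. A" "v \<in>. A" for u v
   using that by (simp add: d_fn D(2-4) Om.sgm_inl fn_simps)
  show "?P ?D" using lin leib deg0 degS val by blast
  fix D' assume D': "?P D'"
  have lin': "linear_map K Om Om D'" using D' by blast
  have D'm: "D' (x \<otimes>\<^sub>Om y) = D' x \<otimes>\<^sub>Om y \<oplus>\<^sub>Om \<sigma> x \<otimes>\<^sub>Om D' y"
   if "x \<in>. Om" "y \<in>. Om" for x y
   using D' odd_leibniz_iff[OF N lin'] that by blast
  have D'd: "D' (\<delta> a) = \<phi> (\<theta> a)" if a: "a \<in>. A" for a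
  proof -
   have "D' (\<phi> \<one>\<^sub>A \<otimes>\<^sub>Om dOm (\<phi> a)) = \<phi> (\<one>\<^sub>A \<otimes>\<^sub>A \<theta> a)" using D' a one_closed by blast
   then show ?thesis using a by (simp add: d_fn fn_simps)
  qed
  have D'f: "D' (\<phi> a) = \<zero>\<^sub>Om" if "a \<in>. A" for a using D' fn_deg[OF that] by blast
  show "D' = ?D"
  proof (rule extensionalityI[of _ "carrier Om"])
   fix x assume x: "x \<in>. Om"
   have "D' x = D x"
    by (rule odd_derivation_unique[where N = Om and rN = "mult Om" and lN = "mult Om" and \<tau> = \<sigma>, OF lin' D(1) _ _ _ _ x])
      (simp_all add: D(2-4) D'm D'f D'd)
   then show "D' x = ?D x" using x by simp
  qed (use D' in blast)+
 qed
qed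

abbreviation "ct \<equiv> contr K A S"

context
 fixes \<theta> assumes \<theta>: "\<theta> \<in>. Dr"
begin

lemmas contr_props = theI'[OF contr_ex1[OF \<theta>], folded contr_def]

lemma contr_linear: "linear_map K Om Om (ct \<theta>)"
 using contr_props by blast

lemma contr_deg_0: "x \<in> Omd 0 ==> ct \<theta> x = \<zero>\<^sub>Om"
 using contr_props by blast

lemma contr_deg_Suc: "x \<in> Omd (Suc n) ==> ct \<theta> x \<in> Omd n"
 using contr_props by blast

lemma contr_mult:
 "x \<in>. Om ==> y \<in>. Om ==> ct \<theta> (x \<otimes>\<^sub>Om y) = ct \<theta> x \<otimes>\<^sub>Om y \<oplus>\<^sub>Om \<sigma> x \<otimes>\<^sub>Om ct \<theta> y"
 using contr_props odd_leibniz_iff[OF Omega.bimodule_self contr_linear] by blast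

lemma contr_fn: "a \<in>. A ==> ct \<theta> (\<phi> a) = \<zero>\<^sub>Om"
 by (rule contr_deg_0[OF fn_deg])

lemma contr_dfn: "a \<in>. A ==> ct \<theta> (\<delta> a) = \<phi> (\<theta> a)"
proof -
 assume a: "a \<in>. A"
 have "ct \<theta> (\<phi> \<one>\<^sub>A \<otimes>\<^sub>Om dOm (\<phi> a)) = \<phi> (\<one>\<^sub>A \<otimes>\<^sub>A \<theta> a)" using contr_props a one_closed by blast
 then show ?thesis using a lin_closed[OF DerD(1)[OF \<theta>]] by (simp add: d_fn fn_simps dfn_simps)
qed

lemmas contr_simps = lin_simps[OF contr_linear] lin_mod_simps[OF contr_linear Om_module Om_module]

lemma contr_sgm: "x \<in>. Om ==> ct \<theta> (\<sigma> x) = \<ominus>\<^sub>Om \<sigma> (ct \<theta> x)"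
 by (rule odd_derivation_sgm[OF Omega.bimodule_self contr_linear Om.sgm_linear])
   (simp_all add: contr_mult Om.sgm_mult contr_fn contr_dfn Om.sgm_inl Om.sgm_simps lin_closed[OF DerD(1)[OF \<theta>]])

end


subsection \<open>Contractions with double derivations\<close>

abbreviation "W \<equiv> tsq K Om {}"
abbreviation "\<tau> \<equiv> tmap K Om {} Om {} \<sigma>"
abbreviation "\<phi>2 \<equiv> tmap K A {} Om {} \<phi>"

lemma W_bimodule: "bimodule K Om W (lact K Om {}) (ract K Om {})"
 by (rule O2.tsq_bimodule)

sublocale W: bimodule K Om W "lact K Om {}" "ract K Om {}"
 by (rule W_bimodule)

lemma sgm2_linear: "linear_map K W W \<tau>"
 and sgm2_tens: "x \<in>. Om ==> y \<in>. Om ==> \<tau> (tens K Om {} x y) = tens K Om {} (\<sigma> x) (\<sigma> y)"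
 by (rule O2.tmap_linear[OF O2.tensor_square_axioms Om.sgm_linear], simp,
   rule O2.tmap_tens[OF O2.tensor_square_axioms Om.sgm_linear], simp_all)

lemma fn2_linear: "linear_map K (tsq K A {}) W \<phi>2"
 and fn2_tens: "x \<in>. A ==> y \<in>. A ==> \<phi>2 (tens K A {} x y) = tens K Om {} (\<phi> x) (\<phi> y)"
 by (rule A2.tmap_linear[OF O2.tensor_square_axioms fn_linear], simp,
   rule A2.tmap_tens[OF O2.tensor_square_axioms fn_linear], simp_all)

lemma sgm2_lact:
 assumes "x \<in>. Om" "t \<in>. W" shows "\<tau> (lact K Om {} x t) = lact K Om {} (\<sigma> x) (\<tau> t)"
 by (rule O2.tsq_ext[OF lin_comp[OF O2.lact_linear[OF assms(1)] sgm2_linear]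
    lin_comp[OF sgm2_linear O2.lact_linear] W.M.module_axioms _ assms(2)])
   (use assms in \<open>simp_all add: O2.lact_tens sgm2_tens Om.sgm_simps Om.sgm_mult\<close>)

lemma sgm2_ract:
 assumes "x \<in>. Om" "t \<in>. W" shows "\<tau> (ract K Om {} t x) = ract K Om {} (\<tau> t) (\<sigma> x)"
 by (rule O2.tsq_ext[OF lin_comp[OF O2.ract_linear[OF assms(1)] sgm2_linear]
    lin_comp[OF sgm2_linear O2.ract_linear] W.M.module_axioms _ assms(2)])
   (use assms in \<open>simp_all add: O2.ract_tens sgm2_tens Om.sgm_simps Om.sgm_mult\<close>)

lemma fn2_lact:
 assumes "x \<in>. A" "t \<in>. tsq K A {}" shows "\<phi>2 (lact K A {} x t) = lact K Om {} (\<phi> x) (\<phi>2 t)"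
 by (rule A2.tsq_ext[OF lin_comp[OF A2.lact_linear[OF assms(1)] fn2_linear]
    lin_comp[OF fn2_linear O2.lact_linear] W.M.module_axioms _ assms(2)])
   (use assms in \<open>simp_all add: O2.lact_tens A2.lact_tens fn2_tens fn_simps\<close>)

lemma fn2_ract:
 assumes "x \<in>. A" "t \<in>. tsq K A {}" shows "\<phi>2 (ract K A {} t x) = ract K Om {} (\<phi>2 t) (\<phi> x)"
 by (rule A2.tsq_ext[OF lin_comp[OF A2.ract_linear[OF assms(1)] fn2_linear]
    lin_comp[OF fn2_linear O2.ract_linear] W.M.module_axioms _ assms(2)])
   (use assms in \<open>simp_all add: O2.ract_tens A2.ract_tens fn2_tens fn_simps\<close>)

lemma sgm2_fn2: "t \<in>. tsq K A {} ==> \<tau> (\<phi>2 t) = \<phi>2 t"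
 by (rule A2.tsq_ext[OF lin_comp[OF fn2_linear sgm2_linear] fn2_linear W.M.module_axioms])
   (simp_all add: fn2_tens sgm2_tens fn_simps Om.sgm_inl)

definition W_deg where
 "W_deg n = lin_span K W {tens K Om {} x y | x y k m. k + m = n \<and> x \<in> Omd k \<and> y \<in> Omd m}"

lemma W_deg_gens: "{tens K Om {} x y | x y k m. k + m = n \<and> x \<in> Omd k \<and> y \<in> Omd m} \<subseteq> carrier W"
 by (auto dest!: Om.Tdeg_closed)

lemma W_deg_submodule: "submodule (W_deg n) K W"
 unfolding W_deg_def by (rule lin_span_submodule[OF W.M.module_axioms W_deg_gens])

lemma W_deg_ract:
 assumes "t \<in> W_deg k" "x \<in> Omd j" shows "ract K Om {} t x \<in> W_deg (k + j)"
proof (rule lin_span_map_into[OF O2.ract_linear W.M.module_axioms W.M.module_axioms W_deg_gens W_deg_submodule _ assms(1)[unfolded W_deg_def]])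
 fix h assume "h \<in> {tens K Om {} x y | x y k' m. k' + m = k \<and> x \<in> Omd k' \<and> y \<in> Omd m}"
 then obtain p q a b where h: "h = tens K Om {} p q" "a + b = k" "p \<in> Omd a" "q \<in> Omd b" by blast
 have "a + (b + j) = k + j" using h(2) by simp
 moreover have "ract K Om {} h x = tens K Om {} p (q \<otimes>\<^sub>Om x)"
  using h assms(2) Om.Tdeg_closed by (simp add: O2.ract_tens)
 ultimately show "ract K Om {} h x \<in> W_deg (k + j)"
  unfolding W_deg_def using h(3) Om.Tdeg_mult[OF h(4) assms(2)] by (intro lin_span_base) blast
qed (use assms Om.Tdeg_closed in auto)

lemma W_deg_lact:
 assumes "t \<in> W_deg k" "x \<in> Omd j" shows "lact K Om {} x t \<in> W_deg (j + k)"
proof (rule lin_span_map_into[OF O2.lact_linear W.M.module_axioms W.M.module_axioms W_deg_gens W_deg_submodule _ assms(1)[unfolded W_deg_def]])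
 fix h assume "h \<in> {tens K Om {} x y | x y k' m. k' + m = k \<and> x \<in> Omd k' \<and> y \<in> Omd m}"
 then obtain p q a b where h: "h = tens K Om {} p q" "a + b = k" "p \<in> Omd a" "q \<in> Omd b" by blast
 have "(j + a) + b = j + k" using h(2) by simp
 moreover have "lact K Om {} x h = tens K Om {} (x \<otimes>\<^sub>Om p) q"
  using h assms(2) Om.Tdeg_closed by (simp add: O2.lact_tens)
 ultimately show "lact K Om {} x h \<in> W_deg (j + k)"
  unfolding W_deg_def using h(4) Om.Tdeg_mult[OF assms(2) h(3)] by (intro lin_span_base) blast
qed (use assms Om.Tdeg_closed in auto)

lemma fn2_deg: "t \<in>. tsq K A {} ==> \<phi>2 t \<in> W_deg 0"
proof (rule A2.tsq_into[OF fn2_linear W.M.module_axioms W_deg_submodule])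
 fix x y assume "x \<in>. A" "y \<in>. A"
 then show "\<phi>2 (tens K A {} x y) \<in> W_deg 0"
  unfolding W_deg_def by (intro lin_span_base) (use fn_deg in \<open>auto simp: fn2_tens\<close>)
qed

lemma DDerD:
 assumes "\<Theta> \<in>. DD"
 shows "linear_map K A (tsq K A {}) \<Theta>"
  "\<And>a b. a \<in>. A ==> b \<in>. A ==> \<Theta> (a \<otimes>\<^sub>A b) = ract K A {} (\<Theta> a) b \<oplus>\<^bsub>tsq K A {}\<^esub> lact K A {} a (\<Theta> b)"
  "\<And>s. s \<in> S ==> \<Theta> s = \<zero>\<^bsub>tsq K A {}\<^esub>" "\<Theta> \<in> extensional (carrier A)"
 using assms by (auto simp: DDer_def Let_def)

text \<open>As for ordinary contractions, now with values in the outer bimodule of tensors of forms.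
  The condition \<open>Em\<close> is the Leibniz rule of \<Theta> carried over by
  \<open>\<phi>2\<close>.\<close>

lemma dbl_contr_ex1:
 assumes \<Theta>: "\<Theta> \<in>. DD"
 shows "\<exists>!D. D \<in> extensional (carrier Om) \<and> linear_map K Om W D \<and>
   (\<forall>x\<in>Omd 0. D x = \<zero>\<^sub>W) \<and> (\<forall>n. D ` Omd (Suc n) \<subseteq> W_deg n) \<and>
   odd_leibniz K A S W (lact K Om {}) (ract K Om {}) D \<and>
   (\<forall>u\<in>carrier A. \<forall>v\<in>carrier A. D (\<phi> u \<otimes>\<^sub>Om dOm (\<phi> v)) = lact K Om {} (\<phi> u) (\<phi>2 (\<Theta> v)))"
  (is "\<exists>!D. ?P D")
proof -
 note N = W_bimodule
 note \<Theta>D = DDerD[OF \<Theta>]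
 note [simp] = fn_simps(1) dfn_simps(1) lin_closed[OF \<Theta>D(1)] lin_closed[OF fn2_linear]
 interpret TA: bimodule K A "tsq K A {}" "lact K A {}" "ract K A {}" by (rule A2.tsq_bimodule)
 obtain D where D: "linear_map K Om W D"
  "\<And>x y. x \<in>. Om ==> y \<in>. Om ==> D (x \<otimes>\<^sub>Om y) = ract K Om {} (D x) y \<oplus>\<^sub>W lact K Om {} (\<sigma> x) (D y)"
  "\<And>a. a \<in>. A ==> D (\<phi> a) = \<zero>\<^sub>W" "\<And>a. a \<in>. A ==> D (\<delta> a) = \<phi>2 (\<Theta> a)"
 proof -
  have "\<exists>D. linear_map K Om W D \<and>
   (\<forall>x\<in>carrier Om. \<forall>y\<in>carrier Om. D (x \<otimes>\<^sub>Om y) = ract K Om {} (D x) y \<oplus>\<^sub>W lact K Om {} (\<sigma> x) (D y)) \<and>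
   (\<forall>a\<in>carrier A. D (\<phi> a) = \<zero>\<^sub>W) \<and> (\<forall>a\<in>carrier A. D (\<delta> a) = \<phi>2 (\<Theta> a))"
   by (rule odd_derivation_ex[OF N lin_const_zero[OF W.M.module_axioms] lin_comp[OF \<Theta>D(1) fn2_linear]])
     (simp_all add: \<Theta>D(2,3) lin_simps(2)[OF fn2_linear] fn2_lact fn2_ract W.r1m W.l2m TA.lr_closed W.lr_closed
      a_minus_def lin_zero[OF fn2_linear A2.tsq_module W.M.module_axioms] W.M.a_inv_zero)
  then show ?thesis using that by blast
 qed
 have deg: "D x \<in> pred_deg W W_deg n" if "x \<in> Omd n" for x n
  by (rule contraction_deg[OF N D(1) _ W_deg_submodule _ _ _ _ that])
    (simp_all add: D(2-4) fn2_deg W_deg_ract W_deg_lact)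
 let ?D = "restrict D (carrier Om)"
 have lin: "linear_map K Om W ?D" by (rule lin_restrict[OF D(1) Om_module])
 have leib: "odd_leibniz K A S W (lact K Om {}) (ract K Om {}) ?D"
  by (simp add: odd_leibniz_iff[OF N lin] D(2) Om.sgm_simps)
 show ?thesis
 proof (rule ex1I[of ?P ?D])
  have deg0: "?D x = \<zero>\<^sub>W" if "x \<in> Omd 0" for x
   using deg[OF that] Om.Tdeg_closed[OF that] by (simp add: pred_deg_def)
  have degS: "?D x \<in> W_deg n" if "x \<in> Omd (Suc n)" for x n
   using deg[OF that] Om.Tdeg_closed[OF that] by (simp add: pred_deg_def)
  have val: "?D (\<phi> u \<otimes>\<^sub>Om dOm (\<phi> v)) = lact K Om {} (\<phi> u) (\<phi>2 (\<Theta> v))" if "u \<in>. A" "v \<in>. A" for u v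
   using that by (simp add: d_fn D(2-4) Om.sgm_inl W.r1m W.lr_closed)
  show "?P ?D" using lin leib deg0 degS val by blast
  fix D' assume D': "?P D'"
  have lin': "linear_map K Om W D'" using D' by blast
  have D'm: "D' (x \<otimes>\<^sub>Om y) = ract K Om {} (D' x) y \<oplus>\<^sub>W lact K Om {} (\<sigma> x) (D' y)"
   if "x \<in>. Om" "y \<in>. Om" for x y
   using D' odd_leibniz_iff[OF N lin'] that by blast
  have D'd: "D' (\<delta> a) = \<phi>2 (\<Theta> a)" if a: "a \<in>. A" for a
  proof -
   have "D' (\<phi> \<one>\<^sub>A \<otimes>\<^sub>Om dOm (\<phi> a)) = lact K Om {} (\<phi> \<one>\<^sub>A) (\<phi>2 (\<Theta> a))" using D' a one_closed by blast
   then show ?thesis using a by (simp add: d_fn fn_simps W.l_one)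
  qed
  have D'f: "D' (\<phi> a) = \<zero>\<^sub>W" if "a \<in>. A" for a using D' fn_deg[OF that] by blast
  show "D' = ?D"
  proof (rule extensionalityI[of _ "carrier Om"])
   fix x assume x: "x \<in>. Om"
   have "D' x = D x"
    by (rule odd_derivation_unique[where N = W and rN = "ract K Om {}" and lN = "lact K Om {}" and \<tau> = \<sigma>, OF lin' D(1) _ _ _ _ x])
      (simp_all add: D(2-4) D'm D'f D'd)
   then show "D' x = ?D x" using x by simp
  qed (use D' in blast)+
 qed
qed

abbreviation "dct \<equiv> dbl_contr K A S"

context
 fixes \<Theta> assumes \<Theta>: "\<Theta> \<in>. DD"
begin

lemmas dbl_contr_props = theI'[OF dbl_contr_ex1[OF \<Theta>], unfolded W_deg_def, folded dbl_contr_def[unfolded Let_def]]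

lemma dbl_contr_linear: "linear_map K Om W (dct \<Theta>)"
 using dbl_contr_props by blast

lemma dbl_contr_deg_0: "x \<in> Omd 0 ==> dct \<Theta> x = \<zero>\<^sub>W"
 using dbl_contr_props by blast

lemma dbl_contr_mult:
 "x \<in>. Om ==> y \<in>. Om ==> dct \<Theta> (x \<otimes>\<^sub>Om y) = ract K Om {} (dct \<Theta> x) y \<oplus>\<^sub>W lact K Om {} (\<sigma> x) (dct \<Theta> y)"
 using dbl_contr_props odd_leibniz_iff[OF W_bimodule dbl_contr_linear] by blast

lemma dbl_contr_fn: "a \<in>. A ==> dct \<Theta> (\<phi> a) = \<zero>\<^sub>W"
 by (rule dbl_contr_deg_0[OF fn_deg])

lemma dbl_contr_dfn: "a \<in>. A ==> dct \<Theta> (\<delta> a) = \<phi>2 (\<Theta> a)"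
proof -
 assume a: "a \<in>. A"
 have "dct \<Theta> (\<phi> \<one>\<^sub>A \<otimes>\<^sub>Om dOm (\<phi> a)) = lact K Om {} (\<phi> \<one>\<^sub>A) (\<phi>2 (\<Theta> a))"
  using dbl_contr_props a one_closed by blast
 then show ?thesis using a lin_closed[OF DDerD(1)[OF \<Theta>]] lin_closed[OF fn2_linear]
  by (simp add: d_fn fn_simps dfn_simps W.l_one)
qed

lemmas dbl_contr_simps = lin_simps[OF dbl_contr_linear] lin_mod_simps[OF dbl_contr_linear Om_module W.M.module_axioms]

lemma dbl_contr_sgm: "x \<in>. Om ==> dct \<Theta> (\<sigma> x) = \<ominus>\<^sub>W \<tau> (dct \<Theta> x)"
 by (rule odd_derivation_sgm[OF W_bimodule dbl_contr_linear sgm2_linear])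
   (simp_all add: dbl_contr_mult sgm2_lact sgm2_ract dbl_contr_fn dbl_contr_dfn lin_closed[OF DDerD(1)[OF \<Theta>]] sgm2_fn2
    lin_zero[OF sgm2_linear W.M.module_axioms W.M.module_axioms] W.M.a_inv_zero)

end

end



section \<open>The Karoubi-de Rham quotient\<close>

text \<open>One half splits a form into parts on which the grading involution is plus or minus the
  identity. Signs that depend on two degrees can then be written by linear operators.\<close>

locale ncf = nc K A S for K :: "'k ring" and A :: "('k, 'a) module" and S +
 assumes half: "\<exists>h\<in>carrier K. h \<oplus>\<^sub>K h = \<one>\<^sub>K"
begin

definition "hf = (SOME h. h \<in>. K \<and> h \<oplus>\<^sub>K h = \<one>\<^sub>K)"

lemma hf [simp]: "hf \<in>. K" "hf \<oplus>\<^sub>K hf = \<one>\<^sub>K"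
 using someI_ex[of "\<lambda>h. h \<in>. K \<and> h \<oplus>\<^sub>K h = \<one>\<^sub>K"] half unfolding hf_def by blast+

lemma hf_double: "x \<in>. Om ==> hf \<odot>\<^sub>Om (x \<oplus>\<^sub>Om x) = x"
 using Omega.smult_l_distr[of hf hf x] by (simp add: Omega.smult_r_distr)

definition "evp x = hf \<odot>\<^sub>Om (x \<oplus>\<^sub>Om \<sigma> x)"
definition "odp x = hf \<odot>\<^sub>Om (x \<ominus>\<^sub>Om \<sigma> x)"

lemma evp_linear: "linear_map K Om Om evp"
 unfolding evp_def[abs_def] by (intro lin_scale lin_plus lin_id Om.sgm_linear Om_module) simp

lemma odp_linear: "linear_map K Om Om odp"
 unfolding odp_def[abs_def] by (intro lin_scale lin_diff lin_id Om.sgm_linear Om_module) simp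

lemmas evp_simps = lin_simps[OF evp_linear] lin_mod_simps[OF evp_linear Om_module Om_module]
lemmas odp_simps = lin_simps[OF odp_linear] lin_mod_simps[OF odp_linear Om_module Om_module]

lemma evp_odp: "x \<in>. Om ==> evp x \<oplus>\<^sub>Om odp x = x"
proof -
 assume x: "x \<in>. Om"
 have s: "\<sigma> x \<in>. Om" using x by (simp add: Om.sgm_simps)
 have "(x \<oplus>\<^sub>Om \<sigma> x) \<oplus>\<^sub>Om (x \<ominus>\<^sub>Om \<sigma> x) = x \<oplus>\<^sub>Om x" using x s by algebra
 then show ?thesis using x s hf_double[OF x]
  unfolding evp_def odp_def by (simp add: Omega.smult_r_distr[symmetric])
qed

lemma evp_even: "x \<in>. Om ==> \<sigma> x = x ==> evp x = x"
 and odp_even: "x \<in>. Om ==> \<sigma> x = x ==> odp x = \<zero>\<^sub>Om"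
 and evp_odd: "x \<in>. Om ==> \<sigma> x = \<ominus>\<^sub>Om x ==> evp x = \<zero>\<^sub>Om"
 and odp_odd: "x \<in>. Om ==> \<sigma> x = \<ominus>\<^sub>Om x ==> odp x = x"
 by (simp_all add: evp_def odp_def hf_double Omega.r_neg a_minus_def)

lemma sgm_evp: "x \<in>. Om ==> \<sigma> (evp x) = evp x"
 by (simp add: evp_def Om.sgm_simps Om.sgm_sgm Omega.a_comm)

lemma sgm_odp: "x \<in>. Om ==> \<sigma> (odp x) = \<ominus>\<^sub>Om odp x"
 by (simp add: odp_def Om.sgm_simps Om.sgm_sgm a_minus_def Omega.a_comm Omega.minus_add
   Omega.smult_r_minus[symmetric])

lemma evp_sgm: "x \<in>. Om ==> evp (\<sigma> x) = evp x"
 by (simp add: evp_def Om.sgm_simps Om.sgm_sgm Omega.a_comm)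

lemma odp_sgm: "x \<in>. Om ==> odp (\<sigma> x) = \<ominus>\<^sub>Om odp x"
 by (simp add: odp_def Om.sgm_simps Om.sgm_sgm a_minus_def Omega.a_comm Omega.minus_add
   Omega.smult_r_minus[symmetric])

lemma evp_minus_odp: "x \<in>. Om ==> evp x \<ominus>\<^sub>Om odp x = \<sigma> x"
 using evp_odp[of "\<sigma> x"] by (simp add: evp_sgm odp_sgm Om.sgm_simps a_minus_def)

lemma evp_mult_even:
 assumes "a \<in>. Om" "b \<in>. Om" "\<sigma> a = a"
 shows "evp (a \<otimes>\<^sub>Om b) = a \<otimes>\<^sub>Om evp b" "odp (a \<otimes>\<^sub>Om b) = a \<otimes>\<^sub>Om odp b"
  "evp (b \<otimes>\<^sub>Om a) = evp b \<otimes>\<^sub>Om a" "odp (b \<otimes>\<^sub>Om a) = odp b \<otimes>\<^sub>Om a"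
 using assms
 by (simp_all add: evp_def odp_def Om.sgm_simps Om.sgm_mult Omega.smult_mult_right Omega.smult_mult_left
   Omega.r_distr Omega.l_distr a_minus_def Omega.r_minus Omega.l_minus)

lemma evp_mult_odd:
 assumes "a \<in>. Om" "b \<in>. Om" "\<sigma> a = \<ominus>\<^sub>Om a"
 shows "evp (a \<otimes>\<^sub>Om b) = a \<otimes>\<^sub>Om odp b" "odp (a \<otimes>\<^sub>Om b) = a \<otimes>\<^sub>Om evp b"
 using assms
 by (simp_all add: evp_def odp_def Om.sgm_simps Om.sgm_mult Omega.smult_mult_right
   Omega.r_distr a_minus_def Omega.r_minus Omega.l_minus)

text \<open>The signed product y x without reference to degrees: the even part of \<open>x\<close>
  passes \<open>y\<close> freely, the odd part turns \<open>y\<close> into \<sigma>(y).\<close>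

definition "sw x y = y \<otimes>\<^sub>Om evp x \<oplus>\<^sub>Om \<sigma> y \<otimes>\<^sub>Om odp x"

lemma sw_bilinear: "bilinear K Om Om Om sw"
 unfolding sw_def[abs_def]
 by (intro bilinear_plus Om_module bilinear_swap[OF bilinear_comp2[OF Omega.bilinear_mult lin_id evp_linear]]
   bilinear_swap[OF bilinear_comp2[OF Omega.bilinear_mult Om.sgm_linear odp_linear]])

lemma sw_deg:
 assumes x: "x \<in> Omd k" and y: "y \<in> Omd m"
 shows "sw x y = signed Om (k * m) (y \<otimes>\<^sub>Om x)"
proof -
 note c = Om.Tdeg_closed[OF x] Om.Tdeg_closed[OF y]
 show ?thesis
 proof (cases "even k")
  case True
  then have "\<sigma> x = x" using Om.sgm_deg[OF x] by (simp add: signed_def)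
  then show ?thesis using True c by (simp add: sw_def evp_even odp_even signed_def Om.sgm_simps)
 next
  case False
  then have "\<sigma> x = \<ominus>\<^sub>Om x" using Om.sgm_deg[OF x] by (simp add: signed_def)
  then show ?thesis using False c Om.sgm_deg[OF y]
   by (simp add: sw_def evp_odd odp_odd signed_def Om.sgm_simps Omega.l_minus)
 qed
qed

abbreviation "dia \<equiv> diamond K A S"
abbreviation "\<mu> \<equiv> tmul K Om {}"

text \<open>\<open>diamond\<close> is specified on homogeneous tensors only. The bilinear map
  \<open>sw\<close> supplies the extension, and homogeneous forms span, so nothing else is
  possible.\<close>

lemma diamond_props:
 shows diamond_linear: "linear_map K W Om dia"
  and diamond_tens: "x \<in>. Om ==> y \<in>. Om ==> dia (tens K Om {} x y) = sw x y"
proof -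
 let ?P = "\<lambda>g. g \<in> extensional (carrier W) \<and> linear_map K W Om g \<and>
   (\<forall>k m. \<forall>x\<in>Omd k. \<forall>y\<in>Omd m. g (tens K Om {} x y) = signed Om (k * m) (y \<otimes>\<^sub>Om x))"
 let ?g = "tlift K Om {} Om sw"
 have gl: "linear_map K W Om ?g" by (rule O2.tlift_linear[OF Om_module sw_bilinear]) simp
 have gt: "?g (tens K Om {} x y) = sw x y" if "x \<in>. Om" "y \<in>. Om" for x y
  by (rule O2.tlift_tens[OF Om_module sw_bilinear _ that]) simp
 have ex: "?P (restrict ?g (carrier W))"
  using lin_restrict[OF gl W.M.module_axioms] by (auto simp: gt sw_deg Om.Tdeg_closed)
 have val: "h (tens K Om {} x y) = sw x y" if "?P h" and xy: "x \<in>. Om" "y \<in>. Om" for h x y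
 proof -
  have hl: "linear_map K W Om h" using that(1) by blast
  show ?thesis
  proof (rule bilinear_span_eq[OF bilinear_comp[OF O2.tens_bilinear hl] sw_bilinear Om_module Om_module Om_module
     _ _ _ Om.Tdeg_span[OF xy(1)] Om.Tdeg_span[OF xy(2)]])
   fix p q assume "p \<in> (\<Union>n. Omd n)" "q \<in> (\<Union>n. Omd n)"
   then obtain n m where nm: "p \<in> Omd n" "q \<in> Omd m" by blast
   then have "h (tens K Om {} p q) = signed Om (n * m) (q \<otimes>\<^sub>Om p)" using that(1) by blast
   then show "h (tens K Om {} p q) = sw p q" by (simp only: sw_deg[OF nm])
  qed (auto simp: Om.Tdeg_closed)
 qed
 have uniq: "h = restrict ?g (carrier W)" if h: "?P h" for h
 proof (rule extensionalityI[of _ "carrier W"])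
  fix t assume t: "t \<in>. W"
  have "h t = ?g t"
   by (rule O2.tsq_ext[OF _ gl Om_module _ t]) (use h in blast, simp only: val[OF h] gt)
  then show "h t = restrict ?g (carrier W) t" using t by simp
 qed (use h in auto)
 have P: "?P dia"
  unfolding diamond_def Let_def by (rule theI[of ?P, OF ex uniq])
 then show "linear_map K W Om dia" by blast
 show "x \<in>. Om ==> y \<in>. Om ==> dia (tens K Om {} x y) = sw x y" by (rule val[OF P])
qed

lemmas diamond_simps = lin_simps[OF diamond_linear] lin_mod_simps[OF diamond_linear W.M.module_axioms Om_module]
lemmas tmul_simps = lin_simps[OF O2.tmul_linear] lin_mod_simps[OF O2.tmul_linear W.M.module_axioms Om_module]

text \<open>On a pure tensor this is the super commutator of the two factors. Its image is the whole
  of \<open>SC\<close>, so a sum of super commutators can be handled as \<kappa> of a single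
  tensor.\<close>

definition "\<kappa> t = \<mu> t \<ominus>\<^sub>Om dia t"

lemma \<kappa>_linear: "linear_map K W Om \<kappa>"
 unfolding \<kappa>_def[abs_def] by (intro lin_diff O2.tmul_linear diamond_linear Om_module)

abbreviation "SC \<equiv> super_comm K A S"

lemma super_comm_gens:
 "{(x \<otimes>\<^sub>Om y) \<ominus>\<^sub>Om signed Om (k * m) (y \<otimes>\<^sub>Om x) | x y k m. x \<in> Omd k \<and> y \<in> Omd m} \<subseteq> carrier Om"
 by (auto dest!: Om.Tdeg_closed intro!: Omega.minus_closed lin_closed[OF signed_linear[OF Om_module]])

lemma super_comm_submodule: "submodule SC K Om"
 unfolding super_comm_def by (rule lin_span_submodule[OF Om_module super_comm_gens])

lemma \<kappa>_tens: "x \<in>. Om ==> y \<in>. Om ==> \<kappa> (tens K Om {} x y) = x \<otimes>\<^sub>Om y \<ominus>\<^sub>Om sw x y"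
 by (simp add: \<kappa>_def O2.tmul_tens diamond_tens)

lemma super_comm_eq: "SC = \<kappa> ` carrier W"
proof
 have sub: "submodule (\<kappa> ` carrier W) K Om"
  by (rule lin_image_submodule[OF \<kappa>_linear W.M.module_axioms Om_module W.M.carrier_is_submodule])
 show "SC \<subseteq> \<kappa> ` carrier W"
  unfolding super_comm_def
 proof (rule lin_span_least[OF sub])
  show "{(x \<otimes>\<^sub>Om y) \<ominus>\<^sub>Om signed Om (k * m) (y \<otimes>\<^sub>Om x) | x y k m. x \<in> Omd k \<and> y \<in> Omd m} \<subseteq> \<kappa> ` carrier W"
  proof
   fix z assume "z \<in> {(x \<otimes>\<^sub>Om y) \<ominus>\<^sub>Om signed Om (k * m) (y \<otimes>\<^sub>Om x) | x y k m. x \<in> Omd k \<and> y \<in> Omd m}"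
   then obtain x y k m where z: "z = (x \<otimes>\<^sub>Om y) \<ominus>\<^sub>Om signed Om (k * m) (y \<otimes>\<^sub>Om x)" "x \<in> Omd k" "y \<in> Omd m" by blast
   then have "z = \<kappa> (tens K Om {} x y)" "tens K Om {} x y \<in>. W"
    using Om.Tdeg_closed by (simp_all add: \<kappa>_tens sw_deg)
   then show "z \<in> \<kappa> ` carrier W" by (rule image_eqI)
  qed
 qed
 show "\<kappa> ` carrier W \<subseteq> SC"
 proof (rule image_subsetI, rule O2.tsq_into[OF \<kappa>_linear Om_module super_comm_submodule])
  fix x y assume xy: "x \<in>. Om" "y \<in>. Om"
  show "\<kappa> (tens K Om {} x y) \<in> SC"
   unfolding \<kappa>_tens[OF xy]
  proof (rule bilinear_span_into[OF bilinear_diff[OF Omega.bilinear_mult sw_bilinear Om_module] Om_module Om_module Om_module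
     super_comm_submodule _ _ _ Om.Tdeg_span[OF xy(1)] Om.Tdeg_span[OF xy(2)]])
   fix p q assume "p \<in> (\<Union>n. Omd n)" "q \<in> (\<Union>n. Omd n)"
   then obtain n m where nm: "p \<in> Omd n" "q \<in> Omd m" by blast
   show "p \<otimes>\<^sub>Om q \<ominus>\<^sub>Om sw p q \<in> SC"
    unfolding sw_deg[OF nm] super_comm_def using nm by (intro lin_span_base) blast
  qed (auto simp: Om.Tdeg_closed)
 qed
qed

lemma super_comm_closed: "x \<in> SC ==> x \<in>. Om"
 using Omega.submoduleE(1)[OF super_comm_submodule] by auto

lemma \<kappa>_in: "t \<in>. W ==> \<kappa> t \<in> SC"
 by (simp add: super_comm_eq)


subsection \<open>Odd derivations and supercommutators\<close>

definition "odd_der D \<longleftrightarrow> linear_map K Om Om D \<and>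
 (\<forall>x\<in>carrier Om. \<forall>y\<in>carrier Om. D (x \<otimes>\<^sub>Om y) = D x \<otimes>\<^sub>Om y \<oplus>\<^sub>Om \<sigma> x \<otimes>\<^sub>Om D y) \<and>
 (\<forall>x\<in>carrier Om. D (\<sigma> x) = \<ominus>\<^sub>Om \<sigma> (D x))"

lemma odd_der_d: "odd_der dOm"
 by (simp add: odd_der_def d_linear d_mult d_sgm)

lemma odd_der_contr: "\<theta> \<in>. Dr ==> odd_der (ct \<theta>)"
 by (simp add: odd_der_def contr_linear contr_mult contr_sgm)

text \<open>The action of an odd derivation on a tensor product, with the usual sign for passing the
  first factor. It is compatible with the product map and with \<open>diamond\<close>, hence
  \<open>D\<close> preserves super commutators.\<close>

definition "ext2 D = tlift K Om {} W (\<lambda>x y. tens K Om {} (D x) y \<oplus>\<^sub>W tens K Om {} (\<sigma> x) (D y))"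

context
 fixes D assumes D: "odd_der D"
begin

lemma odd_der_linear: "linear_map K Om Om D"
 and odd_der_mult: "x \<in>. Om ==> y \<in>. Om ==> D (x \<otimes>\<^sub>Om y) = D x \<otimes>\<^sub>Om y \<oplus>\<^sub>Om \<sigma> x \<otimes>\<^sub>Om D y"
 and odd_der_sgm: "x \<in>. Om ==> D (\<sigma> x) = \<ominus>\<^sub>Om \<sigma> (D x)"
 using D by (auto simp: odd_der_def)

lemmas odd_der_simps = lin_simps[OF odd_der_linear] lin_mod_simps[OF odd_der_linear Om_module Om_module]

lemma ext2_bilinear: "bilinear K Om Om W (\<lambda>x y. tens K Om {} (D x) y \<oplus>\<^sub>W tens K Om {} (\<sigma> x) (D y))"
 by (intro bilinear_plus W.M.module_axioms bilinear_comp2[OF O2.tens_bilinear] odd_der_linear Om.sgm_linear lin_id)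

lemma ext2_linear: "linear_map K W W (ext2 D)"
 unfolding ext2_def by (rule O2.tlift_linear[OF W.M.module_axioms ext2_bilinear]) simp

lemma ext2_tens: "x \<in>. Om ==> y \<in>. Om ==>
  ext2 D (tens K Om {} x y) = tens K Om {} (D x) y \<oplus>\<^sub>W tens K Om {} (\<sigma> x) (D y)"
 unfolding ext2_def by (rule O2.tlift_tens[OF W.M.module_axioms ext2_bilinear]) simp

lemma odd_der_evp: "x \<in>. Om ==> evp (D x) = D (odp x)"
 and odd_der_odp: "x \<in>. Om ==> odp (D x) = D (evp x)"
 by (simp_all add: evp_def odp_def odd_der_simps Om.sgm_simps odd_der_sgm a_minus_def)

lemma tmul_ext2: "t \<in>. W ==> \<mu> (ext2 D t) = D (\<mu> t)"
 by (rule O2.tsq_ext[OF lin_comp[OF ext2_linear O2.tmul_linear] lin_comp[OF O2.tmul_linear odd_der_linear] Om_module])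
   (simp_all add: ext2_tens tmul_simps O2.tmul_tens odd_der_mult odd_der_simps Om.sgm_simps)

lemma diamond_ext2: "t \<in>. W ==> dia (ext2 D t) = D (dia t)"
proof (rule O2.tsq_ext[OF lin_comp[OF ext2_linear diamond_linear] lin_comp[OF diamond_linear odd_der_linear] Om_module])
 fix x y assume [simp]: "x \<in>. Om" "y \<in>. Om"
 note [simp] = odd_der_simps evp_simps odp_simps Om.sgm_simps
 show "dia (ext2 D (tens K Om {} x y)) = D (dia (tens K Om {} x y))"
  by (simp add: ext2_tens diamond_simps diamond_tens sw_def odd_der_evp odd_der_odp odd_der_mult odd_der_sgm
    evp_sgm odp_sgm Om.sgm_sgm Omega.l_minus Omega.r_minus Omega.a_ac)
qed

lemma odd_der_super_comm: "x \<in> SC ==> D x \<in> SC"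
proof -
 assume "x \<in> SC"
 then obtain t where t: "t \<in>. W" "x = \<kappa> t" unfolding super_comm_eq by blast
 then have "D x = \<kappa> (ext2 D t)"
  by (simp add: \<kappa>_def odd_der_simps tmul_simps diamond_simps tmul_ext2 diamond_ext2)
 then show ?thesis using \<kappa>_in[OF lin_closed[OF ext2_linear t(1)]] by simp
qed

lemma ext2_lact:
 assumes x: "x \<in>. Om" and t: "t \<in>. W"
 shows "ext2 D (lact K Om {} x t) = lact K Om {} (D x) t \<oplus>\<^sub>W lact K Om {} (\<sigma> x) (ext2 D t)"
 using x lin_closed[OF odd_der_linear x] Om.sgm_simps(1)[OF x]
 by (intro O2.tsq_ext[OF lin_comp[OF O2.lact_linear ext2_linear] lin_plus[OF O2.lact_linear lin_comp[OF ext2_linear O2.lact_linear] W.M.module_axioms]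
     W.M.module_axioms _ t])
   (simp_all add: O2.lact_tens ext2_tens odd_der_mult odd_der_simps Om.sgm_simps Om.sgm_mult
    lin_add[OF O2.lact_linear] lin_add[OF bilinear1[OF O2.tens_bilinear]] W.M.a_assoc)

lemma ext2_ract:
 assumes x: "x \<in>. Om" and t: "t \<in>. W"
 shows "ext2 D (ract K Om {} t x) = ract K Om {} (ext2 D t) x \<oplus>\<^sub>W ract K Om {} (\<tau> t) (D x)"
 using x lin_closed[OF odd_der_linear x] Om.sgm_simps(1)[OF x]
 by (intro O2.tsq_ext[OF lin_comp[OF O2.ract_linear ext2_linear] lin_plus[OF lin_comp[OF ext2_linear O2.ract_linear] lin_comp[OF sgm2_linear O2.ract_linear] W.M.module_axioms]
     W.M.module_axioms _ t])
   (simp_all add: O2.ract_tens ext2_tens sgm2_tens odd_der_mult odd_der_simps Om.sgm_simps Om.sgm_mult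
    lin_add[OF O2.ract_linear] lin_add[OF bilinear2[OF O2.tens_bilinear]] W.M.a_assoc)

text \<open>The anticommutator of \<open>D\<close> with a double contraction is an even derivation
  into tensors of forms. It equals the prediction \<open>E\<close> as soon as it does so on
  functions and differentials.\<close>

lemma ext2_dbl_contr:
 assumes \<Theta>: "\<Theta> \<in>. DD"
  and 0: "\<And>a. a \<in>. A ==> dct \<Theta> (D (\<phi> a)) = E (\<phi> a)"
  and 1: "\<And>a. a \<in>. A ==> ext2 D (\<phi>2 (\<Theta> a)) \<oplus>\<^sub>W dct \<Theta> (D (\<delta> a)) = E (\<delta> a)"
  and E: "linear_map K Om W E"
  and Em: "\<And>x y. x \<in>. Om ==> y \<in>. Om ==> E (x \<otimes>\<^sub>Om y) = ract K Om {} (E x) y \<oplus>\<^sub>W lact K Om {} x (E y)"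
  and x: "x \<in>. Om"
 shows "ext2 D (dct \<Theta> x) \<oplus>\<^sub>W dct \<Theta> (D x) = E x"
proof (rule odd_derivation_unique[where N = W and rN = "ract K Om {}" and lN = "lact K Om {}" and \<tau> = "\<lambda>x. x", OF _ E _ Em _ _ x])
 show "linear_map K Om W (\<lambda>x. ext2 D (dct \<Theta> x) \<oplus>\<^sub>W dct \<Theta> (D x))"
  by (intro lin_plus lin_comp[OF dbl_contr_linear[OF \<Theta>] ext2_linear] lin_comp[OF odd_der_linear dbl_contr_linear[OF \<Theta>]] W.M.module_axioms)
 show "ext2 D (dct \<Theta> (x \<otimes>\<^sub>Om y)) \<oplus>\<^sub>W dct \<Theta> (D (x \<otimes>\<^sub>Om y)) =
   ract K Om {} (ext2 D (dct \<Theta> x) \<oplus>\<^sub>W dct \<Theta> (D x)) y \<oplus>\<^sub>W lact K Om {} x (ext2 D (dct \<Theta> y) \<oplus>\<^sub>W dct \<Theta> (D y))"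
  if "x \<in>. Om" "y \<in>. Om" for x y
  by (rule supercommutator[OF W_bimodule odd_der_linear dbl_contr_linear[OF \<Theta>] ext2_linear sgm2_linear _ _ _ _ _ _ that])
    (simp_all add: odd_der_mult dbl_contr_mult[OF \<Theta>] ext2_ract ext2_lact odd_der_sgm dbl_contr_sgm[OF \<Theta>])
qed (use 0 1 in \<open>simp_all add: dbl_contr_fn[OF \<Theta>] dbl_contr_dfn[OF \<Theta>] lin_zero[OF ext2_linear W.M.module_axioms W.M.module_axioms]
  dbl_contr_simps[OF \<Theta>] odd_der_simps fn_simps lin_closed[OF E]\<close>)

end

lemma odd_der_supercomm_mult:
 assumes D: "odd_der D" and D': "odd_der D'" and "x \<in>. Om" "y \<in>. Om"
 shows "D (D' (x \<otimes>\<^sub>Om y)) \<oplus>\<^sub>Om D' (D (x \<otimes>\<^sub>Om y)) =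
  (D (D' x) \<oplus>\<^sub>Om D' (D x)) \<otimes>\<^sub>Om y \<oplus>\<^sub>Om x \<otimes>\<^sub>Om (D (D' y) \<oplus>\<^sub>Om D' (D y))"
 by (rule supercommutator[OF Omega.bimodule_self odd_der_linear[OF D] odd_der_linear[OF D'] odd_der_linear[OF D] Om.sgm_linear _ _ _ _ _ _ assms(3,4)])
   (simp_all add: odd_der_mult[OF D] odd_der_mult[OF D'] odd_der_sgm[OF D] odd_der_sgm[OF D'])


subsection \<open>Reduced contractions\<close>

text \<open>\<open>diamond\<close> multiplies the factors in reverse order, so (p \<otimes> q) y and
  y (p \<otimes> q) both become q y p up to sign. For the odd part of \<open>y\<close> the sign is
  carried by \<tau>.\<close>

lemma diamond_ract:
 assumes y: "y \<in>. Om" and t: "t \<in>. W"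
 shows "dia (ract K Om {} t y) = dia (lact K Om {} (evp y) t) \<oplus>\<^sub>Om dia (lact K Om {} (odp y) (\<tau> t))"
proof (rule O2.tsq_ext[OF lin_comp[OF O2.ract_linear diamond_linear] lin_plus[OF lin_comp[OF O2.lact_linear diamond_linear]
   lin_comp[OF sgm2_linear lin_comp[OF O2.lact_linear diamond_linear]] Om_module] Om_module _ t])
 fix p q assume [simp]: "p \<in>. Om" "q \<in>. Om"
 note [simp] = y evp_simps(1) odp_simps(1) Om.sgm_simps(1)
 have e: "evp (evp y \<otimes>\<^sub>Om p) = evp y \<otimes>\<^sub>Om evp p" "odp (evp y \<otimes>\<^sub>Om p) = evp y \<otimes>\<^sub>Om odp p"
  by (simp_all add: evp_mult_even sgm_evp)
 have o: "evp (odp y \<otimes>\<^sub>Om \<sigma> p) = \<ominus>\<^sub>Om (odp y \<otimes>\<^sub>Om odp p)" "odp (odp y \<otimes>\<^sub>Om \<sigma> p) = odp y \<otimes>\<^sub>Om evp p"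
  by (simp_all add: evp_mult_odd sgm_odp odp_sgm evp_sgm Omega.r_minus)
 define u v where uv: "u = evp y" "v = odp y"
 have uvc [simp]: "u \<in>. Om" "v \<in>. Om" by (simp_all add: uv)
 have yy: "y = u \<oplus>\<^sub>Om v" "\<sigma> y = u \<ominus>\<^sub>Om v" unfolding uv by (simp_all add: evp_odp evp_minus_odp)
 have "dia (ract K Om {} (tens K Om {} p q) y) =
   (q \<otimes>\<^sub>Om (u \<oplus>\<^sub>Om v)) \<otimes>\<^sub>Om evp p \<oplus>\<^sub>Om (\<sigma> q \<otimes>\<^sub>Om (u \<ominus>\<^sub>Om v)) \<otimes>\<^sub>Om odp p"
  unfolding yy(1)[symmetric] yy(2)[symmetric] by (simp add: O2.ract_tens diamond_tens sw_def Om.sgm_mult)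
 also have "\<dots> = (q \<otimes>\<^sub>Om (u \<otimes>\<^sub>Om evp p) \<oplus>\<^sub>Om \<sigma> q \<otimes>\<^sub>Om (u \<otimes>\<^sub>Om odp p)) \<oplus>\<^sub>Om
   (\<sigma> q \<otimes>\<^sub>Om (\<ominus>\<^sub>Om (v \<otimes>\<^sub>Om odp p)) \<oplus>\<^sub>Om q \<otimes>\<^sub>Om (v \<otimes>\<^sub>Om evp p))"
  by (simp add: a_minus_def Omega.l_distr Omega.r_distr Omega.m_assoc Omega.l_minus Omega.r_minus Omega.a_ac)
 also have "\<dots> = dia (lact K Om {} (evp y) (tens K Om {} p q)) \<oplus>\<^sub>Om dia (lact K Om {} (odp y) (\<tau> (tens K Om {} p q)))"
  by (simp add: O2.lact_tens sgm2_tens diamond_tens sw_def e o uv Om.sgm_sgm)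
 finally show "dia (ract K Om {} (tens K Om {} p q) y) =
   dia (lact K Om {} (evp y) (tens K Om {} p q)) \<oplus>\<^sub>Om dia (lact K Om {} (odp y) (\<tau> (tens K Om {} p q)))" .
qed (simp_all add: y evp_simps odp_simps)

abbreviation "iota \<equiv> iota_dd K A S"

context
 fixes \<Theta> assumes \<Theta>: "\<Theta> \<in>. DD"
begin

lemma iota_linear: "linear_map K Om Om (iota \<Theta>)"
 unfolding iota_dd_def[abs_def] by (rule lin_comp[OF dbl_contr_linear[OF \<Theta>] diamond_linear])

lemmas iota_simps = lin_simps[OF iota_linear] lin_mod_simps[OF iota_linear Om_module Om_module]

text \<open>Both forms are split by parity. In each of the four products \<open>diamond_ract\<close>
  moves a right factor to the left, after which only expressions \<open>p u v\<close> remain and the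
  two sides agree term by term. This is why the reduced contraction descends to the de Rham
  quotient.\<close>

lemma iota_mult_sw:
 assumes x: "x \<in>. Om" and y: "y \<in>. Om"
 shows "iota \<Theta> (x \<otimes>\<^sub>Om y) = iota \<Theta> (sw x y)"
proof -
 let ?i = "dct \<Theta>"
 define x0 x1 y0 y1 where d: "x0 = evp x" "x1 = odp x" "y0 = evp y" "y1 = odp y"
 have c [simp]: "x0 \<in>. Om" "x1 \<in>. Om" "y0 \<in>. Om" "y1 \<in>. Om"
  using x y by (simp_all add: d evp_simps odp_simps)
 have xs: "x = x0 \<oplus>\<^sub>Om x1" "\<sigma> x = x0 \<ominus>\<^sub>Om x1" "y = y0 \<oplus>\<^sub>Om y1" "\<sigma> y = y0 \<ominus>\<^sub>Om y1"
  using x y by (simp_all add: d evp_odp evp_minus_odp)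
 have s [simp]: "\<sigma> x0 = x0" "\<sigma> x1 = \<ominus>\<^sub>Om x1" "\<sigma> y0 = y0" "\<sigma> y1 = \<ominus>\<^sub>Om y1"
  using x y by (simp_all add: d sgm_evp sgm_odp)
 note [simp] = lin_closed[OF dbl_contr_linear[OF \<Theta>]] lin_closed[OF sgm2_linear] W.lr_closed
  lin_closed[OF diamond_linear]
 have eo [simp]: "evp x0 = x0" "odp x0 = \<zero>\<^sub>Om" "evp x1 = \<zero>\<^sub>Om" "odp x1 = x1"
   "evp y0 = y0" "odp y0 = \<zero>\<^sub>Om" "evp y1 = \<zero>\<^sub>Om" "odp y1 = y1"
  by (simp_all add: evp_even odp_even evp_odd odp_odd)
 have tau: "\<tau> (?i z) = \<ominus>\<^sub>W ?i (\<sigma> z)" if "z \<in>. Om" for z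
  using that by (simp add: dbl_contr_sgm[OF \<Theta>])
 note ds = dbl_contr_simps[OF \<Theta>]
 define p where "p = (\<lambda>u v. dia (lact K Om {} u (?i v)))"
 have pc [simp]: "p u v \<in>. Om" if "u \<in>. Om" "v \<in>. Om" for u v
  using that by (simp add: p_def)
 have r0: "dia (ract K Om {} (?i u) v) = p v u" if "u \<in>. Om" "v \<in> {x0, y0}" for u v
  using that by (auto simp: diamond_ract p_def W.l1m diamond_simps)
 have r1: "dia (ract K Om {} (?i u) v) = \<ominus>\<^sub>Om p v (\<sigma> u)" if "u \<in>. Om" "v \<in> {x1, y1}" for u v
  using that by (auto simp: diamond_ract p_def W.l1m W.l2m diamond_simps tau Om.sgm_simps)
 have pm: "p (\<ominus>\<^sub>Om u) v = \<ominus>\<^sub>Om p u v" "p u (\<ominus>\<^sub>Om v) = \<ominus>\<^sub>Om p u v" if "u \<in>. Om" "v \<in>. Om" for u v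
  using that by (simp_all add: p_def W.l1m W.l2m diamond_simps ds)
 have im: "iota \<Theta> (u \<otimes>\<^sub>Om v) = dia (ract K Om {} (?i u) v) \<oplus>\<^sub>Om p (\<sigma> u) v" if "u \<in>. Om" "v \<in>. Om" for u v
  using that by (simp add: iota_dd_def dbl_contr_mult[OF \<Theta>] diamond_simps p_def Om.sgm_simps)
 have il: "iota \<Theta> ((x0 \<oplus>\<^sub>Om x1) \<otimes>\<^sub>Om (y0 \<oplus>\<^sub>Om y1)) =
   (iota \<Theta> (x0 \<otimes>\<^sub>Om y0) \<oplus>\<^sub>Om iota \<Theta> (x0 \<otimes>\<^sub>Om y1)) \<oplus>\<^sub>Om (iota \<Theta> (x1 \<otimes>\<^sub>Om y0) \<oplus>\<^sub>Om iota \<Theta> (x1 \<otimes>\<^sub>Om y1))"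
  by (simp add: Omega.l_distr Omega.r_distr iota_simps Omega.a_ac)
 have "iota \<Theta> (sw x y) = iota \<Theta> ((y0 \<oplus>\<^sub>Om y1) \<otimes>\<^sub>Om x0 \<oplus>\<^sub>Om (y0 \<ominus>\<^sub>Om y1) \<otimes>\<^sub>Om x1)"
  unfolding sw_def xs(4) d(1,2)[symmetric] by (subst xs(3)) simp
 also have "\<dots> = (iota \<Theta> (y0 \<otimes>\<^sub>Om x0) \<oplus>\<^sub>Om iota \<Theta> (y1 \<otimes>\<^sub>Om x0)) \<oplus>\<^sub>Om (iota \<Theta> (y0 \<otimes>\<^sub>Om x1) \<ominus>\<^sub>Om iota \<Theta> (y1 \<otimes>\<^sub>Om x1))"
  by (simp add: Omega.l_distr Omega.l_minus iota_simps a_minus_def)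
 also have "\<dots> = iota \<Theta> ((x0 \<oplus>\<^sub>Om x1) \<otimes>\<^sub>Om (y0 \<oplus>\<^sub>Om y1))"
  unfolding il by (simp add: im r0 r1 pm Om.sgm_simps a_minus_def Omega.minus_add Omega.a_ac)
 finally show ?thesis using xs(1,3) by simp
qed

lemma iota_super_comm: "x \<in> SC ==> iota \<Theta> x = \<zero>\<^sub>Om"
proof -
 assume "x \<in> SC"
 then obtain t where t: "t \<in>. W" "x = \<kappa> t" unfolding super_comm_eq by blast
 have "iota \<Theta> (\<kappa> t) = \<zero>\<^sub>Om"
 proof (rule O2.tsq_ext[OF lin_comp[OF \<kappa>_linear iota_linear] lin_const_zero[OF Om_module] Om_module _ t(1)])
  fix p q assume pq: "p \<in>. Om" "q \<in>. Om"
  then have "sw p q \<in>. Om" by (simp add: sw_def evp_simps odp_simps Om.sgm_simps)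
  then show "iota \<Theta> (\<kappa> (tens K Om {} p q)) = \<zero>\<^sub>Om"
   using pq by (simp add: \<kappa>_tens iota_simps iota_mult_sw a_minus_def Omega.r_neg)
 qed
 then show ?thesis using t(2) by simp
qed

lemma DDer_mul_Der: "DDer_mul K A \<Theta> \<in>. Dr"
proof -
 note \<Theta>D = DDerD[OF \<Theta>]
 note [simp] = lin_simps[OF \<Theta>D(1)] lin_simps[OF A2.tmul_linear] \<Theta>D(2,3) A2.tmul_lact A2.tmul_ract
  lin_closed[OF A2.lact_linear] lin_closed[OF A2.ract_linear] lin_zero[OF A2.tmul_linear A2.tsq_module module_axioms]
 show ?thesis using S_sub
  by (auto simp: Der_def DDer_mul_def linear_map_def subset_iff)
qed

text \<open>Both sides are odd derivations of the algebra of forms, and on da both are the function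
  obtained by multiplying out \<Theta>(a).\<close>

lemma tmul_dbl_contr:
 assumes x: "x \<in>. Om"
 shows "\<mu> (dct \<Theta> x) = ct (DDer_mul K A \<Theta>) x"
proof (rule odd_derivation_unique[where N = Om and rN = "mult Om" and lN = "mult Om" and \<tau> = \<sigma>,
   OF lin_comp[OF dbl_contr_linear[OF \<Theta>] O2.tmul_linear] contr_linear[OF DDer_mul_Der] _ _ _ _ x])
 note [simp] = lin_closed[OF dbl_contr_linear[OF \<Theta>]] W.lr_closed O2.tmul_lact O2.tmul_ract Om.sgm_simps(1)
 have f: "\<mu> (\<phi>2 \<xi>) = \<phi> (tmul K A {} \<xi>)" if "\<xi> \<in>. tsq K A {}" for \<xi>
  by (rule A2.tsq_ext[OF lin_comp[OF fn2_linear O2.tmul_linear] lin_comp[OF A2.tmul_linear fn_linear] Om_module _ that])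
    (simp_all add: fn2_tens O2.tmul_tens A2.tmul_tens fn_simps)
 show "\<mu> (dct \<Theta> (x \<otimes>\<^sub>Om y)) = \<mu> (dct \<Theta> x) \<otimes>\<^sub>Om y \<oplus>\<^sub>Om \<sigma> x \<otimes>\<^sub>Om \<mu> (dct \<Theta> y)"
  if "x \<in>. Om" "y \<in>. Om" for x y
  using that by (simp add: dbl_contr_mult[OF \<Theta>] tmul_simps)
 show "\<mu> (dct \<Theta> (\<delta> a)) = ct (DDer_mul K A \<Theta>) (\<delta> a)" if "a \<in>. A" for a
 proof -
  have "DDer_mul K A \<Theta> a = tmul K A {} (\<Theta> a)" using that by (simp add: DDer_mul_def)
  then show ?thesis using that lin_closed[OF DDerD(1)[OF \<Theta>]]
   by (simp add: dbl_contr_dfn[OF \<Theta>] contr_dfn[OF DDer_mul_Der] f)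
 qed
qed (simp_all add: contr_mult[OF DDer_mul_Der] contr_fn[OF DDer_mul_Der] dbl_contr_fn[OF \<Theta>] tmul_simps)

text \<open>The two contractions are the product map and \<open>diamond\<close> of one and the same
  double contraction, and these differ by \<kappa>. In the de Rham quotient the two contractions
  therefore coincide.\<close>

lemma contr_iota: "x \<in>. Om ==> ct (DDer_mul K A \<Theta>) x \<ominus>\<^sub>Om iota \<Theta> x \<in> SC"
 using \<kappa>_in[of "dct \<Theta> x"] lin_closed[OF dbl_contr_linear[OF \<Theta>]]
 by (simp add: \<kappa>_def tmul_dbl_contr iota_dd_def)

end

end



subsection \<open>Inner multiplications\<close>

lemma (in tensor_square) inner:
 assumes S: "S = {}" and b: "b \<in>. A"
 shows inner_l_linear: "linear_map K T T (tlift K A S T (\<lambda>x y. x \<diamondop> (b \<otimes>\<^sub>A y)))"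
  and inner_l_tens: "x \<in>. A ==> y \<in>. A ==> tlift K A S T (\<lambda>x y. x \<diamondop> (b \<otimes>\<^sub>A y)) (x \<diamondop> y) = x \<diamondop> (b \<otimes>\<^sub>A y)"
  and inner_r_linear: "linear_map K T T (tlift K A S T (\<lambda>x y. (x \<otimes>\<^sub>A b) \<diamondop> y))"
  and inner_r_tens: "x \<in>. A ==> y \<in>. A ==> tlift K A S T (\<lambda>x y. (x \<otimes>\<^sub>A b) \<diamondop> y) (x \<diamondop> y) = (x \<otimes>\<^sub>A b) \<diamondop> y"
proof -
 have 1: "bilinear K A A T (\<lambda>x y. x \<diamondop> (b \<otimes>\<^sub>A y))"
  by (rule bilinear_comp2[OF tens_bilinear lin_id mult_left_linear[OF b]])
 have 2: "bilinear K A A T (\<lambda>x y. (x \<otimes>\<^sub>A b) \<diamondop> y)"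
  by (rule bilinear_comp2[OF tens_bilinear mult_right_linear[OF b] lin_id])
 show "linear_map K T T (tlift K A S T (\<lambda>x y. x \<diamondop> (b \<otimes>\<^sub>A y)))"
  by (rule tlift_linear[OF tsq_module 1]) (simp add: S)
 show "linear_map K T T (tlift K A S T (\<lambda>x y. (x \<otimes>\<^sub>A b) \<diamondop> y))"
  by (rule tlift_linear[OF tsq_module 2]) (simp add: S)
 show "tlift K A S T (\<lambda>x y. x \<diamondop> (b \<otimes>\<^sub>A y)) (x \<diamondop> y) = x \<diamondop> (b \<otimes>\<^sub>A y)" if "x \<in>. A" "y \<in>. A"
  by (rule tlift_tens[OF tsq_module 1 _ that]) (simp add: S)
 show "tlift K A S T (\<lambda>x y. (x \<otimes>\<^sub>A b) \<diamondop> y) (x \<diamondop> y) = (x \<otimes>\<^sub>A b) \<diamondop> y" if "x \<in>. A" "y \<in>. A"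
  by (rule tlift_tens[OF tsq_module 2 _ that]) (simp add: S)
qed

lemma (in tensor_square) inner_act:
 assumes S: "S = {}" and b: "b \<in>. A" and c: "c \<in>. A" and \<xi>: "\<xi> \<in>. T"
 defines "J \<equiv> tlift K A S T (\<lambda>x y. x \<diamondop> (b \<otimes>\<^sub>A y))" and "J' \<equiv> tlift K A S T (\<lambda>x y. (x \<otimes>\<^sub>A b) \<diamondop> y)"
 shows inner_l_lact: "J (lact K A S c \<xi>) = lact K A S c (J \<xi>)" and inner_l_ract: "J (ract K A S \<xi> c) = ract K A S (J \<xi>) c"
  and inner_r_lact: "J' (lact K A S c \<xi>) = lact K A S c (J' \<xi>)" and inner_r_ract: "J' (ract K A S \<xi> c) = ract K A S (J' \<xi>) c"
  and tmul_inner: "tmul K A S (J \<xi>) = tmul K A S (J' \<xi>)"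
proof -
 note J = inner_l_linear[OF S b, folded J_def] and J' = inner_r_linear[OF S b, folded J'_def]
  and t = inner_l_tens[OF S b, folded J_def] inner_r_tens[OF S b, folded J'_def] lact_tens[OF c] ract_tens[OF c]
 note L = lact_linear[OF c] and R = ract_linear[OF c]
 show "J (lact K A S c \<xi>) = lact K A S c (J \<xi>)"
  by (rule tsq_ext[OF lin_comp[OF L J] lin_comp[OF J L] tsq_module _ \<xi>]) (simp add: t b c)
 show "J (ract K A S \<xi> c) = ract K A S (J \<xi>) c"
  by (rule tsq_ext[OF lin_comp[OF R J] lin_comp[OF J R] tsq_module _ \<xi>]) (simp add: t b c m_assoc)
 show "J' (lact K A S c \<xi>) = lact K A S c (J' \<xi>)"
  by (rule tsq_ext[OF lin_comp[OF L J'] lin_comp[OF J' L] tsq_module _ \<xi>]) (simp add: t b c m_assoc)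
 show "J' (ract K A S \<xi> c) = ract K A S (J' \<xi>) c"
  by (rule tsq_ext[OF lin_comp[OF R J'] lin_comp[OF J' R] tsq_module _ \<xi>]) (simp add: t b c)
 show "tmul K A S (J \<xi>) = tmul K A S (J' \<xi>)"
  by (rule tsq_ext[OF lin_comp[OF J tmul_linear] lin_comp[OF J' tmul_linear] module_axioms _ \<xi>])
    (simp add: t b tmul_tens m_assoc)
qed

text \<open>Serves \<open>Der\<close> and \<open>DDer\<close>, whose elements are extensional
  functions and hence equal once they agree on \<open>X\<close>.\<close>

lemma pointwise_module:
 assumes N: "module K N" and sub: "\<And>f. f \<in>. M ==> f \<in> extensional X \<and> (\<forall>a\<in>X. f a \<in>. N)"
  and zero: "\<zero>\<^sub>M = (\<lambda>a\<in>X. \<zero>\<^sub>N)" "\<zero>\<^sub>M \<in>. M"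
  and add: "\<And>f g. f \<oplus>\<^sub>M g = (\<lambda>a\<in>X. f a \<oplus>\<^sub>N g a)"
   "\<And>f g. f \<in>. M ==> g \<in>. M ==> f \<oplus>\<^sub>M g \<in>. M"
  and smult: "\<And>c f. c \<odot>\<^sub>M f = (\<lambda>a\<in>X. c \<odot>\<^sub>N f a)"
   "\<And>c f. c \<in>. K ==> f \<in>. M ==> c \<odot>\<^sub>M f \<in>. M"
 shows "module K M"
proof -
 interpret N: module K N by (rule N)
 have s: "f \<in> extensional X" "a \<in> X ==> f a \<in>. N" if "f \<in>. M" for f a
  using sub that by auto
 show ?thesis
 proof (rule moduleI)
  show "abelian_group M"
  proof (rule abelian_groupI)
   fix f assume f: "f \<in>. M"
   show "\<exists>g\<in>carrier M. g \<oplus>\<^sub>M f = \<zero>\<^sub>M"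
   proof (rule bexI)
    show "((\<ominus>\<^sub>K \<one>\<^sub>K) \<odot>\<^sub>M f) \<oplus>\<^sub>M f = \<zero>\<^sub>M"
     unfolding zero(1) add(1) smult(1)
     by (rule restrict_ext) (use s[OF f] in \<open>simp add: N.smult_l_minus N.l_neg\<close>)
    show "(\<ominus>\<^sub>K \<one>\<^sub>K) \<odot>\<^sub>M f \<in>. M" by (rule smult(2)) (use f in simp_all)
   qed
   show "\<zero>\<^sub>M \<oplus>\<^sub>M f = f"
    by (rule extensionalityI[of _ X]) (use s[OF f] in \<open>simp_all add: add(1) zero(1)\<close>)
   fix g assume g: "g \<in>. M"
   show "f \<oplus>\<^sub>M g = g \<oplus>\<^sub>M f"
    unfolding add(1) by (rule restrict_ext) (use s(2)[OF f] s(2)[OF g] in \<open>simp add: N.a_comm\<close>)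
   fix h assume h: "h \<in>. M"
   show "f \<oplus>\<^sub>M g \<oplus>\<^sub>M h = f \<oplus>\<^sub>M (g \<oplus>\<^sub>M h)"
    unfolding add(1) by (rule restrict_ext) (use s(2)[OF f] s(2)[OF g] s(2)[OF h] in \<open>simp add: N.a_assoc\<close>)
  qed (use zero(2) add(2) in auto)
  fix f assume f: "f \<in>. M"
  show "\<one>\<^sub>K \<odot>\<^sub>M f = f" by (rule extensionalityI[of _ X]) (use s[OF f] in \<open>simp_all add: smult(1)\<close>)
  fix a b assume a: "a \<in>. K" and b: "b \<in>. K"
  show "(a \<oplus>\<^sub>K b) \<odot>\<^sub>M f = a \<odot>\<^sub>M f \<oplus>\<^sub>M b \<odot>\<^sub>M f"
   unfolding add(1) smult(1) by (rule restrict_ext) (use s(2)[OF f] a b in \<open>simp add: N.smult_l_distr\<close>)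
  show "a \<otimes>\<^sub>K b \<odot>\<^sub>M f = a \<odot>\<^sub>M (b \<odot>\<^sub>M f)"
   unfolding smult(1) by (rule restrict_ext) (use s(2)[OF f] a b in \<open>simp add: N.smult_assoc1\<close>)
 next
  fix a f g assume a: "a \<in>. K" and f: "f \<in>. M" and g: "g \<in>. M"
  show "a \<odot>\<^sub>M (f \<oplus>\<^sub>M g) = a \<odot>\<^sub>M f \<oplus>\<^sub>M a \<odot>\<^sub>M g"
   unfolding add(1) smult(1) by (rule restrict_ext) (use s(2)[OF f] s(2)[OF g] a in \<open>simp add: N.smult_r_distr\<close>)
 qed (use smult(2) N.R.cring_axioms in auto)
qed

context ncf
begin

lemma DDer_ops:
 "\<Theta> \<oplus>\<^sub>DD \<Phi> = (\<lambda>a\<in>carrier A. \<Theta> a \<oplus>\<^bsub>tsq K A {}\<^esub> \<Phi> a)"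
 "c \<odot>\<^sub>DD \<Theta> = (\<lambda>a\<in>carrier A. c \<odot>\<^bsub>tsq K A {}\<^esub> \<Theta> a)"
 "\<zero>\<^sub>DD = (\<lambda>a\<in>carrier A. \<zero>\<^bsub>tsq K A {}\<^esub>)"
 by (simp_all add: DDer_def Let_def)

lemma DDerI:
 assumes "linear_map K A (tsq K A {}) \<Theta>"
  "\<And>a b. a \<in>. A ==> b \<in>. A ==> \<Theta> (a \<otimes>\<^sub>A b) = ract K A {} (\<Theta> a) b \<oplus>\<^bsub>tsq K A {}\<^esub> lact K A {} a (\<Theta> b)"
  "\<And>s. s \<in> S ==> \<Theta> s = \<zero>\<^bsub>tsq K A {}\<^esub>"
 shows "restrict \<Theta> (carrier A) \<in>. DD"
 using assms lin_restrict[OF assms(1) module_axioms] S_sub by (auto simp: DDer_def Let_def subset_iff)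

sublocale TA: bimodule K A "tsq K A {}" "lact K A {}" "ract K A {}" by (rule A2.tsq_bimodule)

lemma DDer_module: "module K DD"
proof (rule pointwise_module[OF A2.tsq_module, where X = "carrier A"])
 note [simp] = TA.lr_closed TA.l1 TA.l2 TA.r1 TA.r2 TA.l2m TA.r1m
 show "\<zero>\<^sub>DD \<in>. DD"
  unfolding DDer_ops by (rule DDerI) (auto intro: lin_const_zero[OF A2.tsq_module])
 fix \<Theta> assume T: "\<Theta> \<in>. DD"
 note TD = DDerD[OF T]
 then show "\<Theta> \<in> extensional (carrier A) \<and> (\<forall>a\<in>carrier A. \<Theta> a \<in>. tsq K A {})"
  using lin_closed[OF TD(1)] by auto
 show "c \<odot>\<^sub>DD \<Theta> \<in>. DD" if "c \<in>. K" for c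
  unfolding DDer_ops
  by (rule DDerI[OF lin_scale[OF TD(1) A2.tsq_module that]])
    (use that lin_closed[OF TD(1)] in \<open>simp_all add: TD(2,3) TA.M.smult_r_distr\<close>)
 fix \<Phi> assume P: "\<Phi> \<in>. DD"
 note PD = DDerD[OF P]
 show "\<Theta> \<oplus>\<^sub>DD \<Phi> \<in>. DD"
  unfolding DDer_ops
  by (rule DDerI[OF lin_plus[OF TD(1) PD(1) A2.tsq_module]])
    (use lin_closed[OF TD(1)] lin_closed[OF PD(1)] in \<open>simp_all add: TD(2,3) PD(2,3) TA.M.a_ac\<close>)
qed (simp_all add: DDer_ops)

lemma dbl_contr_lin:
 assumes T: "\<Theta> \<in>. DD" and P: "\<Phi> \<in>. DD" and x: "x \<in>. Om"
 shows "dct (\<Theta> \<oplus>\<^sub>DD \<Phi>) x = dct \<Theta> x \<oplus>\<^sub>W dct \<Phi> x"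
  and "c \<in>. K ==> dct (c \<odot>\<^sub>DD \<Theta>) x = c \<odot>\<^sub>W dct \<Theta> x"
proof -
 interpret D: module K "DD" by (rule DDer_module)
 note [simp] = lin_closed[OF dbl_contr_linear[OF T]] lin_closed[OF dbl_contr_linear[OF P]] W.lr_closed Om.sgm_simps(1)
  lin_closed[OF DDerD(1)[OF T]] lin_closed[OF DDerD(1)[OF P]] lin_simps(2,3)[OF fn2_linear]
 have TP: "\<Theta> \<oplus>\<^sub>DD \<Phi> \<in>. DD" using T P by simp
 show "dct (\<Theta> \<oplus>\<^sub>DD \<Phi>) x = dct \<Theta> x \<oplus>\<^sub>W dct \<Phi> x"
  by (rule odd_derivation_unique[where N = W and rN = "ract K Om {}" and lN = "lact K Om {}" and \<tau> = \<sigma>,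
     OF dbl_contr_linear[OF TP] lin_plus[OF dbl_contr_linear[OF T] dbl_contr_linear[OF P] W.M.module_axioms] _ _ _ _ x])
    (simp_all add: dbl_contr_mult[OF TP] dbl_contr_mult[OF T] dbl_contr_mult[OF P] dbl_contr_fn[OF TP] dbl_contr_fn[OF T]
     dbl_contr_fn[OF P] dbl_contr_dfn[OF TP] dbl_contr_dfn[OF T] dbl_contr_dfn[OF P] W.r1 W.l2 W.M.a_ac, simp_all add: DDer_ops)
 assume c: "c \<in>. K"
 have cT: "c \<odot>\<^sub>DD \<Theta> \<in>. DD" using T c by simp
 show "dct (c \<odot>\<^sub>DD \<Theta>) x = c \<odot>\<^sub>W dct \<Theta> x"
  by (rule odd_derivation_unique[where N = W and rN = "ract K Om {}" and lN = "lact K Om {}" and \<tau> = \<sigma>,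
     OF dbl_contr_linear[OF cT] lin_scale[OF dbl_contr_linear[OF T] W.M.module_axioms c] _ _ _ _ x])
    (use c in \<open>simp_all add: dbl_contr_mult[OF cT] dbl_contr_mult[OF T] dbl_contr_fn[OF cT] dbl_contr_fn[OF T]
     dbl_contr_dfn[OF cT] dbl_contr_dfn[OF T] W.r1 W.l2 W.M.smult_r_distr\<close>, use c in \<open>simp_all add: DDer_ops\<close>)
qed

lemma iota_linear_arg:
 assumes x: "x \<in>. Om"
 shows "linear_map K DD Om (\<lambda>\<Theta>. iota \<Theta> x)"
 by (rule linear_mapI)
   (use x in \<open>simp_all add: iota_linear[THEN lin_closed] iota_dd_def dbl_contr_lin diamond_simps
    dbl_contr_linear[THEN lin_closed]\<close>)

text \<open>The reversal in \<open>diamond\<close> brings the inner side of a tensor to the outside: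
  x \<otimes> b y becomes b y x. An even \<open>b\<close> causes no sign. This turns the inner
  bimodule structure of double derivations into that of forms and makes \<Theta> \<mapsto>
  \<iota>(\<Theta>) a bimodule map.\<close>

lemma diamond_inner:
 assumes b: "b \<in>. Om" "\<sigma> b = b" and t: "t \<in>. W"
 shows "dia (tlift K Om {} W (\<lambda>x y. tens K Om {} x (b \<otimes>\<^sub>Om y)) t) = b \<otimes>\<^sub>Om dia t"
  and "dia (tlift K Om {} W (\<lambda>x y. tens K Om {} (x \<otimes>\<^sub>Om b) y) t) = dia t \<otimes>\<^sub>Om b"
proof -
 note [simp] = evp_simps(1) odp_simps(1) Om.sgm_simps(1) O2.inner_l_tens[OF refl b(1)] O2.inner_r_tens[OF refl b(1)]
 show "dia (tlift K Om {} W (\<lambda>x y. tens K Om {} x (b \<otimes>\<^sub>Om y)) t) = b \<otimes>\<^sub>Om dia t"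
  by (rule O2.tsq_ext[OF lin_comp[OF O2.inner_l_linear[OF refl b(1)] diamond_linear] lin_comp[OF diamond_linear O2.mult_left_linear[OF b(1)]] Om_module _ t])
    (simp add: b diamond_tens sw_def Om.sgm_mult Omega.r_distr Omega.m_assoc)
 show "dia (tlift K Om {} W (\<lambda>x y. tens K Om {} (x \<otimes>\<^sub>Om b) y) t) = dia t \<otimes>\<^sub>Om b"
  by (rule O2.tsq_ext[OF lin_comp[OF O2.inner_r_linear[OF refl b(1)] diamond_linear] lin_comp[OF diamond_linear O2.mult_right_linear[OF b(1)]] Om_module _ t])
    (simp add: b diamond_tens sw_def evp_mult_even Omega.l_distr Omega.m_assoc)
qed

context
 fixes \<Theta> b assumes T: "\<Theta> \<in>. DD" and b: "b \<in>. A"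
begin

lemma DDer_lact_closed: "DDer_lact K A b \<Theta> \<in>. DD"
 and DDer_ract_closed: "DDer_ract K A \<Theta> b \<in>. DD"
proof -
 note TD = DDerD[OF T]
 note il = A2.inner_l_linear[OF refl b] and ir = A2.inner_r_linear[OF refl b]
 note [simp] = lin_closed[OF TD(1)] TA.lr_closed
 show "DDer_lact K A b \<Theta> \<in>. DD" unfolding DDer_lact_def
  by (rule DDerI[OF lin_comp[OF TD(1) il]])
    (simp_all add: TD(2,3) lin_simps(2)[OF il] lin_zero[OF il A2.tsq_module A2.tsq_module] A2.inner_l_lact[OF refl b] A2.inner_l_ract[OF refl b])
 show "DDer_ract K A \<Theta> b \<in>. DD" unfolding DDer_ract_def
  by (rule DDerI[OF lin_comp[OF TD(1) ir]])
    (simp_all add: TD(2,3) lin_simps(2)[OF ir] lin_zero[OF ir A2.tsq_module A2.tsq_module] A2.inner_r_lact[OF refl b] A2.inner_r_ract[OF refl b])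
qed

lemma fn2_inner:
 assumes \<xi>: "\<xi> \<in>. tsq K A {}"
 shows "\<phi>2 (tlift K A {} (tsq K A {}) (\<lambda>x y. tens K A {} x (b \<otimes>\<^sub>A y)) \<xi>) =
   tlift K Om {} W (\<lambda>x y. tens K Om {} x (\<phi> b \<otimes>\<^sub>Om y)) (\<phi>2 \<xi>)"
  and "\<phi>2 (tlift K A {} (tsq K A {}) (\<lambda>x y. tens K A {} (x \<otimes>\<^sub>A b) y) \<xi>) =
   tlift K Om {} W (\<lambda>x y. tens K Om {} (x \<otimes>\<^sub>Om \<phi> b) y) (\<phi>2 \<xi>)"
proof -
 have fb: "\<phi> b \<in>. Om" using b by (rule fn_simps(1))
 note [simp] = A2.inner_l_tens[OF refl b] A2.inner_r_tens[OF refl b] O2.inner_l_tens[OF refl fb] O2.inner_r_tens[OF refl fb] fn2_tens b fn_simps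
 show "\<phi>2 (tlift K A {} (tsq K A {}) (\<lambda>x y. tens K A {} x (b \<otimes>\<^sub>A y)) \<xi>) =
   tlift K Om {} W (\<lambda>x y. tens K Om {} x (\<phi> b \<otimes>\<^sub>Om y)) (\<phi>2 \<xi>)"
  by (rule A2.tsq_ext[OF lin_comp[OF A2.inner_l_linear[OF refl b] fn2_linear] lin_comp[OF fn2_linear O2.inner_l_linear[OF refl fb]] W.M.module_axioms _ \<xi>]) simp
 show "\<phi>2 (tlift K A {} (tsq K A {}) (\<lambda>x y. tens K A {} (x \<otimes>\<^sub>A b) y) \<xi>) =
   tlift K Om {} W (\<lambda>x y. tens K Om {} (x \<otimes>\<^sub>Om \<phi> b) y) (\<phi>2 \<xi>)"
  by (rule A2.tsq_ext[OF lin_comp[OF A2.inner_r_linear[OF refl b] fn2_linear] lin_comp[OF fn2_linear O2.inner_r_linear[OF refl fb]] W.M.module_axioms _ \<xi>]) simp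
qed

lemma iota_DDer_lact: "x \<in>. Om ==> iota (DDer_lact K A b \<Theta>) x = \<phi> b \<otimes>\<^sub>Om iota \<Theta> x"
 and iota_DDer_ract: "x \<in>. Om ==> iota (DDer_ract K A \<Theta> b) x = iota \<Theta> x \<otimes>\<^sub>Om \<phi> b"
proof -
 assume x: "x \<in>. Om"
 have fb: "\<phi> b \<in>. Om" using b by (rule fn_simps(1))
 let ?l = "tlift K Om {} W (\<lambda>x y. tens K Om {} x (\<phi> b \<otimes>\<^sub>Om y))"
 let ?r = "tlift K Om {} W (\<lambda>x y. tens K Om {} (x \<otimes>\<^sub>Om \<phi> b) y)"
 note il = O2.inner_l_linear[OF refl fb] and ir = O2.inner_r_linear[OF refl fb]
 note [simp] = lin_closed[OF dbl_contr_linear[OF T]] W.lr_closed Om.sgm_simps(1) lin_closed[OF DDerD(1)[OF T]]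
 have "dct (DDer_lact K A b \<Theta>) x = ?l (dct \<Theta> x)"
  by (rule odd_derivation_unique[where N = W and rN = "ract K Om {}" and lN = "lact K Om {}" and \<tau> = \<sigma>,
     OF dbl_contr_linear[OF DDer_lact_closed] lin_comp[OF dbl_contr_linear[OF T] il] _ _ _ _ x])
    (simp_all add: dbl_contr_mult[OF DDer_lact_closed] dbl_contr_mult[OF T] dbl_contr_fn[OF DDer_lact_closed] dbl_contr_fn[OF T]
     dbl_contr_dfn[OF DDer_lact_closed] dbl_contr_dfn[OF T] lin_simps(2)[OF il] lin_zero[OF il W.M.module_axioms W.M.module_axioms]
     O2.inner_l_lact[OF refl fb] O2.inner_l_ract[OF refl fb], simp_all add: DDer_lact_def fn2_inner)
 then show "iota (DDer_lact K A b \<Theta>) x = \<phi> b \<otimes>\<^sub>Om iota \<Theta> x"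
  using x b fb by (simp add: iota_dd_def diamond_inner Om.sgm_inl)
 have "dct (DDer_ract K A \<Theta> b) x = ?r (dct \<Theta> x)"
  by (rule odd_derivation_unique[where N = W and rN = "ract K Om {}" and lN = "lact K Om {}" and \<tau> = \<sigma>,
     OF dbl_contr_linear[OF DDer_ract_closed] lin_comp[OF dbl_contr_linear[OF T] ir] _ _ _ _ x])
    (simp_all add: dbl_contr_mult[OF DDer_ract_closed] dbl_contr_mult[OF T] dbl_contr_fn[OF DDer_ract_closed] dbl_contr_fn[OF T]
     dbl_contr_dfn[OF DDer_ract_closed] dbl_contr_dfn[OF T] lin_simps(2)[OF ir] lin_zero[OF ir W.M.module_axioms W.M.module_axioms]
     O2.inner_r_lact[OF refl fb] O2.inner_r_ract[OF refl fb], simp_all add: DDer_ract_def fn2_inner)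
 then show "iota (DDer_ract K A \<Theta> b) x = iota \<Theta> x \<otimes>\<^sub>Om \<phi> b"
  using x b fb by (simp add: iota_dd_def diamond_inner Om.sgm_inl)
qed

text \<open>Once the tensor factors are multiplied, both actions insert \<open>b\<close> between
  them. The passage to derivations therefore kills commutators of double derivations.\<close>

lemma DDer_mul_lact_ract: "DDer_mul K A (DDer_lact K A b \<Theta>) = DDer_mul K A (DDer_ract K A \<Theta> b)"
 unfolding DDer_mul_def DDer_lact_def DDer_ract_def
 by (rule restrict_ext) (simp add: A2.tmul_inner[OF refl b b] lin_closed[OF DDerD(1)[OF T]])

end

lemma DDer_mul_linear: "linear_map K DD Dr (DDer_mul K A)"
proof (rule linear_mapI)
 interpret D: module K "DD" by (rule DDer_module)
 fix \<Theta> assume T: "\<Theta> \<in>. DD"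
 note [simp] = lin_closed[OF DDerD(1)[OF T]] lin_simps(2,3)[OF A2.tmul_linear]
 show "DDer_mul K A \<Theta> \<in>. Dr" by (rule DDer_mul_Der[OF T])
 show "DDer_mul K A (c \<odot>\<^sub>DD \<Theta>) = c \<odot>\<^sub>Dr DDer_mul K A \<Theta>" if "c \<in>. K" for c
  using that by (auto simp: DDer_mul_def DDer_ops Der_def intro!: restrict_ext)
 fix \<Phi> assume P: "\<Phi> \<in>. DD"
 note [simp] = lin_closed[OF DDerD(1)[OF P]]
 show "DDer_mul K A (\<Theta> \<oplus>\<^sub>DD \<Phi>) = DDer_mul K A \<Theta> \<oplus>\<^sub>Dr DDer_mul K A \<Phi>"
  by (auto simp: DDer_mul_def DDer_ops Der_def intro!: restrict_ext)
qed


subsection \<open>Projections to low degree\<close>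

text \<open>The projection to degree zero, given as an algebra map. It shows that \<phi> is
  injective and that a function which is a super commutator of forms already lies in [A, A].\<close>

definition "pr0 = (SOME h. linear_map K Om A h \<and> h \<one>\<^sub>Om = \<one>\<^sub>A \<and>
  (\<forall>x\<in>carrier Om. \<forall>y\<in>carrier Om. h (x \<otimes>\<^sub>Om y) = h x \<otimes>\<^sub>A h y) \<and>
  (\<forall>a\<in>carrier A. h (\<phi> a) = a) \<and> (\<forall>m\<in>carrier O1. h (one_form K A S m) = \<zero>\<^sub>A))"

lemma pr0_linear: "linear_map K Om A pr0"
 and pr0_one: "pr0 \<one>\<^sub>Om = \<one>\<^sub>A"
 and pr0_mult: "x \<in>. Om ==> y \<in>. Om ==> pr0 (x \<otimes>\<^sub>Om y) = pr0 x \<otimes>\<^sub>A pr0 y"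
 and pr0_fn: "a \<in>. A ==> pr0 (\<phi> a) = a"
 and pr0_one_form: "\<xi> \<in>. O1 ==> pr0 (one_form K A S \<xi>) = \<zero>\<^sub>A"
proof -
 have "\<exists>h. linear_map K Om A h \<and> h \<one>\<^sub>Om = \<one>\<^sub>A \<and>
  (\<forall>x\<in>carrier Om. \<forall>y\<in>carrier Om. h (x \<otimes>\<^sub>Om y) = h x \<otimes>\<^sub>A h y) \<and>
  (\<forall>a\<in>carrier A. h (\<phi> a) = a) \<and> (\<forall>m\<in>carrier O1. h (one_form K A S m) = \<zero>\<^sub>A)"
  by (rule Om.TA_universal[OF assoc_algebra_axioms lin_id lin_const_zero[OF module_axioms]]) simp_all
 from someI_ex[OF this, folded pr0_def]
 show "linear_map K Om A pr0" "pr0 \<one>\<^sub>Om = \<one>\<^sub>A"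
  "x \<in>. Om ==> y \<in>. Om ==> pr0 (x \<otimes>\<^sub>Om y) = pr0 x \<otimes>\<^sub>A pr0 y"
  "a \<in>. A ==> pr0 (\<phi> a) = a" "\<xi> \<in>. O1 ==> pr0 (one_form K A S \<xi>) = \<zero>\<^sub>A"
  by auto
qed

lemmas pr0_simps = lin_simps[OF pr0_linear] lin_mod_simps[OF pr0_linear Om_module module_axioms]

lemma pr0_sgm: "x \<in>. Om ==> pr0 (\<sigma> x) = pr0 x"
 by (induction rule: Om_induct)
   (simp_all add: Om.sgm_inl sgm_dfn Om.sgm_mult Om.sgm_simps pr0_mult pr0_simps pr0_one_form univ_der_closed dfn_simps)

lemma fn_inj: "a \<in>. A ==> b \<in>. A ==> \<phi> a = \<phi> b ==> a = b"
 by (metis pr0_fn)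

lemma double_half: "a \<in>. A ==> hf \<odot>\<^sub>A (a \<oplus>\<^sub>A a) = a"
 using smult_l_distr[of hf hf a] by (simp add: smult_r_distr)

lemma pr0_evp: "x \<in>. Om ==> pr0 (evp x) = pr0 x" and pr0_odp: "x \<in>. Om ==> pr0 (odp x) = \<zero>\<^sub>A"
 by (simp_all add: evp_def odp_def pr0_simps pr0_sgm Om.sgm_simps double_half r_neg a_minus_def)

abbreviation "comms \<equiv> {(a \<otimes>\<^sub>A b) \<ominus>\<^sub>A (b \<otimes>\<^sub>A a) | a b. a \<in>. A \<and> b \<in>. A}"

lemma comms_closed: "comms \<subseteq> carrier A"
 by auto

lemmas comms_submodule = lin_span_submodule[OF module_axioms comms_closed]

lemma pr0_super_comm: "x \<in> SC ==> pr0 x \<in> lin_span K A comms"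
proof -
 assume "x \<in> SC"
 then obtain t where t: "t \<in>. W" "x = \<kappa> t" unfolding super_comm_eq by blast
 have "pr0 (\<kappa> t) \<in> lin_span K A comms"
 proof (rule O2.tsq_into[OF lin_comp[OF \<kappa>_linear pr0_linear] module_axioms comms_submodule _ t(1)])
  fix p q assume pq: "p \<in>. Om" "q \<in>. Om"
  note [simp] = pq pr0_simps pr0_mult evp_simps(1) odp_simps(1) Om.sgm_simps(1) pr0_sgm pr0_evp pr0_odp
  have "pr0 (\<kappa> (tens K Om {} p q)) = pr0 p \<otimes>\<^sub>A pr0 q \<ominus>\<^sub>A pr0 q \<otimes>\<^sub>A pr0 p"
   by (simp add: \<kappa>_tens sw_def)
  also have "\<dots> \<in> lin_span K A comms" by (rule lin_span_base) (use pq pr0_simps(1) in blast)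
  finally show "pr0 (\<kappa> (tens K Om {} p q)) \<in> lin_span K A comms" .
 qed
 then show ?thesis using t(2) by simp
qed

text \<open>Forms act on one-forms through their component of degree zero; forms of positive degree
  act as zero.\<close>

lemma Omega1_bimodule_pr0: "bimodule K Om O1 (\<lambda>x. lact K A S (pr0 x)) (\<lambda>\<xi> x. ract K A S \<xi> (pr0 x))"
 by (intro bimodule.intro bimodule_axioms.intro Omega.assoc_algebra_axioms Om.M.module_axioms
   bilinear_comp2[OF Om.l_bilinear pr0_linear lin_id] bilinear_comp2[OF Om.r_bilinear lin_id pr0_linear])
   (simp_all add: pr0_one pr0_mult pr0_simps Om.l_one Om.r_one Om.l_mult Om.r_mult Om.l_r)

text \<open>The projection to degree one, given as an odd derivation into the preceding bimodule. It
  shows that a one-form which is a super commutator of forms lies in the commutators of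
  \<open>A\<close> with one-forms.\<close>

definition "pr1 = (SOME D. linear_map K Om O1 D \<and>
  (\<forall>x\<in>carrier Om. \<forall>y\<in>carrier Om. D (x \<otimes>\<^sub>Om y) = ract K A S (D x) (pr0 y) \<oplus>\<^sub>T lact K A S (pr0 (\<sigma> x)) (D y)) \<and>
  (\<forall>a\<in>carrier A. D (\<phi> a) = \<zero>\<^sub>T) \<and> (\<forall>m\<in>carrier O1. D (one_form K A S m) = m))"

lemma pr1_linear: "linear_map K Om O1 pr1"
 and pr1_mult: "x \<in>. Om ==> y \<in>. Om ==> pr1 (x \<otimes>\<^sub>Om y) = ract K A S (pr1 x) (pr0 y) \<oplus>\<^sub>T lact K A S (pr0 x) (pr1 y)"
 and pr1_fn: "a \<in>. A ==> pr1 (\<phi> a) = \<zero>\<^sub>T"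
 and pr1_one_form: "\<xi> \<in>. O1 ==> pr1 (one_form K A S \<xi>) = \<xi>"
proof -
 have "\<exists>D. linear_map K Om O1 D \<and>
  (\<forall>x\<in>carrier Om. \<forall>y\<in>carrier Om. D (x \<otimes>\<^sub>Om y) = ract K A S (D x) (pr0 y) \<oplus>\<^sub>O1 lact K A S (pr0 (\<sigma> x)) (D y)) \<and>
  (\<forall>a\<in>carrier A. D (\<phi> a) = \<zero>\<^sub>O1) \<and> (\<forall>m\<in>carrier O1. D (one_form K A S m) = m)"
  by (rule Om.odd_derivation_ex[OF Omega1_bimodule_pr0 lin_const_zero[OF Om.M.module_axioms] lin_id])
    (simp_all add: pr0_fn pr0_one_form fn_simps Om.r1m Om.l2m Om.lr_closed Om.M.a_inv_zero a_minus_def)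
 from someI_ex[OF this[unfolded Omega1_ops], folded pr1_def]
 show "linear_map K Om O1 pr1"
  "x \<in>. Om ==> y \<in>. Om ==> pr1 (x \<otimes>\<^sub>Om y) = ract K A S (pr1 x) (pr0 y) \<oplus>\<^sub>T lact K A S (pr0 x) (pr1 y)"
  "a \<in>. A ==> pr1 (\<phi> a) = \<zero>\<^sub>T" "\<xi> \<in>. O1 ==> pr1 (one_form K A S \<xi>) = \<xi>"
  by (auto simp: pr0_sgm)
qed

lemmas pr1_simps = lin_simps[OF pr1_linear] lin_mod_simps[OF pr1_linear Om_module Om.M.module_axioms]

lemma pr1_sgm: "x \<in>. Om ==> pr1 (\<sigma> x) = \<ominus>\<^sub>O1 pr1 x"
 by (induction rule: Om_induct)
   (simp_all add: Om.sgm_inl sgm_dfn Om.sgm_mult Om.sgm_simps pr1_mult[folded Omega1_ops(1)] pr1_fn[folded Omega1_ops(3)] pr1_simps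
    pr1_one_form univ_der_closed dfn_simps pr0_simps pr0_sgm Om.r1m Om.l2m Om.lr_closed Om.M.minus_add Om.M.smult_r_minus
    Om.M.a_inv_zero)

lemma pr1_evp: "x \<in>. Om ==> pr1 (evp x) = \<zero>\<^sub>O1"
 and pr1_odp: "x \<in>. Om ==> pr1 (odp x) = pr1 x"
proof -
 assume x: "x \<in>. Om"
 have "hf \<odot>\<^sub>O1 (pr1 x \<oplus>\<^sub>O1 pr1 x) = pr1 x"
  using Om.M.smult_l_distr[of hf hf "pr1 x"] pr1_simps(1)[OF x] by (simp add: Om.M.smult_r_distr)
 then show "pr1 (evp x) = \<zero>\<^sub>O1" "pr1 (odp x) = pr1 x"
  using x by (simp_all add: evp_def odp_def pr1_simps pr1_sgm Om.sgm_simps Om.M.r_neg a_minus_def)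
qed

abbreviation "comms1 \<equiv> {lact K A S a \<xi> \<ominus>\<^sub>O1 ract K A S \<xi> a | a \<xi>. a \<in>. A \<and> \<xi> \<in>. O1}"

lemma comms1_closed: "comms1 \<subseteq> carrier O1"
 using Om.lr_closed by auto

lemmas comms1_submodule = lin_span_submodule[OF Om.M.module_axioms comms1_closed]

lemma pr1_super_comm: "x \<in> SC ==> pr1 x \<in> lin_span K O1 comms1"
proof -
 assume "x \<in> SC"
 then obtain t where t: "t \<in>. W" "x = \<kappa> t" unfolding super_comm_eq by blast
 have "pr1 (\<kappa> t) \<in> lin_span K O1 comms1"
 proof (rule O2.tsq_into[OF lin_comp[OF \<kappa>_linear pr1_linear] Om.M.module_axioms comms1_submodule _ t(1)])
  fix p q assume pq: "p \<in>. Om" "q \<in>. Om"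
  note [simp] = pq pr1_simps pr0_simps(1) pr1_mult[folded Omega1_ops(1)] evp_simps(1) odp_simps(1) Om.sgm_simps(1) pr0_sgm pr0_evp pr0_odp
   pr1_evp pr1_odp pr1_sgm Om.lr_closed Om.l1m Om.l2m Om.r1m Om.r2m
  define a b c d where abcd: "a = ract K A S (pr1 p) (pr0 q)" "b = lact K A S (pr0 p) (pr1 q)"
   "c = ract K A S (pr1 q) (pr0 p)" "d = lact K A S (pr0 q) (pr1 p)"
  have cl: "a \<in>. O1" "b \<in>. O1" "c \<in>. O1" "d \<in>. O1"
   by (simp_all add: abcd)
  have "pr1 (\<kappa> (tens K Om {} p q)) = (a \<oplus>\<^sub>O1 b) \<ominus>\<^sub>O1 (c \<oplus>\<^sub>O1 d)"
   unfolding abcd by (simp add: \<kappa>_tens sw_def)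
  \<comment> \<open>Regrouped as the commutator of the function part of \<open>p\<close> with the
    one-form part of \<open>q\<close>, minus the same with the roles exchanged.\<close>
  also have "\<dots> = (b \<ominus>\<^sub>O1 c) \<ominus>\<^sub>O1 (d \<ominus>\<^sub>O1 a)"
   using cl by algebra
  finally have eq: "pr1 (\<kappa> (tens K Om {} p q)) = (b \<ominus>\<^sub>O1 c) \<ominus>\<^sub>O1 (d \<ominus>\<^sub>O1 a)" .
  have "b \<ominus>\<^sub>O1 c \<in> lin_span K O1 comms1" "d \<ominus>\<^sub>O1 a \<in> lin_span K O1 comms1"
   unfolding abcd by (rule lin_span_base; use pq pr0_simps(1) pr1_simps(1) in blast)+
  then show "pr1 (\<kappa> (tens K Om {} p q)) \<in> lin_span K O1 comms1"
   unfolding eq a_minus_def[of _ "b \<ominus>\<^sub>O1 c"]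
   using Om.M.submoduleE(3,5)[OF comms1_submodule] by blast
 qed
 then show ?thesis using t(2) by simp
qed

end



section \<open>Lie algebras and Cartan calculus\<close>

lemma lie_algebra_image:
 assumes G: "lie_algebra K G" and Q: "module K Q" and p: "linear_map K G Q p" and car: "carrier Q = p ` carrier G"
  and mult: "\<And>x y. x \<in>. G ==> y \<in>. G ==> p x \<otimes>\<^sub>Q p y = p (x \<otimes>\<^sub>G y)"
 shows "lie_algebra K Q"
proof -
 interpret G: lie_algebra K G by (rule G)
 note l = lin_simps[OF G.bracket_linear_left] and r = lin_simps[OF G.bracket_linear_right]
 note ps = lin_simps(2,3)[OF p, symmetric]
 show ?thesis
 proof (intro lie_algebra.intro lie_algebra_axioms.intro Q linear_mapI)
  fix x assume x: "x \<in>. Q"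
  then obtain u where u: "u \<in>. G" "x = p u" unfolding car by blast
  show "x \<otimes>\<^sub>Q x = \<zero>\<^sub>Q"
   using u G.bracket_alternating lin_zero[OF p G.module_axioms Q] by (simp add: mult)
  fix y assume y: "y \<in>. Q"
  then obtain v where v: "v \<in>. G" "y = p v" unfolding car by blast
  show "x \<otimes>\<^sub>Q y \<in>. Q" using u v lin_closed[OF p] by (simp add: mult r)
  show "y \<otimes>\<^sub>Q x \<in>. Q" using u v lin_closed[OF p] by (simp add: mult r)
  fix z assume z: "z \<in>. Q"
  then obtain t where t: "t \<in>. G" "z = p t" unfolding car by blast
  show "(y \<oplus>\<^sub>Q z) \<otimes>\<^sub>Q x = y \<otimes>\<^sub>Q x \<oplus>\<^sub>Q z \<otimes>\<^sub>Q x"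
   using u v t by (simp add: mult ps l r)
  show "x \<otimes>\<^sub>Q (y \<oplus>\<^sub>Q z) = x \<otimes>\<^sub>Q y \<oplus>\<^sub>Q x \<otimes>\<^sub>Q z"
   using u v t by (simp add: mult ps l r)
  show "x \<otimes>\<^sub>Q (y \<otimes>\<^sub>Q z) \<oplus>\<^sub>Q y \<otimes>\<^sub>Q (z \<otimes>\<^sub>Q x) \<oplus>\<^sub>Q z \<otimes>\<^sub>Q (x \<otimes>\<^sub>Q y) = \<zero>\<^sub>Q"
   using u v t G.jacobi[OF u(1) v(1) t(1)] lin_zero[OF p G.module_axioms Q] by (simp add: mult ps l r)
 next
  fix c x y assume c: "c \<in>. K" and x: "x \<in>. Q" and y: "y \<in>. Q"
  obtain u v where u: "u \<in>. G" "x = p u" "v \<in>. G" "y = p v" using x y unfolding car by blast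
  show "(c \<odot>\<^sub>Q x) \<otimes>\<^sub>Q y = c \<odot>\<^sub>Q (x \<otimes>\<^sub>Q y)"
   using u c by (simp add: mult ps l r)
  show "x \<otimes>\<^sub>Q (c \<odot>\<^sub>Q y) = c \<odot>\<^sub>Q (x \<otimes>\<^sub>Q y)"
   using u c by (simp add: mult ps l r)
 qed
qed

context equivariant_complex
begin

text \<open>\<open>H\<close> is a right inverse of contraction into the closed cochain
  \<open>w\<close>. With all cochains written as contractions of \<open>w\<close>, skew-symmetry is
  the anticommutation of contractions. The lemma is used for derivations of \<open>A\<close> and
  again for \<open>HH1\<close> of the reduced algebra.\<close>

lemma hamiltonI:
 assumes H: "linear_map K (C (Suc 0)) G H" and w: "w \<in>. (C (Suc (Suc 0)))" and dw: "d (Suc (Suc 0)) w = \<zero>\<^bsub>C (Suc (Suc (Suc 0)))\<^esub>"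
  and Hw: "\<And>\<alpha>. \<alpha> \<in>. (C (Suc 0)) ==> i (H \<alpha>) (Suc (Suc 0)) w = \<alpha>"
 shows "hamilton_operator K G C d L i H"
proof -
 interpret C0: module K "C 0" by (rule C_module)
 interpret C1: module K "C (Suc 0)" by (rule C_module)
 interpret C2: module K "C (Suc (Suc 0))" by (rule C_module)
 note Hc = lin_closed[OF H]
 note il1 = i_linear[of _ 0] and il2 = i_linear[of _ "Suc 0"] and il3 = i_linear[of _ "Suc (Suc 0)"]
 note ll = L_linear
 have ic [simp]: "x \<in>. G ==> c \<in>. (C (Suc 0)) ==> i x (Suc 0) c \<in>. C 0"
  "x \<in>. G ==> c \<in>. (C (Suc (Suc 0))) ==> i x (Suc (Suc 0)) c \<in>. (C (Suc 0))"
  "x \<in>. G ==> c \<in>. (C (Suc (Suc (Suc 0)))) ==> i x (Suc (Suc (Suc 0))) c \<in>. (C (Suc (Suc 0)))" for x c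
  by (rule lin_closed[OF il1], assumption+, rule lin_closed[OF il2], assumption+, rule lin_closed[OF il3], assumption+)
 have lc [simp]: "x \<in>. G ==> c \<in>. C k ==> L x k c \<in>. C k" for x c k
  using lin_closed[OF L_linear] .
 have br [simp]: "x \<in>. G ==> y \<in>. G ==> x \<otimes>\<^sub>G y \<in>. G" for x y
  using lin_closed[OF G.bracket_linear_right] .
 have dc [simp]: "c \<in>. C 0 ==> d 0 c \<in>. (C (Suc 0))" "c \<in>. (C (Suc 0)) ==> d (Suc 0) c \<in>. (C (Suc (Suc 0)))" for c
  using lin_closed[OF d_linear[of 0]] lin_closed[OF d_linear[of "Suc 0"]] by simp_all
 have ii: "i x (Suc 0) (i y (Suc (Suc 0)) w) \<oplus>\<^bsub>C 0\<^esub> i y (Suc 0) (i x (Suc (Suc 0)) w) = \<zero>\<^bsub>C 0\<^esub>" if "x \<in>. G" "y \<in>. G" for x y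
  using i_i[of x y w 0] that w by simp
 \<comment> \<open>The value of the 2-form \<open>w\<close> on a pair; all terms of the cyclic
   identity are expressed by \<open>f\<close> and Lie derivatives of its values.\<close>
 define f where "f x y = i x (Suc 0) (i y (Suc (Suc 0)) w)" for x y
 have fc [simp]: "x \<in>. G ==> y \<in>. G ==> f x y \<in>. C 0" for x y
  using w by (simp add: f_def)
 have fs: "f x y = \<ominus>\<^bsub>C 0\<^esub> f y x" if "x \<in>. G" "y \<in>. G" for x y
  using ii[OF that] that by (simp add: f_def[symmetric] C0.minus_equality C0.a_comm)
 have Lf: "i z (Suc 0) (L x (Suc 0) (i y (Suc (Suc 0)) w)) = L x 0 (f z y) \<ominus>\<^bsub>C 0\<^esub> f (x \<otimes>\<^sub>G z) y"
  if "x \<in>. G" "y \<in>. G" "z \<in>. G" for x y z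
 proof -
  have "L x 0 (i z (Suc 0) (i y (Suc (Suc 0)) w)) \<ominus>\<^bsub>C 0\<^esub> i z (Suc 0) (L x (Suc 0) (i y (Suc (Suc 0)) w)) = i (x \<otimes>\<^sub>G z) (Suc 0) (i y (Suc (Suc 0)) w)"
   using L_i[of x z "i y (Suc (Suc 0)) w" 0] that w by simp
  moreover have "i z (Suc 0) (L x (Suc 0) (i y (Suc (Suc 0)) w)) = L x 0 (f z y) \<ominus>\<^bsub>C 0\<^esub> (L x 0 (f z y) \<ominus>\<^bsub>C 0\<^esub> i z (Suc 0) (L x (Suc 0) (i y (Suc (Suc 0)) w)))"
  proof -
   have "i z (Suc 0) (L x (Suc 0) (i y (Suc (Suc 0)) w)) \<in>. C 0" "L x 0 (f z y) \<in>. C 0" using that w by simp_all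
   then show ?thesis by algebra
  qed
  ultimately show ?thesis by (simp add: f_def)
 qed
 text \<open>The cyclic identity is \<open>dw(x, y, z) = 0\<close>, evaluated by the Cartan formulas.\<close>
 have key: "i z (Suc 0) (L x (Suc 0) (i y (Suc (Suc 0)) w)) \<oplus>\<^bsub>C 0\<^esub> i x (Suc 0) (L y (Suc 0) (i z (Suc (Suc 0)) w)) \<oplus>\<^bsub>C 0\<^esub> i y (Suc 0) (L z (Suc 0) (i x (Suc (Suc 0)) w)) = \<zero>\<^bsub>C 0\<^esub>"
  if xyz [simp]: "x \<in>. G" "y \<in>. G" "z \<in>. G" for x y z
 proof -
  note [simp] = w
  \<comment> \<open>Closedness of \<open>w\<close> leaves a single term of the Cartan
    formula.\<close>
  have "L x (Suc (Suc 0)) w = d (Suc 0) (i x (Suc (Suc 0)) w) \<oplus>\<^bsub>C (Suc (Suc 0))\<^esub> i x (Suc (Suc (Suc 0))) (d (Suc (Suc 0)) w)" using cartan_Suc[of x w "Suc 0"] by simp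
  moreover have "i x (Suc (Suc (Suc 0))) (d (Suc (Suc 0)) w) = \<zero>\<^bsub>C (Suc (Suc 0))\<^esub>" using dw lin_zero[OF il3 C_module C_module] by simp
  ultimately have Lw: "L x (Suc (Suc 0)) w = d (Suc 0) (i x (Suc (Suc 0)) w)"
   by (simp add: C2.r_zero)
  have e1: "L x (Suc 0) (i y (Suc (Suc 0)) w) \<ominus>\<^bsub>C (Suc 0)\<^esub> i y (Suc (Suc 0)) (L x (Suc (Suc 0)) w) = i (x \<otimes>\<^sub>G y) (Suc (Suc 0)) w"
   using L_i[of x y w "Suc 0"] by simp
  have e2: "L y (Suc 0) (i x (Suc (Suc 0)) w) = d 0 (f y x) \<oplus>\<^bsub>C (Suc 0)\<^esub> i y (Suc (Suc 0)) (d (Suc 0) (i x (Suc (Suc 0)) w))"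
   using cartan_Suc[of y "i x (Suc (Suc 0)) w" 0] by (simp add: f_def)
  define p q r s where pqrs: "p = L x (Suc 0) (i y (Suc (Suc 0)) w)" "q = L y (Suc 0) (i x (Suc (Suc 0)) w)" "r = d 0 (f y x)" "s = i (x \<otimes>\<^sub>G y) (Suc (Suc 0)) w"
  have pc: "p \<in>. (C (Suc 0))" "q \<in>. (C (Suc 0))" "r \<in>. (C (Suc 0))" "s \<in>. (C (Suc 0))" "i y (Suc (Suc 0)) (L x (Suc (Suc 0)) w) \<in>. (C (Suc 0))"
   by (simp_all add: pqrs)
  have "p = q \<ominus>\<^bsub>C (Suc 0)\<^esub> r \<oplus>\<^bsub>C (Suc 0)\<^esub> s"
  proof -
   have "i y (Suc (Suc 0)) (L x (Suc (Suc 0)) w) = q \<ominus>\<^bsub>C (Suc 0)\<^esub> r"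
   proof -
    have "q = r \<oplus>\<^bsub>C (Suc 0)\<^esub> i y (Suc (Suc 0)) (L x (Suc (Suc 0)) w)" using e2 by (simp add: pqrs Lw)
    then have "q \<ominus>\<^bsub>C (Suc 0)\<^esub> r = (r \<oplus>\<^bsub>C (Suc 0)\<^esub> i y (Suc (Suc 0)) (L x (Suc (Suc 0)) w)) \<ominus>\<^bsub>C (Suc 0)\<^esub> r" by simp
    also have "\<dots> = i y (Suc (Suc 0)) (L x (Suc (Suc 0)) w)" using pc by algebra
    finally show ?thesis by simp
   qed
   moreover have "p = i y (Suc (Suc 0)) (L x (Suc (Suc 0)) w) \<oplus>\<^bsub>C (Suc 0)\<^esub> (p \<ominus>\<^bsub>C (Suc 0)\<^esub> i y (Suc (Suc 0)) (L x (Suc (Suc 0)) w))" using pc by algebra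
   ultimately show ?thesis using e1 by (simp add: pqrs)
  qed
  then have "i z (Suc 0) p = i z (Suc 0) q \<ominus>\<^bsub>C 0\<^esub> i z (Suc 0) r \<oplus>\<^bsub>C 0\<^esub> i z (Suc 0) s"
   using pc by (simp add: lin_add[OF il1] lin_minus[OF il1 C_module C_module])
  then have main: "i z (Suc 0) (L x (Suc 0) (i y (Suc (Suc 0)) w)) = i z (Suc 0) (L y (Suc 0) (i x (Suc (Suc 0)) w)) \<ominus>\<^bsub>C 0\<^esub> L z 0 (f y x) \<oplus>\<^bsub>C 0\<^esub> f z (x \<otimes>\<^sub>G y)"
   using cartan_0[of z "f y x"] by (simp add: pqrs f_def)
  define a b c u v t where abc: "a = L x 0 (f z y)" "b = L y 0 (f z x)" "c = L z 0 (f x y)"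
   "u = f (x \<otimes>\<^sub>G z) y" "v = f (y \<otimes>\<^sub>G z) x" "t = f (x \<otimes>\<^sub>G y) z"
  have cl: "a \<in>. C 0" "b \<in>. C 0" "c \<in>. C 0" "u \<in>. C 0" "v \<in>. C 0" "t \<in>. C 0"
   by (simp_all add: abc)
  note ln = lin_neg[OF L_linear C_module C_module]
  have anti: "x \<otimes>\<^sub>G y = \<ominus>\<^sub>G (y \<otimes>\<^sub>G x)" if "x \<in>. G" "y \<in>. G" for x y
  proof -
   have c: "x \<otimes>\<^sub>G y \<in>. G" "y \<otimes>\<^sub>G x \<in>. G" using that by simp_all
   have "\<zero>\<^sub>G = (x \<oplus>\<^sub>G y) \<otimes>\<^sub>G (x \<oplus>\<^sub>G y)" using that by (simp add: G.bracket_alternating)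
   also have "\<dots> = x \<otimes>\<^sub>G (x \<oplus>\<^sub>G y) \<oplus>\<^sub>G y \<otimes>\<^sub>G (x \<oplus>\<^sub>G y)"
    using that by (intro lin_add[OF G.bracket_linear_left]) simp_all
   also have "\<dots> = x \<otimes>\<^sub>G y \<oplus>\<^sub>G y \<otimes>\<^sub>G x"
    using that c by (simp add: lin_add[OF G.bracket_linear_right] G.bracket_alternating)
   finally show ?thesis using c G.minus_equality by metis
  qed
  have fneg: "f (\<ominus>\<^sub>G g) h = \<ominus>\<^bsub>C 0\<^esub> f g h" if "g \<in>. G" "h \<in>. G" for g h
   using lin_neg[OF i_linear_arg[of "i h (Suc (Suc 0)) w" 0] G.module_axioms C_module] that by (simp add: f_def)
  have t1: "i z (Suc 0) (L x (Suc 0) (i y (Suc (Suc 0)) w)) = a \<ominus>\<^bsub>C 0\<^esub> u" by (simp add: Lf abc)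
  have t2: "i z (Suc 0) (L y (Suc 0) (i x (Suc (Suc 0)) w)) = b \<ominus>\<^bsub>C 0\<^esub> v" by (simp add: Lf abc)
  have t3: "i x (Suc 0) (L y (Suc 0) (i z (Suc (Suc 0)) w)) = \<ominus>\<^bsub>C 0\<^esub> b \<oplus>\<^bsub>C 0\<^esub> t"
   using cl by (simp add: Lf abc fs[of x z] ln anti[of y x] fneg a_minus_def)
  have t4: "i y (Suc 0) (L z (Suc 0) (i x (Suc (Suc 0)) w)) = \<ominus>\<^bsub>C 0\<^esub> c \<oplus>\<^bsub>C 0\<^esub> v"
   using cl by (simp add: Lf abc fs[of y x] ln anti[of z y] fneg a_minus_def)
  have "a \<ominus>\<^bsub>C 0\<^esub> u = (b \<ominus>\<^bsub>C 0\<^esub> v) \<oplus>\<^bsub>C 0\<^esub> c \<ominus>\<^bsub>C 0\<^esub> t"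
   using main unfolding t1 t2 using cl by (simp add: fs[of y x] fs[of z "x \<otimes>\<^sub>G y"] ln abc a_minus_def)
  then show ?thesis unfolding t1 t3 t4 using cl by (simp only:) algebra
 qed
 show ?thesis
 proof (intro hamilton_operator.intro equivariant_complex_axioms hamilton_operator_axioms.intro)
  fix \<alpha> \<beta> assume ab: "\<alpha> \<in>. C 1" "\<beta> \<in>. C 1"
  show "i (H \<alpha>) 1 \<beta> \<oplus>\<^bsub>C 0\<^esub> i (H \<beta>) 1 \<alpha> = \<zero>\<^bsub>C 0\<^esub>"
   using ii[OF Hc[OF ab(1)[simplified]] Hc[OF ab(2)[simplified]]] by (simp add: Hw ab[simplified])
  fix \<gamma> assume c: "\<gamma> \<in>. C 1"
  show "i (H \<gamma>) 1 (L (H \<alpha>) 1 \<beta>) \<oplus>\<^bsub>C 0\<^esub> i (H \<alpha>) 1 (L (H \<beta>) 1 \<gamma>) \<oplus>\<^bsub>C 0\<^esub> i (H \<beta>) 1 (L (H \<gamma>) 1 \<alpha>) = \<zero>\<^bsub>C 0\<^esub>"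
   using key[OF Hc[OF ab(1)[simplified]] Hc[OF ab(2)[simplified]] Hc[OF c[simplified]]] by (simp add: Hw ab[simplified] c[simplified])
 qed (use H in simp)
qed

end

context hamilton_operator
begin

text \<open>As d(dq) = 0, the Lie derivative of dq along H(dp) is d of the bracket of p and q, so
  the cyclic identity becomes the Jacobi identity. One half turns skew-symmetry into the alternating
  law.\<close>

lemma lie_C0:
 assumes two: "\<exists>h\<in>carrier K. h \<oplus>\<^sub>K h = \<one>\<^sub>K"
 shows "lie_algebra K ((C 0)\<lparr>mult := \<lambda>p q. i (H (d 0 p)) (Suc 0) (d 0 q)\<rparr>)" (is "lie_algebra K ?Q")
proof -
 interpret C0: module K "C 0" by (rule C_module)
 have Q: "module K ?Q"
  by (rule module_image[OF C_module[of 0], where p = "\<lambda>x. x"]) simp_all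
 note dl = d_linear[of 0] and il = i_linear[of _ 0]
 have H1: "linear_map K (C (Suc 0)) G H" using H_linear by simp
 note Hd = lin_comp[OF dl H1]
 have c [simp]: "p \<in>. C 0 ==> H (d 0 p) \<in>. G" "p \<in>. C 0 ==> d 0 p \<in>. (C (Suc 0))" for p
  by (rule lin_closed[OF Hd], assumption, rule lin_closed[OF dl], assumption)
 have lr: "linear_map K (C 0) (C 0) (\<lambda>q. i (H (d 0 p)) (Suc 0) (d 0 q))" if "p \<in>. C 0" for p
  by (rule lin_comp[OF dl il]) (simp add: that)
 have ll: "linear_map K (C 0) (C 0) (\<lambda>p. i (H (d 0 p)) (Suc 0) (d 0 q))" if "q \<in>. C 0" for q
  using lin_comp[OF Hd i_linear_arg[of "d 0 q" 0]] that by simp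
 have skew: "i (H (d 0 p)) (Suc 0) (d 0 q) \<oplus>\<^bsub>C 0\<^esub> i (H (d 0 q)) (Suc 0) (d 0 p) = \<zero>\<^bsub>C 0\<^esub>"
  if "p \<in>. C 0" "q \<in>. C 0" for p q
  using that H_skew[of "d 0 p" "d 0 q"] by simp
 have brc [simp]: "p \<in>. C 0 ==> q \<in>. C 0 ==> i (H (d 0 p)) (Suc 0) (d 0 q) \<in>. C 0" for p q
  using lin_closed[OF lr] .
 have jac: "i (H (d 0 r)) (Suc 0) (d 0 (i (H (d 0 p)) (Suc 0) (d 0 q))) = i (H (d 0 r)) (Suc 0) (L (H (d 0 p)) (Suc 0) (d 0 q))"
  if "p \<in>. C 0" "q \<in>. C 0" "r \<in>. C 0" for p q r
 proof -
  interpret C1: module K "C (Suc 0)" by (rule C_module)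
  have "L (H (d 0 p)) (Suc 0) (d 0 q) = d 0 (i (H (d 0 p)) (Suc 0) (d 0 q)) \<oplus>\<^bsub>C (Suc 0)\<^esub> i (H (d 0 p)) (Suc (Suc 0)) (d (Suc 0) (d 0 q))"
   using cartan_Suc[of "H (d 0 p)" "d 0 q" 0] that by simp
  also have "d (Suc 0) (d 0 q) = \<zero>\<^bsub>C (Suc (Suc 0))\<^esub>" using d_d[of q 0] that by simp
  also have "i (H (d 0 p)) (Suc (Suc 0)) \<zero>\<^bsub>C (Suc (Suc 0))\<^esub> = \<zero>\<^bsub>C (Suc 0)\<^esub>"
   using lin_zero[OF i_linear[of "H (d 0 p)" "Suc 0"] C_module C_module] that by simp
  finally show ?thesis using that by simp
 qed
 have alt: "i (H (d 0 p)) (Suc 0) (d 0 p) = \<zero>\<^bsub>C 0\<^esub>" if "p \<in>. C 0" for p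
 proof -
  obtain h where h: "h \<in>. K" "h \<oplus>\<^sub>K h = \<one>\<^sub>K" using two by blast
  let ?b = "i (H (d 0 p)) (Suc 0) (d 0 p)"
  have "?b = h \<odot>\<^bsub>C 0\<^esub> (?b \<oplus>\<^bsub>C 0\<^esub> ?b)"
   using C0.smult_l_distr[of h h ?b] h that by (simp add: C0.smult_r_distr)
  then show ?thesis using skew[OF that that] h by simp
 qed
 show ?thesis
 proof (intro lie_algebra.intro lie_algebra_axioms.intro Q)
  fix x y z assume xyz: "x \<in>. ?Q" "y \<in>. ?Q" "z \<in>. ?Q"
  show "x \<otimes>\<^sub>?Q (y \<otimes>\<^sub>?Q z) \<oplus>\<^sub>?Q y \<otimes>\<^sub>?Q (z \<otimes>\<^sub>?Q x) \<oplus>\<^sub>?Q z \<otimes>\<^sub>?Q (x \<otimes>\<^sub>?Q y) = \<zero>\<^sub>?Q"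
   using xyz H_cyclic[of "d 0 y" "d 0 z" "d 0 x"] by (simp add: jac)
 qed (use lr ll alt in \<open>simp_all add: linear_map_def\<close>)
qed

end



section \<open>The Lie algebra of derivations\<close>

context ncf
begin

lemma Der_ops:
 "\<theta> \<oplus>\<^sub>Dr \<psi> = (\<lambda>a\<in>carrier A. \<theta> a \<oplus>\<^sub>A \<psi> a)"
 "c \<odot>\<^sub>Dr \<theta> = (\<lambda>a\<in>carrier A. c \<odot>\<^sub>A \<theta> a)"
 "\<zero>\<^sub>Dr = (\<lambda>a\<in>carrier A. \<zero>\<^sub>A)"
 "\<theta> \<otimes>\<^sub>Dr \<psi> = (\<lambda>a\<in>carrier A. \<theta> (\<psi> a) \<ominus>\<^sub>A \<psi> (\<theta> a))"
 by (simp_all add: Der_def)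

lemma DerI:
 assumes "linear_map K A A \<theta>"
  "\<And>a b. a \<in>. A ==> b \<in>. A ==> \<theta> (a \<otimes>\<^sub>A b) = \<theta> a \<otimes>\<^sub>A b \<oplus>\<^sub>A a \<otimes>\<^sub>A \<theta> b"
  "\<And>s. s \<in> S ==> \<theta> s = \<zero>\<^sub>A"
 shows "restrict \<theta> (carrier A) \<in>. Dr"
 using assms lin_restrict[OF assms(1) module_axioms] S_sub by (auto simp: Der_def subset_iff)

lemma Der_eqI:
 "\<theta> \<in>. Dr ==> \<psi> \<in>. Dr ==> (\<And>a. a \<in>. A ==> \<theta> a = \<psi> a) ==> \<theta> = \<psi>"
 by (rule extensionalityI[of _ "carrier A"]) (auto dest: DerD(4))

lemma Der_closed: "\<theta> \<in>. Dr ==> a \<in>. A ==> \<theta> a \<in>. A"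
 by (rule lin_closed[OF DerD(1)])

lemma Der_module: "module K Dr"
proof (rule pointwise_module[OF module_axioms, where X = "carrier A"])
 show "\<zero>\<^sub>Dr \<in>. Dr"
  unfolding Der_ops by (rule DerI) (auto intro: lin_const_zero[OF module_axioms])
 fix \<theta> assume T: "\<theta> \<in>. Dr"
 note TD = DerD[OF T]
 then show "\<theta> \<in> extensional (carrier A) \<and> (\<forall>a\<in>carrier A. \<theta> a \<in>. A)"
  using lin_closed[OF TD(1)] by auto
 show "c \<odot>\<^sub>Dr \<theta> \<in>. Dr" if "c \<in>. K" for c
  unfolding Der_ops
  by (rule DerI[OF lin_scale[OF TD(1) module_axioms that]])
    (use that lin_closed[OF TD(1)] in \<open>simp_all add: TD(2,3) smult_r_distr smult_mult_left smult_mult_right\<close>)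
 fix \<psi> assume P: "\<psi> \<in>. Dr"
 note PD = DerD[OF P]
 show "\<theta> \<oplus>\<^sub>Dr \<psi> \<in>. Dr"
  unfolding Der_ops
  by (rule DerI[OF lin_plus[OF TD(1) PD(1) module_axioms]])
    (use lin_closed[OF TD(1)] lin_closed[OF PD(1)] in \<open>simp_all add: TD(2,3) PD(2,3) a_ac l_distr r_distr\<close>)
qed (simp_all add: Der_ops)

lemma bracket_closed:
 assumes T: "\<theta> \<in>. Dr" and P: "\<psi> \<in>. Dr"
 shows "\<theta> \<otimes>\<^sub>Dr \<psi> \<in>. Dr"
proof -
 note TD = DerD[OF T] and PD = DerD[OF P]
 note [simp] = lin_simps[OF TD(1)] lin_simps[OF PD(1)] lin_mod_simps[OF TD(1) module_axioms module_axioms]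
  lin_mod_simps[OF PD(1) module_axioms module_axioms]
 show ?thesis unfolding Der_ops
 proof (rule DerI)
  show "linear_map K A A (\<lambda>a. \<theta> (\<psi> a) \<ominus>\<^sub>A \<psi> (\<theta> a))"
   by (intro lin_diff lin_comp[OF TD(1) PD(1)] lin_comp[OF PD(1) TD(1)] module_axioms)
  show "\<theta> (\<psi> s) \<ominus>\<^sub>A \<psi> (\<theta> s) = \<zero>\<^sub>A" if "s \<in> S" for s
   using that by (simp add: TD(3) PD(3) r_neg a_minus_def)
  fix a b assume ab [simp]: "a \<in>. A" "b \<in>. A"
  have c: "\<theta> a \<in>. A" "\<psi> a \<in>. A" "\<theta> b \<in>. A" "\<psi> b \<in>. A"
   "\<theta> (\<psi> a) \<in>. A" "\<psi> (\<theta> a) \<in>. A" "\<theta> (\<psi> b) \<in>. A" "\<psi> (\<theta> b) \<in>. A" by simp_all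
  have "\<theta> (\<psi> (a \<otimes>\<^sub>A b)) \<ominus>\<^sub>A \<psi> (\<theta> (a \<otimes>\<^sub>A b)) =
    ((\<theta> (\<psi> a) \<otimes>\<^sub>A b \<oplus>\<^sub>A \<psi> a \<otimes>\<^sub>A \<theta> b) \<oplus>\<^sub>A (\<theta> a \<otimes>\<^sub>A \<psi> b \<oplus>\<^sub>A a \<otimes>\<^sub>A \<theta> (\<psi> b))) \<ominus>\<^sub>A
    ((\<psi> (\<theta> a) \<otimes>\<^sub>A b \<oplus>\<^sub>A \<theta> a \<otimes>\<^sub>A \<psi> b) \<oplus>\<^sub>A (\<psi> a \<otimes>\<^sub>A \<theta> b \<oplus>\<^sub>A a \<otimes>\<^sub>A \<psi> (\<theta> b)))"
   by (simp add: TD(2) PD(2))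
  also have "\<dots> = (\<theta> (\<psi> a) \<ominus>\<^sub>A \<psi> (\<theta> a)) \<otimes>\<^sub>A b \<oplus>\<^sub>A a \<otimes>\<^sub>A (\<theta> (\<psi> b) \<ominus>\<^sub>A \<psi> (\<theta> b))"
   using c ab by algebra
  finally show "\<theta> (\<psi> (a \<otimes>\<^sub>A b)) \<ominus>\<^sub>A \<psi> (\<theta> (a \<otimes>\<^sub>A b)) =
   (\<theta> (\<psi> a) \<ominus>\<^sub>A \<psi> (\<theta> a)) \<otimes>\<^sub>A b \<oplus>\<^sub>A a \<otimes>\<^sub>A (\<theta> (\<psi> b) \<ominus>\<^sub>A \<psi> (\<theta> b))" .
 qed
qed

lemma Der_lie: "lie_algebra K Dr"
proof -
 interpret D: module K "Dr" by (rule Der_module)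
 note s = DerD(1)[THEN lin_closed] DerD(1)[THEN lin_add] DerD(1)[THEN lin_smult]
 have val: "(\<theta> \<otimes>\<^sub>Dr \<psi>) a = \<theta> (\<psi> a) \<ominus>\<^sub>A \<psi> (\<theta> a)" if "a \<in>. A" for \<theta> \<psi> a
  using that by (simp add: Der_ops)
 have vals: "(\<theta> \<oplus>\<^sub>Dr \<psi>) a = \<theta> a \<oplus>\<^sub>A \<psi> a" "(c \<odot>\<^sub>Dr \<theta>) a = c \<odot>\<^sub>A \<theta> a" if "a \<in>. A" for \<theta> \<psi> a c
  using that by (simp_all add: Der_ops)
 show ?thesis
 proof (intro lie_algebra.intro lie_algebra_axioms.intro Der_module linear_mapI bracket_closed)
  fix x y z assume xyz: "x \<in>. Dr" "y \<in>. Dr" "z \<in>. Dr"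
  note cl = xyz bracket_closed[OF xyz(1,2)] bracket_closed[OF xyz(2,3)] bracket_closed[OF xyz(3,1)] bracket_closed[OF xyz(1,3)]
  note [simp] = s[OF xyz(1)] s[OF xyz(2)] s[OF xyz(3)] val vals
  note m = lin_minus[OF DerD(1)[OF xyz(1)] module_axioms module_axioms] lin_minus[OF DerD(1)[OF xyz(2)] module_axioms module_axioms]
   lin_minus[OF DerD(1)[OF xyz(3)] module_axioms module_axioms]
  show "(y \<oplus>\<^sub>Dr z) \<otimes>\<^sub>Dr x = y \<otimes>\<^sub>Dr x \<oplus>\<^sub>Dr z \<otimes>\<^sub>Dr x"
   by (rule Der_eqI) (simp_all add: xyz bracket_closed a_minus_def minus_add a_ac)
  show "x \<otimes>\<^sub>Dr (y \<oplus>\<^sub>Dr z) = x \<otimes>\<^sub>Dr y \<oplus>\<^sub>Dr x \<otimes>\<^sub>Dr z"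
   by (rule Der_eqI) (simp_all add: xyz bracket_closed a_minus_def minus_add a_ac)
  show "x \<otimes>\<^sub>Dr (y \<otimes>\<^sub>Dr z) \<oplus>\<^sub>Dr y \<otimes>\<^sub>Dr (z \<otimes>\<^sub>Dr x) \<oplus>\<^sub>Dr
    z \<otimes>\<^sub>Dr (x \<otimes>\<^sub>Dr y) = \<zero>\<^sub>Dr"
  proof (rule Der_eqI)
   fix a assume a [simp]: "a \<in>. A"
   define p1 p2 p3 p4 p5 p6 where p: "p1 = x (y (z a))" "p2 = x (z (y a))" "p3 = y (z (x a))" "p4 = y (x (z a))"
    "p5 = z (x (y a))" "p6 = z (y (x a))"
   have pc: "p1 \<in>. A" "p2 \<in>. A" "p3 \<in>. A" "p4 \<in>. A" "p5 \<in>. A" "p6 \<in>. A"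
    by (simp_all add: p)
   have "((p1 \<ominus>\<^sub>A p2) \<ominus>\<^sub>A (p3 \<ominus>\<^sub>A p6)) \<oplus>\<^sub>A ((p3 \<ominus>\<^sub>A p4) \<ominus>\<^sub>A (p5 \<ominus>\<^sub>A p2)) \<oplus>\<^sub>A ((p5 \<ominus>\<^sub>A p6) \<ominus>\<^sub>A (p1 \<ominus>\<^sub>A p4)) = \<zero>\<^sub>A"
    using pc by algebra
   moreover have "(x \<otimes>\<^sub>Dr (y \<otimes>\<^sub>Dr z) \<oplus>\<^sub>Dr y \<otimes>\<^sub>Dr (z \<otimes>\<^sub>Dr x) \<oplus>\<^sub>Dr
    z \<otimes>\<^sub>Dr (x \<otimes>\<^sub>Dr y)) a =
    ((p1 \<ominus>\<^sub>A p2) \<ominus>\<^sub>A (p3 \<ominus>\<^sub>A p6)) \<oplus>\<^sub>A ((p3 \<ominus>\<^sub>A p4) \<ominus>\<^sub>A (p5 \<ominus>\<^sub>A p2)) \<oplus>\<^sub>A ((p5 \<ominus>\<^sub>A p6) \<ominus>\<^sub>A (p1 \<ominus>\<^sub>A p4))"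
    unfolding p by (simp add: m)
   ultimately show "(x \<otimes>\<^sub>Dr (y \<otimes>\<^sub>Dr z) \<oplus>\<^sub>Dr y \<otimes>\<^sub>Dr (z \<otimes>\<^sub>Dr x) \<oplus>\<^sub>Dr
    z \<otimes>\<^sub>Dr (x \<otimes>\<^sub>Dr y)) a = \<zero>\<^sub>Dr a" by (simp add: Der_ops(3))
  qed (simp_all add: xyz bracket_closed)
 next
  fix c x y assume c: "c \<in>. K" and xy: "x \<in>. Dr" "y \<in>. Dr"
  note [simp] = s[OF xy(1)] s[OF xy(2)] val vals
  show "(c \<odot>\<^sub>Dr y) \<otimes>\<^sub>Dr x = c \<odot>\<^sub>Dr (y \<otimes>\<^sub>Dr x)"
   by (rule Der_eqI) (simp_all add: xy c bracket_closed a_minus_def smult_r_distr smult_r_minus)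
  show "x \<otimes>\<^sub>Dr (c \<odot>\<^sub>Dr y) = c \<odot>\<^sub>Dr (x \<otimes>\<^sub>Dr y)"
   by (rule Der_eqI) (simp_all add: xy c bracket_closed a_minus_def smult_r_distr smult_r_minus)
 next
  fix x assume x: "x \<in>. Dr"
  show "x \<otimes>\<^sub>Dr x = \<zero>\<^sub>Dr"
   by (rule Der_eqI) (simp_all add: x bracket_closed, simp add: Der_ops s(1)[OF x] r_neg a_minus_def)
 qed
qed

section \<open>Inner derivations and the Lie algebra \<open>HH1\<close>\<close>

lemma InnI:
 assumes "\<theta> \<in>. Dr" "b \<in>. A" "\<And>a. a \<in>. A ==> \<theta> a = b \<otimes>\<^sub>A a \<ominus>\<^sub>A a \<otimes>\<^sub>A b"
 shows "\<theta> \<in> Inn K A S"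
 using assms by (auto simp: Inn_def)

lemma Inn_submodule: "submodule (Inn K A S) K Dr"
proof -
 interpret D: module K "Dr" by (rule Der_module)
 have sm: "c \<odot>\<^sub>Dr \<theta> \<in> Inn K A S" if c: "c \<in>. K" and t: "\<theta> \<in> Inn K A S" for c \<theta>
 proof -
  obtain b where b: "\<theta> \<in>. Dr" "b \<in>. A" "\<And>a. a \<in>. A ==> \<theta> a = b \<otimes>\<^sub>A a \<ominus>\<^sub>A a \<otimes>\<^sub>A b"
   using t by (auto simp: Inn_def)
  show ?thesis
   by (rule InnI[of _ "c \<odot>\<^sub>A b"])
     (simp_all add: b c, simp add: Der_ops b c a_minus_def smult_r_distr smult_r_minus smult_mult_left smult_mult_right)
 qed
 show ?thesis
 proof (rule D.submoduleI)
  show "Inn K A S \<subseteq> carrier Dr" by (auto simp: Inn_def)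
  show "\<zero>\<^sub>Dr \<in> Inn K A S"
   by (rule InnI[of _ "\<zero>\<^sub>A"]) (simp_all, simp add: Der_ops r_neg a_minus_def)
  show "c \<odot>\<^sub>Dr \<theta> \<in> Inn K A S" if c: "c \<in>. K" and t: "\<theta> \<in> Inn K A S" for c \<theta> by (rule sm[OF that])
  show "\<ominus>\<^sub>Dr \<theta> \<in> Inn K A S" if t: "\<theta> \<in> Inn K A S" for \<theta>
  proof -
   have "\<theta> \<in>. Dr" using t by (auto simp: Inn_def)
   then have "\<ominus>\<^sub>Dr \<theta> = (\<ominus>\<^sub>K \<one>\<^sub>K) \<odot>\<^sub>Dr \<theta>" by (simp add: D.smult_l_minus)
   then show ?thesis using sm[OF _ t] by simp
  qed
  fix \<theta> \<psi> assume "\<theta> \<in> Inn K A S" "\<psi> \<in> Inn K A S"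
  then obtain b c where b: "\<theta> \<in>. Dr" "b \<in>. A" "\<And>a. a \<in>. A ==> \<theta> a = b \<otimes>\<^sub>A a \<ominus>\<^sub>A a \<otimes>\<^sub>A b"
   and c: "\<psi> \<in>. Dr" "c \<in>. A" "\<And>a. a \<in>. A ==> \<psi> a = c \<otimes>\<^sub>A a \<ominus>\<^sub>A a \<otimes>\<^sub>A c"
   by (auto simp: Inn_def)
  show "\<theta> \<oplus>\<^sub>Dr \<psi> \<in> Inn K A S"
  proof (rule InnI[of _ "b \<oplus>\<^sub>A c"])
   fix a assume a: "a \<in>. A"
   show "(\<theta> \<oplus>\<^sub>Dr \<psi>) a = (b \<oplus>\<^sub>A c) \<otimes>\<^sub>A a \<ominus>\<^sub>A a \<otimes>\<^sub>A (b \<oplus>\<^sub>A c)"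
    using a b(2) c(2) by (simp add: Der_ops b(3) c(3) l_distr r_distr a_minus_def minus_add a_ac)
  qed (simp_all add: b c)
 qed
qed

text \<open>The bracket of \<psi> with the inner derivation of \<open>b\<close> is the inner
  derivation of \<psi>(b).\<close>

lemma Inn_ideal:
 assumes t: "\<theta> \<in> Inn K A S" and p: "\<psi> \<in>. Dr"
 shows "\<theta> \<otimes>\<^sub>Dr \<psi> \<in> Inn K A S \<and> \<psi> \<otimes>\<^sub>Dr \<theta> \<in> Inn K A S"
proof -
 obtain b where b: "\<theta> \<in>. Dr" "b \<in>. A" "\<And>a. a \<in>. A ==> \<theta> a = b \<otimes>\<^sub>A a \<ominus>\<^sub>A a \<otimes>\<^sub>A b"
  using t by (auto simp: Inn_def)
 note PD = DerD[OF p]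
 note [simp] = Der_closed[OF p] b(2) Der_closed[OF b(1)]
 have pv: "\<psi> (b \<otimes>\<^sub>A a \<ominus>\<^sub>A a \<otimes>\<^sub>A b) =
   (\<psi> b \<otimes>\<^sub>A a \<oplus>\<^sub>A b \<otimes>\<^sub>A \<psi> a) \<ominus>\<^sub>A (\<psi> a \<otimes>\<^sub>A b \<oplus>\<^sub>A a \<otimes>\<^sub>A \<psi> b)" if "a \<in>. A" for a
  using that by (simp add: lin_minus[OF PD(1) module_axioms module_axioms] PD(2))
 have 1: "\<psi> \<otimes>\<^sub>Dr \<theta> \<in> Inn K A S"
 proof (rule InnI[of _ "\<psi> b"])
  fix a assume a [simp]: "a \<in>. A"
  have c: "\<psi> a \<in>. A" "\<psi> b \<in>. A" "b \<in>. A" by simp_all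
  have "(\<psi> \<otimes>\<^sub>Dr \<theta>) a = ((\<psi> b \<otimes>\<^sub>A a \<oplus>\<^sub>A b \<otimes>\<^sub>A \<psi> a) \<ominus>\<^sub>A (\<psi> a \<otimes>\<^sub>A b \<oplus>\<^sub>A a \<otimes>\<^sub>A \<psi> b)) \<ominus>\<^sub>A
    (b \<otimes>\<^sub>A \<psi> a \<ominus>\<^sub>A \<psi> a \<otimes>\<^sub>A b)"
   by (simp add: Der_ops b(3) pv)
  also have "\<dots> = \<psi> b \<otimes>\<^sub>A a \<ominus>\<^sub>A a \<otimes>\<^sub>A \<psi> b" using c a by algebra
  finally show "(\<psi> \<otimes>\<^sub>Dr \<theta>) a = \<psi> b \<otimes>\<^sub>A a \<ominus>\<^sub>A a \<otimes>\<^sub>A \<psi> b" .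
 qed (simp_all add: bracket_closed p b)
 have 2: "\<theta> \<otimes>\<^sub>Dr \<psi> \<in> Inn K A S"
 proof (rule InnI[of _ "\<ominus>\<^sub>A \<psi> b"])
  fix a assume a [simp]: "a \<in>. A"
  have c: "\<psi> a \<in>. A" "\<psi> b \<in>. A" "b \<in>. A" by simp_all
  have "(\<theta> \<otimes>\<^sub>Dr \<psi>) a = (b \<otimes>\<^sub>A \<psi> a \<ominus>\<^sub>A \<psi> a \<otimes>\<^sub>A b) \<ominus>\<^sub>A
    ((\<psi> b \<otimes>\<^sub>A a \<oplus>\<^sub>A b \<otimes>\<^sub>A \<psi> a) \<ominus>\<^sub>A (\<psi> a \<otimes>\<^sub>A b \<oplus>\<^sub>A a \<otimes>\<^sub>A \<psi> b))"
   by (simp add: Der_ops b(3) pv)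
  also have "\<dots> = (\<ominus>\<^sub>A \<psi> b) \<otimes>\<^sub>A a \<ominus>\<^sub>A a \<otimes>\<^sub>A (\<ominus>\<^sub>A \<psi> b)" using c a by algebra
  finally show "(\<theta> \<otimes>\<^sub>Dr \<psi>) a = (\<ominus>\<^sub>A \<psi> b) \<otimes>\<^sub>A a \<ominus>\<^sub>A a \<otimes>\<^sub>A (\<ominus>\<^sub>A \<psi> b)" .
 qed (simp_all add: bracket_closed p b)
 show ?thesis using 1 2 by simp
qed

lemma Der_bilinear: "bilinear K Dr Dr Dr (\<lambda>x y. x \<otimes>\<^sub>Dr y)"
 by (intro bilinearI lie_algebra.bracket_linear_left[OF Der_lie] lie_algebra.bracket_linear_right[OF Der_lie])

abbreviation "hcl \<theta> \<equiv> Inn K A S +>\<^sub>Dr \<theta>"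

lemmas HH1_module = quot_module[OF Der_module Inn_submodule, folded HH1_def]
lemmas HH1_carrier = quot_carrier[OF Der_module Inn_submodule, folded HH1_def]
lemmas HH1_proj = quot_proj_linear[OF Der_module Inn_submodule, folded HH1_def]
lemmas HH1_rep = quot_rep[OF Der_module Inn_submodule, folded HH1_def]
lemmas HH1_eq = coset_eq_iff[OF Der_module Inn_submodule]

lemma HH1_mult: "x \<in>. Dr ==> y \<in>. Dr ==> hcl x \<otimes>\<^bsub>HH1 K A S\<^esub> hcl y = hcl (x \<otimes>\<^sub>Dr y)"
 unfolding HH1_def by (rule quot_mult[OF Der_module Inn_submodule Der_bilinear Inn_ideal])

lemma HH1_lie: "lie_algebra K (HH1 K A S)"
 by (rule lie_algebra_image[OF Der_lie HH1_module HH1_proj HH1_carrier]) (rule HH1_mult)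


subsection \<open>Cartan identities on forms\<close>

lemma even_der_zero:
 assumes E: "linear_map K Om Om E"
  and m: "\<And>x y. x \<in>. Om ==> y \<in>. Om ==> E (x \<otimes>\<^sub>Om y) = E x \<otimes>\<^sub>Om y \<oplus>\<^sub>Om x \<otimes>\<^sub>Om E y"
  and 0: "\<And>a. a \<in>. A ==> E (\<phi> a) = \<zero>\<^sub>Om" "\<And>a. a \<in>. A ==> E (\<delta> a) = \<zero>\<^sub>Om" and x: "x \<in>. Om"
 shows "E x = \<zero>\<^sub>Om"
 using x by (induction rule: Om_induct) (simp_all add: 0 m lin_simps[OF E])

text \<open>The anticommutator is an even derivation and vanishes on functions and
  differentials.\<close>

lemma contr_contr:
 assumes t: "\<theta> \<in>. Dr" and p: "\<psi> \<in>. Dr" and x: "x \<in>. Om"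
 shows "ct \<theta> (ct \<psi> x) \<oplus>\<^sub>Om ct \<psi> (ct \<theta> x) = \<zero>\<^sub>Om"
 by (rule even_der_zero[OF _ _ _ _ x])
   (simp_all add: odd_der_supercomm_mult[OF odd_der_contr[OF t] odd_der_contr[OF p]] contr_fn[OF t] contr_fn[OF p]
    contr_dfn[OF t] contr_dfn[OF p] Der_closed[OF t] Der_closed[OF p] contr_simps[OF t] contr_simps[OF p]
    lin_plus[OF lin_comp[OF contr_linear[OF p] contr_linear[OF t]] lin_comp[OF contr_linear[OF t] contr_linear[OF p]] Om_module])

definition "LieOm \<theta> x = dOm (ct \<theta> x) \<oplus>\<^sub>Om ct \<theta> (dOm x)"

lemma LieOm_linear: "\<theta> \<in>. Dr ==> linear_map K Om Om (LieOm \<theta>)"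
 unfolding LieOm_def[abs_def]
 by (intro lin_plus lin_comp[OF contr_linear d_linear] lin_comp[OF d_linear contr_linear] Om_module)

text \<open>The commutator of the even derivation \<open>LieOm \<theta>\<close> with the odd
  derivation \<open>ct \<psi>\<close> is again an odd derivation, so functions and differentials
  decide; on da it is the commutator of \<theta> and \<psi> at a.\<close>

lemma LieOm_contr:
 assumes t: "\<theta> \<in>. Dr" and p: "\<psi> \<in>. Dr" and x: "x \<in>. Om"
 shows "LieOm \<theta> (ct \<psi> x) \<ominus>\<^sub>Om ct \<psi> (LieOm \<theta> x) = ct (\<theta> \<otimes>\<^sub>Dr \<psi>) x"
proof (rule odd_derivation_unique[where N = Om and rN = "mult Om" and lN = "mult Om" and \<tau> = \<sigma>,
   OF _ contr_linear[OF bracket_closed[OF t p]] _ _ _ _ x])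
 note tp = bracket_closed[OF t p]
 note Ll = LieOm_linear[OF t] and cl = contr_linear[OF p]
 note [simp] = lin_simps[OF Ll] lin_simps[OF cl] Om.sgm_simps(1) Der_closed[OF t] Der_closed[OF p] fn_simps(1) dfn_simps(1)
  lin_mod_simps[OF Ll Om_module Om_module] lin_mod_simps[OF cl Om_module Om_module]
 show "linear_map K Om Om (\<lambda>x. LieOm \<theta> (ct \<psi> x) \<ominus>\<^sub>Om ct \<psi> (LieOm \<theta> x))"
  by (intro lin_diff lin_comp[OF cl Ll] lin_comp[OF Ll cl] Om_module)
 have Lm: "LieOm \<theta> (x \<otimes>\<^sub>Om y) = LieOm \<theta> x \<otimes>\<^sub>Om y \<oplus>\<^sub>Om x \<otimes>\<^sub>Om LieOm \<theta> y" if "x \<in>. Om" "y \<in>. Om" for x y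
  unfolding LieOm_def by (rule odd_der_supercomm_mult[OF odd_der_d odd_der_contr[OF t] that])
 have Ls: "LieOm \<theta> (\<sigma> x) = \<sigma> (LieOm \<theta> x)" if "x \<in>. Om" for x
  using that by (simp add: LieOm_def contr_sgm[OF t] d_sgm Om.sgm_simps contr_simps[OF t] d_simps)
 show "LieOm \<theta> (ct \<psi> (x \<otimes>\<^sub>Om y)) \<ominus>\<^sub>Om ct \<psi> (LieOm \<theta> (x \<otimes>\<^sub>Om y)) =
   (LieOm \<theta> (ct \<psi> x) \<ominus>\<^sub>Om ct \<psi> (LieOm \<theta> x)) \<otimes>\<^sub>Om y \<oplus>\<^sub>Om \<sigma> x \<otimes>\<^sub>Om (LieOm \<theta> (ct \<psi> y) \<ominus>\<^sub>Om ct \<psi> (LieOm \<theta> y))"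
  if xy [simp]: "x \<in>. Om" "y \<in>. Om" for x y
 proof -
  define a b c d e f where a: "a = LieOm \<theta> (ct \<psi> x)" "b = ct \<psi> (LieOm \<theta> x)" "c = ct \<psi> x \<otimes>\<^sub>Om LieOm \<theta> y"
   "d = \<sigma> (LieOm \<theta> x) \<otimes>\<^sub>Om ct \<psi> y" "e = LieOm \<theta> (ct \<psi> y)" "f = ct \<psi> (LieOm \<theta> y)"
  have cl: "a \<in>. Om" "b \<in>. Om" "c \<in>. Om" "d \<in>. Om" "e \<in>. Om" "f \<in>. Om" "\<sigma> x \<in>. Om"
   by (simp_all add: a)
  have "LieOm \<theta> (ct \<psi> (x \<otimes>\<^sub>Om y)) \<ominus>\<^sub>Om ct \<psi> (LieOm \<theta> (x \<otimes>\<^sub>Om y)) =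
    ((a \<otimes>\<^sub>Om y \<oplus>\<^sub>Om c) \<oplus>\<^sub>Om (d \<oplus>\<^sub>Om \<sigma> x \<otimes>\<^sub>Om e)) \<ominus>\<^sub>Om ((b \<otimes>\<^sub>Om y \<oplus>\<^sub>Om d) \<oplus>\<^sub>Om (c \<oplus>\<^sub>Om \<sigma> x \<otimes>\<^sub>Om f))"
   unfolding a by (simp add: contr_mult[OF p] Lm Ls)
  also have "\<dots> = (a \<ominus>\<^sub>Om b) \<otimes>\<^sub>Om y \<oplus>\<^sub>Om \<sigma> x \<otimes>\<^sub>Om (e \<ominus>\<^sub>Om f)"
   using cl xy by algebra
  finally show ?thesis unfolding a .
 qed
 show "ct (\<theta> \<otimes>\<^sub>Dr \<psi>) (x \<otimes>\<^sub>Om y) = ct (\<theta> \<otimes>\<^sub>Dr \<psi>) x \<otimes>\<^sub>Om y \<oplus>\<^sub>Om \<sigma> x \<otimes>\<^sub>Om ct (\<theta> \<otimes>\<^sub>Dr \<psi>) y"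
  if "x \<in>. Om" "y \<in>. Om" for x y by (rule contr_mult[OF tp that])
 fix a assume a [simp]: "a \<in>. A"
 have L0: "LieOm \<theta> (\<phi> b) = \<phi> (\<theta> b)" if "b \<in>. A" for b
  using that by (simp add: LieOm_def contr_fn[OF t] d_fn contr_dfn[OF t] d_simps)
 have L1: "LieOm \<theta> (\<delta> a) = \<delta> (\<theta> a)"
  by (simp add: LieOm_def contr_dfn[OF t] d_fn d_dfn contr_simps[OF t])
 show "LieOm \<theta> (ct \<psi> (\<phi> a)) \<ominus>\<^sub>Om ct \<psi> (LieOm \<theta> (\<phi> a)) = ct (\<theta> \<otimes>\<^sub>Dr \<psi>) (\<phi> a)"
  by (simp add: contr_fn[OF p] L0 contr_fn[OF tp] a_minus_def)
 have "(\<theta> \<otimes>\<^sub>Dr \<psi>) a = \<theta> (\<psi> a) \<ominus>\<^sub>A \<psi> (\<theta> a)" by (simp add: Der_ops)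
 then show "LieOm \<theta> (ct \<psi> (\<delta> a)) \<ominus>\<^sub>Om ct \<psi> (LieOm \<theta> (\<delta> a)) = ct (\<theta> \<otimes>\<^sub>Dr \<psi>) (\<delta> a)"
  by (simp add: contr_dfn[OF p] contr_dfn[OF tp] L0 L1 fn_simps)
qed

lemma contr_linear_arg:
 assumes x: "x \<in>. Om"
 shows "linear_map K Dr Om (\<lambda>\<theta>. ct \<theta> x)"
proof (rule linear_mapI)
 interpret D: module K "Dr" by (rule Der_module)
 fix \<theta> assume t: "\<theta> \<in>. Dr"
 show "ct \<theta> x \<in>. Om" using x by (simp add: contr_simps[OF t])
 note [simp] = contr_simps(1)[OF t] Om.sgm_simps(1) Der_closed[OF t] fn_simps(2,3)
 show "ct (c \<odot>\<^sub>Dr \<theta>) x = c \<odot>\<^sub>Om ct \<theta> x" if c: "c \<in>. K" for c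
 proof -
  have ctt: "c \<odot>\<^sub>Dr \<theta> \<in>. Dr" using c t by simp
  show ?thesis
   by (rule odd_derivation_unique[where N = Om and rN = "mult Om" and lN = "mult Om" and \<tau> = \<sigma>,
      OF contr_linear[OF ctt] lin_scale[OF contr_linear[OF t] Om_module c] _ _ _ _ x])
     (simp_all add: contr_mult[OF ctt] contr_mult[OF t] contr_fn[OF ctt] contr_fn[OF t] contr_dfn[OF ctt] contr_dfn[OF t] c
      Omega.smult_r_distr Omega.smult_mult_left Omega.smult_mult_right, simp_all add: Der_ops c)
 qed
 fix \<psi> assume p: "\<psi> \<in>. Dr"
 have tp: "\<theta> \<oplus>\<^sub>Dr \<psi> \<in>. Dr" using t p by simp
 note [simp] = contr_simps(1)[OF p] Der_closed[OF p]
 show "ct (\<theta> \<oplus>\<^sub>Dr \<psi>) x = ct \<theta> x \<oplus>\<^sub>Om ct \<psi> x"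
  by (rule odd_derivation_unique[where N = Om and rN = "mult Om" and lN = "mult Om" and \<tau> = \<sigma>,
     OF contr_linear[OF tp] lin_plus[OF contr_linear[OF t] contr_linear[OF p] Om_module] _ _ _ _ x])
    (simp_all add: contr_mult[OF tp] contr_mult[OF t] contr_mult[OF p] contr_fn[OF tp] contr_fn[OF t] contr_fn[OF p]
     contr_dfn[OF tp] contr_dfn[OF t] contr_dfn[OF p] Omega.l_distr Omega.r_distr Omega.a_ac, simp_all add: Der_ops)
qed

end



subsection \<open>The Karoubi-de Rham complex\<close>

lemma sub_minus:
 fixes M :: "('k, 'm) module"
 assumes "module K M" "submodule U K M" "x \<in> U" "y \<in> U"
 shows "x \<ominus>\<^bsub>M\<lparr>carrier := U\<rparr>\<^esub> y = x \<ominus>\<^sub>M y"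
 using lin_minus[OF lin_from[OF lin_id[of K M] module.submoduleE(1)[OF assms(1,2)]] submodule_module[OF assms(1,2)] assms(1)] assms(3,4)
 by simp

context ncf
begin

abbreviation "DRm \<equiv> DR K A S"
abbreviation "cl \<equiv> DR_class K A S"
abbreviation "DRn \<equiv> DR_deg K A S"
abbreviation "dD \<equiv> DR_d K A S"
abbreviation "cD \<equiv> DR_contr K A S"
abbreviation "LD \<equiv> DR_Lie K A S"

lemmas DR_module = quot_module[OF Om_module super_comm_submodule, folded DR_def]
lemmas DR_carrier = quot_carrier[OF Om_module super_comm_submodule, folded DR_def DR_class_def]
lemmas cl_linear = quot_proj_linear[OF Om_module super_comm_submodule, folded DR_def DR_class_def]
lemmas cl_eq = coset_eq_iff[OF Om_module super_comm_submodule, folded DR_class_def]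
lemmas rep_cl = quot_rep_coset[OF Om_module super_comm_submodule, folded DR_class_def]
lemmas cl_simps = lin_simps[OF cl_linear] lin_mod_simps[OF cl_linear Om_module DR_module]

sublocale DR: module K DRm by (rule DR_module)

lemma DR_cases:
 assumes "X \<in>. DRm" obtains x where "x \<in>. Om" "X = cl x"
 using assms DR_carrier by auto

text \<open>Operators on classes are defined by a chosen representative. The choice is immaterial
  because the operator preserves \<open>SC\<close>.\<close>

lemma DR_op:
 assumes f: "linear_map K Om Om f" and s: "\<And>x. x \<in> SC ==> f x \<in> SC" and x: "x \<in>. Om"
 shows "cl (f (rep (cl x))) = cl (f x)"
 using s[OF rep_cl(2)[OF x]] rep_cl(1)[OF x] x lin_closed[OF f] by (simp add: cl_eq lin_minus[OF f Om_module Om_module])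

lemma DR_d_cl: "x \<in>. Om ==> dD (cl x) = cl (dOm x)"
 unfolding DR_d_def by (rule DR_op[OF d_linear odd_der_super_comm[OF odd_der_d]])

lemma DR_contr_cl: "\<theta> \<in>. Dr ==> x \<in>. Om ==> cD \<theta> (cl x) = cl (ct \<theta> x)"
 unfolding DR_contr_def by (rule DR_op[OF contr_linear odd_der_super_comm[OF odd_der_contr]])

lemma DR_iota_cl:
 assumes T: "\<Theta> \<in>. DD" and x: "x \<in>. Om"
 shows "DR_iota K A S \<Theta> (cl x) = iota \<Theta> x"
proof -
 note r = rep_cl[OF x]
 have "iota \<Theta> (rep (cl x)) \<ominus>\<^sub>Om iota \<Theta> x = \<zero>\<^sub>Om"
  using iota_super_comm[OF T r(2)] r(1) x by (simp add: iota_simps[OF T])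
 then show ?thesis
  using r(1) x by (simp add: DR_iota_def Omega.minus_eq_zero_iff iota_simps[OF T])
qed

lemma lin_DR:
 assumes f: "linear_map K Om N f" and g: "\<And>x. x \<in>. Om ==> g (cl x) = f x"
 shows "linear_map K DRm N g"
proof (rule linear_mapI)
 fix X assume "X \<in>. DRm"
 then obtain x where x: "x \<in>. Om" "X = cl x" by (rule DR_cases)
 show "g X \<in>. N" using x lin_closed[OF f] by (simp add: g)
 show "g (c \<odot>\<^sub>DRm X) = c \<odot>\<^sub>N g X" if "c \<in>. K" for c
  using x that g[of "c \<odot>\<^sub>Om x"] by (simp add: g cl_simps lin_smult[OF f])
 fix Y assume "Y \<in>. DRm"
 then obtain y where y: "y \<in>. Om" "Y = cl y" by (rule DR_cases)
 show "g (X \<oplus>\<^sub>DRm Y) = g X \<oplus>\<^sub>N g Y"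
  using x y g[of "x \<oplus>\<^sub>Om y"] by (simp add: g cl_simps lin_add[OF f])
qed

lemma DR_d_linear: "linear_map K DRm DRm dD"
 by (rule lin_DR[OF lin_comp[OF d_linear cl_linear]]) (rule DR_d_cl)

lemma DR_contr_linear: "\<theta> \<in>. Dr ==> linear_map K DRm DRm (cD \<theta>)"
proof -
 assume t: "\<theta> \<in>. Dr"
 show ?thesis by (rule lin_DR[OF lin_comp[OF contr_linear[OF t] cl_linear]]) (rule DR_contr_cl[OF t])
qed

lemma DR_iota_linear: "\<Theta> \<in>. DD ==> linear_map K DRm Om (DR_iota K A S \<Theta>)"
proof -
 assume t: "\<Theta> \<in>. DD"
 show ?thesis by (rule lin_DR[OF iota_linear[OF t]]) (rule DR_iota_cl[OF t])
qed

lemma DR_contr_linear_arg: "X \<in>. DRm ==> linear_map K Dr DRm (\<lambda>\<theta>. cD \<theta> X)"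
proof -
 assume "X \<in>. DRm"
 then obtain x where x: "x \<in>. Om" "X = cl x" by (rule DR_cases)
 show ?thesis
  by (rule lin_cong[OF lin_comp[OF contr_linear_arg[OF x(1)] cl_linear] _ Der_module]) (simp add: x DR_contr_cl)
qed

lemmas dD_simps = lin_simps[OF DR_d_linear] lin_mod_simps[OF DR_d_linear DR_module DR_module]
lemmas cD_simps = lin_simps[OF DR_contr_linear] lin_mod_simps[OF DR_contr_linear DR_module DR_module]

lemma DR_d_d: "X \<in>. DRm ==> dD (dD X) = \<zero>\<^sub>DRm"
 by (erule DR_cases) (simp add: DR_d_cl d_simps d_d cl_simps)

lemma DR_contr_contr:
 "\<theta> \<in>. Dr ==> \<psi> \<in>. Dr ==> X \<in>. DRm ==>
  cD \<theta> (cD \<psi> X) \<oplus>\<^sub>DRm cD \<psi> (cD \<theta> X) = \<zero>\<^sub>DRm"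
 by (erule DR_cases) (simp add: DR_contr_cl contr_simps contr_contr lin_add[OF cl_linear, symmetric] cl_simps(4))

lemma DR_Lie_cl: "\<theta> \<in>. Dr ==> x \<in>. Om ==> LD \<theta> (cl x) = cl (LieOm \<theta> x)"
 by (simp add: DR_Lie_def LieOm_def DR_contr_cl DR_d_cl contr_simps d_simps cl_simps)

lemma DR_Lie_linear: "\<theta> \<in>. Dr ==> linear_map K DRm DRm (LD \<theta>)"
proof -
 assume t: "\<theta> \<in>. Dr"
 show ?thesis by (rule lin_DR[OF lin_comp[OF LieOm_linear[OF t] cl_linear]]) (rule DR_Lie_cl[OF t])
qed

lemmas LD_simps = lin_simps[OF DR_Lie_linear] lin_mod_simps[OF DR_Lie_linear DR_module DR_module]

lemma DR_Lie_contr: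
 assumes "\<theta> \<in>. Dr" "\<psi> \<in>. Dr" "X \<in>. DRm"
 shows "LD \<theta> (cD \<psi> X) \<ominus>\<^sub>DRm cD \<psi> (LD \<theta> X) = cD (\<theta> \<otimes>\<^sub>Dr \<psi>) X"
proof -
 obtain x where x: "x \<in>. Om" "X = cl x" using assms(3) by (rule DR_cases)
 show ?thesis
  using x assms LieOm_contr[OF assms(1,2) x(1)] lin_closed[OF LieOm_linear[OF assms(1)]]
  by (simp add: DR_contr_cl DR_Lie_cl contr_simps bracket_closed cl_simps(6)[symmetric])
qed

lemma DR_Lie_d: "\<theta> \<in>. Dr ==> X \<in>. DRm ==> LD \<theta> (dD X) = dD (LD \<theta> X)"
 by (simp add: DR_Lie_def DR_d_d dD_simps cD_simps)

text \<open>The outer Lie derivative commutes with d, so after the Cartan formula for \<psi> both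
  halves are instances of \<open>DR_Lie_contr\<close>, one at X and one at dX.\<close>

lemma DR_Lie_Lie:
 assumes t: "\<theta> \<in>. Dr" and p: "\<psi> \<in>. Dr" and X: "X \<in>. DRm"
 shows "LD \<theta> (LD \<psi> X) \<ominus>\<^sub>DRm LD \<psi> (LD \<theta> X) = LD (\<theta> \<otimes>\<^sub>Dr \<psi>) X"
proof -
 note [simp] = dD_simps cD_simps[OF p] cD_simps[OF t] LD_simps[OF t] X
 define a b c e where abce: "a = dD (LD \<theta> (cD \<psi> X))" "b = LD \<theta> (cD \<psi> (dD X))" "c = dD (cD \<psi> (LD \<theta> X))" "e = cD \<psi> (LD \<theta> (dD X))"
 have cl: "a \<in>. DRm" "b \<in>. DRm" "c \<in>. DRm" "e \<in>. DRm" by (simp_all add: abce)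
 have 1: "LD \<theta> (LD \<psi> X) = a \<oplus>\<^sub>DRm b"
  unfolding abce DR_Lie_def[of _ _ _ \<psi>] by (simp add: DR_Lie_d[OF t])
 have 2: "LD \<psi> (LD \<theta> X) = c \<oplus>\<^sub>DRm e"
  unfolding abce DR_Lie_def[of _ _ _ \<psi>] by (simp add: DR_Lie_d[OF t])
 have 3: "a \<ominus>\<^sub>DRm c = dD (cD (\<theta> \<otimes>\<^sub>Dr \<psi>) X)"
  unfolding abce DR_Lie_contr[OF t p X, symmetric] by simp
 have 4: "b \<ominus>\<^sub>DRm e = cD (\<theta> \<otimes>\<^sub>Dr \<psi>) (dD X)"
  unfolding abce by (rule DR_Lie_contr[OF t p]) simp
 show ?thesis
  unfolding 1 2 DR.swap_minus[OF cl(1,2,3,4)] 3 4 by (simp add: DR_Lie_def)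
qed

lemma DR_deg_submodule: "submodule (DRn n) K DRm"
 unfolding DR_deg_def by (rule lin_image_submodule[OF cl_linear Om_module DR_module Om.Tdeg_submodule])

lemma DR_deg_closed: "X \<in> DRn n ==> X \<in>. DRm"
 using DR.submoduleE(1)[OF DR_deg_submodule] by auto

lemma DR_deg_cases:
 assumes "X \<in> DRn n" obtains x where "x \<in> Omd n" "x \<in>. Om" "X = cl x"
 using assms Om.Tdeg_closed unfolding DR_deg_def by blast

lemma cl_deg: "x \<in> Omd n ==> cl x \<in> DRn n"
 by (simp add: DR_deg_def)

lemma DR_d_deg: "X \<in> DRn n ==> dD X \<in> DRn (Suc n)"
 by (erule DR_deg_cases) (simp add: DR_d_cl cl_deg d_deg)

lemma DR_contr_deg: "\<theta> \<in>. Dr ==> X \<in> DRn (Suc n) ==> cD \<theta> X \<in> DRn n"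
 by (erule DR_deg_cases) (simp add: DR_contr_cl cl_deg contr_deg_Suc)

lemma DR_contr_deg_0: "\<theta> \<in>. Dr ==> X \<in> DRn 0 ==> cD \<theta> X = \<zero>\<^sub>DRm"
 by (erule DR_deg_cases) (simp add: DR_contr_cl contr_deg_0 cl_simps)

text \<open>One verification for two complexes: derivations acting on all classes, with
  \<open>r\<close> the identity, and \<open>HH1\<close> acting on the kernel complex, with
  \<open>r\<close> a choice of representatives. The last three hypotheses ask \<open>r\<close> to be
  a Lie morphism only as far as contractions on \<open>C\<close> can tell.\<close>

lemma DR_complex:
 assumes G: "lie_algebra K G" and r: "\<And>x. x \<in>. G ==> r x \<in>. Dr"
  and C: "\<And>n. submodule (C n) K DRm" "\<And>n. C n \<subseteq> DRn n"
  and Cd: "\<And>n X. X \<in> C n ==> dD X \<in> C (Suc n)"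
  and Cc: "\<And>n x X. x \<in>. G ==> X \<in> C (Suc n) ==> cD (r x) X \<in> C n"
  and radd: "\<And>n x y X. x \<in>. G ==> y \<in>. G ==> X \<in> C n ==> cD (r (x \<oplus>\<^sub>G y)) X = cD (r x \<oplus>\<^sub>Dr r y) X"
  and rsmult: "\<And>n c x X. c \<in>. K ==> x \<in>. G ==> X \<in> C n ==> cD (r (c \<odot>\<^sub>G x)) X = cD (c \<odot>\<^sub>Dr r x) X"
  and rmult: "\<And>n x y X. x \<in>. G ==> y \<in>. G ==> X \<in> C n ==> cD (r (x \<otimes>\<^sub>G y)) X = cD (r x \<otimes>\<^sub>Dr r y) X"
 shows "equivariant_complex K G (\<lambda>n. DRm\<lparr>carrier := C n\<rparr>) (\<lambda>n. dD) (\<lambda>x n. LD (r x)) (\<lambda>x n. cD (r x))"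
proof -
 interpret G: lie_algebra K G by (rule G)
 interpret D: module K "Dr" by (rule Der_module)
 have CD: "X \<in>. DRm" if "X \<in> C n" for X n using C(2) DR_deg_closed that by blast
 have Cz: "\<zero>\<^sub>DRm \<in> C n" for n by (rule DR.submodule_zero[OF C(1)])
 have Ca: "X \<oplus>\<^sub>DRm Y \<in> C n" if "X \<in> C n" "Y \<in> C n" for X Y n using DR.submoduleE(5)[OF C(1)] that .
 \<comment> \<open>In degree zero contractions give zero, which lies in every \<open>C n\<close>; so
   the Cartan formula stays inside the complex there as well.\<close>
 have Cc0: "cD (r x) X \<in> C n" if "x \<in>. G" "X \<in> C 0" for x X n
  using DR_contr_deg_0[OF r[OF that(1)]] C(2)[of 0] that(2) Cz by auto
 have CL: "LD (r x) X \<in> C n" if x: "x \<in>. G" and X: "X \<in> C n" for x X n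
 proof (cases n)
  case 0
  then show ?thesis unfolding DR_Lie_def using X x Cc Cd Cc0[OF x, of X] dD_simps(4)
   DR_contr_deg_0[OF r[OF x]] C(2)[of 0] Cz by (intro Ca) auto
 next
  case (Suc m)
  then show ?thesis unfolding DR_Lie_def using X x by (intro Ca) (auto intro: Cd Cc)
 qed
 have br: "x \<otimes>\<^sub>G y \<in>. G" if "x \<in>. G" "y \<in>. G" for x y
  using lin_closed[OF G.bracket_linear_right[OF that(1)] that(2)] .
 note sm = sub_minus[OF DR_module C(1)]
 have cadd: "cD (r (x \<oplus>\<^sub>G y)) X = cD (r x) X \<oplus>\<^sub>DRm cD (r y) X" if "x \<in>. G" "y \<in>. G" "X \<in> C n" for x y X n
  using radd[OF that] lin_add[OF DR_contr_linear_arg[OF CD[OF that(3)]] r[OF that(1)] r[OF that(2)]] by simp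
 have csm: "cD (r (c \<odot>\<^sub>G x)) X = c \<odot>\<^sub>DRm cD (r x) X" if "c \<in>. K" "x \<in>. G" "X \<in> C n" for c x X n
  using rsmult[OF that] lin_smult[OF DR_contr_linear_arg[OF CD[OF that(3)]] that(1) r[OF that(2)]] by simp
 show ?thesis
 proof (intro equivariant_complex.intro equivariant_complex_axioms.intro G submodule_module[OF DR_module C(1)])
  show "linear_map K (DRm\<lparr>carrier := C n\<rparr>) (DRm\<lparr>carrier := C (Suc n)\<rparr>) dD" for n
   using CD Cd by (auto simp: linear_map_def dD_simps)
  show "dD (dD c) = \<zero>\<^bsub>DRm\<lparr>carrier := C (Suc (Suc n))\<rparr>\<^esub>" if "c \<in>. (DRm\<lparr>carrier := C n\<rparr>)" for n c
   using CD that by (simp add: DR_d_d)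
  fix x assume x: "x \<in>. G"
  note rx = r[OF x]
  show "linear_map K (DRm\<lparr>carrier := C n\<rparr>) (DRm\<lparr>carrier := C n\<rparr>) (LD (r x))" for n
   using CD CL[OF x] by (auto simp: linear_map_def LD_simps[OF rx])
  show "linear_map K (DRm\<lparr>carrier := C (Suc n)\<rparr>) (DRm\<lparr>carrier := C n\<rparr>) (cD (r x))" for n
   using CD Cc[OF x] by (auto simp: linear_map_def cD_simps[OF rx])
  show "LD (r x) c = cD (r x) (dD c)" if "c \<in>. (DRm\<lparr>carrier := C 0\<rparr>)" for c
   using that CD C(2)[of 0] by (auto simp: DR_Lie_def DR_contr_deg_0[OF rx] dD_simps cD_simps[OF rx])
  show "LD (r x) c = dD (cD (r x) c) \<oplus>\<^bsub>DRm\<lparr>carrier := C (Suc n)\<rparr>\<^esub> cD (r x) (dD c)" for n c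
   by (simp add: DR_Lie_def)
  fix y assume y: "y \<in>. G"
  note ry = r[OF y]
  show "LD (r x) (LD (r y) c) \<ominus>\<^bsub>DRm\<lparr>carrier := C n\<rparr>\<^esub> LD (r y) (LD (r x) c) = LD (r (x \<otimes>\<^sub>G y)) c"
   if "c \<in>. (DRm\<lparr>carrier := C n\<rparr>)" for c n
  proof -
   have c: "c \<in> C n" using that by simp
   have "LD (r (x \<otimes>\<^sub>G y)) c = LD (r x \<otimes>\<^sub>Dr r y) c"
    unfolding DR_Lie_def using rmult[OF x y c] rmult[OF x y Cd[OF c]] by simp
   then show ?thesis using DR_Lie_Lie[OF rx ry CD[OF c]] CL[OF x CL[OF y c]] CL[OF y CL[OF x c]] by (simp add: sm)
  qed
  show "cD (r x) (cD (r y) c) \<oplus>\<^bsub>DRm\<lparr>carrier := C n\<rparr>\<^esub> cD (r y) (cD (r x) c) = \<zero>\<^bsub>DRm\<lparr>carrier := C n\<rparr>\<^esub>"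
   if "c \<in>. (DRm\<lparr>carrier := C (Suc (Suc n))\<rparr>)" for c n
   using that CD by (simp add: DR_contr_contr[OF rx ry])
  show "LD (r x) (cD (r y) c) \<ominus>\<^bsub>DRm\<lparr>carrier := C n\<rparr>\<^esub> cD (r y) (LD (r x) c) = cD (r (x \<otimes>\<^sub>G y)) c"
   if "c \<in>. (DRm\<lparr>carrier := C (Suc n)\<rparr>)" for c n
  proof -
   have c: "c \<in> C (Suc n)" using that by simp
   show ?thesis using DR_Lie_contr[OF rx ry CD[OF c]] rmult[OF x y c] CL[OF x Cc[OF y c]] Cc[OF y CL[OF x c]] by (simp add: sm)
  qed
 next
  show "linear_map K G (DRm\<lparr>carrier := C n\<rparr>) (\<lambda>x. LD (r x) c)" if "c \<in>. (DRm\<lparr>carrier := C n\<rparr>)" for c n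
  proof -
   have c: "c \<in> C n" using that by simp
   note cc = CD[OF c] CD[OF Cd[OF c]]
   show ?thesis
   proof (rule linear_mapI)
    fix x y assume x: "x \<in>. G" and y: "y \<in>. G"
    show "LD (r (x \<oplus>\<^sub>G y)) c = LD (r x) c \<oplus>\<^bsub>DRm\<lparr>carrier := C n\<rparr>\<^esub> LD (r y) c"
     unfolding DR_Lie_def cadd[OF x y c] cadd[OF x y Cd[OF c]]
     using cc by (simp add: dD_simps cD_simps[OF r[OF x]] cD_simps[OF r[OF y]] DR.a_ac)
   next
    fix k x assume k: "k \<in>. K" and x: "x \<in>. G"
    show "LD (r (k \<odot>\<^sub>G x)) c = k \<odot>\<^bsub>DRm\<lparr>carrier := C n\<rparr>\<^esub> LD (r x) c"
     unfolding DR_Lie_def csm[OF k x c] csm[OF k x Cd[OF c]]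
     using cc k by (simp add: dD_simps cD_simps[OF r[OF x]] DR.smult_r_distr)
   qed (use CL c in auto)
  qed
  show "linear_map K G (DRm\<lparr>carrier := C n\<rparr>) (\<lambda>x. cD (r x) c)" if "c \<in>. (DRm\<lparr>carrier := C (Suc n)\<rparr>)" for c n
  proof -
   have c: "c \<in> C (Suc n)" using that by simp
   show ?thesis
    by (rule linear_mapI) (use c in \<open>simp_all add: cadd[OF _ _ c] csm[OF _ _ c] Cc\<close>)
  qed
 qed
qed

lemma Der_complex:
 "equivariant_complex K Dr (\<lambda>n. DRm\<lparr>carrier := DRn n\<rparr>) (\<lambda>n. dD) (\<lambda>\<theta> n. LD \<theta>) (\<lambda>\<theta> n. cD \<theta>)"
 by (rule DR_complex[OF Der_lie, where r = "\<lambda>x. x"]) (simp_all add: DR_deg_submodule DR_d_deg DR_contr_deg)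


subsection \<open>Degree zero\<close>

abbreviation "NA \<equiv> nat_alg K A"

lemmas NA_module = quot_module[OF module_axioms comms_submodule, folded nat_alg_def]
lemmas NA_carrier = quot_carrier[OF module_axioms comms_submodule, folded nat_alg_def nat_class_def]
lemmas ncl_linear = quot_proj_linear[OF module_axioms comms_submodule, folded nat_alg_def nat_class_def]
lemmas ncl_eq = coset_eq_iff[OF module_axioms comms_submodule, folded nat_class_def]
lemmas NA_rep = quot_rep[OF module_axioms comms_submodule, folded nat_alg_def nat_class_def]
lemmas rep_ncl = quot_rep_coset[OF module_axioms comms_submodule, folded nat_class_def]

lemma fn_comms: "a \<in> lin_span K A comms ==> \<phi> a \<in> SC"
proof (erule lin_span_map_into[OF fn_linear module_axioms Om_module comms_closed super_comm_submodule, rotated])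
 fix h assume "h \<in> comms"
 then obtain a b where ab: "h = a \<otimes>\<^sub>A b \<ominus>\<^sub>A b \<otimes>\<^sub>A a" "a \<in>. A" "b \<in>. A" by blast
 then have "\<phi> h = \<kappa> (tens K Om {} (\<phi> a) (\<phi> b))"
  by (simp add: \<kappa>_tens fn_simps sw_deg[OF fn_deg fn_deg])
 then show "\<phi> h \<in> SC" using ab by (simp add: \<kappa>_in fn_simps)
qed

lemma nat_to_DR_ncl: "a \<in>. A ==> nat_to_DR K A S (nat_class K A a) = cl (\<phi> a)"
 unfolding nat_to_DR_def
 using rep_ncl[of a] fn_comms[of "rep (nat_class K A a) \<ominus>\<^sub>A a"] by (simp add: cl_eq fn_simps)

lemma nat_to_DR_linear: "linear_map K NA (DRm\<lparr>carrier := DRn 0\<rparr>) (nat_to_DR K A S)"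
proof (rule linear_mapI)
 fix p assume "p \<in>. NA"
 then obtain a where a: "a \<in>. A" "p = nat_class K A a" using NA_carrier by auto
 show "nat_to_DR K A S p \<in>. (DRm\<lparr>carrier := DRn 0\<rparr>)" using a by (simp add: nat_to_DR_ncl cl_deg fn_deg)
 show "nat_to_DR K A S (c \<odot>\<^sub>NA p) = c \<odot>\<^bsub>DRm\<lparr>carrier := DRn 0\<rparr>\<^esub> nat_to_DR K A S p" if "c \<in>. K" for c
  using a that by (simp add: lin_smult[OF ncl_linear, symmetric] nat_to_DR_ncl cl_simps fn_simps)
 fix q assume "q \<in>. NA"
 then obtain b where b: "b \<in>. A" "q = nat_class K A b" using NA_carrier by auto
 show "nat_to_DR K A S (p \<oplus>\<^sub>NA q) = nat_to_DR K A S p \<oplus>\<^bsub>DRm\<lparr>carrier := DRn 0\<rparr>\<^esub> nat_to_DR K A S q"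
  using a b by (simp add: lin_add[OF ncl_linear, symmetric] nat_to_DR_ncl cl_simps fn_simps)
qed

text \<open>Injectivity is the point: by \<open>pr0_super_comm\<close>, super commutators of higher
  forms contribute nothing new in degree zero.\<close>

lemma nat_to_DR_bij: "bij_betw (nat_to_DR K A S) (carrier NA) (DRn 0)"
proof (rule bij_betw_imageI)
 show "inj_on (nat_to_DR K A S) (carrier NA)"
 proof (rule inj_onI)
  fix p q assume "p \<in>. NA" "q \<in>. NA" and eq: "nat_to_DR K A S p = nat_to_DR K A S q"
  then obtain a b where ab: "a \<in>. A" "p = nat_class K A a" "b \<in>. A" "q = nat_class K A b" using NA_carrier by auto
  then have "\<phi> (a \<ominus>\<^sub>A b) \<in> SC" using eq by (simp add: nat_to_DR_ncl cl_eq fn_simps)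
  then have "pr0 (\<phi> (a \<ominus>\<^sub>A b)) \<in> lin_span K A comms" by (rule pr0_super_comm)
  then show "p = q" using ab by (simp add: pr0_fn ncl_eq)
 qed
 show "nat_to_DR K A S ` carrier NA = DRn 0"
  unfolding DR_deg_def Om.Tdeg_0 NA_carrier image_image by (rule image_cong) (simp_all add: nat_to_DR_ncl)
qed

lemma DR_d_fn: "a \<in>. A ==> dD (cl (\<phi> a)) = cl (\<delta> a)"
 by (simp add: DR_d_cl fn_simps d_fn)

lemma DR_contr_dfn: "\<theta> \<in>. Dr ==> a \<in>. A ==> cD \<theta> (cl (\<delta> a)) = cl (\<phi> (\<theta> a))"
 by (simp add: DR_contr_cl dfn_simps contr_dfn)

end


section \<open>The distinguished double derivation\<close>

text \<open>What a separability element leaves behind in an algebra over its base, and what also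
  survives in a quotient: a sum of tensors of base elements that commutes with the base and
  multiplies to the unit.\<close>

locale ncs = ncf K A S for K :: "'k ring" and A :: "('k, 'a) module" and S +
 fixes e
 assumes e_span: "e \<in> lin_span K (tsq K A {}) {tens K A {} s t | s t. s \<in> S \<and> t \<in> S}"
  and e_central: "\<And>s. s \<in> S ==> lact K A {} s e = ract K A {} e s"
  and e_mul: "tmul K A {} e = \<one>\<^sub>A"
begin

abbreviation "\<Delta> \<equiv> Delta K A e"

lemma e_gens: "{tens K A {} s t | s t. s \<in> S \<and> t \<in> S} \<subseteq> carrier (tsq K A {})"
 using S_sub by (auto simp: subset_iff)

lemma e_closed [simp]: "e \<in>. tsq K A {}"
 by (rule lin_span_closed[OF A2.tsq_module e_gens e_span])

lemma Delta_DDer: "\<Delta> \<in>. DD"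
 unfolding Delta_def
proof (rule DDerI)
 show "linear_map K A (tsq K A {}) (\<lambda>a. lact K A {} a e \<ominus>\<^bsub>tsq K A {}\<^esub> ract K A {} e a)"
  by (intro lin_diff bilinear1[OF TA.l_bilinear] bilinear2[OF TA.r_bilinear] A2.tsq_module) simp_all
 fix a b assume ab [simp]: "a \<in>. A" "b \<in>. A"
 note [simp] = TA.lr_closed
 show "lact K A {} (a \<otimes>\<^sub>A b) e \<ominus>\<^bsub>tsq K A {}\<^esub> ract K A {} e (a \<otimes>\<^sub>A b) =
  ract K A {} (lact K A {} a e \<ominus>\<^bsub>tsq K A {}\<^esub> ract K A {} e a) b \<oplus>\<^bsub>tsq K A {}\<^esub>
  lact K A {} a (lact K A {} b e \<ominus>\<^bsub>tsq K A {}\<^esub> ract K A {} e b)"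
 proof -
  define p q r where pqr: "p = lact K A {} (a \<otimes>\<^sub>A b) e" "q = ract K A {} e (a \<otimes>\<^sub>A b)" "r = ract K A {} (lact K A {} a e) b"
  have cl: "p \<in>. tsq K A {}" "q \<in>. tsq K A {}" "r \<in>. tsq K A {}" by (simp_all add: pqr)
  have "p \<ominus>\<^bsub>tsq K A {}\<^esub> q = (r \<ominus>\<^bsub>tsq K A {}\<^esub> q) \<oplus>\<^bsub>tsq K A {}\<^esub> (p \<ominus>\<^bsub>tsq K A {}\<^esub> r)" using cl by algebra
  then show ?thesis unfolding pqr by (simp add: TA.r1m TA.l2m TA.l_mult TA.r_mult TA.l_r)
 qed
qed (use S_sub in \<open>auto simp: e_central TA.lr_closed TA.M.r_neg a_minus_def\<close>)

abbreviation "e2 \<equiv> \<phi>2 e"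

lemma e2_closed [simp]: "e2 \<in>. W"
 by (simp add: lin_closed[OF fn2_linear])

text \<open>\<open>e\<close> is a sum of tensors of base elements, and \<open>D\<close> kills
  these.\<close>

lemma ext2_e:
 assumes D: "odd_der D" and 0: "\<And>s. s \<in> S ==> D (\<phi> s) = \<zero>\<^sub>Om"
 shows "ext2 D e2 = \<zero>\<^sub>W"
proof (rule lin_span_vanish[OF lin_comp[OF fn2_linear ext2_linear[OF D]] A2.tsq_module W.M.module_axioms e_gens _ e_span])
 fix h assume "h \<in> {tens K A {} s t | s t. s \<in> S \<and> t \<in> S}"
 then obtain s t where h: "h = tens K A {} s t" "s \<in> S" "t \<in> S" by blast
 then have [simp]: "s \<in>. A" "t \<in>. A" using S_sub by auto
 show "ext2 D (\<phi>2 h) = \<zero>\<^sub>W"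
  using h by (simp add: fn2_tens fn_simps ext2_tens[OF D] 0 Om.sgm_inl lin_zero[OF bilinear1[OF O2.tens_bilinear] Om_module W.M.module_axioms]
    lin_zero[OF bilinear2[OF O2.tens_bilinear] Om_module W.M.module_axioms])
qed

text \<open>The anticommutator of the two contractions is an even derivation. It vanishes on da
  because each contraction sends da to functions, which the other one kills. Applying
  \<open>diamond\<close> gives the claim.\<close>

lemma iota_Delta_contr:
 assumes t: "\<theta> \<in>. Dr" and T: "\<Theta> \<in>. DD" and x: "x \<in>. Om"
 shows "iota \<Theta> (ct \<theta> x) = \<ominus>\<^sub>Om ct \<theta> (iota \<Theta> x)"
proof -
 note D = odd_der_contr[OF t]
 note [simp] = lin_closed[OF dbl_contr_linear[OF T]] W.lr_closed contr_simps[OF t]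
  diamond_simps lin_closed[OF ext2_linear[OF D]] lin_closed[OF fn2_linear] lin_closed[OF DDerD(1)[OF T]]
 have z: "ext2 (ct \<theta>) (\<phi>2 \<xi>) = \<zero>\<^sub>W" if "\<xi> \<in>. tsq K A {}" for \<xi>
  by (rule A2.tsq_ext[OF lin_comp[OF fn2_linear ext2_linear[OF D]] lin_const_zero[OF W.M.module_axioms] W.M.module_axioms _ that])
    (simp add: fn2_tens fn_simps ext2_tens[OF D] contr_fn[OF t] Om.sgm_inl lin_zero[OF bilinear1[OF O2.tens_bilinear] Om_module W.M.module_axioms]
    lin_zero[OF bilinear2[OF O2.tens_bilinear] Om_module W.M.module_axioms])
 have "ext2 (ct \<theta>) (dct \<Theta> x) \<oplus>\<^sub>W dct \<Theta> (ct \<theta> x) = \<zero>\<^sub>W"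
  by (rule ext2_dbl_contr[OF D T _ _ lin_const_zero[OF W.M.module_axioms] _ x])
    (simp_all add: contr_fn[OF t] contr_dfn[OF t] dbl_contr_simps[OF T] dbl_contr_fn[OF T] z Der_closed[OF t] W.r1m W.l2m)
 then have "dia (ext2 (ct \<theta>) (dct \<Theta> x) \<oplus>\<^sub>W dct \<Theta> (ct \<theta> x)) = \<zero>\<^sub>Om" by simp
 then have "ct \<theta> (iota \<Theta> x) \<oplus>\<^sub>Om iota \<Theta> (ct \<theta> x) = \<zero>\<^sub>Om"
  using x by (simp add: diamond_ext2[OF D] iota_dd_def)
 then have "\<ominus>\<^sub>Om ct \<theta> (iota \<Theta> x) = iota \<Theta> (ct \<theta> x)"
  using x by (intro Omega.minus_equality) (simp_all add: Omega.a_comm iota_simps[OF T])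
 then show ?thesis by simp
qed

text \<open>The anticommutator of d with the double contraction by \<Delta> is x \<mapsto> x e - e
  x: on functions by the definition of \<Delta>, on differentials because d kills \<open>e\<close>.
  As \<open>e2\<close> is fixed by \<tau>, \<open>diamond\<close> does not see on which side x
  stands, and the result is zero.\<close>

lemma iota_Delta_d:
 assumes x: "x \<in>. Om"
 shows "iota \<Delta> (dOm x) = \<ominus>\<^sub>Om dOm (iota \<Delta> x)"
proof -
 note T = Delta_DDer and D = odd_der_d
 let ?E = "\<lambda>x. lact K Om {} x e2 \<ominus>\<^sub>W ract K Om {} e2 x"
 note [simp] = lin_closed[OF dbl_contr_linear[OF T]] W.lr_closed d_simps
  diamond_simps lin_closed[OF ext2_linear[OF D]] lin_closed[OF fn2_linear] TA.lr_closed fn_simps(1) dfn_simps(1)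
 have e0: "ext2 dOm e2 = \<zero>\<^sub>W" using S_sub by (intro ext2_e[OF D]) (auto simp: d_fn dfn_S)
 have \<Delta>v: "\<phi>2 (\<Delta> a) = ?E (\<phi> a)" if "a \<in>. A" for a
  using that by (simp add: Delta_def lin_minus[OF fn2_linear A2.tsq_module W.M.module_axioms] fn2_lact fn2_ract)
 have E: "linear_map K Om W ?E"
  by (intro lin_diff bilinear1[OF W.l_bilinear] bilinear2[OF W.r_bilinear] W.M.module_axioms) simp_all
 have "ext2 dOm (dct \<Delta> x) \<oplus>\<^sub>W dct \<Delta> (dOm x) = ?E x"
 proof (rule ext2_dbl_contr[OF D T _ _ E _ x])
  show "dct \<Delta> (dOm (\<phi> a)) = ?E (\<phi> a)" if "a \<in>. A" for a
   using that by (simp add: d_fn dbl_contr_dfn[OF T] \<Delta>v)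
  show "ext2 dOm (\<phi>2 (\<Delta> a)) \<oplus>\<^sub>W dct \<Delta> (dOm (\<delta> a)) = ?E (\<delta> a)" if "a \<in>. A" for a
   using that by (simp add: \<Delta>v d_dfn dbl_contr_simps[OF T] lin_minus[OF ext2_linear[OF D] W.M.module_axioms W.M.module_axioms]
     ext2_lact[OF D] ext2_ract[OF D] e0 d_fn Om.sgm_inl W.l2m W.r1m sgm2_fn2)
  show "?E (x \<otimes>\<^sub>Om y) = ract K Om {} (?E x) y \<oplus>\<^sub>W lact K Om {} x (?E y)"
   if [simp]: "x \<in>. Om" "y \<in>. Om" for x y
  proof -
   define p q r where pqr: "p = lact K Om {} (x \<otimes>\<^sub>Om y) e2" "q = ract K Om {} e2 (x \<otimes>\<^sub>Om y)" "r = ract K Om {} (lact K Om {} x e2) y"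
   have cl: "p \<in>. W" "q \<in>. W" "r \<in>. W" by (simp_all add: pqr)
   have "p \<ominus>\<^sub>W q = (r \<ominus>\<^sub>W q) \<oplus>\<^sub>W (p \<ominus>\<^sub>W r)" using cl by algebra
   then show ?thesis unfolding pqr by (simp add: W.r1m W.l2m W.l_mult W.r_mult W.l_r)
  qed
 qed
 then have "dia (ext2 dOm (dct \<Delta> x) \<oplus>\<^sub>W dct \<Delta> (dOm x)) = dia (?E x)" by (rule arg_cong)
 moreover have "dia (?E x) = \<zero>\<^sub>Om"
 proof -
  have "dia (ract K Om {} e2 x) = dia (lact K Om {} (evp x \<oplus>\<^sub>Om odp x) e2)"
   using x evp_simps(1)[OF x] odp_simps(1)[OF x] by (simp add: diamond_ract sgm2_fn2 W.l1)
  then have "dia (ract K Om {} e2 x) = dia (lact K Om {} x e2)" using x by (simp add: evp_odp)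
  then show ?thesis using x by (simp add: Omega.r_neg a_minus_def)
 qed
 ultimately have "dOm (iota \<Delta> x) \<oplus>\<^sub>Om iota \<Delta> (dOm x) = \<zero>\<^sub>Om"
  using x by (simp add: diamond_ext2[OF D] iota_dd_def)
 then have "\<ominus>\<^sub>Om dOm (iota \<Delta> x) = iota \<Delta> (dOm x)"
  using x by (intro Omega.minus_equality) (simp_all add: Omega.a_comm iota_simps[OF T])
 then show ?thesis by simp
qed

text \<open>An element that commutes with the base can be moved out of the middle of
  \<open>e\<close>, where the product of \<open>e\<close>, the unit, is left.\<close>

lemma tmul_inner_e:
 assumes b: "b \<in>. A" "\<And>s. s \<in> S ==> b \<otimes>\<^sub>A s = s \<otimes>\<^sub>A b"
 shows "tmul K A {} (tlift K A {} (tsq K A {}) (\<lambda>x y. tens K A {} x (b \<otimes>\<^sub>A y)) e) = b"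
proof -
 let ?J = "tlift K A {} (tsq K A {}) (\<lambda>x y. tens K A {} x (b \<otimes>\<^sub>A y))"
 have "tmul K A {} (?J e) = b \<otimes>\<^sub>A tmul K A {} e"
 proof (rule lin_span_eq[OF lin_comp[OF A2.inner_l_linear[OF refl b(1)] A2.tmul_linear] lin_comp[OF A2.tmul_linear mult_left_linear[OF b(1)]]
    A2.tsq_module module_axioms e_gens _ e_span])
  fix h assume "h \<in> {tens K A {} s t | s t. s \<in> S \<and> t \<in> S}"
  then obtain s t where h: "h = tens K A {} s t" "s \<in> S" "t \<in> S" by blast
  then have [simp]: "s \<in>. A" "t \<in>. A" using S_sub by auto
  show "tmul K A {} (?J h) = b \<otimes>\<^sub>A tmul K A {} h"
   using h(1) b(1) by (simp add: A2.inner_l_tens[OF refl b(1)] A2.tmul_tens m_assoc[symmetric] b(2)[OF h(2)])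
 qed
 then show ?thesis using b(1) by (simp add: e_mul)
qed

text \<open>Multiplying out \<open>b\<close> times \<Delta> gives an inner derivation, because the
  outer actions pass the insertion of \<open>b\<close> into the middle of \<open>e\<close>.\<close>

lemma DDer_mul_Delta:
 assumes b: "b \<in>. A" and a: "a \<in>. A"
 defines "m \<equiv> tmul K A {} (tlift K A {} (tsq K A {}) (\<lambda>x y. tens K A {} x (b \<otimes>\<^sub>A y)) e)"
 shows "m \<in>. A" and "DDer_mul K A (DDer_lact K A b \<Delta>) a = a \<otimes>\<^sub>A m \<ominus>\<^sub>A m \<otimes>\<^sub>A a"
proof -
 note J = A2.inner_l_linear[OF refl b]
 note [simp] = lin_closed[OF J] TA.lr_closed
 show "m \<in>. A" unfolding m_def by (simp add: lin_closed[OF A2.tmul_linear])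
 show "DDer_mul K A (DDer_lact K A b \<Delta>) a = a \<otimes>\<^sub>A m \<ominus>\<^sub>A m \<otimes>\<^sub>A a"
  using a unfolding m_def
  by (simp add: DDer_mul_def DDer_lact_def Delta_def lin_minus[OF J A2.tsq_module A2.tsq_module]
    lin_minus[OF A2.tmul_linear A2.tsq_module module_axioms] A2.inner_l_lact[OF refl b] A2.inner_l_ract[OF refl b]
    A2.tmul_lact A2.tmul_ract)
qed

text \<open>As \<theta> kills the base, \<open>b\<close> commutes with it and \<theta> is minus the
  derivation of \<open>b\<close> times \<Delta>. By \<open>contr_iota\<close>, contraction with
  \<theta> is then a multiple of the reduced contraction with \<Delta>, up to super commutators.
  This is why \<open>HH1\<close> acts on the kernel complex.\<close>

lemma contr_Inn:
 assumes t: "\<theta> \<in> Inn K A S" and x: "x \<in>. Om" and 0: "iota \<Delta> x = \<zero>\<^sub>Om"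
 shows "ct \<theta> x \<in> SC"
proof -
 interpret D: module K "Dr" by (rule Der_module)
 obtain b where b: "\<theta> \<in>. Dr" "b \<in>. A" "\<And>a. a \<in>. A ==> \<theta> a = b \<otimes>\<^sub>A a \<ominus>\<^sub>A a \<otimes>\<^sub>A b"
  using t by (auto simp: Inn_def)
 have bs: "b \<otimes>\<^sub>A s = s \<otimes>\<^sub>A b" if "s \<in> S" for s
 proof -
  have s: "s \<in>. A" using S_sub that by auto
  then have "b \<otimes>\<^sub>A s \<ominus>\<^sub>A s \<otimes>\<^sub>A b = \<zero>\<^sub>A" using b(3) DerD(3)[OF b(1) that] by simp
  then show ?thesis using s b(2) by (simp add: minus_eq_zero_iff)
 qed
 let ?T = "DDer_lact K A b \<Delta>"
 have T: "?T \<in>. DD" by (rule DDer_lact_closed[OF Delta_DDer b(2)])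
 note M = DDer_mul_Der[OF T]
 have eq: "DDer_mul K A ?T = \<ominus>\<^sub>Dr \<theta>"
 proof (rule Der_eqI[OF M D.a_inv_closed[OF b(1)]])
  fix a assume a: "a \<in>. A"
  have "\<ominus>\<^sub>Dr \<theta> = (\<ominus>\<^sub>K \<one>\<^sub>K) \<odot>\<^sub>Dr \<theta>" using b(1) by (simp add: D.smult_l_minus)
  then have "(\<ominus>\<^sub>Dr \<theta>) a = \<ominus>\<^sub>A \<theta> a" using a Der_closed[OF b(1) a] by (simp add: Der_ops smult_l_minus)
  also have "\<dots> = a \<otimes>\<^sub>A b \<ominus>\<^sub>A b \<otimes>\<^sub>A a" using a b(2) unfolding b(3)[OF a] by algebra
  finally show "DDer_mul K A ?T a = (\<ominus>\<^sub>Dr \<theta>) a"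
   using DDer_mul_Delta(2)[OF b(2) a] by (simp add: tmul_inner_e[OF b(2) bs])
 qed
 have "ct (DDer_mul K A ?T) x \<in> SC"
  using contr_iota[OF T x] x by (simp add: iota_DDer_lact[OF Delta_DDer b(2)] 0 fn_simps b(2) contr_simps[OF M] a_minus_def)
 then have "\<ominus>\<^sub>Om ct \<theta> x \<in> SC"
  unfolding eq using lin_neg[OF contr_linear_arg[OF x] Der_module Om_module b(1)] by simp
 then have "\<ominus>\<^sub>Om (\<ominus>\<^sub>Om ct \<theta> x) \<in> SC" by (rule Omega.submoduleE(3)[OF super_comm_submodule])
 then show ?thesis using x by (simp add: contr_simps[OF b(1)])
qed

end



section \<open>The kernel complex\<close>

context ncs
begin

abbreviation "KC n \<equiv> {X \<in> DRn n. DR_iota K A S \<Delta> X = \<zero>\<^sub>Om}"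

lemma KC_submodule: "submodule (KC n) K DRm"
proof -
 have "submodule (DRn n \<inter> {X \<in> carrier DRm. DR_iota K A S \<Delta> X = \<zero>\<^sub>Om}) K DRm"
  using DR.submodule_Inter[of "{DRn n, {X \<in> carrier DRm. DR_iota K A S \<Delta> X = \<zero>\<^sub>Om}}"] DR_deg_submodule
   lin_kernel_submodule[OF DR_iota_linear[OF Delta_DDer] DR_module Om_module] by auto
 moreover have "DRn n \<inter> {X \<in> carrier DRm. DR_iota K A S \<Delta> X = \<zero>\<^sub>Om} = KC n" using DR_deg_closed by auto
 ultimately show ?thesis by simp
qed

lemma KC_cases:
 assumes "X \<in> KC n" obtains x where "x \<in> Omd n" "x \<in>. Om" "X = cl x" "iota \<Delta> x = \<zero>\<^sub>Om"
proof -
 have "X \<in> DRn n" using assms by simp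
 then obtain x where x: "x \<in> Omd n" "x \<in>. Om" "X = cl x" by (rule DR_deg_cases)
 then show ?thesis using assms that by (simp add: DR_iota_cl[OF Delta_DDer])
qed

lemma KC_I: "x \<in> Omd n ==> iota \<Delta> x = \<zero>\<^sub>Om ==> cl x \<in> KC n"
 using Om.Tdeg_closed by (simp add: DR_iota_cl[OF Delta_DDer] cl_deg)

lemma KC_0: "KC 0 = DRn 0"
proof
 show "DRn 0 \<subseteq> KC 0"
 proof
  fix X assume "X \<in> DRn 0"
  then obtain x where x: "x \<in> Omd 0" "X = cl x" by (rule DR_deg_cases)
  show "X \<in> KC 0" unfolding x(2)
   by (rule KC_I[OF x(1)]) (simp add: iota_dd_def dbl_contr_deg_0[OF Delta_DDer x(1)] diamond_simps)
 qed
qed auto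

lemma KC_d: "X \<in> KC n ==> dD X \<in> KC (Suc n)"
 by (erule KC_cases) (simp only: DR_d_cl, rule KC_I, simp_all add: d_deg d_simps iota_Delta_d)

lemma KC_contr: "\<theta> \<in>. Dr ==> X \<in> KC (Suc n) ==> cD \<theta> X \<in> KC n"
 by (erule KC_cases) (simp only: DR_contr_cl, rule KC_I, simp_all add: contr_deg_Suc contr_simps iota_Delta_contr[OF _ Delta_DDer])

lemma contr_hcl:
 assumes "\<theta> \<in>. Dr" "\<psi> \<in>. Dr" "hcl \<theta> = hcl \<psi>" and X: "X \<in> KC n"
 shows "cD \<theta> X = cD \<psi> X"
proof -
 obtain x where x: "x \<in>. Om" "X = cl x" "iota \<Delta> x = \<zero>\<^sub>Om" using X by (rule KC_cases)
 have i: "\<theta> \<ominus>\<^sub>Dr \<psi> \<in> Inn K A S" using assms(1-3) HH1_eq by simp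
 have "ct (\<theta> \<ominus>\<^sub>Dr \<psi>) x \<in> SC" by (rule contr_Inn[OF i x(1,3)])
 then have "ct \<theta> x \<ominus>\<^sub>Om ct \<psi> x \<in> SC"
  using lin_minus[OF contr_linear_arg[OF x(1)] Der_module Om_module assms(1,2)] by simp
 then show ?thesis using x by (simp add: DR_contr_cl assms(1,2) cl_eq contr_simps)
qed

lemma HH1_rep_hcl: "\<theta> \<in>. Dr ==> X \<in> KC n ==> cD (rep (hcl \<theta>)) X = cD \<theta> X"
 using HH1_rep[of "hcl \<theta>"] by (intro contr_hcl[where n = n]) (simp_all add: HH1_carrier)

text \<open>Chosen representatives of classes respect the operations only up to inner derivations,
  and these act as zero on the kernel complex.\<close>

lemma Kcx_complex:
 "equivariant_complex K (HH1 K A S) (Kcx K A S e) (\<lambda>n. dD) (\<lambda>x n. Kcx_Lie K A S x) (\<lambda>x n. Kcx_contr K A S x)"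
proof -
 note r = HH1_rep
 have eq: "Kcx K A S e = (\<lambda>n. DRm\<lparr>carrier := KC n\<rparr>)" by (rule ext) (simp add: Kcx_def)
 show ?thesis
  unfolding Kcx_Lie_def Kcx_contr_def eq
 proof (rule DR_complex[OF HH1_lie r(1) KC_submodule])
  fix x y X n assume x: "x \<in>. HH1 K A S" and y: "y \<in>. HH1 K A S" and X: "X \<in> KC n"
  interpret D: module K "Dr" by (rule Der_module)
  show "cD (rep (x \<oplus>\<^bsub>HH1 K A S\<^esub> y)) X = cD (rep x \<oplus>\<^sub>Dr rep y) X"
   using HH1_rep_hcl[OF D.a_closed[OF r(1)[OF x] r(1)[OF y]] X] lin_add[OF HH1_proj r(1)[OF x] r(1)[OF y]] r(2)[OF x] r(2)[OF y] by simp
  show "cD (rep (x \<otimes>\<^bsub>HH1 K A S\<^esub> y)) X = cD (rep x \<otimes>\<^sub>Dr rep y) X"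
   using HH1_rep_hcl[OF bracket_closed[OF r(1)[OF x] r(1)[OF y]] X] HH1_mult[OF r(1)[OF x] r(1)[OF y]] r(2)[OF x] r(2)[OF y] by simp
  show "cD (rep (c \<odot>\<^bsub>HH1 K A S\<^esub> x)) X = cD (c \<odot>\<^sub>Dr rep x) X" if c: "c \<in>. K" for c
   using HH1_rep_hcl[OF D.smult_closed[OF c r(1)[OF x]] X] lin_smult[OF HH1_proj c r(1)[OF x]] r(2)[OF x] by simp
 next
  show "KC n \<subseteq> DRn n" for n by blast
  show "dD X \<in> KC (Suc n)" if "X \<in> KC n" for n X by (rule KC_d[OF that])
  show "cD (rep x) X \<in> KC n" if "x \<in>. HH1 K A S" "X \<in> KC (Suc n)" for n x X by (rule KC_contr[OF r(1)[OF that(1)] that(2)])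
 qed
qed

end


section \<open>Bi-symplectic forms\<close>

text \<open>Brackets live on the degree zero part of a de Rham complex and are carried to A / [A, A]
  along the inverse of \<open>nat_to_DR\<close>; used for \<open>A\<close> and for the reduced
  algebra.\<close>

lemma (in ncf) nat_lieI:
 assumes L: "lie_algebra K (DRm\<lparr>carrier := DRn 0, mult := m\<rparr>)"
  and mu: "\<And>p q. p \<in>. NA ==> q \<in>. NA ==> nat_to_DR K A S (\<mu>' p q) = m (nat_to_DR K A S p) (nat_to_DR K A S q)"
   "\<And>p q. p \<in>. NA ==> q \<in>. NA ==> \<mu>' p q \<in>. NA"
 shows "lie_algebra K (NA\<lparr>mult := \<mu>'\<rparr>)"
proof -
 let ?n = "nat_to_DR K A S" and ?D = "DRm\<lparr>carrier := DRn 0, mult := m\<rparr>"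
 let ?g = "inv_into (carrier NA) ?n"
 note bij = nat_to_DR_bij
 interpret NA: module K NA by (rule NA_module)
 interpret D: lie_algebra K ?D by (rule L)
 have g [simp]: "?g (?n p) = p" if "p \<in>. NA" for p using bij_betw_inv_into_left[OF bij that] .
 have n: thesis if "x \<in> DRn 0" "\<And>p. p \<in>. NA ==> x = ?n p ==> thesis" for x thesis
  using that bij_betw_imp_surj_on[OF bij] by blast
 have na: "?n (p \<oplus>\<^sub>NA q) = ?n p \<oplus>\<^sub>DRm ?n q" if "p \<in>. NA" "q \<in>. NA" for p q
  using lin_add[OF nat_to_DR_linear that] by simp
 have ns: "?n (c \<odot>\<^sub>NA p) = c \<odot>\<^sub>DRm ?n p" if "c \<in>. K" "p \<in>. NA" for p c
  using lin_smult[OF nat_to_DR_linear that] by simp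
 show ?thesis
 proof (rule lie_algebra_image[OF L, where p = ?g])
  show "module K (NA\<lparr>mult := \<mu>'\<rparr>)" by (rule module_image[OF NA_module, where p = "\<lambda>x. x"]) simp_all
  show "linear_map K ?D (NA\<lparr>mult := \<mu>'\<rparr>) ?g"
  proof (rule linear_mapI)
   fix x assume "x \<in>. ?D"
   then obtain p where p: "p \<in>. NA" "x = ?n p" using n by auto
   show "?g x \<in>. (NA\<lparr>mult := \<mu>'\<rparr>)" using p by simp
   show "?g (c \<odot>\<^sub>?D x) = c \<odot>\<^bsub>NA\<lparr>mult := \<mu>'\<rparr>\<^esub> ?g x" if "c \<in>. K" for c using p that by (simp add: ns[symmetric])
   fix y assume "y \<in>. ?D"
   then obtain q where q: "q \<in>. NA" "y = ?n q" using n by auto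
   show "?g (x \<oplus>\<^sub>?D y) = ?g x \<oplus>\<^bsub>NA\<lparr>mult := \<mu>'\<rparr>\<^esub> ?g y" using p q by (simp add: na[symmetric])
  qed
  show "carrier (NA\<lparr>mult := \<mu>'\<rparr>) = ?g ` carrier ?D"
   using bij_betw_imp_surj_on[OF bij_betw_inv_into[OF bij]] by simp
  show "?g x \<otimes>\<^bsub>NA\<lparr>mult := \<mu>'\<rparr>\<^esub> ?g y = ?g (x \<otimes>\<^sub>?D y)" if "x \<in>. ?D" "y \<in>. ?D" for x y
  proof -
   have xy: "x \<in> DRn 0" "y \<in> DRn 0" using that by simp_all
   obtain p where "p \<in>. NA" "x = ?n p" using xy(1) by (rule n)
   moreover obtain q where "q \<in>. NA" "y = ?n q" using xy(2) by (rule n)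
   ultimately show ?thesis by (simp add: mu(1)[symmetric] mu(2))
  qed
 qed
qed

text \<open>A form \<open>x0\<close> representing the class is fixed, so that reduced contractions
  can be computed on forms.\<close>

locale bisymp = ncf K A S for K :: "'k ring" and A :: "('k, 'a) module" and S +
 fixes \<omega> x0
 assumes bis: "bisymplectic K A S \<omega>" and x0d: "x0 \<in> Omd 2" and \<omega>: "\<omega> = cl x0"
begin

lemma x0 [simp]: "x0 \<in>. Om" using x0d by (rule Om.Tdeg_closed)

abbreviation "\<Psi> \<Theta> \<equiv> cl (iota \<Theta> x0)"

lemma iota_bij: "bij_betw (\<lambda>\<Theta>. iota \<Theta> x0) (carrier DD) (Omd (Suc 0))"
 using bis unfolding bisymplectic_def \<omega> One_nat_def by (elim conjE) (subst (asm) bij_betw_cong, erule DR_iota_cl[OF _ x0])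

abbreviation "DDcomms \<equiv> {DDer_lact K A a \<Theta> \<ominus>\<^sub>DD DDer_ract K A \<Theta> a | a \<Theta>. a \<in>. A \<and> \<Theta> \<in>. DD}"

sublocale DD: module K DD by (rule DDer_module)

lemma DDcomms_closed: "DDcomms \<subseteq> carrier DD"
 by (auto simp: DDer_lact_closed DDer_ract_closed)

lemmas DDcomms_submodule = lin_span_submodule[OF DDer_module DDcomms_closed]

lemma \<Psi>_linear: "linear_map K DD DRm \<Psi>"
 by (rule lin_comp[OF iota_linear_arg[OF x0] cl_linear])

text \<open>Commutators go to commutators because the reduced contraction is a bimodule map.
  Conversely, a one-form in \<open>SC\<close> is a sum of commutators by
  \<open>pr1_super_comm\<close>, and the inverse \<open>h\<close> of the reduced contraction, a
  bimodule map too, carries these back to \<open>DDcomms\<close>.\<close>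

lemma \<Psi>_kernel:
 assumes T: "\<Theta> \<in>. DD"
 shows "\<Psi> \<Theta> = \<zero>\<^sub>DRm \<longleftrightarrow> \<Theta> \<in> lin_span K DD DDcomms"
proof
 assume "\<Theta> \<in> lin_span K DD DDcomms"
 then show "\<Psi> \<Theta> = \<zero>\<^sub>DRm"
 proof (rule lin_span_vanish[OF \<Psi>_linear DDer_module DR_module DDcomms_closed, rotated])
  fix h assume "h \<in> DDcomms"
  then obtain a \<Phi> where h: "h = DDer_lact K A a \<Phi> \<ominus>\<^sub>DD DDer_ract K A \<Phi> a" and [simp]: "a \<in>. A" and P: "\<Phi> \<in>. DD" by blast
  have d: "iota \<Phi> x0 \<in> Omd (Suc 0)" using bij_betwE[OF iota_bij] P by blast
  note [simp] = Om.Tdeg_closed[OF d]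
  have "\<kappa> (tens K Om {} (\<phi> a) (iota \<Phi> x0)) = iota h x0"
   unfolding h using P DDer_lact_closed[OF P] DDer_ract_closed[OF P]
   by (simp add: \<kappa>_tens fn_simps sw_deg[OF fn_deg d] lin_minus[OF iota_linear_arg[OF x0] DDer_module Om_module] iota_DDer_lact iota_DDer_ract)
  moreover have "\<kappa> (tens K Om {} (\<phi> a) (iota \<Phi> x0)) \<in> SC" by (rule \<kappa>_in) (simp add: fn_simps)
  ultimately have i: "iota h x0 \<in> SC" by simp
  then show "\<Psi> h = \<zero>\<^sub>DRm"
   using cl_eq[OF super_comm_closed[OF i] Omega.zero_closed] by (simp add: super_comm_closed cl_simps a_minus_def)
 qed
next
 assume 0: "\<Psi> \<Theta> = \<zero>\<^sub>DRm"
 define h where "h \<xi> = inv_into (carrier DD) (\<lambda>\<Theta>. iota \<Theta> x0) (one_form K A S \<xi>)" for \<xi>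
 have hh: "h \<xi> = \<Phi>" if "\<Phi> \<in>. DD" "one_form K A S \<xi> = iota \<Phi> x0" for \<Phi> \<xi>
  unfolding h_def that(2) using bij_betw_inv_into_left[OF iota_bij that(1)] .
 have ex: "\<exists>\<Phi>\<in>carrier DD. one_form K A S \<xi> = iota \<Phi> x0" if "\<xi> \<in>. O1" for \<xi>
  using bij_betw_imp_surj_on[OF iota_bij] one_form_deg[OF that] by blast
 note il = lin_simps[OF iota_linear_arg[OF x0]] lin_mod_simps[OF iota_linear_arg[OF x0] DDer_module Om_module]
 note ol = lin_simps[OF one_form_linear] lin_mod_simps[OF one_form_linear Om.M.module_axioms Om_module]
 have hl: "linear_map K O1 DD h"
 proof (rule linear_mapI)
  fix \<xi> assume x: "\<xi> \<in>. O1"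
  then obtain \<Phi> where P: "\<Phi> \<in>. DD" "one_form K A S \<xi> = iota \<Phi> x0" using ex by blast
  show "h \<xi> \<in>. DD" using hh[OF P] P by simp
  show "h (c \<odot>\<^sub>O1 \<xi>) = c \<odot>\<^sub>DD h \<xi>" if "c \<in>. K" for c
   unfolding hh[OF P] by (rule hh) (simp_all add: P that ol x il)
  fix \<zeta> assume y: "\<zeta> \<in>. O1"
  then obtain \<Phi>' where P': "\<Phi>' \<in>. DD" "one_form K A S \<zeta> = iota \<Phi>' x0" using ex by blast
  show "h (\<xi> \<oplus>\<^sub>O1 \<zeta>) = h \<xi> \<oplus>\<^sub>DD h \<zeta>"
   unfolding hh[OF P] hh[OF P'] by (rule hh) (simp_all add: P P' ol x y il)
 qed
 obtain \<xi> where x: "\<xi> \<in>. O1" "iota \<Theta> x0 = one_form K A S \<xi>"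
  using bij_betwE[OF iota_bij] T unfolding Om.Tdeg_1 by blast
 have "\<Psi> \<Theta> = cl \<zero>\<^sub>Om" using 0 by (simp add: cl_simps)
 then have "iota \<Theta> x0 \<in> SC" using T by (subst (asm) cl_eq) (simp_all add: il a_minus_def)
 from pr1_super_comm[OF this] have "\<xi> \<in> lin_span K O1 comms1" by (simp add: x pr1_one_form)
 then have "h \<xi> \<in> lin_span K DD DDcomms"
 proof (rule lin_span_map_into[OF hl Om.M.module_axioms DDer_module comms1_closed DDcomms_submodule, rotated])
  fix g assume "g \<in> comms1"
  then obtain a \<zeta> where g: "g = lact K A S a \<zeta> \<ominus>\<^sub>O1 ract K A S \<zeta> a" "a \<in>. A" "\<zeta> \<in>. O1" by blast
  obtain \<Phi> where P: "\<Phi> \<in>. DD" "one_form K A S \<zeta> = iota \<Phi> x0" using ex[OF g(3)] by blast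
  have "h g = DDer_lact K A a \<Phi> \<ominus>\<^sub>DD DDer_ract K A \<Phi> a"
   using g P by (intro hh) (simp_all add: DDer_lact_closed DDer_ract_closed ol il Om.lr_closed Om.inr_l Om.inr_r iota_DDer_lact iota_DDer_ract)
  then show "h g \<in> lin_span K DD DDcomms" using g(2) P(1) by (auto intro!: lin_span_base)
 qed
 then show "\<Theta> \<in> lin_span K DD DDcomms" by (simp add: hh[OF T x(2)[symmetric]])
qed

lemma DDer_mul_kernel:
 assumes "\<Theta> \<in> lin_span K DD DDcomms"
 shows "DDer_mul K A \<Theta> = \<zero>\<^sub>Dr"
proof -
 interpret D: module K "Dr" by (rule Der_module)
 show ?thesis
  by (rule lin_span_vanish[OF DDer_mul_linear DDer_module Der_module DDcomms_closed _ assms])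
    (clarsimp simp: lin_minus[OF DDer_mul_linear DDer_module Der_module] DDer_lact_closed DDer_ract_closed DDer_mul_lact_ract
     lin_closed[OF DDer_mul_linear] D.minus_eq_zero_iff)
qed

text \<open>The definition of \<open>Ham\<close> contains two choices. The preimage class taken by
  \<open>inv_into\<close> is unique by \<open>\<Psi>_kernel\<close>; the double derivation taken by
  \<open>rep\<close> is immaterial by \<open>DDer_mul_kernel\<close>.\<close>

lemma Ham_\<Psi>:
 assumes T: "\<Theta> \<in>. DD"
 shows "Ham K A S \<omega> (\<Psi> \<Theta>) = DDer_mul K A \<Theta>"
proof -
 let ?N = "lin_span K DD DDcomms"
 let ?f = "\<lambda>X. cl (DR_iota K A S (rep X) \<omega>)"
 note qc = quot_carrier[OF DDer_module DDcomms_submodule, folded DDer_nat_def]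
 note rc = quot_rep_coset[OF DDer_module DDcomms_submodule]
 note ce = coset_eq_iff[OF DDer_module DDcomms_submodule]
 interpret D: module K "Dr" by (rule Der_module)
 have \<Psi>eq: "\<Psi> \<Phi> = \<Psi> \<Phi>' \<longleftrightarrow> \<Phi> \<ominus>\<^sub>DD \<Phi>' \<in> ?N" if "\<Phi> \<in>. DD" "\<Phi>' \<in>. DD" for \<Phi> \<Phi>'
  using that \<Psi>_kernel[of "\<Phi> \<ominus>\<^sub>DD \<Phi>'"] lin_minus[OF \<Psi>_linear DDer_module DR_module that]
   lin_closed[OF \<Psi>_linear] by (simp add: DR.minus_eq_zero_iff)
 have f: "?f (?N +>\<^sub>DD \<Phi>) = \<Psi> \<Phi>" if "\<Phi> \<in>. DD" for \<Phi>
  using rc[OF that] \<Psi>eq[OF rc(1)[OF that] that] by (simp add: \<omega> DR_iota_cl)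
 have inj: "inj_on ?f (carrier (DDer_nat K A S))"
  unfolding qc by (rule inj_onI) (elim imageE, simp only: f \<Psi>eq, simp only: ce)
 have "inv_into (carrier (DDer_nat K A S)) ?f (\<Psi> \<Theta>) = ?N +>\<^sub>DD \<Theta>"
  by (subst f[OF T, symmetric], rule inv_into_f_f[OF inj]) (use T qc in blast)
 then have "Ham K A S \<omega> (\<Psi> \<Theta>) = DDer_mul K A (rep (?N +>\<^sub>DD \<Theta>))" by (simp add: Ham_def)
 also have "\<dots> = DDer_mul K A \<Theta>"
  using DDer_mul_kernel[OF rc(2)[OF T]] rc(1)[OF T] T
  by (simp add: lin_minus[OF DDer_mul_linear DDer_module Der_module] D.minus_eq_zero_iff lin_closed[OF DDer_mul_linear])
 finally show ?thesis .
qed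

lemma DR1_cases:
 assumes "\<beta> \<in> DRn (Suc 0)" obtains \<Theta> where "\<Theta> \<in>. DD" "\<beta> = \<Psi> \<Theta>"
 using assms unfolding DR_deg_def bij_betw_imp_surj_on[OF iota_bij, symmetric] by (elim imageE) simp

lemma \<Psi>_deg: "\<Theta> \<in>. DD ==> \<Psi> \<Theta> \<in> DRn (Suc 0)"
 using bij_betwE[OF iota_bij] by (auto intro: cl_deg)

lemma Ham_linear: "linear_map K (DRm\<lparr>carrier := DRn (Suc 0)\<rparr>) Dr (Ham K A S \<omega>)"
 by (rule linear_mapI) (auto elim!: DR1_cases simp: Ham_\<Psi> lin_simps[OF DDer_mul_linear] lin_simps(2,3)[OF \<Psi>_linear, symmetric])

lemmas Ham_Der = lin_closed[OF Ham_linear, simplified]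

text \<open>\<open>contr_iota\<close> at \<open>x0\<close>. It makes \<open>Ham\<close> a right
  inverse of contraction into \<omega>, as \<open>hamiltonI\<close> requires.\<close>

lemma contr_\<Psi>: "\<Theta> \<in>. DD ==> cD (DDer_mul K A \<Theta>) \<omega> = \<Psi> \<Theta>"
 using contr_iota[of \<Theta> x0] by (simp add: \<omega> DR_contr_cl DDer_mul_Der cl_eq contr_simps iota_simps)

lemma contr_Ham: "\<beta> \<in> DRn (Suc 0) ==> cD (Ham K A S \<omega> \<beta>) \<omega> = \<beta>"
 by (erule DR1_cases) (simp add: Ham_\<Psi> contr_\<Psi>)

lemma nat_lie_lie: "lie_algebra K (nat_lie K A S \<omega>)"
 and nat_lie_ncl: "a \<in>. A ==> b \<in>. A ==>
  nat_class K A a \<otimes>\<^bsub>nat_lie K A S \<omega>\<^esub> nat_class K A b = nat_class K A (Ham K A S \<omega> (cl (\<delta> a)) b)"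
proof -
 interpret E: equivariant_complex K "Dr" "\<lambda>n. DRm\<lparr>carrier := DRn n\<rparr>" "\<lambda>n. dD" "\<lambda>\<theta> n. LD \<theta>" "\<lambda>\<theta> n. cD \<theta>"
  by (rule Der_complex)
 have H: "hamilton_operator K Dr (\<lambda>n. DRm\<lparr>carrier := DRn n\<rparr>) (\<lambda>n. dD) (\<lambda>\<theta> n. LD \<theta>) (\<lambda>\<theta> n. cD \<theta>) (Ham K A S \<omega>)"
  by (rule E.hamiltonI[OF Ham_linear, where w = \<omega>]) (use bis in \<open>simp_all add: bisymplectic_def numeral_2_eq_2 contr_Ham\<close>)
 have dn: "dD (nat_to_DR K A S p) \<in> DRn (Suc 0)" if "p \<in>. NA" for p
  using DR_d_deg bij_betwE[OF nat_to_DR_bij] that by blast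
 \<comment> \<open>On A / [A, A] a derivation acts as contraction of an exact class, hence
   independently of the representative chosen by \<open>rep\<close> in the bracket.\<close>
 have key: "nat_to_DR K A S (nat_class K A (\<theta> b)) = cD \<theta> (dD (nat_to_DR K A S (nat_class K A b)))"
  if "\<theta> \<in>. Dr" "b \<in>. A" for \<theta> b
  using that by (simp add: nat_to_DR_ncl Der_closed DR_d_fn DR_contr_dfn)
 show "lie_algebra K (nat_lie K A S \<omega>)"
  unfolding nat_lie_def
 proof (rule nat_lieI[OF hamilton_operator.lie_C0[OF H half, simplified]])
  fix p q assume p: "p \<in>. NA" and q: "q \<in>. NA"
  note r = NA_rep[OF q] Ham_Der[OF dn[OF p]]
  show "nat_class K A (Ham K A S \<omega> (dD (nat_to_DR K A S p)) (rep q)) \<in>. NA"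
   using Der_closed[OF r(3,1)] NA_carrier by blast
  show "nat_to_DR K A S (nat_class K A (Ham K A S \<omega> (dD (nat_to_DR K A S p)) (rep q))) =
    cD (Ham K A S \<omega> (dD (nat_to_DR K A S p))) (dD (nat_to_DR K A S q))"
   using key[OF r(3,1)] r(2) by simp
 qed
 show "nat_class K A a \<otimes>\<^bsub>nat_lie K A S \<omega>\<^esub> nat_class K A b = nat_class K A (Ham K A S \<omega> (cl (\<delta> a)) b)"
  if a: "a \<in>. A" and b: "b \<in>. A"
 proof -
  have q: "nat_class K A b \<in>. NA" and p: "nat_class K A a \<in>. NA" using a b NA_carrier by auto
  note r = NA_rep[OF q] Ham_Der[OF dn[OF p]]
  have "nat_to_DR K A S (nat_class K A (Ham K A S \<omega> (dD (nat_to_DR K A S (nat_class K A a))) (rep (nat_class K A b)))) =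
    nat_to_DR K A S (nat_class K A (Ham K A S \<omega> (dD (nat_to_DR K A S (nat_class K A a))) b))"
   using key[OF r(3,1)] key[OF r(3) b] r(2) by simp
  then have "nat_class K A (Ham K A S \<omega> (dD (nat_to_DR K A S (nat_class K A a))) (rep (nat_class K A b))) =
    nat_class K A (Ham K A S \<omega> (dD (nat_to_DR K A S (nat_class K A a))) b)"
   by (rule inj_onD[OF bij_betw_imp_inj_on[OF nat_to_DR_bij]]) (simp_all add: NA_carrier Der_closed[OF r(3,1)] Der_closed[OF r(3) b])
  then show ?thesis using a by (simp add: nat_lie_def nat_to_DR_ncl DR_d_fn)
 qed
qed

end



section \<open>Functoriality for surjective homomorphisms\<close>

locale alg_hom = A: tensor_square K A S + B: tensor_square K B U
 for K :: "'k ring" and A :: "('k, 'a) module" and S and B :: "('k, 'b) module" and U +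
 fixes f :: "'a \<Rightarrow> 'b"
 assumes f_linear: "linear_map K A B f"
  and f_mult: "x \<in>. A ==> y \<in>. A ==> f (x \<otimes>\<^sub>A y) = f x \<otimes>\<^sub>B f y"
  and f_one: "f \<one>\<^sub>A = \<one>\<^sub>B" and f_S_sub: "f ` S \<subseteq> U"
begin

lemmas f_simps = lin_simps[OF f_linear] lin_mod_simps[OF f_linear A.module_axioms B.module_axioms]

abbreviation "tm \<equiv> tmap K A S B U f"
abbreviation "TA \<equiv> tsq K A S"
abbreviation "TB \<equiv> tsq K B U"

lemma tm_linear: "linear_map K TA TB tm"
 by (rule A.tmap_linear[OF B.tensor_square_axioms f_linear]) (simp add: f_S_sub f_mult)

lemma tm_tens: "x \<in>. A ==> y \<in>. A ==> tm (tens K A S x y) = tens K B U (f x) (f y)"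
 by (rule A.tmap_tens[OF B.tensor_square_axioms f_linear]) (simp_all add: f_S_sub f_mult)

lemmas tm_simps = lin_simps[OF tm_linear] lin_mod_simps[OF tm_linear A.tsq_module B.tsq_module]

lemma tmul_tm: "\<xi> \<in>. TA ==> tmul K B U (tm \<xi>) = f (tmul K A S \<xi>)"
 by (erule A.tsq_ext[OF lin_comp[OF tm_linear B.tmul_linear] lin_comp[OF A.tmul_linear f_linear] B.module_axioms, rotated])
   (simp add: tm_tens B.tmul_tens A.tmul_tens f_mult f_simps)

lemma tm_lact: "a \<in>. A ==> \<xi> \<in>. TA ==> tm (lact K A S a \<xi>) = lact K B U (f a) (tm \<xi>)"
 by (erule A.tsq_ext[OF lin_comp[OF A.lact_linear tm_linear] lin_comp[OF tm_linear B.lact_linear] B.tsq_module, rotated 3])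
   (simp_all add: tm_tens A.lact_tens B.lact_tens f_mult f_simps)

lemma tm_ract: "a \<in>. A ==> \<xi> \<in>. TA ==> tm (ract K A S \<xi> a) = ract K B U (tm \<xi>) (f a)"
 by (erule A.tsq_ext[OF lin_comp[OF A.ract_linear tm_linear] lin_comp[OF tm_linear B.ract_linear] B.tsq_module, rotated 3])
   (simp_all add: tm_tens A.ract_tens B.ract_tens f_mult f_simps)

end

locale alg_surj = alg_hom +
 assumes f_surj: "f ` carrier A = carrier B" and f_S: "f ` S = U"
begin

text \<open>Right exactness of the tensor product. Modulo the span \<open>?N\<close> the class of x
  \<otimes> y depends only on f(x) and f(y), which gives a map from the tensor square of
  \<open>B\<close> back to the quotient by \<open>?N\<close>; following \<open>tm\<close> by it is
  the projection.\<close>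

lemma tm_kernel:
 assumes x: "\<xi> \<in>. TA" and 0: "tm \<xi> = \<zero>\<^sub>TB"
 shows "\<xi> \<in> lin_span K TA {tens K A S x y | x y. x \<in>. A \<and> y \<in>. A \<and> (f x = \<zero>\<^sub>B \<or> f y = \<zero>\<^sub>B)}" (is "_ \<in> ?N")
proof -
 let ?G = "{tens K A S x y | x y. x \<in>. A \<and> y \<in>. A \<and> (f x = \<zero>\<^sub>B \<or> f y = \<zero>\<^sub>B)}"
 interpret TA: module K TA by (rule A.tsq_module)
 have G: "?G \<subseteq> carrier TA" by (auto simp: subset_iff)
 note N = lin_span_submodule[OF A.tsq_module G]
 note Q = quot_module[OF A.tsq_module N] and p = quot_proj_linear[OF A.tsq_module N]
 define s where "s b = (SOME a. a \<in>. A \<and> f a = b)" for b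
 have s: "s b \<in>. A" "f (s b) = b" if "b \<in>. B" for b
 proof -
  have "\<exists>a. a \<in>. A \<and> f a = b" using that f_surj by (metis imageE)
  from someI_ex[OF this] show "s b \<in>. A" "f (s b) = b" by (simp_all add: s_def)
 qed
 let ?F = "\<lambda>b c. ?N +>\<^sub>TA tens K A S (s b) (s c)"
 \<comment> \<open>The section \<open>s\<close> is only a choice of preimages; this identity makes
   \<open>?F\<close> bilinear and balanced although \<open>s\<close> is not linear.\<close>
 have F: "?F (f x) (f y) = ?N +>\<^sub>TA tens K A S x y" if [simp]: "x \<in>. A" "y \<in>. A" for x y
 proof -
  have [simp]: "s (f x) \<in>. A" "f (s (f x)) = f x" "s (f y) \<in>. A" "f (s (f y)) = f y" by (simp_all add: s f_simps)
  note m1 = lin_minus[OF bilinear1[OF A.tens_bilinear] A.module_axioms A.tsq_module]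
   and m2 = lin_minus[OF bilinear2[OF A.tens_bilinear] A.module_axioms A.tsq_module]
  have "tens K A S (s (f x)) (s (f y)) \<ominus>\<^sub>TA tens K A S x y =
    tens K A S (s (f x) \<ominus>\<^sub>A x) (s (f y)) \<oplus>\<^sub>TA tens K A S x (s (f y) \<ominus>\<^sub>A y)"
   by (simp add: m1 m2 TA.minus_eq_trans)
  also have "\<dots> \<in> ?N"
  proof (intro TA.submoduleE(5)[OF N] lin_span_base)
   show "tens K A S (s (f x) \<ominus>\<^sub>A x) (s (f y)) \<in> ?G"
    by (rule CollectI, rule exI[of _ "s (f x) \<ominus>\<^sub>A x"], rule exI[of _ "s (f y)"]) (simp add: f_simps B.r_neg a_minus_def)
   show "tens K A S x (s (f y) \<ominus>\<^sub>A y) \<in> ?G"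
    by (rule CollectI, rule exI[of _ x], rule exI[of _ "s (f y) \<ominus>\<^sub>A y"]) (simp add: f_simps B.r_neg a_minus_def)
  qed
  finally show ?thesis by (subst coset_eq_iff[OF A.tsq_module N]) simp_all
 qed
 have ex: thesis if "b \<in>. B" "\<And>x. x \<in>. A ==> b = f x ==> thesis" for b thesis
  using that f_surj by blast
 note l1 = lin_simps[OF lin_comp[OF bilinear1[OF A.tens_bilinear] p]] and l2 = lin_simps[OF lin_comp[OF bilinear2[OF A.tens_bilinear] p]]
 have bil: "bilinear K B B (quot_mod TA ?N) ?F"
 proof (rule bilinearI; rule linear_mapI)
  fix b c assume "b \<in>. B" "c \<in>. B"
  then obtain x y where xy: "x \<in>. A" "b = f x" "y \<in>. A" "c = f y" by (metis ex)
  show "?F b c \<in>. (quot_mod TA ?N)" using xy by (simp add: F l1)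
  then show "?F b c \<in>. (quot_mod TA ?N)" .
  show "?F b (k \<odot>\<^sub>B c) = k \<odot>\<^bsub>quot_mod TA ?N\<^esub> ?F b c" if "k \<in>. K" for k
   using xy that F[of x "k \<odot>\<^sub>A y"] by (simp add: F f_simps l2)
  show "?F (k \<odot>\<^sub>B b) c = k \<odot>\<^bsub>quot_mod TA ?N\<^esub> ?F b c" if "k \<in>. K" for k
   using xy that F[of "k \<odot>\<^sub>A x" y] by (simp add: F f_simps l1)
  fix d assume "d \<in>. B"
  then obtain z where z: "z \<in>. A" "d = f z" by (metis ex)
  show "?F b (c \<oplus>\<^sub>B d) = ?F b c \<oplus>\<^bsub>quot_mod TA ?N\<^esub> ?F b d"
   using xy z F[of x "y \<oplus>\<^sub>A z"] by (simp add: F f_simps l2)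
  show "?F (b \<oplus>\<^sub>B d) c = ?F b c \<oplus>\<^bsub>quot_mod TA ?N\<^esub> ?F d c"
   using xy z F[of "x \<oplus>\<^sub>A z" y] by (simp add: F f_simps l1)
 qed
 have bal: "?F (b \<otimes>\<^sub>B t) c = ?F b (t \<otimes>\<^sub>B c)" if tbc: "t \<in> U" "b \<in>. B" "c \<in>. B" for t b c
 proof -
  obtain r where r: "r \<in> S" "t = f r" using tbc(1) f_S by blast
  obtain x y where xy: "x \<in>. A" "b = f x" "y \<in>. A" "c = f y" using tbc(2,3) by (metis ex)
  have ra: "r \<in>. A" using r A.S_sub by auto
  show ?thesis
   using xy ra F[of "x \<otimes>\<^sub>A r" y] F[of x "r \<otimes>\<^sub>A y"] A.tens_balanced[OF r(1) xy(1,3)] by (simp add: r(2) f_mult)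
 qed
 note tl = B.tlift_linear[OF Q bil bal] and tt = B.tlift_tens[OF Q bil bal]
 have "tlift K B U (quot_mod TA ?N) ?F (tm \<xi>) = ?N +>\<^sub>TA \<xi>"
  by (rule A.tsq_ext[OF lin_comp[OF tm_linear tl] p Q _ x]) (simp_all add: tm_tens tt f_simps F)
 then have "?N +>\<^sub>TA \<xi> = ?N +>\<^sub>TA \<zero>\<^sub>TA"
  using lin_zero[OF tl B.tsq_module Q] quot_zero[OF A.tsq_module N] by (simp add: 0)
 then show ?thesis using coset_eq_iff[OF A.tsq_module N x] x by (simp add: a_minus_def)
qed

end

text \<open>The homomorphism acts on two tensor squares: over the base for one-forms
  (\<open>s\<close>) and over the scalars for double derivations (\<open>s0\<close>).\<close>

locale nc_surj = A: ncs K A S e + B: ncs K B U e' + s: alg_surj K A S B U f + s0: alg_surj K A "{}" B "{}" f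
 for K :: "'k ring" and A :: "('k, 'a) module" and S e and B :: "('k, 'b) module" and U e' and f +
 assumes f_e: "tmap K A {} B {} f e = e'"
begin

abbreviation "tm0 \<equiv> tmap K A {} B {} f"
abbreviation "M \<equiv> Omega_map K A S B U f"
abbreviation "DM \<equiv> DR_map K A S B U f"

lemma tm_Omega1: "linear_map K (Omega1 K A S) (Omega1 K B U) s.tm"
proof -
 have "linear_map K (s.TA\<lparr>carrier := carrier (Omega1 K A S)\<rparr>) (s.TB\<lparr>carrier := carrier (Omega1 K B U)\<rparr>) s.tm"
  by (rule lin_into[OF lin_from[OF s.tm_linear]]) (auto simp: A.Omega1_carrier B.Omega1_carrier s.tm_simps s.tmul_tm s.f_simps)
 then show ?thesis by (simp add: linear_map_def A.Omega1_ops B.Omega1_ops)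
qed

lemma tm_univ_der: "a \<in>. A ==> s.tm (univ_der K A S a) = univ_der K B U (f a)"
 by (simp add: univ_der_def s.tm_simps s.tm_tens s.f_one)

lemma Omega1_T: "\<xi> \<in>. Omega1 K A S ==> \<xi> \<in>. s.TA"
 by (simp add: A.Omega1_carrier)

lemma Omega_map_ex1: "\<exists>!g. g \<in> extensional (carrier A.Om) \<and> g \<in> ring_hom A.Om B.Om \<and> linear_map K A.Om B.Om g \<and>
   (\<forall>a\<in>carrier A. g (A.\<phi> a) = B.\<phi> (f a) \<and> g (A.dOm (A.\<phi> a)) = B.dOm (B.\<phi> (f a)))" (is "\<exists>!g. ?P g")
proof -
 obtain h where h: "linear_map K A.Om B.Om h" "h \<one>\<^sub>A.Om = \<one>\<^sub>B.Om"
  "\<forall>x\<in>carrier A.Om. \<forall>y\<in>carrier A.Om. h (x \<otimes>\<^sub>A.Om y) = h x \<otimes>\<^sub>B.Om h y"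
  "\<forall>a\<in>carrier A. h (A.\<phi> a) = B.\<phi> (f a)" "\<forall>m\<in>carrier (Omega1 K A S). h (one_form K A S m) = one_form K B U (s.tm m)"
  using A.Om.TA_universal[OF B.Omega.assoc_algebra_axioms lin_comp[OF s.f_linear B.fn_linear] lin_comp[OF tm_Omega1 B.one_form_linear]]
  by (auto simp: s.f_one s.f_mult B.fn_simps s.f_simps s.tm_lact s.tm_ract Omega1_T B.Om.inr_l B.Om.inr_r lin_closed[OF tm_Omega1])
 let ?h = "restrict h (carrier A.Om)"
 show ?thesis
 proof (rule ex1I[of _ ?h])
  show "?P ?h"
   using h lin_closed[OF h(1)] lin_restrict[OF h(1) A.Om_module]
   by (auto simp: ring_hom_def A.fn_simps A.d_fn B.d_fn A.dfn_simps s.f_simps A.univ_der_closed tm_univ_der lin_add[OF h(1)])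
  fix g assume g: "?P g"
  note gm = conjunct1[OF conjunct2[OF g]]
  show "g = ?h"
  proof (rule extensionalityI[of _ "carrier A.Om"])
   fix x assume "x \<in>. A.Om"
   then have "g x = h x"
   proof (induction x rule: A.Om_induct)
    case (mult x y)
    then show ?case using h(3) ring_hom_mult[OF gm] by simp
   next
    case (dfn a)
    then show ?case using g h(5) by (metis A.d_fn B.d_fn A.univ_der_closed tm_univ_der lin_closed[OF s.f_linear])
   qed (use g h in \<open>auto simp: linear_map_def\<close>)
   then show "g x = ?h x" using \<open>x \<in>. A.Om\<close> by simp
  qed (use g in auto)
 qed
qed

lemmas Omega_map_props = theI'[OF Omega_map_ex1, folded Omega_map_def]

lemma M_linear: "linear_map K A.Om B.Om M"
 and M_fn: "a \<in>. A ==> M (A.\<phi> a) = B.\<phi> (f a)"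
 and M_mult: "x \<in>. A.Om ==> y \<in>. A.Om ==> M (x \<otimes>\<^sub>A.Om y) = M x \<otimes>\<^sub>B.Om M y"
 using Omega_map_props ring_hom_mult[of M A.Om B.Om] by blast+

lemma M_dfn: "a \<in>. A ==> M (A.\<delta> a) = B.\<delta> (f a)"
 using Omega_map_props A.d_fn[of a] B.d_fn[of "f a"] by (auto simp: s.f_simps)

lemmas M_simps = lin_simps[OF M_linear] lin_mod_simps[OF M_linear A.Om_module B.Om_module]

text \<open>\<open>Omega_map\<close> is specified only on functions and their differentials.
  One-forms are sums of terms u dv, where both sides are products of known values.\<close>

lemma M_one_form: "\<xi> \<in>. Omega1 K A S ==> M (one_form K A S \<xi>) = one_form K B U (s.tm \<xi>)"
proof -
 note l = lin_comp[OF A.one_form_linear M_linear] and r = lin_comp[OF tm_Omega1 B.one_form_linear]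
 assume x: "\<xi> \<in>. Omega1 K A S"
 have "\<xi> \<in> {x \<in> carrier (Omega1 K A S). M (one_form K A S x) \<ominus>\<^sub>B.Om one_form K B U (s.tm x) = \<zero>\<^sub>B.Om}"
 proof (rule A.Omega1_into[OF lin_id A.Om.M.module_axioms lin_kernel_submodule[OF lin_diff[OF l r B.Om_module] A.Om.M.module_axioms B.Om_module] _ x])
  fix u v assume uv: "u \<in>. A" "v \<in>. A"
  then have "M (one_form K A S (lact K A S u (univ_der K A S v))) = one_form K B U (s.tm (lact K A S u (univ_der K A S v)))"
   by (simp add: A.one_form_udv s.tm_lact Omega1_T A.univ_der_closed tm_univ_der B.one_form_udv s.f_simps M_mult M_fn M_dfn A.fn_simps A.dfn_simps)
  moreover have c: "lact K A S u (univ_der K A S v) \<in>. Omega1 K A S" using uv by (simp add: A.Om.lr_closed A.univ_der_closed)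
  ultimately show "lact K A S u (univ_der K A S v) \<in> {x \<in> carrier (Omega1 K A S). M (one_form K A S x) \<ominus>\<^sub>B.Om one_form K B U (s.tm x) = \<zero>\<^sub>B.Om}"
   using lin_closed[OF r c] by (simp add: B.Omega.r_neg a_minus_def)
 qed
 then show ?thesis using B.Omega.minus_eq_zero_iff[OF lin_closed[OF l x] lin_closed[OF r x]] by simp
qed

lemma M_sgm: "x \<in>. A.Om ==> M (A.\<sigma> x) = B.\<sigma> (M x)"
 by (induction x rule: A.Om_induct)
   (simp_all add: A.Om.sgm_inl B.Om.sgm_inl A.sgm_dfn B.sgm_dfn M_fn M_dfn s.f_simps A.dfn_simps M_simps A.Om.sgm_mult B.Om.sgm_mult
    A.Om.sgm_simps B.Om.sgm_simps M_mult)

text \<open>Both sides are odd derivations along the algebra map \<open>M\<close>: forms on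
  \<open>A\<close> act on forms on \<open>B\<close> through \<open>M\<close>. The same pattern gives
  \<open>M_contr\<close> and \<open>M2_dbl_contr\<close>.\<close>

lemma M_d: "x \<in>. A.Om ==> M (A.dOm x) = B.dOm (M x)"
 by (erule A.odd_derivation_unique[where N = B.Om and rN = "\<lambda>n y. n \<otimes>\<^sub>B.Om M y" and lN = "\<lambda>x n. M x \<otimes>\<^sub>B.Om n" and \<tau> = A.\<sigma>,
    OF lin_comp[OF A.d_linear M_linear] lin_comp[OF M_linear B.d_linear], rotated 4])
   (simp_all add: A.d_mult B.d_mult M_mult M_simps A.d_simps A.Om.sgm_simps M_sgm A.d_fn B.d_fn A.d_dfn B.d_dfn M_fn M_dfn s.f_simps)

lemma M_contr:
 assumes t: "\<theta> \<in>. Der K A S" and t': "\<theta>' \<in>. Der K B U" and rel: "\<And>a. a \<in>. A ==> \<theta>' (f a) = f (\<theta> a)"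
 shows "x \<in>. A.Om ==> M (A.ct \<theta> x) = B.ct \<theta>' (M x)"
 by (erule A.odd_derivation_unique[where N = B.Om and rN = "\<lambda>n y. n \<otimes>\<^sub>B.Om M y" and lN = "\<lambda>x n. M x \<otimes>\<^sub>B.Om n" and \<tau> = A.\<sigma>,
    OF lin_comp[OF A.contr_linear[OF t] M_linear] lin_comp[OF M_linear B.contr_linear[OF t']], rotated 4])
   (simp_all add: A.contr_mult[OF t] B.contr_mult[OF t'] M_mult M_simps A.contr_simps[OF t] A.Om.sgm_simps M_sgm A.contr_fn[OF t] B.contr_fn[OF t']
    A.contr_dfn[OF t] B.contr_dfn[OF t'] M_fn M_dfn s.f_simps rel A.Der_closed[OF t])

abbreviation "M2 \<equiv> tmap K A.Om {} B.Om {} M"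

lemmas M2_linear = A.O2.tmap_linear[OF B.O2.tensor_square_axioms M_linear disjI1, OF refl]
lemmas M2_tens = A.O2.tmap_tens[OF B.O2.tensor_square_axioms M_linear disjI1, OF refl]
lemmas M2_simps = lin_simps[OF M2_linear] lin_mod_simps[OF M2_linear A.W.M.module_axioms B.W.M.module_axioms]

lemma M2_lact: "x \<in>. A.Om ==> t \<in>. A.W ==> M2 (lact K A.Om {} x t) = lact K B.Om {} (M x) (M2 t)"
 by (erule A.O2.tsq_ext[OF lin_comp[OF A.O2.lact_linear M2_linear] lin_comp[OF M2_linear B.O2.lact_linear] B.W.M.module_axioms, rotated 3])
   (simp_all add: M2_tens A.O2.lact_tens B.O2.lact_tens M_mult M_simps)

lemma M2_ract: "x \<in>. A.Om ==> t \<in>. A.W ==> M2 (ract K A.Om {} t x) = ract K B.Om {} (M2 t) (M x)"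
 by (erule A.O2.tsq_ext[OF lin_comp[OF A.O2.ract_linear M2_linear] lin_comp[OF M2_linear B.O2.ract_linear] B.W.M.module_axioms, rotated 3])
   (simp_all add: M2_tens A.O2.ract_tens B.O2.ract_tens M_mult M_simps)

lemma M2_fn2: "t \<in>. tsq K A {} ==> M2 (A.\<phi>2 t) = B.\<phi>2 (tm0 t)"
 by (erule A.A2.tsq_ext[OF lin_comp[OF A.fn2_linear M2_linear] lin_comp[OF s0.tm_linear B.fn2_linear] B.W.M.module_axioms, rotated])
   (simp add: A.fn2_tens B.fn2_tens M2_tens s0.tm_tens M_fn A.fn_simps s.f_simps)

lemma Delta_f: "a \<in>. A ==> tm0 (A.\<Delta> a) = B.\<Delta> (f a)"
 by (simp add: Delta_def s0.tm_simps A.TA.lr_closed s0.tm_lact s0.tm_ract f_e s.f_simps)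

lemma M2_dbl_contr: "x \<in>. A.Om ==> M2 (A.dct A.\<Delta> x) = B.dct B.\<Delta> (M x)"
 by (erule A.odd_derivation_unique[where N = B.W and rN = "\<lambda>n y. ract K B.Om {} n (M y)" and lN = "\<lambda>x n. lact K B.Om {} (M x) n" and \<tau> = A.\<sigma>,
    OF lin_comp[OF A.dbl_contr_linear[OF A.Delta_DDer] M2_linear] lin_comp[OF M_linear B.dbl_contr_linear[OF B.Delta_DDer]], rotated 4])
   (simp_all add: A.dbl_contr_mult[OF A.Delta_DDer] B.dbl_contr_mult[OF B.Delta_DDer] M_mult M_simps M2_simps M2_lact M2_ract A.W.lr_closed
    A.dbl_contr_simps[OF A.Delta_DDer] A.Om.sgm_simps M_sgm A.dbl_contr_fn[OF A.Delta_DDer] B.dbl_contr_fn[OF B.Delta_DDer]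
    A.dbl_contr_dfn[OF A.Delta_DDer] B.dbl_contr_dfn[OF B.Delta_DDer] M_fn M_dfn s.f_simps M2_fn2 Delta_f lin_closed[OF A.DDerD(1)[OF A.Delta_DDer]])

lemma M_evp: "x \<in>. A.Om ==> M (A.evp x) = B.evp (M x)" and M_odp: "x \<in>. A.Om ==> M (A.odp x) = B.odp (M x)"
 by (simp_all add: A.evp_def B.evp_def A.odp_def B.odp_def M_simps A.Om.sgm_simps M_sgm)

lemma M_diamond: "t \<in>. A.W ==> M (A.dia t) = B.dia (M2 t)"
 by (erule A.O2.tsq_ext[OF lin_comp[OF A.diamond_linear M_linear] lin_comp[OF M2_linear B.diamond_linear] B.Om_module, rotated])
   (simp add: A.diamond_tens B.diamond_tens M2_tens A.sw_def B.sw_def M_simps M_mult M_evp M_odp M_sgm A.evp_simps A.odp_simps A.Om.sgm_simps)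

lemma M_iota: "x \<in>. A.Om ==> M (A.iota A.\<Delta> x) = B.iota B.\<Delta> (M x)"
 by (simp add: iota_dd_def M_diamond M2_dbl_contr A.dbl_contr_simps[OF A.Delta_DDer])

text \<open>\<open>M\<close> is compatible with the product map and with \<open>diamond\<close>,
  hence with \<kappa>.\<close>

lemma M_super_comm: "x \<in> A.SC ==> M x \<in> B.SC"
proof -
 assume "x \<in> A.SC"
 then obtain t where t: "t \<in>. A.W" "x = A.\<kappa> t" unfolding A.super_comm_eq by blast
 have "M (A.\<mu> t) = B.\<mu> (M2 t)"
  by (rule A.O2.tsq_ext[OF lin_comp[OF A.O2.tmul_linear M_linear] lin_comp[OF M2_linear B.O2.tmul_linear] B.Om_module _ t(1)])
    (simp add: M2_tens A.O2.tmul_tens B.O2.tmul_tens M_mult M_simps)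
 then have "M x = B.\<kappa> (M2 t)"
  using t by (simp add: A.\<kappa>_def B.\<kappa>_def M_simps M_diamond A.tmul_simps A.diamond_simps)
 then show ?thesis using t by (simp add: B.\<kappa>_in M2_simps)
qed

lemma M_deg:
 assumes x: "x \<in> A.Omd n" shows "M x \<in> B.Omd n"
proof -
 let ?word = "tensor_word K A (Omega1 K A S) (lact K A S) (ract K A S)"
 have w: "M (?word u) \<in> B.Omd (length (filter (Not \<circ> isl) u))" if "u \<in> lists (carrier A <+> carrier (Omega1 K A S))" for u
  using that
 proof (induction u rule: lists.induct)
  case Nil
  then show ?case
   using M_fn[of "\<one>\<^sub>A"] B.fn_deg[of "\<one>\<^sub>B"] by (simp add: A.Om.word_Nil s.f_one A.fn_simps)
 next
  case (Cons x u)
  note c = A.Om.word_closed[OF Cons(2)] and wc = A.Om.word_Cons[OF Cons(1,2)]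
  show ?case
  proof (cases x)
   case (Inl a)
   then have a: "a \<in>. A" using Cons(1) by auto
   show ?thesis unfolding Inl wc[unfolded Inl] fn_def[symmetric]
    using B.Om.Tdeg_mult[OF B.fn_deg[OF lin_closed[OF s.f_linear a]] Cons(3)] a c by (simp add: M_mult M_fn A.fn_simps)
  next
   case (Inr m)
   then have a: "m \<in>. Omega1 K A S" using Cons(1) by auto
   show ?thesis unfolding Inr wc[unfolded Inr] one_form_def[symmetric]
    using B.Om.Tdeg_mult[OF B.one_form_deg[OF lin_closed[OF tm_Omega1 a]] Cons(3)] a c by (simp add: M_mult M_one_form lin_closed[OF A.one_form_linear])
  qed
 qed
 show ?thesis
  by (rule A.Om.Tdeg_into[OF M_linear B.Om_module B.Om.Tdeg_submodule _ x]) (use w in blast)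
qed

lemma DM_cl: "x \<in>. A.Om ==> DM (A.cl x) = B.cl (M x)"
proof -
 assume x: "x \<in>. A.Om"
 note r = A.rep_cl[OF x]
 show ?thesis unfolding DR_map_def
  using M_super_comm[OF r(2)] r(1) x by (simp add: B.cl_eq M_simps)
qed

lemma DM_linear: "linear_map K A.DRm B.DRm DM"
 by (rule A.lin_DR[OF lin_comp[OF M_linear B.cl_linear]]) (rule DM_cl)

lemma DM_d: "X \<in>. A.DRm ==> DM (A.dD X) = B.dD (DM X)"
 by (erule A.DR_cases) (simp add: A.DR_d_cl B.DR_d_cl DM_cl M_simps A.d_simps M_d)

lemma DM_contr:
 assumes "\<theta> \<in>. Der K A S" "\<theta>' \<in>. Der K B U" "\<And>a. a \<in>. A ==> \<theta>' (f a) = f (\<theta> a)" "X \<in>. A.DRm"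
 shows "DM (A.cD \<theta> X) = B.cD \<theta>' (DM X)"
 using assms(4) by (rule A.DR_cases) (simp add: A.DR_contr_cl B.DR_contr_cl assms(1,2) DM_cl M_simps A.contr_simps M_contr[OF assms(1-3)])

lemma tm_surj: "s.tm ` carrier (Omega1 K A S) = carrier (Omega1 K B U)"
proof -
 have surj: "carrier (Omega1 K B U) \<subseteq> s.tm ` carrier (Omega1 K A S)"
 proof
  fix \<xi> assume x: "\<xi> \<in>. Omega1 K B U"
  show "\<xi> \<in> s.tm ` carrier (Omega1 K A S)"
  proof (rule B.Omega1_into[OF lin_id B.Om.M.module_axioms _ _ x])
   show "submodule (s.tm ` carrier (Omega1 K A S)) K (Omega1 K B U)"
    by (rule lin_image_submodule[OF tm_Omega1 A.Om.M.module_axioms B.Om.M.module_axioms])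
      (rule A.Om.M.submoduleI; simp)
   fix b c assume "b \<in>. B" "c \<in>. B"
   then obtain u v where uv: "u \<in>. A" "b = f u" "v \<in>. A" "c = f v" using s.f_surj by blast
   then have "lact K B U b (univ_der K B U c) = s.tm (lact K A S u (univ_der K A S v))"
    by (simp add: s.tm_lact Omega1_T A.univ_der_closed tm_univ_der)
   then show "lact K B U b (univ_der K B U c) \<in> s.tm ` carrier (Omega1 K A S)" using uv by (simp add: A.Om.lr_closed A.univ_der_closed)
  qed
 qed
 show ?thesis using surj lin_closed[OF tm_Omega1] by blast
qed

lemma DM_deg_1: "DM ` A.DRn (Suc 0) = B.DRn (Suc 0)"
proof -
 have "DM ` A.DRn (Suc 0) = (\<lambda>\<xi>. B.cl (one_form K B U (s.tm \<xi>))) ` carrier (Omega1 K A S)"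
  unfolding DR_deg_def A.Om.Tdeg_1 image_image by (rule image_cong) (simp_all add: DM_cl M_one_form lin_closed[OF A.one_form_linear])
 then show ?thesis unfolding DR_deg_def B.Om.Tdeg_1 tm_surj[symmetric] image_image .
qed

end



section \<open>Hamiltonian reduction\<close>

text \<open>Functions are even, so moving one cyclically around a form costs no sign.\<close>

lemma (in ncf) cl_commute:
 assumes x: "x \<in>. Om" and c: "c \<in>. A"
 shows "cl (x \<otimes>\<^sub>Om \<phi> c) = cl (\<phi> c \<otimes>\<^sub>Om x)"
proof -
 note [simp] = x c fn_simps(1)
 have "\<kappa> (tens K Om {} (\<phi> c) x) = \<phi> c \<otimes>\<^sub>Om x \<ominus>\<^sub>Om x \<otimes>\<^sub>Om \<phi> c"
  by (simp add: \<kappa>_tens sw_def evp_even odp_even Om.sgm_inl Om.sgm_simps)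
 then have "\<phi> c \<otimes>\<^sub>Om x \<ominus>\<^sub>Om x \<otimes>\<^sub>Om \<phi> c \<in> SC" using \<kappa>_in[of "tens K Om {} (\<phi> c) x"] by simp
 then show ?thesis using cl_eq[of "\<phi> c \<otimes>\<^sub>Om x" "x \<otimes>\<^sub>Om \<phi> c"] by simp
qed

locale reduction = nc_surj K A S e B U e' f + bis: bisymp K A S \<omega> x0
 for K :: "'k ring" and A :: "('k, 'a) module" and S e and B :: "('k, 'b) module" and U e' f \<omega> x0 +
 fixes w
 assumes w: "w \<in>. A" and fw: "f w = \<zero>\<^sub>B"
  and ker: "a \<in>. A ==> f a = \<zero>\<^sub>B ==> a \<in> lin_span K A {x \<otimes>\<^sub>A w \<otimes>\<^sub>A y | x y. x \<in>. A \<and> y \<in>. A}"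
  and moment: "A.iota A.\<Delta> x0 = A.\<delta> w"
begin

lemma ideal_gens: "{x \<otimes>\<^sub>A w \<otimes>\<^sub>A y | x y. x \<in>. A \<and> y \<in>. A} \<subseteq> carrier A"
 using w by (auto simp: subset_iff)

abbreviation "hm \<equiv> Ham K A S \<omega>"
abbreviation "DRA \<equiv> A.DRn (Suc 0)"

text \<open>Classes whose Hamiltonian derivation becomes inner on \<open>B\<close>, with
  \<open>b\<close> any element of \<open>B\<close>. They form a submodule, so that
  \<open>kernel_inner\<close> can be checked on generators.\<close>

definition "inner_forms = {\<beta> \<in> DRA. \<exists>b\<in>carrier B. \<forall>a\<in>carrier A. f (hm \<beta> a) = b \<otimes>\<^sub>B f a \<ominus>\<^sub>B f a \<otimes>\<^sub>B b}"

lemma hm_value: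
 assumes "\<beta> \<in> DRA" "a \<in>. A"
 shows "hm \<beta> a \<in>. A" "\<gamma> \<in> DRA ==> hm (\<beta> \<oplus>\<^sub>A.DRm \<gamma>) a = hm \<beta> a \<oplus>\<^sub>A hm \<gamma> a"
  "c \<in>. K ==> hm (c \<odot>\<^sub>A.DRm \<beta>) a = c \<odot>\<^sub>A hm \<beta> a"
 using assms A.Der_closed[OF bis.Ham_Der] lin_simps(2,3)[OF bis.Ham_linear] by (simp_all add: A.Der_ops)

lemma inner_forms_submodule: "submodule inner_forms K A.DRm"
proof -
 note D = A.DR_deg_submodule[of "Suc 0"]
 have sm: "c \<odot>\<^sub>A.DRm \<beta> \<in> inner_forms" if c: "c \<in>. K" and b: "\<beta> \<in> inner_forms" for c \<beta>
 proof -
  obtain b where b: "\<beta> \<in> DRA" "b \<in>. B" "\<forall>a\<in>carrier A. f (hm \<beta> a) = b \<otimes>\<^sub>B f a \<ominus>\<^sub>B f a \<otimes>\<^sub>B b"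
   using b by (auto simp: inner_forms_def)
  show ?thesis unfolding inner_forms_def
   using b c A.DR.submoduleE(4)[OF D]
   by (auto simp: hm_value s.f_simps B.smult_r_distr B.smult_mult_left B.smult_mult_right B.smult_r_minus a_minus_def intro!: bexI[of _ "c \<odot>\<^sub>B b"])
 qed
 show ?thesis
 proof (rule A.DR.submoduleI)
  show "inner_forms \<subseteq> carrier A.DRm" using A.DR_deg_closed by (auto simp: inner_forms_def)
  have "hm \<zero>\<^sub>A.DRm = \<zero>\<^bsub>Der K A S\<^esub>"
   using lin_zero[OF bis.Ham_linear submodule_module[OF A.DR_module D] A.Der_module] by simp
  then show "\<zero>\<^sub>A.DRm \<in> inner_forms"
   using A.DR.submodule_zero[OF D] unfolding inner_forms_def
   by (auto simp: A.Der_ops s.f_simps B.r_neg a_minus_def intro!: bexI[of _ "\<zero>\<^sub>B"])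
  show "\<ominus>\<^sub>A.DRm \<beta> \<in> inner_forms" if "\<beta> \<in> inner_forms" for \<beta>
  proof -
   have "\<beta> \<in>. A.DRm" using that A.DR_deg_closed by (auto simp: inner_forms_def)
   then have "\<ominus>\<^sub>A.DRm \<beta> = (\<ominus>\<^sub>K \<one>\<^sub>K) \<odot>\<^sub>A.DRm \<beta>" by (simp add: A.DR.smult_l_minus)
   then show ?thesis using sm[OF _ that] by simp
  qed
  fix \<beta> \<gamma> assume "\<beta> \<in> inner_forms" "\<gamma> \<in> inner_forms"
  then obtain b c where b: "\<beta> \<in> DRA" "b \<in>. B" "\<And>a. a \<in>. A ==> f (hm \<beta> a) = b \<otimes>\<^sub>B f a \<ominus>\<^sub>B f a \<otimes>\<^sub>B b"
   and c: "\<gamma> \<in> DRA" "c \<in>. B" "\<And>a. a \<in>. A ==> f (hm \<gamma> a) = c \<otimes>\<^sub>B f a \<ominus>\<^sub>B f a \<otimes>\<^sub>B c"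
   by (auto simp: inner_forms_def)
  have "f (hm (\<beta> \<oplus>\<^sub>A.DRm \<gamma>) a) = (b \<oplus>\<^sub>B c) \<otimes>\<^sub>B f a \<ominus>\<^sub>B f a \<otimes>\<^sub>B (b \<oplus>\<^sub>B c)" if a: "a \<in>. A" for a
   using a b(1,2) c(1,2) s.f_simps(1)[OF a]
   by (simp add: hm_value s.f_simps b(3) c(3) B.l_distr B.r_distr a_minus_def B.minus_add B.a_ac)
  then show "\<beta> \<oplus>\<^sub>A.DRm \<gamma> \<in> inner_forms"
   unfolding inner_forms_def using b(1,2) c(1,2) A.DR.submoduleE(5)[OF D] by blast
 qed (rule sm)
qed

lemma fdv_deg: "u \<in>. A ==> v \<in>. A ==> A.cl (A.\<phi> u \<otimes>\<^sub>A.Om A.\<delta> v) \<in> DRA"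
 using A.Om.Tdeg_mult[OF A.fn_deg A.dfn_deg] by (simp add: A.cl_deg)

lemma hm_lact:
 assumes T: "\<Theta> \<in>. DDer K A S" and u: "u \<in>. A"
 shows "hm (A.cl (A.\<phi> u \<otimes>\<^sub>A.Om A.iota \<Theta> x0)) = DDer_mul K A (DDer_lact K A u \<Theta>)"
 using bis.Ham_\<Psi>[OF A.DDer_lact_closed[OF T u]] by (simp add: A.iota_DDer_lact T u)

text \<open>As \<omega> is bi-symplectic, dv is a reduced contraction by some \<Theta>, and u dv has
  the derivation that inserts \<open>u\<close> between the factors of \<Theta>(a). Its values lie in
  the kernel of \<open>f\<close>.\<close>

lemma inner_forms_left:
 assumes u: "u \<in>. A" "f u = \<zero>\<^sub>B" and v: "v \<in>. A"
 shows "A.cl (A.\<phi> u \<otimes>\<^sub>A.Om A.\<delta> v) \<in> inner_forms"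
proof -
 obtain \<Theta> where T: "\<Theta> \<in>. DDer K A S" "A.\<delta> v = A.iota \<Theta> x0"
  using bij_betw_imp_surj_on[OF bis.iota_bij] A.dfn_deg[OF v] by blast
 let ?J = "tlift K A {} (tsq K A {}) (\<lambda>x y. tens K A {} x (u \<otimes>\<^sub>A y))"
 have "f (tmul K A {} (?J \<xi>)) = \<zero>\<^sub>B" if "\<xi> \<in>. tsq K A {}" for \<xi>
  by (rule A.A2.tsq_ext[OF lin_comp[OF A.A2.inner_l_linear[OF refl u(1)] lin_comp[OF A.A2.tmul_linear s.f_linear]]
     lin_const_zero[OF B.module_axioms] B.module_axioms _ that])
    (simp add: A.A2.inner_l_tens[OF refl u(1)] A.A2.tmul_tens s.f_mult s.f_simps u)
 then have "f (hm (A.cl (A.\<phi> u \<otimes>\<^sub>A.Om A.\<delta> v)) a) = \<zero>\<^sub>B" if "a \<in>. A" for a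
  using that lin_closed[OF A.DDerD(1)[OF T(1)]] by (simp add: T(2) hm_lact[OF T(1) u(1)] DDer_mul_def DDer_lact_def)
 then show ?thesis
  unfolding inner_forms_def using fdv_deg[OF u(1) v] by (auto simp: s.f_simps a_minus_def intro!: bexI[of _ "\<zero>\<^sub>B"])
qed

lemma inner_forms_w:
 assumes u: "u \<in>. A"
 shows "A.cl (A.\<phi> u \<otimes>\<^sub>A.Om A.\<delta> w) \<in> inner_forms"
proof -
 define m where "m = tmul K A {} (tlift K A {} (tsq K A {}) (\<lambda>x y. tens K A {} x (u \<otimes>\<^sub>A y)) e)"
 note D = A.DDer_mul_Delta[OF u, folded m_def]
 have m: "m \<in>. A" using D(1) u by simp
 \<comment> \<open>The sign of the witness reflects two conventions: \<Delta> is a e - e a, while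
   inner derivations are written b a - a b.\<close>
 have "f (hm (A.cl (A.\<phi> u \<otimes>\<^sub>A.Om A.\<delta> w)) a) = (\<ominus>\<^sub>B f m) \<otimes>\<^sub>B f a \<ominus>\<^sub>B f a \<otimes>\<^sub>B (\<ominus>\<^sub>B f m)" if a: "a \<in>. A" for a
 proof -
  have c: "f a \<in>. B" "f m \<in>. B" using a m by (simp_all add: s.f_simps)
  have "f (hm (A.cl (A.\<phi> u \<otimes>\<^sub>A.Om A.\<delta> w)) a) = f a \<otimes>\<^sub>B f m \<ominus>\<^sub>B f m \<otimes>\<^sub>B f a"
   using hm_lact[OF A.Delta_DDer u] D(2)[OF a] a m by (simp add: moment s.f_simps s.f_mult)
  also have "\<dots> = (\<ominus>\<^sub>B f m) \<otimes>\<^sub>B f a \<ominus>\<^sub>B f a \<otimes>\<^sub>B (\<ominus>\<^sub>B f m)" using c by algebra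
  finally show ?thesis .
 qed
 then show ?thesis unfolding inner_forms_def using fdv_deg[OF u w] m by (auto simp: s.f_simps intro!: bexI[of _ "\<ominus>\<^sub>B f m"])
qed

text \<open>For v = x w y the Leibniz rule gives u dx w y + u x dw y + u x w dy. After rotating
  functions to the front, the outer terms have a coefficient in the ideal of \<open>w\<close>, and
  the middle one is a multiple of dw.\<close>

lemma inner_forms_right:
 assumes u: "u \<in>. A" and v: "v \<in>. A" "f v = \<zero>\<^sub>B"
 shows "A.cl (A.\<phi> u \<otimes>\<^sub>A.Om A.\<delta> v) \<in> inner_forms"
proof (rule lin_span_map_into[OF _ A.module_axioms A.DR_module ideal_gens inner_forms_submodule _ ker[OF v]])
 show "linear_map K A A.DRm (\<lambda>v. A.cl (A.\<phi> u \<otimes>\<^sub>A.Om A.\<delta> v))"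
  by (rule lin_comp[OF lin_comp[OF A.dfn_linear A.O2.mult_left_linear] A.cl_linear]) (simp add: u A.fn_simps)
 fix h assume "h \<in> {x \<otimes>\<^sub>A w \<otimes>\<^sub>A y | x y. x \<in>. A \<and> y \<in>. A}"
 then obtain x y where h: "h = x \<otimes>\<^sub>A w \<otimes>\<^sub>A y" and [simp]: "x \<in>. A" "y \<in>. A" by blast
 note [simp] = w u A.fn_simps(1) A.dfn_simps(1)
 have comm: "A.cl ((A.\<phi> u \<otimes>\<^sub>A.Om A.\<delta> x) \<otimes>\<^sub>A.Om A.\<phi> c) = A.cl (A.\<phi> (c \<otimes>\<^sub>A u) \<otimes>\<^sub>A.Om A.\<delta> x)"
  if [simp]: "u \<in>. A" "x \<in>. A" "c \<in>. A" for u x c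
  using A.cl_commute[of "A.\<phi> u \<otimes>\<^sub>A.Om A.\<delta> x" c] by (simp add: A.fn_simps A.Omega.m_assoc)
 have "A.\<phi> u \<otimes>\<^sub>A.Om A.\<delta> h = (A.\<phi> u \<otimes>\<^sub>A.Om A.\<delta> x) \<otimes>\<^sub>A.Om A.\<phi> (w \<otimes>\<^sub>A y) \<oplus>\<^sub>A.Om
   ((A.\<phi> (u \<otimes>\<^sub>A x) \<otimes>\<^sub>A.Om A.\<delta> w) \<otimes>\<^sub>A.Om A.\<phi> y \<oplus>\<^sub>A.Om A.\<phi> (u \<otimes>\<^sub>A (x \<otimes>\<^sub>A w)) \<otimes>\<^sub>A.Om A.\<delta> y)"
  unfolding h by (simp add: A.dfn_mult A.fn_simps A.Omega.l_distr A.Omega.r_distr A.Omega.m_assoc A.Omega.a_assoc)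
 then have "A.cl (A.\<phi> u \<otimes>\<^sub>A.Om A.\<delta> h) = A.cl (A.\<phi> ((w \<otimes>\<^sub>A y) \<otimes>\<^sub>A u) \<otimes>\<^sub>A.Om A.\<delta> x) \<oplus>\<^sub>A.DRm
   (A.cl (A.\<phi> (y \<otimes>\<^sub>A (u \<otimes>\<^sub>A x)) \<otimes>\<^sub>A.Om A.\<delta> w) \<oplus>\<^sub>A.DRm A.cl (A.\<phi> (u \<otimes>\<^sub>A (x \<otimes>\<^sub>A w)) \<otimes>\<^sub>A.Om A.\<delta> y))"
  by (simp add: A.cl_simps(2) comm)
 also have "\<dots> \<in> inner_forms"
  by (intro A.DR.submoduleE(5)[OF inner_forms_submodule] inner_forms_left inner_forms_w) (simp_all add: s.f_mult s.f_simps fw)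
 finally show "A.cl (A.\<phi> u \<otimes>\<^sub>A.Om A.\<delta> h) \<in> inner_forms" .
qed

text \<open>The image of \<xi> is a sum of commutators of one-forms on \<open>B\<close>. Lifting
  these to \<zeta> on \<open>A\<close> and subtracting does not change the class of \<xi> and leaves
  \<gamma>, which vanishes as a tensor over \<open>B\<close>, so \<open>tm_kernel\<close>
  applies.\<close>

lemma kernel_inner:
 assumes b: "\<beta> \<in> DRA" and 0: "DM \<beta> = \<zero>\<^sub>B.DRm"
 shows "\<beta> \<in> inner_forms"
proof -
 obtain \<xi> where x: "\<xi> \<in>. Omega1 K A S" "\<beta> = A.cl (one_form K A S \<xi>)"
  using b unfolding DR_deg_def A.Om.Tdeg_1 by blast
 note ol = lin_simps[OF A.one_form_linear] lin_mod_simps[OF A.one_form_linear A.Om.M.module_axioms A.Om_module]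
 note tl = lin_simps[OF tm_Omega1] lin_mod_simps[OF tm_Omega1 A.Om.M.module_axioms B.Om.M.module_axioms]
 have "B.cl (one_form K B U (s.tm \<xi>)) = B.cl \<zero>\<^sub>B.Om" using 0 x by (simp add: DM_cl M_one_form ol B.cl_simps)
 then have "one_form K B U (s.tm \<xi>) \<in> B.SC"
  using x lin_closed[OF B.one_form_linear] by (subst (asm) B.cl_eq) (simp_all add: tl a_minus_def)
 from B.pr1_super_comm[OF this] have "s.tm \<xi> \<in> lin_span K (Omega1 K B U) B.comms1" using x by (simp add: B.pr1_one_form tl)
 moreover have "B.comms1 \<subseteq> s.tm ` lin_span K (Omega1 K A S) A.comms1"
 proof
  fix g assume "g \<in> B.comms1"
  then obtain c \<zeta> where g: "g = lact K B U c \<zeta> \<ominus>\<^bsub>Omega1 K B U\<^esub> ract K B U \<zeta> c" "c \<in>. B" "\<zeta> \<in>. Omega1 K B U" by blast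
  obtain u where u: "u \<in>. A" "c = f u" using g(2) s.f_surj by (metis imageE)
  obtain \<xi>' where y: "\<xi>' \<in>. Omega1 K A S" "\<zeta> = s.tm \<xi>'" using g(3) tm_surj by (metis imageE)
  have ge: "g = s.tm (lact K A S u \<xi>' \<ominus>\<^bsub>Omega1 K A S\<^esub> ract K A S \<xi>' u)"
   using u y by (simp add: g(1) tl A.Om.lr_closed s.tm_lact s.tm_ract Omega1_T)
  show "g \<in> s.tm ` lin_span K (Omega1 K A S) A.comms1" unfolding ge
   by (rule imageI, rule lin_span_base, rule CollectI, intro exI conjI, rule refl, rule u(1), rule y(1))
 qed
 ultimately have "s.tm \<xi> \<in> s.tm ` lin_span K (Omega1 K A S) A.comms1"
  using lin_span_least[OF lin_image_submodule[OF tm_Omega1 A.Om.M.module_axioms B.Om.M.module_axioms A.comms1_submodule]] by blast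
 then obtain \<zeta> where z: "\<zeta> \<in> lin_span K (Omega1 K A S) A.comms1" "s.tm \<xi> = s.tm \<zeta>" by blast
 have zc: "\<zeta> \<in>. Omega1 K A S" by (rule lin_span_closed[OF A.Om.M.module_axioms A.comms1_closed z(1)])
 have zz: "A.cl (one_form K A S \<zeta>) = \<zero>\<^sub>A.DRm"
 proof (rule lin_span_vanish[OF lin_comp[OF A.one_form_linear A.cl_linear] A.Om.M.module_axioms A.DR_module A.comms1_closed _ z(1)])
  fix g assume "g \<in> A.comms1"
  then obtain c \<zeta> where g: "g = lact K A S c \<zeta> \<ominus>\<^bsub>Omega1 K A S\<^esub> ract K A S \<zeta> c" "c \<in>. A" "\<zeta> \<in>. Omega1 K A S" by blast
  show "A.cl (one_form K A S g) = \<zero>\<^sub>A.DRm"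
   using g(2,3) A.cl_commute[OF ol(1) g(2)] lin_closed[OF A.cl_linear, of "A.\<phi> c \<otimes>\<^sub>A.Om one_form K A S \<zeta>"]
   by (simp add: g(1) ol A.Om.lr_closed A.Om.inr_l A.Om.inr_r A.cl_simps A.fn_simps A.DR.minus_eq_zero_iff)
 qed
 define \<gamma> where "\<gamma> = \<xi> \<ominus>\<^bsub>Omega1 K A S\<^esub> \<zeta>"
 have gc: "\<gamma> \<in>. Omega1 K A S" using x zc by (simp add: \<gamma>_def)
 have bg: "\<beta> = A.cl (one_form K A S \<gamma>)"
 proof -
  have "A.cl (one_form K A S \<gamma>) = \<beta> \<ominus>\<^sub>A.DRm \<zero>\<^sub>A.DRm"
   using x zc by (simp add: \<gamma>_def ol A.cl_simps zz)
  then show ?thesis using A.DR_deg_closed[OF b] by (simp add: a_minus_def)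
 qed
 have "s.tm \<gamma> = \<zero>\<^bsub>Omega1 K B U\<^esub>" using x(1) zc by (simp add: \<gamma>_def tl z(2) B.Om.M.r_neg a_minus_def)
 then have g0: "\<gamma> \<in> lin_span K s.TA {tens K A S x y | x y. x \<in>. A \<and> y \<in>. A \<and> (f x = \<zero>\<^sub>B \<or> f y = \<zero>\<^sub>B)}"
  by (intro s.tm_kernel) (simp_all add: Omega1_T gc B.Omega1_ops)
 have bil: "bilinear K A A A.DRm (\<lambda>u v. A.cl (A.\<phi> u \<otimes>\<^sub>A.Om A.\<delta> v))"
  by (rule bilinear_comp[OF bilinear_comp2[OF A.Omega.bilinear_mult A.fn_linear A.dfn_linear] A.cl_linear])
 have bal: "A.cl (A.\<phi> (u \<otimes>\<^sub>A r) \<otimes>\<^sub>A.Om A.\<delta> v) = A.cl (A.\<phi> u \<otimes>\<^sub>A.Om A.\<delta> (r \<otimes>\<^sub>A v))"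
  if "r \<in> S" "u \<in>. A" "v \<in>. A" for r u v
  using that A.S_sub by (simp add: subset_iff A.dfn_mult A.dfn_S A.fn_simps A.dfn_simps A.Omega.m_assoc)
 note G = A.tlift_linear[OF A.DR_module bil bal] and Gt = A.tlift_tens[OF A.DR_module bil bal]
 let ?G = "tlift K A S A.DRm (\<lambda>u v. A.cl (A.\<phi> u \<otimes>\<^sub>A.Om A.\<delta> v))"
 \<comment> \<open>\<open>?G\<close> sends u \<otimes> v to the class of u dv, which makes sense for
   all tensors; on one-forms it is minus the class of the form. The generators from
   \<open>tm_kernel\<close> are no one-forms themselves.\<close>
 have "\<beta> = \<ominus>\<^sub>A.DRm ?G \<gamma>"
  unfolding bg by (rule A.Omega1_value[OF lin_comp[OF A.one_form_linear A.cl_linear] G A.DR_module _ gc]) (simp_all add: Gt A.one_form_udv)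
 moreover have "?G \<gamma> \<in> inner_forms"
  by (rule lin_span_map_into[OF G A.tsq_module A.DR_module _ inner_forms_submodule _ g0])
    (auto simp: subset_iff Gt intro: inner_forms_left inner_forms_right)
 ultimately show ?thesis using A.DR.submoduleE(3)[OF inner_forms_submodule] by simp
qed

text \<open>By the Leibniz rule, f(\<theta>(x w y)) is a sum of terms with the factor f(w) or
  f(\<theta>(w)), so the ideal of \<open>w\<close> is respected as soon as \<theta>(w) is
  killed.\<close>

lemma Der_descends:
 assumes t: "\<theta> \<in>. Der K A S" and 0: "f (\<theta> w) = \<zero>\<^sub>B"
 shows "\<exists>\<theta>'\<in>carrier (Der K B U). \<forall>a\<in>carrier A. \<theta>' (f a) = f (\<theta> a)"
proof -
 note TD = A.DerD[OF t]
 note [simp] = lin_simps[OF TD(1)] w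
 have van: "f (\<theta> a) = \<zero>\<^sub>B" if "a \<in>. A" "f a = \<zero>\<^sub>B" for a
  by (rule lin_span_vanish[OF lin_comp[OF TD(1) s.f_linear] A.module_axioms B.module_axioms ideal_gens _ ker[OF that]])
    (auto simp: TD(2) s.f_simps s.f_mult fw 0)
 define r where "r b = (SOME a. a \<in>. A \<and> f a = b)" for b
 have r [simp]: "r b \<in>. A" "f (r b) = b" if "b \<in>. B" for b
 proof -
  have "\<exists>a. a \<in>. A \<and> f a = b" using that s.f_surj by (metis imageE)
  from someI_ex[OF this] show "r b \<in>. A" "f (r b) = b" by (simp_all add: r_def)
 qed
 have v: "f (\<theta> (r (f a))) = f (\<theta> a)" if "a \<in>. A" for a
 proof -
  have c: "f a \<in>. B" using that by (simp add: s.f_simps)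
  have "f (\<theta> (r (f a) \<ominus>\<^sub>A a)) = \<zero>\<^sub>B"
   by (rule van) (simp_all add: that c s.f_simps B.r_neg a_minus_def)
  then show ?thesis using that c by (simp add: lin_minus[OF TD(1) A.module_axioms A.module_axioms] s.f_simps B.minus_eq_zero_iff)
 qed
 have v': "f (\<theta> (r b)) = f (\<theta> a)" if "a \<in>. A" "b = f a" for a b using v that by simp
 have "restrict (\<lambda>b. f (\<theta> (r b))) (carrier B) \<in>. Der K B U"
 proof (rule B.DerI)
  show "linear_map K B B (\<lambda>b. f (\<theta> (r b)))"
  proof (rule linear_mapI)
   show "f (\<theta> (r (b \<oplus>\<^sub>B c))) = f (\<theta> (r b)) \<oplus>\<^sub>B f (\<theta> (r c))" if "b \<in>. B" "c \<in>. B" for b c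
    using that by (subst v'[of "r b \<oplus>\<^sub>A r c"]) (simp_all add: s.f_simps)
   show "f (\<theta> (r (k \<odot>\<^sub>B b))) = k \<odot>\<^sub>B f (\<theta> (r b))" if "b \<in>. B" "k \<in>. K" for b k
    using that by (subst v'[of "k \<odot>\<^sub>A r b"]) (simp_all add: s.f_simps)
  qed (simp add: s.f_simps)
  show "f (\<theta> (r (b \<otimes>\<^sub>B c))) = f (\<theta> (r b)) \<otimes>\<^sub>B c \<oplus>\<^sub>B b \<otimes>\<^sub>B f (\<theta> (r c))" if "b \<in>. B" "c \<in>. B" for b c
   using that by (subst v'[of "r b \<otimes>\<^sub>A r c"]) (simp_all add: s.f_simps s.f_mult TD(2))
  show "f (\<theta> (r u)) = \<zero>\<^sub>B" if u: "u \<in> U" for u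
  proof -
   obtain t where "t \<in> S" "u = f t" using u s.f_S by blast
   then show ?thesis using A.S_sub by (subst v'[of t]) (auto simp: TD(3) s.f_simps)
  qed
 qed
 moreover have "restrict (\<lambda>b. f (\<theta> (r b))) (carrier B) (f a) = f (\<theta> a)" if "a \<in>. A" for a
  using that v by (simp add: s.f_simps)
 ultimately show ?thesis by blast
qed

section \<open>The Hamilton operator of the reduced algebra\<close>

abbreviation "KB \<equiv> B.KC (Suc 0)"
abbreviation "\<omega>B \<equiv> DM \<omega>"

lemma DRA_closed: "\<beta> \<in> DRA ==> \<beta> \<in>. A.DRm"
 by (rule A.DR_deg_closed)

lemma \<omega>_closed: "\<omega> \<in>. A.DRm"
 by (simp add: bis.\<omega> A.cl_simps)

lemma Ham_w:
 assumes b: "\<beta> \<in> DRA" and k: "DM \<beta> \<in> KB"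
 shows "f (hm \<beta> w) = \<zero>\<^sub>B"
proof -
 note H = bis.Ham_Der[OF b]
 let ?x = "A.ct (hm \<beta>) x0"
 note c = A.contr_simps(1)[OF H bis.x0]
 have e: "\<beta> = A.cl ?x" using bis.contr_Ham[OF b] A.DR_contr_cl[OF H bis.x0] by (simp add: bis.\<omega>)
 have "DM \<beta> = B.cl (M ?x)" using arg_cong[OF e, of DM] DM_cl[OF c] by (rule trans)
 then have "DR_iota K B U B.\<Delta> (B.cl (M ?x)) = \<zero>\<^sub>B.Om" using k by simp
 then have "B.iota B.\<Delta> (M ?x) = \<zero>\<^sub>B.Om" using c by (simp add: B.DR_iota_cl[OF B.Delta_DDer] M_simps)
 then have "M (A.iota A.\<Delta> ?x) = \<zero>\<^sub>B.Om" using c by (simp add: M_iota)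
 \<comment> \<open>Contractions anticommute and the reduced contraction of \<omega> with \<Delta> is
   dw, so minus the function \<theta>(w) is left.\<close>
 moreover have "A.iota A.\<Delta> ?x = \<ominus>\<^sub>A.Om A.\<phi> (hm \<beta> w)"
  using A.iota_Delta_contr[OF H A.Delta_DDer bis.x0] w by (simp add: moment A.contr_dfn[OF H])
 ultimately have "\<ominus>\<^sub>B.Om B.\<phi> (f (hm \<beta> w)) = \<zero>\<^sub>B.Om"
  using hm_value(1)[OF b w] by (simp add: M_simps A.fn_simps M_fn)
 moreover have fb: "f (hm \<beta> w) \<in>. B" using hm_value(1)[OF b w] by (simp add: s.f_simps)
 ultimately have "B.\<phi> (f (hm \<beta> w)) = B.\<phi> \<zero>\<^sub>B"
  using B.Omega.minus_minus[of "B.\<phi> (f (hm \<beta> w))"] by (simp add: B.fn_simps)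
 then show ?thesis using fb by (intro B.fn_inj) simp_all
qed

text \<open>A relation rather than a function, since the one-form \<beta> above \<alpha> is not
  canonical; \<open>lifts_unique\<close> shows that the class of \<theta> is.\<close>

definition "lifts \<alpha> \<theta> \<longleftrightarrow> \<theta> \<in>. Der K B U \<and> (\<exists>\<beta>\<in>DRA. DM \<beta> = \<alpha> \<and> (\<forall>a\<in>carrier A. \<theta> (f a) = f (hm \<beta> a)))"

lemma lifts_ex: "\<alpha> \<in> KB ==> \<exists>\<theta>. lifts \<alpha> \<theta>"
proof -
 assume a: "\<alpha> \<in> KB"
 then have "\<alpha> \<in> DM ` DRA" using DM_deg_1 by simp
 then obtain \<beta> where b: "\<beta> \<in> DRA" "\<alpha> = DM \<beta>" by blast
 then show ?thesis using Der_descends[OF bis.Ham_Der[OF b(1)] Ham_w[OF b(1)]] a unfolding lifts_def by blast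
qed

lemma lifts_unique:
 assumes "lifts \<alpha> \<theta>" "lifts \<alpha> \<theta>'"
 shows "B.hcl \<theta> = B.hcl \<theta>'"
proof -
 interpret D: module K "Der K B U" by (rule B.Der_module)
 obtain \<beta> \<beta>' where t: "\<theta> \<in>. Der K B U" "\<theta>' \<in>. Der K B U" "\<beta> \<in> DRA" "\<beta>' \<in> DRA" "DM \<beta> = DM \<beta>'"
  and r: "\<And>a. a \<in>. A ==> \<theta> (f a) = f (hm \<beta> a)" "\<And>a. a \<in>. A ==> \<theta>' (f a) = f (hm \<beta>' a)"
  using assms by (auto simp: lifts_def)
 note bc = DRA_closed[OF t(3)] DRA_closed[OF t(4)]
 \<comment> \<open>The difference of \<beta> and \<beta>', written with a scalar so that
   \<open>hm_value\<close> evaluates it.\<close>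
 let ?g = "\<beta> \<oplus>\<^sub>A.DRm (\<ominus>\<^sub>K \<one>\<^sub>K) \<odot>\<^sub>A.DRm \<beta>'"
 have g1: "(\<ominus>\<^sub>K \<one>\<^sub>K) \<odot>\<^sub>A.DRm \<beta>' \<in> DRA" using A.DR.submoduleE(4)[OF A.DR_deg_submodule _ t(4)] by simp
 then have g: "?g \<in> DRA" using A.DR.submoduleE(5)[OF A.DR_deg_submodule t(3)] by simp
 have "DM ?g = \<zero>\<^sub>B.DRm"
  using bc lin_closed[OF DM_linear bc(2)] by (simp add: lin_simps[OF DM_linear] t(5) B.DR.smult_l_minus B.DR.r_neg)
 from kernel_inner[OF g this] obtain b where b: "b \<in>. B" "\<And>a. a \<in>. A ==> f (hm ?g a) = b \<otimes>\<^sub>B f a \<ominus>\<^sub>B f a \<otimes>\<^sub>B b"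
  by (auto simp: inner_forms_def)
 have "\<theta> \<ominus>\<^bsub>Der K B U\<^esub> \<theta>' \<in> Inn K B U"
 proof (rule B.InnI[OF _ b(1)])
  fix c assume c: "c \<in>. B"
  then obtain a where a: "a \<in>. A" "c = f a" using s.f_surj by (metis imageE)
  have "\<theta> \<ominus>\<^bsub>Der K B U\<^esub> \<theta>' = \<theta> \<oplus>\<^bsub>Der K B U\<^esub> (\<ominus>\<^sub>K \<one>\<^sub>K) \<odot>\<^bsub>Der K B U\<^esub> \<theta>'" using t by (simp add: D.smult_l_minus a_minus_def)
  then have "(\<theta> \<ominus>\<^bsub>Der K B U\<^esub> \<theta>') c = \<theta> c \<oplus>\<^sub>B (\<ominus>\<^sub>K \<one>\<^sub>K) \<odot>\<^sub>B \<theta>' c" using c by (simp add: B.Der_ops)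
  also have "\<dots> = f (hm ?g a)"
   unfolding a(2) r[OF a(1)] hm_value(2)[OF t(3) a(1) g1] using hm_value[OF t(4) a(1)] hm_value[OF t(3) a(1)] by (simp add: s.f_simps)
  finally show "(\<theta> \<ominus>\<^bsub>Der K B U\<^esub> \<theta>') c = b \<otimes>\<^sub>B c \<ominus>\<^sub>B c \<otimes>\<^sub>B b" using b(2) a by simp
 qed (simp add: t)
 then show ?thesis using t by (simp add: B.HH1_eq)
qed

definition "Hop \<alpha> = B.hcl (SOME \<theta>. lifts \<alpha> \<theta>)"

lemma Hop_eq: "lifts \<alpha> \<theta> ==> Hop \<alpha> = B.hcl \<theta>"
 unfolding Hop_def by (rule lifts_unique[OF someI[of "lifts \<alpha>"]])

lemma Hop_cases:
 assumes "\<alpha> \<in> KB"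
 obtains \<theta> where "lifts \<alpha> \<theta>" "Hop \<alpha> = B.hcl \<theta>" "\<theta> \<in>. Der K B U"
 using lifts_ex[OF assms] Hop_eq lifts_def by metis

lemma Hop_linear: "linear_map K (B.DRm\<lparr>carrier := KB\<rparr>) (HH1 K B U) Hop"
proof (rule linear_mapI)
 interpret D: module K "Der K B U" by (rule B.Der_module)
 fix \<alpha> assume "\<alpha> \<in>. (B.DRm\<lparr>carrier := KB\<rparr>)"
 then have "\<alpha> \<in> KB" by simp
 then obtain \<theta> where t: "lifts \<alpha> \<theta>" "Hop \<alpha> = B.hcl \<theta>" "\<theta> \<in>. Der K B U" by (rule Hop_cases)
 obtain \<beta> where b: "\<beta> \<in> DRA" "DM \<beta> = \<alpha>" "\<forall>a\<in>carrier A. \<theta> (f a) = f (hm \<beta> a)" using t(1)[unfolded lifts_def] by blast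
 note DL = lin_simps(2,3)[OF DM_linear]
 show "Hop \<alpha> \<in>. HH1 K B U" using t by (simp add: B.HH1_carrier)
 show "Hop (c \<odot>\<^bsub>B.DRm\<lparr>carrier := KB\<rparr>\<^esub> \<alpha>) = c \<odot>\<^bsub>HH1 K B U\<^esub> Hop \<alpha>" if c: "c \<in>. K" for c
 proof -
  have "lifts (c \<odot>\<^sub>B.DRm \<alpha>) (c \<odot>\<^bsub>Der K B U\<^esub> \<theta>)"
   unfolding lifts_def
   using t(3) b c DL(2)[OF c DRA_closed[OF b(1)]] A.DR.submoduleE(4)[OF A.DR_deg_submodule c b(1)] hm_value(3)[OF b(1) _ c]
   by (intro conjI bexI[of _ "c \<odot>\<^sub>A.DRm \<beta>"]) (simp_all add: hm_value(1) s.f_simps, simp add: B.Der_ops s.f_simps hm_value(1))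
  then show ?thesis using t(2) lin_smult[OF B.HH1_proj c t(3)] by (simp add: Hop_eq)
 qed
 fix \<gamma> assume "\<gamma> \<in>. (B.DRm\<lparr>carrier := KB\<rparr>)"
 then have "\<gamma> \<in> KB" by simp
 then obtain \<psi> where u: "lifts \<gamma> \<psi>" "Hop \<gamma> = B.hcl \<psi>" "\<psi> \<in>. Der K B U" by (rule Hop_cases)
 obtain \<beta>' where b': "\<beta>' \<in> DRA" "DM \<beta>' = \<gamma>" "\<forall>a\<in>carrier A. \<psi> (f a) = f (hm \<beta>' a)" using u(1)[unfolded lifts_def] by blast
 have "lifts (\<alpha> \<oplus>\<^sub>B.DRm \<gamma>) (\<theta> \<oplus>\<^bsub>Der K B U\<^esub> \<psi>)"
  unfolding lifts_def
  using t(3) u(3) b b' DL(1)[OF DRA_closed[OF b(1)] DRA_closed[OF b'(1)]] A.DR.submoduleE(5)[OF A.DR_deg_submodule b(1) b'(1)] hm_value(2)[OF b(1) _ b'(1)]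
  by (intro conjI bexI[of _ "\<beta> \<oplus>\<^sub>A.DRm \<beta>'"]) (simp_all add: hm_value(1) s.f_simps, simp add: B.Der_ops s.f_simps hm_value(1))
 then show "Hop (\<alpha> \<oplus>\<^bsub>B.DRm\<lparr>carrier := KB\<rparr>\<^esub> \<gamma>) = Hop \<alpha> \<oplus>\<^bsub>HH1 K B U\<^esub> Hop \<gamma>"
  using t(2) u(2) lin_add[OF B.HH1_proj t(3) u(3)] by (simp add: Hop_eq)
qed

lemma Kcx_1: "Kcx K B U e' 1 = B.DRm\<lparr>carrier := KB\<rparr>"
 by (simp add: Kcx_def)

lemma Hop_induced: "induced_by_Ham K A S \<omega> B U e' f Hop"
 unfolding induced_by_Ham_def Kcx_1
proof (intro conjI ballI impI)
 show "Hop \<in> carrier (B.DRm\<lparr>carrier := KB\<rparr>) \<rightarrow> carrier (HH1 K B U)" using lin_closed[OF Hop_linear] by blast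
 fix \<beta> assume b': "\<beta> \<in> A.DRn 1" "DM \<beta> \<in>. (B.DRm\<lparr>carrier := KB\<rparr>)"
 have b: "\<beta> \<in> DRA" and k: "DM \<beta> \<in> KB" using b' by simp_all
 then obtain \<theta> where t: "\<theta> \<in>. Der K B U" "\<forall>a\<in>carrier A. \<theta> (f a) = f (hm \<beta> a)"
  using Der_descends[OF bis.Ham_Der[OF b] Ham_w[OF b k]] by blast
 then have "lifts (DM \<beta>) \<theta>" using b unfolding lifts_def by auto
 then have "\<theta> \<in> Hop (DM \<beta>)" using coset_self[OF B.Der_module B.Inn_submodule t(1)] by (simp add: Hop_eq)
 then show "\<exists>\<theta>\<in>Hop (DM \<beta>). \<forall>a\<in>carrier A. \<theta> (f a) = f (hm \<beta> a)" using t(2) by blast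
qed

text \<open>An induced operator has in its value at \<alpha> some derivation that descends
  \<open>Ham\<close> of a preimage of \<alpha>. That derivation lifts \<alpha>, and it determines
  its coset.\<close>

lemma Hop_unique:
 assumes H: "induced_by_Ham K A S \<omega> B U e' f H'" and a: "\<alpha> \<in> KB"
 shows "H' \<alpha> = Hop \<alpha>"
proof -
 have "\<alpha> \<in> DM ` DRA" using a DM_deg_1 by simp
 then obtain \<beta> where b: "\<beta> \<in> DRA" "\<alpha> = DM \<beta>" by blast
 have H1: "H' \<in> KB \<rightarrow> carrier (HH1 K B U)" and H2: "\<forall>\<beta>\<in>DRA. DM \<beta> \<in> KB \<longrightarrow> (\<exists>\<theta>\<in>H' (DM \<beta>). \<forall>a\<in>carrier A. \<theta> (f a) = f (hm \<beta> a))"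
  using H unfolding induced_by_Ham_def Kcx_1 by simp_all
 have c: "H' \<alpha> \<in>. HH1 K B U" using H1 a by (rule funcset_mem)
 obtain \<theta> where t: "\<theta> \<in> H' \<alpha>" "\<forall>a\<in>carrier A. \<theta> (f a) = f (hm \<beta> a)" using H2 b a by blast
 obtain \<psi> where p: "\<psi> \<in>. Der K B U" "H' \<alpha> = B.hcl \<psi>" using c B.HH1_carrier by auto
 note m = coset_memD[OF B.Der_module B.Inn_submodule p(1) t(1)[unfolded p(2)]]
 have "lifts \<alpha> \<theta>" unfolding lifts_def using m(1) b t(2) by blast
 then show ?thesis using m p by (simp add: Hop_eq)
qed

text \<open>Here the passage to the quotient takes effect: the reduced contraction of the image of
  \<omega> with \<Delta> is d of the image of \<open>w\<close>, which is zero.\<close>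

lemma \<omega>B_KC: "\<omega>B \<in> B.KC (Suc (Suc 0))"
proof -
 have eq: "\<omega>B = B.cl (M x0)" by (simp add: bis.\<omega> DM_cl)
 show ?thesis unfolding eq
  using M_deg[OF bis.x0d] M_iota[OF bis.x0] M_dfn[OF w] B.dfn_simps fw
  by (intro B.KC_I) (simp_all add: numeral_2_eq_2 moment)
qed

text \<open>The identity \<open>contr_Ham\<close> on \<open>A\<close>, pushed forward to
  \<open>B\<close>; contraction is natural for a derivation and its descent.\<close>

lemma contr_Hop: "\<alpha> \<in> KB ==> Kcx_contr K B U (Hop \<alpha>) \<omega>B = \<alpha>"
proof -
 assume "\<alpha> \<in> KB"
 then obtain \<theta> where t: "lifts \<alpha> \<theta>" "Hop \<alpha> = B.hcl \<theta>" "\<theta> \<in>. Der K B U" by (rule Hop_cases)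
 obtain \<beta> where b: "\<beta> \<in> DRA" "DM \<beta> = \<alpha>" "\<And>a. a \<in>. A ==> \<theta> (f a) = f (hm \<beta> a)" using t(1)[unfolded lifts_def] by blast
 show ?thesis
  unfolding Kcx_contr_def t(2) B.HH1_rep_hcl[OF t(3) \<omega>B_KC]
  using DM_contr[OF bis.Ham_Der[OF b(1)] t(3) b(3) \<omega>_closed] bis.contr_Ham[OF b(1)] b(2) by simp
qed

lemma Hop_hamilton: "hamilton_operator K (HH1 K B U) (Kcx K B U e') (\<lambda>n. B.dD) (\<lambda>x n. Kcx_Lie K B U x) (\<lambda>x n. Kcx_contr K B U x) Hop"
proof -
 interpret E: equivariant_complex K "HH1 K B U" "Kcx K B U e'" "\<lambda>n. B.dD" "\<lambda>x n. Kcx_Lie K B U x" "\<lambda>x n. Kcx_contr K B U x"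
  by (rule B.Kcx_complex)
 have d: "A.dD \<omega> = \<zero>\<^sub>A.DRm" using bis.bis by (simp add: bisymplectic_def)
 have "B.dD \<omega>B = \<zero>\<^sub>B.DRm"
  using DM_d[OF \<omega>_closed] lin_zero[OF DM_linear A.DR_module B.DR_module] d by simp
 then show ?thesis
  by (intro E.hamiltonI[where w = \<omega>B]) (use Hop_linear \<omega>B_KC contr_Hop in \<open>simp_all add: Kcx_def\<close>)
qed

lemma reduced_lie: "lie_algebra K (reduced_nat_lie K B U Hop)"
 and nat_map_ncl: "a \<in>. A ==> nat_map K B f (nat_class K A a) = nat_class K B (f a)"
 and nat_map_lie: "lie_morphism K (nat_lie K A S \<omega>) (reduced_nat_lie K B U Hop) (nat_map K B f)"
proof -
 have C0: "Kcx K B U e' 0 = B.DRm\<lparr>carrier := B.DRn 0\<rparr>" using B.KC_0 by (simp add: Kcx_def)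
 note bij = B.nat_to_DR_bij
 let ?m = "\<lambda>p q. Kcx_contr K B U (Hop (B.dD p)) (B.dD q)"
 have L: "lie_algebra K (B.DRm\<lparr>carrier := B.DRn 0, mult := ?m\<rparr>)"
  using hamilton_operator.lie_C0[OF Hop_hamilton B.half] by (simp add: C0)
 interpret L: lie_algebra K "B.DRm\<lparr>carrier := B.DRn 0, mult := ?m\<rparr>" by (rule L)
 have mc: "?m p q \<in> B.DRn 0" if "p \<in> B.DRn 0" "q \<in> B.DRn 0" for p q
  using lin_closed[OF L.bracket_linear_right[of p], of q] that by simp
 have n: "nat_to_DR K B U p \<in> B.DRn 0" if "p \<in>. B.NA" for p using bij_betwE[OF bij] that by blast
 show l: "lie_algebra K (reduced_nat_lie K B U Hop)"
  unfolding reduced_nat_lie_def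
 proof (rule B.nat_lieI[OF L])
  fix p q assume pq: "p \<in>. B.NA" "q \<in>. B.NA"
  note mm = mc[OF n[OF pq(1)] n[OF pq(2)]]
  show "nat_to_DR K B U (inv_into (carrier B.NA) (nat_to_DR K B U) (?m (nat_to_DR K B U p) (nat_to_DR K B U q))) = ?m (nat_to_DR K B U p) (nat_to_DR K B U q)"
   by (rule bij_betw_inv_into_right[OF bij mm])
  show "inv_into (carrier B.NA) (nat_to_DR K B U) (?m (nat_to_DR K B U p) (nat_to_DR K B U q)) \<in>. B.NA"
   using bij_betwE[OF bij_betw_inv_into[OF bij]] mm by blast
 qed
 show nm: "nat_map K B f (nat_class K A a) = nat_class K B (f a)" if a: "a \<in>. A" for a
 proof -
  note r = A.rep_ncl[OF a]
  have "f (rep (nat_class K A a) \<ominus>\<^sub>A a) \<in> lin_span K B B.comms"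
  proof (rule lin_span_map_into[OF s.f_linear A.module_axioms B.module_axioms A.comms_closed B.comms_submodule _ r(2)])
   fix h assume "h \<in> A.comms"
   then obtain u v where h: "h = u \<otimes>\<^sub>A v \<ominus>\<^sub>A v \<otimes>\<^sub>A u" "u \<in>. A" "v \<in>. A" by blast
   then have e: "f h = f u \<otimes>\<^sub>B f v \<ominus>\<^sub>B f v \<otimes>\<^sub>B f u" by (simp add: s.f_simps s.f_mult)
   show "f h \<in> lin_span K B B.comms" unfolding e
    by (rule lin_span_base, rule CollectI, intro exI conjI, rule refl, rule s.f_simps(1)[OF h(2)], rule s.f_simps(1)[OF h(3)])
  qed
  then show ?thesis unfolding nat_map_def using a r(1) by (simp add: B.ncl_eq s.f_simps)
 qed
 have carr: "carrier (nat_lie K A S \<omega>) = carrier A.NA" "carrier (reduced_nat_lie K B U Hop) = carrier B.NA"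
  by (simp_all add: nat_lie_def reduced_nat_lie_def)
 show "lie_morphism K (nat_lie K A S \<omega>) (reduced_nat_lie K B U Hop) (nat_map K B f)"
  unfolding lie_morphism_def
 proof (intro conjI ballI bis.nat_lie_lie l)
  have "linear_map K A.NA B.NA (nat_map K B f)"
  proof (rule linear_mapI)
   fix p assume "p \<in>. A.NA"
   then obtain a where a: "a \<in>. A" "p = nat_class K A a" using A.NA_carrier by auto
   show "nat_map K B f p \<in>. B.NA" using a by (simp add: nm B.NA_carrier s.f_simps)
   show "nat_map K B f (c \<odot>\<^sub>A.NA p) = c \<odot>\<^sub>B.NA nat_map K B f p" if "c \<in>. K" for c
    using a that by (simp add: nm s.f_simps lin_smult[OF A.ncl_linear, symmetric] lin_smult[OF B.ncl_linear, symmetric])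
   fix q assume "q \<in>. A.NA"
   then obtain b where b: "b \<in>. A" "q = nat_class K A b" using A.NA_carrier by auto
   show "nat_map K B f (p \<oplus>\<^sub>A.NA q) = nat_map K B f p \<oplus>\<^sub>B.NA nat_map K B f q"
    using a b by (simp add: nm s.f_simps lin_add[OF A.ncl_linear, symmetric] lin_add[OF B.ncl_linear, symmetric])
  qed
  then show "linear_map K (nat_lie K A S \<omega>) (reduced_nat_lie K B U Hop) (nat_map K B f)"
   by (simp add: linear_map_def nat_lie_def reduced_nat_lie_def)
  fix p q assume "p \<in>. nat_lie K A S \<omega>" "q \<in>. nat_lie K A S \<omega>"
  then obtain a b where ab: "a \<in>. A" "p = nat_class K A a" "b \<in>. A" "q = nat_class K A b"
   unfolding carr A.NA_carrier by blast
  note [simp] = ab(1,3) s.f_simps(1)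
  let ?b = "A.cl (A.\<delta> a)"
  have bD: "?b \<in> DRA" by (simp add: A.cl_deg A.dfn_deg)
  have al: "DM ?b = B.cl (B.\<delta> (f a))" by (simp add: DM_cl A.dfn_simps M_dfn)
  have "B.cl (B.\<phi> (f a)) \<in> B.KC 0" using B.KC_0 by (simp add: B.cl_deg B.fn_deg)
  \<comment> \<open>The kernel complex is everything in degree zero, so exact one-forms always lie
    in it.\<close>
  from B.KC_d[OF this] have k: "DM ?b \<in> KB" unfolding al by (simp add: B.DR_d_fn)
  obtain \<theta> where t: "\<theta> \<in>. Der K B U" "\<forall>a\<in>carrier A. \<theta> (f a) = f (hm ?b a)"
   using Der_descends[OF bis.Ham_Der[OF bD] Ham_w[OF bD k]] by blast
  then have H: "Hop (B.cl (B.\<delta> (f a))) = B.hcl \<theta>" using bD unfolding al[symmetric] by (intro Hop_eq) (auto simp: lifts_def)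
  have kb: "B.cl (B.\<delta> (f b)) \<in> KB" using B.KC_d[of "B.cl (B.\<phi> (f b))" 0] B.KC_0 by (simp add: B.cl_deg B.fn_deg B.DR_d_fn)
  \<comment> \<open>Both brackets come down to the class of f(hm(b)): the descended derivation takes
    f(b) to the image of the value of the original one at b.\<close>
  have "?m (B.cl (B.\<phi> (f a))) (B.cl (B.\<phi> (f b))) = nat_to_DR K B U (nat_class K B (f (hm ?b b)))"
   using t hm_value(1)[OF bD ab(3)]
   by (simp add: B.DR_d_fn H Kcx_contr_def B.HH1_rep_hcl[OF t(1) kb] B.DR_contr_dfn B.nat_to_DR_ncl)
  then have "nat_class K B (f a) \<otimes>\<^bsub>reduced_nat_lie K B U Hop\<^esub> nat_class K B (f b) = nat_class K B (f (hm ?b b))"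
   using hm_value(1)[OF bD ab(3)] bij_betw_inv_into_left[OF bij, of "nat_class K B (f (hm ?b b))"]
   by (simp add: reduced_nat_lie_def B.nat_to_DR_ncl B.NA_carrier)
  then show "nat_map K B f (p \<otimes>\<^bsub>nat_lie K A S \<omega>\<^esub> q) = nat_map K B f p \<otimes>\<^bsub>reduced_nat_lie K B U Hop\<^esub> nat_map K B f q"
   using hm_value(1)[OF bD ab(3)] by (simp add: ab(2,4) bis.nat_lie_ncl nm)
 qed
qed

end



section \<open>Smooth algebras\<close>

lemma lin_finsum:
 assumes f: "linear_map K M N f" and M: "module K M" and N: "module K N" and Y: "finite Y" and g: "\<And>x. x \<in> Y ==> g x \<in>. M"
 shows "f (\<Oplus>\<^sub>M x\<in>Y. g x) = (\<Oplus>\<^sub>N x\<in>Y. f (g x))"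
proof -
 interpret M: module K M by (rule M)
 interpret N: module K N by (rule N)
 show ?thesis
  using Y g by (induction Y) (simp_all add: lin_zero[OF f M N] Pi_def lin_closed[OF f] lin_add[OF f])
qed

context nc_surj
begin

abbreviation "T2 \<equiv> tsq K A {}"
abbreviation "En \<equiv> enveloping K A"

lemma En_simps: "carrier En = carrier T2" "\<zero>\<^sub>En = \<zero>\<^sub>T2" "x \<oplus>\<^sub>En y = x \<oplus>\<^sub>T2 y" "\<one>\<^sub>En = tens K A {} \<one>\<^sub>A \<one>\<^sub>A"
 by (simp_all add: enveloping_def)

text \<open>Left multiplication by a \<otimes> b is the outer action of a from the left and of b
  from the right, so linearity over the enveloping algebra is linearity for bimodules.\<close>

lemma En_mult:
 assumes z: "\<zeta> \<in>. T2"
 shows En_mult_linear: "linear_map K T2 T2 (\<lambda>\<xi>. \<xi> \<otimes>\<^sub>En \<zeta>)"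
  and En_mult_tens: "a \<in>. A ==> b \<in>. A ==> tens K A {} a b \<otimes>\<^sub>En \<zeta> = lact K A {} a (ract K A {} \<zeta> b)"
proof -
 let ?F = "\<lambda>x y. tlift K A {} T2 (\<lambda>u v. tens K A {} (x \<otimes>\<^sub>A u) (v \<otimes>\<^sub>A y)) \<zeta>"
 have F: "?F x y = lact K A {} x (ract K A {} \<zeta> y)" if [simp]: "x \<in>. A" "y \<in>. A" for x y
 proof -
  note b = bilinear_comp2[OF A.A2.tens_bilinear A.A2.mult_left_linear[OF that(1)] A.A2.mult_right_linear[OF that(2)]]
  have tt: "tlift K A {} T2 (\<lambda>u v. tens K A {} (x \<otimes>\<^sub>A u) (v \<otimes>\<^sub>A y)) (tens K A {} u v) = tens K A {} (x \<otimes>\<^sub>A u) (v \<otimes>\<^sub>A y)"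
   if "u \<in>. A" "v \<in>. A" for u v
   by (rule A.A2.tlift_tens[OF A.A2.tsq_module b]) (simp_all add: that)
  show ?thesis
   by (rule A.A2.tsq_ext[OF A.A2.tlift_linear[OF A.A2.tsq_module b] lin_comp[OF A.A2.ract_linear A.A2.lact_linear] A.A2.tsq_module _ z])
     (simp_all add: tt A.A2.lact_tens A.A2.ract_tens)
 qed
 have b: "bilinear K A A T2 ?F"
 proof (rule bilinearI)
  show "linear_map K A T2 (?F x)" if "x \<in>. A" for x
   by (rule lin_cong[OF lin_comp[OF bilinear2[OF A.TA.r_bilinear z] bilinear2[OF A.TA.l_bilinear that]] _ A.module_axioms]) (simp add: F that)
  show "linear_map K A T2 (\<lambda>x. ?F x y)" if "y \<in>. A" for y
   by (rule lin_cong[OF bilinear1[OF A.TA.l_bilinear A.TA.lr_closed(2)[OF that z]] _ A.module_axioms]) (simp add: F that)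
 qed
 note m = A.A2.tlift_linear[OF A.A2.tsq_module b] A.A2.tlift_tens[OF A.A2.tsq_module b]
 show "linear_map K T2 T2 (\<lambda>\<xi>. \<xi> \<otimes>\<^sub>En \<zeta>)" using m(1) by (simp add: enveloping_def)
 show "tens K A {} a b \<otimes>\<^sub>En \<zeta> = lact K A {} a (ract K A {} \<zeta> b)" if "a \<in>. A" "b \<in>. A"
  using m(2)[of a b] that by (simp add: enveloping_def F)
qed

lemma En_mult_one: "\<xi> \<in>. T2 ==> \<xi> \<otimes>\<^sub>En \<one>\<^sub>En = \<xi>"
 by (erule A.A2.tsq_ext[OF En_mult_linear lin_id A.A2.tsq_module, rotated 2])
   (simp_all add: En_simps En_mult_tens A.A2.lact_tens A.A2.ract_tens)

lemma En_mult_zero: "\<xi> \<in>. T2 ==> \<xi> \<otimes>\<^sub>En \<zero>\<^sub>En = \<zero>\<^sub>T2"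
 by (erule A.A2.tsq_ext[OF En_mult_linear lin_const_zero A.A2.tsq_module, rotated 3])
   (simp_all add: En_simps En_mult_tens A.TA.r1m A.TA.l2m A.A2.tsq_module)

text \<open>
 A dual basis of the projective bimodule of one-forms writes a derivation into \<open>B\<close> as the product
 map applied to a double derivation over the scalars; the sum over the dual basis is finite at each
 element of \<open>A\<close>.
\<close>

lemma smooth_scalar_lift:
 assumes sm: "smooth_algebra K A" and t: "\<theta> \<in>. Der K B U"
 shows "\<exists>\<Theta>. linear_map K A T2 \<Theta> \<and>
  (\<forall>a\<in>carrier A. \<forall>b\<in>carrier A. \<Theta> (a \<otimes>\<^sub>A b) = ract K A {} (\<Theta> a) b \<oplus>\<^sub>T2 lact K A {} a (\<Theta> b)) \<and>
  (\<forall>a\<in>carrier A. f (tmul K A {} (\<Theta> a)) = \<theta> (f a))"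
proof -
 \<comment> \<open>Smoothness speaks of one-forms relative to the scalars, so the base of the forms
   used here is the image of the scalars and not \<open>S\<close>.\<close>
 define S0 where "S0 = (\<lambda>c. c \<odot>\<^sub>A \<one>\<^sub>A) ` carrier K"
 have S0: "S0 \<subseteq> carrier A" by (auto simp: S0_def)
 interpret Z: nc K A S0 by unfold_locales (rule S0)
 let ?O = "Omega1 K A S0" and ?E = "env_module K A (Omega1 K A S0) (lact K A S0) (ract K A S0)"
 obtain X :: "('a \<times> 'a \<Rightarrow> 'k) set set" and s p where s: "linear_map En ?E (free_mod En X) s" and p: "linear_map En (free_mod En X) ?E p"
  and ps: "\<And>m. m \<in>. ?E ==> p (s m) = m"
  using conjunct2[OF sm[unfolded smooth_algebra_def Let_def projective_module_def, folded S0_def]] by (elim exE conjE) (rule that, assumption+, erule (1) bspec)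
 let ?act = "\<lambda>\<xi> m. tlift K A {} ?O (\<lambda>x y. ract K A S0 (lact K A S0 x m) y) \<xi>"
 have act: "linear_map K T2 ?O (\<lambda>\<xi>. ?act \<xi> m)" "\<And>a b. a \<in>. A ==> b \<in>. A ==> ?act (tens K A {} a b) m = ract K A S0 (lact K A S0 a m) b"
  if m: "m \<in>. ?O" for m
 proof -
  have b: "bilinear K A A ?O (\<lambda>x y. ract K A S0 (lact K A S0 x m) y)"
   by (rule bilinear_comp2[OF Z.Om.r_bilinear bilinear1[OF Z.Om.l_bilinear m] lin_id])
  note r = A.A2.tlift_linear[OF Z.Om.M.module_axioms b] A.A2.tlift_tens[OF Z.Om.M.module_axioms b]
  show "linear_map K T2 ?O (\<lambda>\<xi>. ?act \<xi> m)" using r(1) by simp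
  show "?act (tens K A {} a b) m = ract K A S0 (lact K A S0 a m) b" if "a \<in>. A" "b \<in>. A" for a b
   using r(2) that by simp
 qed
 have E: "carrier ?E = carrier ?O" "\<And>x y. x \<oplus>\<^sub>?E y = x \<oplus>\<^sub>?O y" "\<And>x y. x \<odot>\<^sub>?E y = ?act x y"
  by (simp_all add: env_module_def)
 note fm = free_mod_simps[where K = En, unfolded En_simps]
 have sc: "s m x \<in>. T2" "finite {x. s m x \<noteq> \<zero>\<^sub>T2}" "x \<notin> X ==> s m x = \<zero>\<^sub>T2" if "m \<in>. ?O" for m x
  using lin_closed[OF s] that unfolding fm E by blast+
 have sa: "s (m \<oplus>\<^sub>?O n) x = s m x \<oplus>\<^sub>T2 s n x" if "m \<in>. ?O" "n \<in>. ?O" for m n x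
  using lin_add[OF s] that unfolding fm E by simp
 have ss: "s (?act \<xi> m) x = \<xi> \<otimes>\<^sub>En s m x" if "m \<in>. ?O" "\<xi> \<in>. T2" for m \<xi> x
  using lin_smult[OF s] that unfolding fm E En_simps by simp
 \<comment> \<open>The elements a \<otimes> 1 and 1 \<otimes> a of the enveloping algebra show that
   each coordinate of \<open>s\<close> is a bimodule map.\<close>
 have sl: "s (lact K A S0 a m) x = lact K A {} a (s m x)" and sr: "s (ract K A S0 m a) x = ract K A {} (s m x) a"
  if m: "m \<in>. ?O" and a: "a \<in>. A" for m a x
  using ss[OF m, of "tens K A {} a \<one>\<^sub>A" x] ss[OF m, of "tens K A {} \<one>\<^sub>A a" x] a m
  by (simp_all add: act En_mult_tens sc Z.Om.l_one Z.Om.r_one Z.Om.lr_closed A.TA.l_one A.TA.r_one A.TA.lr_closed)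
 have sk: "s (c \<odot>\<^sub>?O m) x = c \<odot>\<^sub>T2 s m x" if m: "m \<in>. ?O" and c: "c \<in>. K" for m c x
  using ss[OF m, of "c \<odot>\<^sub>T2 tens K A {} \<one>\<^sub>A \<one>\<^sub>A" x] c m
  by (simp add: lin_smult[OF act(1)] act(2) lin_smult[OF En_mult_linear] En_mult_tens sc Z.Om.l_one Z.Om.r_one A.TA.l_one A.TA.r_one)
 note TD = B.DerD[OF t]
 note [simp] = lin_simps[OF TD(1)] s.f_simps
 have hb: "bilinear K A A B (\<lambda>u v. \<theta> (f u) \<otimes>\<^sub>B f v)"
  by (rule bilinear_comp2[OF B.bilinear_mult lin_comp[OF s.f_linear TD(1)] s.f_linear])
 have hbal: "\<theta> (f (x \<otimes>\<^sub>A r)) \<otimes>\<^sub>B f y = \<theta> (f x) \<otimes>\<^sub>B f (r \<otimes>\<^sub>A y)" if "r \<in> S0" "x \<in>. A" "y \<in>. A" for r x y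
  using that by (auto simp: S0_def A.smult_mult_left A.smult_mult_right B.smult_mult_left B.smult_mult_right)
 \<comment> \<open>The map of one-forms to \<open>B\<close> that sends da to \<theta>(f(a)). On all
   tensors it is right linear, and left linear up to a term containing the product map, which
   vanishes on one-forms.\<close>
 define h where "h = tlift K A S0 B (\<lambda>u v. \<theta> (f u) \<otimes>\<^sub>B f v)"
 have h: "linear_map K (tsq K A S0) B h" "\<And>u v. u \<in>. A ==> v \<in>. A ==> h (tens K A S0 u v) = \<theta> (f u) \<otimes>\<^sub>B f v"
  unfolding h_def by (rule Z.tlift_linear[OF B.module_axioms hb hbal], assumption+)
    (rule Z.tlift_tens[OF B.module_axioms hb hbal], assumption+)
 have OT: "m \<in>. tsq K A S0" "tmul K A S0 m = \<zero>\<^sub>A" if "m \<in>. ?O" for m using that by (simp_all add: Z.Omega1_carrier)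
 have hr: "h (ract K A S0 m b) = h m \<otimes>\<^sub>B f b" if b: "b \<in>. A" and m: "m \<in>. tsq K A S0" for m b
  by (rule Z.tsq_ext[OF lin_comp[OF Z.ract_linear[OF b] h(1)] lin_comp[OF h(1) B.A2.mult_right_linear] B.module_axioms _ m])
    (simp_all add: Z.ract_tens b h(2) s.f_mult B.m_assoc)
 have hl: "h (lact K A S0 b m) = \<theta> (f b) \<otimes>\<^sub>B f (tmul K A S0 m) \<oplus>\<^sub>B f b \<otimes>\<^sub>B h m"
  if b: "b \<in>. A" and m: "m \<in>. tsq K A S0" for m b
  by (rule Z.tsq_ext[OF lin_comp[OF Z.lact_linear[OF b] h(1)]
     lin_plus[OF lin_comp[OF lin_comp[OF Z.tmul_linear s.f_linear] B.A2.mult_left_linear] lin_comp[OF h(1) B.A2.mult_left_linear] B.module_axioms] B.module_axioms _ m])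
    (simp_all add: Z.lact_tens Z.tmul_tens b h(2) s.f_mult TD(2) B.m_assoc B.l_distr)
 have hO: "h m \<in>. B" if "m \<in>. ?O" for m using lin_closed[OF h(1) OT(1)[OF that]] .
 have hu: "h (univ_der K A S0 a) = \<theta> (f a)" if "a \<in>. A" for a
 proof -
  have "\<theta> \<one>\<^sub>B = \<zero>\<^sub>B"
  proof -
   have "\<theta> (\<one>\<^sub>B \<otimes>\<^sub>B \<one>\<^sub>B) = \<theta> \<one>\<^sub>B \<oplus>\<^sub>B \<theta> \<one>\<^sub>B" using TD(2)[of "\<one>\<^sub>B" "\<one>\<^sub>B"] by simp
   then show ?thesis by simp
  qed
  moreover have "h (univ_der K A S0 a) = \<theta> (f a) \<otimes>\<^sub>B f \<one>\<^sub>A \<ominus>\<^sub>B \<theta> (f \<one>\<^sub>A) \<otimes>\<^sub>B f a"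
   using that by (simp add: univ_der_def lin_minus[OF h(1) Z.tsq_module B.module_axioms] h(2))
  ultimately show ?thesis using that by (simp add: s.f_one a_minus_def)
 qed
 \<comment> \<open>An element of \<open>A\<close> above the value of \<open>h\<close> at the
   one-form belonging to the basis element \<open>x\<close>; it exists because \<open>f\<close> is
   surjective.\<close>
 define r where "r x = (if x \<in> X then SOME a. a \<in>. A \<and> f a = h (p (single En x)) else \<zero>\<^sub>A)" for x
 have sing: "single En x \<in>. free_mod En X" if "x \<in> X" for x
  using that by (auto simp: fm single_def En_simps intro: finite_subset[of _ "{x}"])
 have pc: "p g \<in>. ?O" if "g \<in>. free_mod En X" for g using lin_closed[OF p that] by (simp add: E)
 have rx: "r x \<in>. A \<and> f (r x) = h (p (single En x))" if "x \<in> X" for x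
 proof -
  have "h (p (single En x)) \<in> f ` carrier A" unfolding s.f_surj by (rule hO[OF pc[OF sing[OF that]]])
  then have "\<exists>a. a \<in>. A \<and> f a = h (p (single En x))" by (metis imageE)
  from someI_ex[OF this] show ?thesis by (simp add: r_def that)
 qed
 have rc [simp]: "r x \<in>. A" for x by (cases "x \<in> X") (simp_all add: rx, simp add: r_def)
 \<comment> \<open>Inserting \<open>r x\<close> on the inner side respects the outer bimodule
   structure, and multiplying out J x (a \<otimes> b) gives a lift of f(a) h(p x) f(b).\<close>
 define J where "J x = tlift K A {} T2 (\<lambda>u v. tens K A {} u (r x \<otimes>\<^sub>A v))" for x
 note Jl = A.A2.inner_l_linear[OF refl rc, folded J_def] and Jt = A.A2.inner_l_tens[OF refl rc, folded J_def]
 note Jact = A.A2.inner_l_lact[OF refl rc, folded J_def] A.A2.inner_l_ract[OF refl rc, folded J_def]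
 note Jc = lin_closed[OF Jl] and J0 = lin_zero[OF Jl A.A2.tsq_module A.A2.tsq_module]
 have ha: "h (?act \<xi> (p (single En x))) = f (tmul K A {} (J x \<xi>))" if x: "x \<in> X" and xi: "\<xi> \<in>. T2" for x \<xi>
 proof (rule A.A2.tsq_ext[OF _ lin_comp[OF Jl lin_comp[OF A.A2.tmul_linear s.f_linear]] B.module_axioms _ xi])
  note m = pc[OF sing[OF x]]
  show "linear_map K T2 B (\<lambda>\<xi>. h (?act \<xi> (p (single En x))))"
   by (rule lin_comp[OF lin_comp[OF act(1)[OF m] Z.Omega1_into_T] h(1)])
  show "h (?act (tens K A {} a b) (p (single En x))) = f (tmul K A {} (J x (tens K A {} a b)))" if ab: "a \<in>. A" "b \<in>. A" for a b
   using ab OT[OF m] OT[OF Z.Om.lr_closed(1)[OF ab(1) m]] hO[OF m]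
   by (simp add: act(2)[OF m] hr hl Jt A.A2.tmul_tens s.f_mult rx[OF x] B.m_assoc)
 qed
 \<comment> \<open>Induction on a finite set carrying the coordinates, with one basis element split
   off at a time.\<close>
 have hp: "h (p g) = f (tmul K A {} (\<Oplus>\<^sub>T2 x\<in>Y. J x (g x)))"
  if "finite Y" "Y \<subseteq> X" "\<And>x. g x \<in>. T2" "\<And>x. x \<notin> Y ==> g x = \<zero>\<^sub>T2" for g Y
  using that
 proof (induction Y arbitrary: g)
  case empty
  then have g: "g = (\<lambda>x. \<zero>\<^sub>T2)" by auto
  have gc: "g \<in>. free_mod En X" by (simp add: g fm)
  \<comment> \<open>The value of \<open>p\<close> at zero is found by scaling with zero, through
    compatibility with scalars.\<close>
  have "p (\<zero>\<^sub>T2 \<odot>\<^bsub>free_mod En X\<^esub> g) = ?act \<zero>\<^sub>T2 (p g)" using lin_smult[OF p _ gc, of "\<zero>\<^sub>T2"] by (simp add: E En_simps)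
  moreover have "\<zero>\<^sub>T2 \<odot>\<^bsub>free_mod En X\<^esub> g = g" using En_mult_zero by (simp add: fm g En_simps)
  ultimately have "p g = \<zero>\<^sub>?O" using lin_zero[OF act(1)[OF pc[OF gc]] A.A2.tsq_module Z.Om.M.module_axioms] by simp
  then show ?case by (simp add: Z.Omega1_ops lin_zero[OF h(1) Z.tsq_module B.module_axioms] lin_zero[OF A.A2.tmul_linear A.A2.tsq_module A.module_axioms])
 next
  case (insert y Y)
  define g' where "g' x = (if x = y then \<zero>\<^sub>T2 else g x)" for x
  have y: "y \<in> X" using insert.prems(1) by simp
  note gy = insert.prems(2)[of y] and gx = insert.prems(2)
  have IH: "h (p g') = f (tmul K A {} (\<Oplus>\<^sub>T2 x\<in>Y. J x (g' x)))"
   by (rule insert.IH) (use insert.prems in \<open>auto simp: g'_def\<close>)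
  have cong: "(\<Oplus>\<^sub>T2 x\<in>Y. J x (g' x)) = (\<Oplus>\<^sub>T2 x\<in>Y. J x (g x))"
   by (rule A.TA.M.finsum_cong') (use insert.hyps in \<open>auto simp: g'_def Jc gx\<close>)
  have gc: "g' \<in>. free_mod En X"
   unfolding fm using insert.prems insert.hyps(1) by (auto simp: g'_def intro!: finite_subset[of _ Y])
  have ge: "g = g y \<odot>\<^bsub>free_mod En X\<^esub> single En y \<oplus>\<^bsub>free_mod En X\<^esub> g'"
   using En_mult_one[OF gy] En_mult_zero[OF gy] by (simp add: fm g'_def single_def gx fun_eq_iff)
  have gs: "g y \<odot>\<^bsub>free_mod En X\<^esub> single En y \<in>. free_mod En X"
   using En_mult_one[OF gy] En_mult_zero[OF gy] y gy by (auto simp: fm single_def intro: finite_subset[of _ "{y}"])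
  have "p g = p (g y \<odot>\<^bsub>free_mod En X\<^esub> single En y \<oplus>\<^bsub>free_mod En X\<^esub> g')" by (rule arg_cong[OF ge])
  also have "\<dots> = ?act (g y) (p (single En y)) \<oplus>\<^sub>?O p g'"
   using lin_add[OF p gs gc] lin_smult[OF p _ sing[OF y], of "g y"] gy by (simp add: E En_simps)
  finally have "h (p g) = h (?act (g y) (p (single En y))) \<oplus>\<^sub>B h (p g')"
   using lin_add[OF h(1) OT(1)[OF lin_closed[OF act(1)[OF pc[OF sing[OF y]]] gy]] OT(1)[OF pc[OF gc]]] by (simp add: Z.Omega1_ops)
  also have "\<dots> = f (tmul K A {} (J y (g y) \<oplus>\<^sub>T2 (\<Oplus>\<^sub>T2 x\<in>Y. J x (g x))))"
   using A.TA.M.finsum_closed[of "\<lambda>x. J x (g x)" Y] by (simp add: ha y gx IH cong lin_simps[OF A.A2.tmul_linear] Jc Pi_def)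
  also have "J y (g y) \<oplus>\<^sub>T2 (\<Oplus>\<^sub>T2 x\<in>Y. J x (g x)) = (\<Oplus>\<^sub>T2 x\<in>insert y Y. J x (g x))"
   using insert.hyps by (simp add: Jc gx Pi_def)
  finally show ?case .
 qed
 \<comment> \<open>The dual basis sum; a lift of \<open>h\<close> on one-forms to a bimodule map
   with values in tensors over \<open>A\<close>, finite for each one-form.\<close>
 define G where "G m = (\<Oplus>\<^sub>T2 x\<in>{x. s m x \<noteq> \<zero>\<^sub>T2}. J x (s m x))" for m
 have G: "G m = (\<Oplus>\<^sub>T2 x\<in>Y. J x (s m x))" if "m \<in>. ?O" "finite Y" "{x. s m x \<noteq> \<zero>\<^sub>T2} \<subseteq> Y" for m Y
  unfolding G_def using that by (intro A.TA.M.add.finprod_mono_neutral_cong_left) (auto simp: J0 Jc sc)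
 have Gc: "G m \<in>. T2" if "m \<in>. ?O" for m unfolding G_def by (rule A.TA.M.finsum_closed) (auto simp: Jc sc that)
 have Ga: "G (m \<oplus>\<^sub>?O n) = G m \<oplus>\<^sub>T2 G n" if m: "m \<in>. ?O" and n: "n \<in>. ?O" for m n
 proof -
  let ?Y = "{x. s m x \<noteq> \<zero>\<^sub>T2} \<union> {x. s n x \<noteq> \<zero>\<^sub>T2}"
  have f: "finite ?Y" using sc(2)[OF m] sc(2)[OF n] by simp
  have "G (m \<oplus>\<^sub>?O n) = (\<Oplus>\<^sub>T2 x\<in>?Y. J x (s (m \<oplus>\<^sub>?O n) x))"
   using m n by (intro G f) (auto simp: sa simp del: Z.Omega1_ops)
  also have "\<dots> = (\<Oplus>\<^sub>T2 x\<in>?Y. J x (s m x) \<oplus>\<^sub>T2 J x (s n x))"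
   using m n by (intro A.TA.M.finsum_cong') (auto simp: sa lin_add[OF Jl] Jc sc simp del: Z.Omega1_ops)
  also have "\<dots> = (\<Oplus>\<^sub>T2 x\<in>?Y. J x (s m x)) \<oplus>\<^sub>T2 (\<Oplus>\<^sub>T2 x\<in>?Y. J x (s n x))"
   using m n by (intro A.TA.M.finsum_addf) (auto simp: Jc sc)
  also have "\<dots> = G m \<oplus>\<^sub>T2 G n"
   using G[OF m f] G[OF n f] by simp
  finally show ?thesis .
 qed
 \<comment> \<open>One statement for scalars and for both actions: \<open>q\<close> is any linear
   operation that commutes with the coordinates and with the insertions.\<close>
 have Gf: "G n = q (G m)" if q: "linear_map K T2 T2 q" and n: "n \<in>. ?O" and m: "m \<in>. ?O"
  and e: "\<And>x. s n x = q (s m x)" and c: "\<And>x \<xi>. \<xi> \<in>. T2 ==> J x (q \<xi>) = q (J x \<xi>)" for q n m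
 proof -
  let ?Y = "{x. s m x \<noteq> \<zero>\<^sub>T2}"
  have "G n = (\<Oplus>\<^sub>T2 x\<in>?Y. J x (s n x))"
   by (rule G[OF n sc(2)[OF m]], rule Collect_mono, rule impI, erule contrapos_nn)
     (simp only: e lin_zero[OF q A.A2.tsq_module A.A2.tsq_module])
  also have "\<dots> = (\<Oplus>\<^sub>T2 x\<in>?Y. q (J x (s m x)))"
   by (rule A.TA.M.finsum_cong') (simp_all add: Pi_def e c sc m Jc lin_closed[OF q])
  also have "\<dots> = q (G m)" unfolding G_def
   by (rule lin_finsum[OF q A.A2.tsq_module A.A2.tsq_module sc(2)[OF m], symmetric]) (simp add: Jc sc m)
  finally show ?thesis .
 qed
 let ?\<Theta> = "\<lambda>a. G (univ_der K A S0 a)"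
 note u = Z.univ_der_closed
 have "linear_map K A T2 ?\<Theta>"
 proof (rule linear_mapI)
  fix a assume a: "a \<in>. A"
  show "?\<Theta> a \<in>. T2" by (rule Gc[OF u[OF a]])
  show "?\<Theta> (c \<odot>\<^sub>A a) = c \<odot>\<^sub>T2 ?\<Theta> a" if c: "c \<in>. K" for c
   using c a u[OF a] by (subst lin_smult[OF Z.univ_der_linear c a], intro Gf lin_scale[OF lin_id A.A2.tsq_module c])
    (simp_all add: sk lin_smult[OF Jl])
  fix b assume b: "b \<in>. A"
  show "?\<Theta> (a \<oplus>\<^sub>A b) = ?\<Theta> a \<oplus>\<^sub>T2 ?\<Theta> b"
   unfolding lin_add[OF Z.univ_der_linear a b] by (rule Ga[OF u[OF a] u[OF b]])
 qed
 moreover have "?\<Theta> (a \<otimes>\<^sub>A b) = ract K A {} (?\<Theta> a) b \<oplus>\<^sub>T2 lact K A {} a (?\<Theta> b)" if a: "a \<in>. A" and b: "b \<in>. A" for a b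
 proof -
  note lr = Z.Om.lr_closed(2)[OF b u[OF a]] Z.Om.lr_closed(1)[OF a u[OF b]]
  have "?\<Theta> (a \<otimes>\<^sub>A b) = G (ract K A S0 (univ_der K A S0 a) b) \<oplus>\<^sub>T2 G (lact K A S0 a (univ_der K A S0 b))"
   using Ga[OF lr] by (simp add: Z.univ_der_mult[OF a b] Z.Omega1_ops)
  also have "G (ract K A S0 (univ_der K A S0 a) b) = ract K A {} (?\<Theta> a) b"
   by (rule Gf[OF A.A2.ract_linear[OF b] lr(1) u[OF a]]) (simp_all add: sr u a b Jact)
  also have "G (lact K A S0 a (univ_der K A S0 b)) = lact K A {} a (?\<Theta> b)"
   by (rule Gf[OF A.A2.lact_linear[OF a] lr(2) u[OF b]]) (simp_all add: sl u a b Jact)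
  finally show ?thesis .
 qed
 moreover have "f (tmul K A {} (?\<Theta> a)) = \<theta> (f a)" if a: "a \<in>. A" for a
 proof -
  have "h (p (s (univ_der K A S0 a))) = f (tmul K A {} (?\<Theta> a))"
   unfolding G_def using sc[OF u[OF a]] by (intro hp) auto
  then show ?thesis using ps u[OF a] hu[OF a] by (simp add: E)
 qed
 ultimately show ?thesis by blast
qed

text \<open>The double derivation is made to vanish on \<open>S\<close> by subtracting an inner one, using separability.\<close>

lemma smooth_lift:
 assumes sm: "smooth_algebra K A" and t: "\<theta> \<in>. Der K B U"
 shows "\<exists>\<Theta>\<in>carrier (DDer K A S). \<forall>a\<in>carrier A. f (DDer_mul K A \<Theta> a) = \<theta> (f a)"
proof -
 obtain \<Theta> where T: "linear_map K A T2 \<Theta>"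
  and Tm: "\<And>a b. a \<in>. A ==> b \<in>. A ==> \<Theta> (a \<otimes>\<^sub>A b) = ract K A {} (\<Theta> a) b \<oplus>\<^sub>T2 lact K A {} a (\<Theta> b)"
  and Tf: "\<And>a. a \<in>. A ==> f (tmul K A {} (\<Theta> a)) = \<theta> (f a)"
  using smooth_scalar_lift[OF sm t] by blast
 note [simp] = A.TA.lr_closed lin_closed[OF T] lin_simps(1)[OF A.A2.tmul_linear]
 note kb = bilinear_comp2[OF A.TA.r_bilinear T lin_id]
 define k where "k = tlift K A {} T2 (\<lambda>x y. ract K A {} (\<Theta> x) y)"
 have k: "linear_map K T2 T2 k" "\<And>x y. x \<in>. A ==> y \<in>. A ==> k (tens K A {} x y) = ract K A {} (\<Theta> x) y"
  unfolding k_def by (rule A.A2.tlift_linear[OF A.A2.tsq_module kb], simp) (rule A.A2.tlift_tens[OF A.A2.tsq_module kb], simp_all)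
 \<comment> \<open>The sum of \<Theta>(e') e'' over the separability element. The inner double
   derivation of \<open>c\<close> agrees on the base with \<Theta> up to sign.\<close>
 define c where "c = k e"
 have c [simp]: "c \<in>. T2" by (simp add: c_def lin_closed[OF k(1)])
 have Ss [simp]: "s \<in>. A" if "s \<in> S" for s using that A.S_sub by auto
 \<comment> \<open>The correction does not disturb the derivation of \<open>B\<close>: on base
   elements \<Theta> multiplies out to \<theta>, which vanishes there.\<close>
 have fc: "f (tmul K A {} c) = \<zero>\<^sub>B"
  unfolding c_def
 proof (rule lin_span_vanish[OF lin_comp[OF k(1) lin_comp[OF A.A2.tmul_linear s.f_linear]] A.A2.tsq_module B.module_axioms A.e_gens _ A.e_span])
  fix g assume "g \<in> {tens K A {} s t | s t. s \<in> S \<and> t \<in> S}"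
  then obtain s t where g: "g = tens K A {} s t" "s \<in> S" "t \<in> S" by blast
  have "f s \<in> U" using g(2) s.f_S by auto
  then show "f (tmul K A {} (k g)) = \<zero>\<^sub>B"
   using g by (simp add: k(2) A.A2.tmul_ract s.f_mult Tf B.DerD(3)[OF t] s.f_simps)
 qed
 have Ts: "\<Theta> s = ract K A {} c s \<ominus>\<^sub>T2 lact K A {} s c" if s: "s \<in> S" for s
 proof -
  \<comment> \<open>\<open>k\<close> is right linear, while on the left it picks up \<Theta>(s)
    times the product. Comparing both at \<open>e\<close>, where s e = e s and the product is the
    unit, gives the formula for \<Theta>(s).\<close>
  have "k (lact K A {} s \<xi>) = ract K A {} (\<Theta> s) (tmul K A {} \<xi>) \<oplus>\<^sub>T2 lact K A {} s (k \<xi>)" if "\<xi> \<in>. T2" for \<xi>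
   by (rule A.A2.tsq_ext[OF lin_comp[OF A.A2.lact_linear k(1)]
      lin_plus[OF lin_comp[OF A.A2.tmul_linear bilinear2[OF A.TA.r_bilinear]] lin_comp[OF k(1) A.A2.lact_linear] A.A2.tsq_module] A.A2.tsq_module _ that])
     (simp_all add: s A.A2.lact_tens k(2) A.A2.tmul_tens Tm A.TA.r1 A.TA.r_mult A.TA.l_r)
  from this[of e] have 1: "k (lact K A {} s e) = \<Theta> s \<oplus>\<^sub>T2 lact K A {} s c" using s by (simp add: c_def A.e_mul A.TA.r_one)
  have "k (ract K A {} \<xi> s) = ract K A {} (k \<xi>) s" if "\<xi> \<in>. T2" for \<xi>
   by (rule A.A2.tsq_ext[OF lin_comp[OF A.A2.ract_linear k(1)] lin_comp[OF k(1) A.A2.ract_linear] A.A2.tsq_module _ that])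
     (simp_all add: s A.A2.ract_tens k(2) A.TA.r_mult)
  from this[of e] have "ract K A {} c s = \<Theta> s \<oplus>\<^sub>T2 lact K A {} s c" using 1 by (simp add: c_def A.e_central[OF s])
  moreover have "\<Theta> s = (\<Theta> s \<oplus>\<^sub>T2 lact K A {} s c) \<ominus>\<^sub>T2 lact K A {} s c"
  proof -
   have "\<Theta> s \<in>. T2" "lact K A {} s c \<in>. T2" using s by simp_all
   then show ?thesis by algebra
  qed
  ultimately show ?thesis by simp
 qed
 let ?\<Phi> = "\<lambda>a. \<Theta> a \<oplus>\<^sub>T2 (lact K A {} a c \<ominus>\<^sub>T2 ract K A {} c a)"
 have "restrict ?\<Phi> (carrier A) \<in>. DDer K A S"
 proof (rule A.DDerI)
  show "linear_map K A T2 ?\<Phi>"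
   by (intro lin_plus lin_diff T bilinear1[OF A.TA.l_bilinear] bilinear2[OF A.TA.r_bilinear] A.A2.tsq_module c)
  show "?\<Phi> s = \<zero>\<^sub>T2" if s: "s \<in> S" for s
  proof -
   have "ract K A {} c s \<in>. T2" "lact K A {} s c \<in>. T2" using s by simp_all
   then show ?thesis unfolding Ts[OF s] by algebra
  qed
  show "?\<Phi> (a \<otimes>\<^sub>A b) = ract K A {} (?\<Phi> a) b \<oplus>\<^sub>T2 lact K A {} a (?\<Phi> b)" if [simp]: "a \<in>. A" "b \<in>. A" for a b
  proof -
   define p q r t u where pq: "p = lact K A {} a (lact K A {} b c)" "q = ract K A {} (ract K A {} c a) b" "r = ract K A {} (lact K A {} a c) b"
    "t = ract K A {} (\<Theta> a) b" "u = lact K A {} a (\<Theta> b)"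
   have cl: "p \<in>. T2" "q \<in>. T2" "r \<in>. T2" "t \<in>. T2" "u \<in>. T2" by (simp_all add: pq)
   have "(t \<oplus>\<^sub>T2 u) \<oplus>\<^sub>T2 (p \<ominus>\<^sub>T2 q) = (t \<oplus>\<^sub>T2 (r \<ominus>\<^sub>T2 q)) \<oplus>\<^sub>T2 (u \<oplus>\<^sub>T2 (p \<ominus>\<^sub>T2 r))" using cl by algebra
   then show ?thesis unfolding pq by (simp add: Tm A.TA.l_mult A.TA.r_mult A.TA.r1 A.TA.l2 A.TA.r1m A.TA.l2m A.TA.l_r)
  qed
 qed
 moreover have "f (DDer_mul K A (restrict ?\<Phi> (carrier A)) a) = \<theta> (f a)" if "a \<in>. A" for a
  using that s.f_simps(1)[OF that] B.Der_closed[OF t s.f_simps(1)[OF that]]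
  by (simp add: DDer_mul_def lin_simps[OF A.A2.tmul_linear] lin_mod_simps[OF A.A2.tmul_linear A.A2.tsq_module A.module_axioms] A.A2.tmul_lact A.A2.tmul_ract
    s.f_simps s.f_mult fc Tf a_minus_def)
 ultimately show ?thesis by blast
qed

end

context reduction
begin

lemma Kcx_contr_KB: "x \<in>. HH1 K B U ==> Kcx_contr K B U x \<omega>B \<in> KB"
 unfolding Kcx_contr_def by (rule B.KC_contr[OF B.HH1_rep(1) \<omega>B_KC])

text \<open>A double derivation above x gives a one-form on \<open>A\<close> whose Hamiltonian
  derivation descends to x and whose image is the contraction of \<omega> with x. So the
  representative of x itself is a lift in the sense of \<open>lifts\<close>.\<close>

lemma Hop_contr:
 assumes sm: "smooth_algebra K A" and x: "x \<in>. HH1 K B U"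
 shows "Hop (Kcx_contr K B U x \<omega>B) = x"
proof -
 note r = B.HH1_rep[OF x]
 obtain \<Theta> where T: "\<Theta> \<in>. DDer K A S" "\<And>a. a \<in>. A ==> f (DDer_mul K A \<Theta> a) = rep x (f a)"
  using smooth_lift[OF sm r(1)] by blast
 have "DM (bis.\<Psi> \<Theta>) = B.cD (rep x) \<omega>B"
  using DM_contr[OF A.DDer_mul_Der[OF T(1)] r(1) _ \<omega>_closed] T(2) bis.contr_\<Psi>[OF T(1)] by simp
 then have "lifts (Kcx_contr K B U x \<omega>B) (rep x)"
  unfolding lifts_def Kcx_contr_def
  using r(1) bis.\<Psi>_deg[OF T(1)] T(2) by (intro conjI bexI[of _ "bis.\<Psi> \<Theta>"]) (simp_all add: bis.Ham_\<Psi>[OF T(1)])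
 then show ?thesis using r(2) by (simp add: Hop_eq)
qed

lemma smooth_bij:
 assumes "smooth_algebra K A"
 shows "bij_betw (\<lambda>x. Kcx_contr K B U x \<omega>B) (carrier (HH1 K B U)) KB" "bij_betw Hop KB (carrier (HH1 K B U))"
proof -
 have c: "Hop \<alpha> \<in>. HH1 K B U" if "\<alpha> \<in> KB" for \<alpha> using lin_closed[OF Hop_linear] that by simp
 show "bij_betw (\<lambda>x. Kcx_contr K B U x \<omega>B) (carrier (HH1 K B U)) KB"
  by (rule bij_betwI[where g = Hop]) (rule funcsetI, erule Kcx_contr_KB, rule funcsetI, erule c, erule Hop_contr[OF assms], erule contr_Hop)
 show "bij_betw Hop KB (carrier (HH1 K B U))"
  by (rule bij_betwI[where g = "\<lambda>x. Kcx_contr K B U x \<omega>B"])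
    (rule funcsetI, erule c, rule funcsetI, erule Kcx_contr_KB, erule contr_Hop, erule Hop_contr[OF assms])
qed

end



section \<open>The reduced algebra\<close>

text \<open>A separability element of the source becomes the data of \<open>ncs\<close> for the
  image as base. It is applied to \<eta> and to \<eta> followed by the projection.\<close>

lemma (in alg_hom) separability_ncs:
 assumes S: "S = {}" "U = {}" and sep: "symmetric_separability_element K A e" and half: "\<exists>h\<in>carrier K. h \<oplus>\<^sub>K h = \<one>\<^sub>K"
 shows "ncs K B (f ` carrier A) (tm e)"
proof -
 have e: "e \<in>. tsq K A {}" "\<And>r. r \<in>. A ==> lact K A {} r e = ract K A {} e r" "tmul K A {} e = \<one>\<^sub>A"
  using sep by (simp_all add: symmetric_separability_element_def)
 have G: "{tens K B {} s t | s t. s \<in> f ` carrier A \<and> t \<in> f ` carrier A} \<subseteq> carrier (tsq K B {})"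
  using B.tens_closed f_simps(1) unfolding S by blast
 show ?thesis
 proof unfold_locales
  show "f ` carrier A \<subseteq> carrier B" using f_simps(1) by blast
  show "\<exists>h\<in>carrier K. h \<oplus>\<^sub>K h = \<one>\<^sub>K" by (rule half)
  have "tmap K A {} B {} f e \<in> lin_span K (tsq K B {}) {tens K B {} s t | s t. s \<in> f ` carrier A \<and> t \<in> f ` carrier A}"
  proof (rule A.tsq_into[unfolded S, OF tm_linear[unfolded S] B.tsq_module[unfolded S] lin_span_submodule[OF B.tsq_module[unfolded S] G] _ e(1)])
   fix x y assume xy: "x \<in>. A" "y \<in>. A"
   show "tmap K A {} B {} f (tens K A {} x y) \<in> lin_span K (tsq K B {}) {tens K B {} s t | s t. s \<in> f ` carrier A \<and> t \<in> f ` carrier A}"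
    unfolding tm_tens[unfolded S, OF xy]
    by (rule lin_span_base, rule CollectI, intro exI conjI, rule refl, rule imageI, rule xy(1), rule imageI, rule xy(2))
  qed
  then show "tm e \<in> lin_span K (tsq K B {}) {tens K B {} s t | s t. s \<in> f ` carrier A \<and> t \<in> f ` carrier A}" by (simp add: S)
  show "lact K B {} s (tm e) = ract K B {} (tm e) s" if "s \<in> f ` carrier A" for s
   using that e by (auto simp: S tm_lact[unfolded S, symmetric] tm_ract[unfolded S, symmetric])
  show "tmul K B {} (tm e) = \<one>\<^sub>B" using tmul_tm[unfolded S, OF e(1)] e(3) by (simp add: S f_one)
 qed
qed

text \<open>Turns the ideal into a span, so that linear maps on it can be tested on the elements x w
  y.\<close>

lemma (in assoc_algebra) genideal_span:
 assumes w: "w \<in>. A" and a: "a \<in> Idl\<^bsub>A\<^esub> {w}"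
 shows "a \<in> lin_span K A {x \<otimes>\<^sub>A w \<otimes>\<^sub>A y | x y. x \<in>. A \<and> y \<in>. A}" (is "_ \<in> lin_span K A ?G")
proof -
 have G: "?G \<subseteq> carrier A" using w by (auto simp: subset_iff)
 note J = lin_span_submodule[OF module_axioms G] and b = bilinear_mult
 have "ideal (lin_span K A ?G) A"
 proof (rule idealI[OF ring_axioms submodule.axioms(1)[OF J]])
  fix a x assume a: "a \<in> lin_span K A ?G" and x: "x \<in>. A"
  show "x \<otimes>\<^sub>A a \<in> lin_span K A ?G"
  proof (rule lin_span_map_into[OF bilinear2[OF b x] module_axioms module_axioms G J _ a])
   fix h assume "h \<in> ?G"
   then obtain u v where h: "h = u \<otimes>\<^sub>A w \<otimes>\<^sub>A v" and uv: "u \<in>. A" "v \<in>. A" by blast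
   have "x \<otimes>\<^sub>A h = (x \<otimes>\<^sub>A u) \<otimes>\<^sub>A w \<otimes>\<^sub>A v" using uv w x by (simp add: h m_assoc)
   then show "x \<otimes>\<^sub>A h \<in> lin_span K A ?G" using uv x m_closed by (intro lin_span_base) blast
  qed
  show "a \<otimes>\<^sub>A x \<in> lin_span K A ?G"
  proof (rule lin_span_map_into[OF bilinear1[OF b x] module_axioms module_axioms G J _ a])
   fix h assume "h \<in> ?G"
   then obtain u v where h: "h = u \<otimes>\<^sub>A w \<otimes>\<^sub>A v" and uv: "u \<in>. A" "v \<in>. A" by blast
   have "h \<otimes>\<^sub>A x = u \<otimes>\<^sub>A w \<otimes>\<^sub>A (v \<otimes>\<^sub>A x)" using uv w x by (simp add: h m_assoc)
   then show "h \<otimes>\<^sub>A x \<in> lin_span K A ?G" using uv x m_closed by (intro lin_span_base) blast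
  qed
 qed
 moreover have "w = \<one>\<^sub>A \<otimes>\<^sub>A w \<otimes>\<^sub>A \<one>\<^sub>A" using w by simp
 then have "w \<in> ?G" using one_closed by blast
 then have "w \<in> lin_span K A ?G" by (rule lin_span_base)
 ultimately have "Idl\<^bsub>A\<^esub> {w} \<subseteq> lin_span K A ?G" by (intro genideal_minimal) simp_all
 then show ?thesis using a by (rule subsetD)
qed

text \<open>The word canonically is rendered by the first conjunct: being induced by
  \<open>Ham\<close> determines the operator on the whole of K^1. The proof instantiates
  \<open>reduction\<close> at the quotient by the ideal of \<open>w\<close>.\<close>

theorem theorem7p2p3:
  fixes K :: "'k ring" and R :: "('k, 'r) module" and A :: "('k, 'a) module"
    and \<eta> :: "'r \<Rightarrow> 'a" and e :: "('r \<times> 'r \<Rightarrow> 'k) set"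
    and \<omega> :: "('k, 'a) form set" and \<mu> :: "'a set" and w :: 'a
  assumes "field K"
    and "\<forall>n::nat. n > 0 \<longrightarrow> [n] \<cdot>\<^bsub>K\<^esub> \<one>\<^bsub>K\<^esub> \<noteq> \<zero>\<^bsub>K\<^esub>"
    and "assoc_algebra K R" and "finite_dimensional K R" and "semisimple_ring R"
    and "symmetric_separability_element K R e"
    and "r_algebra K R A \<eta>"
    and "bisymplectic K A (\<eta> ` carrier R) \<omega>"
    and "is_moment_class K A (\<eta> ` carrier R) (tmap K R {} A {} \<eta> e) \<omega> \<mu>"
    and "w \<in> \<mu>"
  shows
    "let S = \<eta> ` carrier R;
         I = Idl\<^bsub>A\<^esub> {w};
         B = quot_mod A I;
         \<pi> = (\<lambda>a. I +>\<^bsub>A\<^esub> a);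
         T = \<pi> ` S;
         eB = tmap K R {} B {} (\<pi> \<circ> \<eta>) e;
         \<omega>B = DR_map K A S B T \<pi> \<omega>
     in \<exists>H.
       (induced_by_Ham K A S \<omega> B T eB \<pi> H \<and>
        (\<forall>H'. induced_by_Ham K A S \<omega> B T eB \<pi> H' \<longrightarrow>
           (\<forall>\<alpha>\<in>carrier (Kcx K B T eB 1). H' \<alpha> = H \<alpha>))) \<and>
       (hamilton_operator K (HH1 K B T) (Kcx K B T eB) (\<lambda>n. DR_d K B T)
          (\<lambda>x n. Kcx_Lie K B T x) (\<lambda>x n. Kcx_contr K B T x) H \<and>
        (\<forall>\<alpha>\<in>carrier (Kcx K B T eB 1). Kcx_contr K B T (H \<alpha>) \<omega>B = \<alpha>)) \<and>
       lie_morphism K (nat_lie K A S \<omega>) (reduced_nat_lie K B T H) (nat_map K B \<pi>) \<and>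
       (smooth_algebra K A \<longrightarrow>
          bij_betw (\<lambda>x. Kcx_contr K B T x \<omega>B) (carrier (HH1 K B T)) (carrier (Kcx K B T eB 1)) \<and>
          bij_betw H (carrier (Kcx K B T eB 1)) (carrier (HH1 K B T)) \<and>
          (\<forall>x\<in>carrier (HH1 K B T). H (Kcx_contr K B T x \<omega>B) = x) \<and>
          (\<forall>\<alpha>\<in>carrier (Kcx K B T eB 1). Kcx_contr K B T (H \<alpha>) \<omega>B = \<alpha>))"
proof -
 interpret K: field K by (rule assms(1))
 interpret R: assoc_algebra K R by (rule assms(3))
 interpret A: assoc_algebra K A using assms(7) by (simp add: r_algebra_def)
 have \<eta>: "\<eta> \<in> ring_hom R A" "linear_map K R A \<eta>" using assms(7) by (simp_all add: r_algebra_def)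
 \<comment> \<open>Characteristic zero makes 1 + 1 a unit of the field.\<close>
 have half: "\<exists>h\<in>carrier K. h \<oplus>\<^sub>K h = \<one>\<^sub>K"
 proof -
  have "[(2::nat)] \<cdot>\<^sub>K \<one>\<^sub>K = \<one>\<^sub>K \<oplus>\<^sub>K \<one>\<^sub>K" by (simp add: numeral_2_eq_2 add_pow_def)
  then have "\<one>\<^sub>K \<oplus>\<^sub>K \<one>\<^sub>K \<noteq> \<zero>\<^sub>K" using assms(2)[rule_format, of 2] by simp
  then have u: "\<one>\<^sub>K \<oplus>\<^sub>K \<one>\<^sub>K \<in> Units K" by (simp add: K.field_Units)
  define h where "h = inv\<^bsub>K\<^esub> (\<one>\<^sub>K \<oplus>\<^sub>K \<one>\<^sub>K)"
  have h: "h \<in>. K" using u by (simp add: h_def)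
  have "h \<otimes>\<^sub>K (\<one>\<^sub>K \<oplus>\<^sub>K \<one>\<^sub>K) = \<one>\<^sub>K" using u by (simp add: h_def)
  then show ?thesis using h by (auto simp: K.r_distr)
 qed
 let ?S = "\<eta> ` carrier R" and ?I = "Idl\<^bsub>A\<^esub> {w}"
 let ?B = "quot_mod A ?I" and ?\<pi> = "\<lambda>a. ?I +>\<^sub>A a" and ?eA = "tmap K R {} A {} \<eta> e"
 let ?T = "?\<pi> ` ?S" and ?eB = "tmap K R {} ?B {} (?\<pi> \<circ> \<eta>) e"
 have Ssub: "submodule ?S K A"
  by (rule lin_image_submodule[OF \<eta>(2) R.module_axioms A.module_axioms]) (rule R.submoduleI; simp)
 obtain x where x: "x \<in>. A" "\<mu> = ?S +>\<^sub>A x"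
  using assms(9) unfolding is_moment_class_def quot_carrier[OF A.module_axioms Ssub] by blast
 have w: "w \<in>. A" using coset_memD(1)[OF A.module_axioms Ssub x(1)] assms(10) x(2) by simp
 have I: "ideal ?I A" by (rule A.genideal_ideal) (simp add: w)
 note Is = A.ideal_submodule[OF I]
 interpret B: assoc_algebra K ?B by (rule A.quot_ideal(1)[OF I])
 have \<pi>: "linear_map K A ?B ?\<pi>" by (rule quot_proj_linear[OF A.module_axioms Is])
 have \<pi>0: "?\<pi> a = \<zero>\<^sub>?B \<longleftrightarrow> a \<in> ?I" if "a \<in>. A" for a
  using that coset_eq_iff[OF A.module_axioms Is that A.zero_closed] by (simp add: quot_zero[OF A.module_axioms Is] a_minus_def)
 have hA: "alg_hom K R {} A {} \<eta>"
  by unfold_locales (use \<eta> in \<open>simp_all add: ring_hom_mult ring_hom_one\<close>)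
 have hB: "alg_hom K R {} ?B {} (?\<pi> \<circ> \<eta>)"
  by unfold_locales (use \<eta> lin_comp[OF \<eta>(2) \<pi>] lin_closed[OF \<eta>(2)] in \<open>simp_all add: comp_def ring_hom_mult ring_hom_one A.quot_ideal(2)[OF I] quot_one[OF A.module_axioms Is]\<close>)
 interpret nA: ncs K A ?S ?eA by (rule alg_hom.separability_ncs[OF hA refl refl assms(6) half])
 have "?T = (?\<pi> \<circ> \<eta>) ` carrier R" by (simp add: image_comp)
 then interpret nB: ncs K ?B ?T ?eB using alg_hom.separability_ncs[OF hB refl refl assms(6) half] by simp
 have surj: "?\<pi> ` carrier A = carrier ?B" by (rule quot_carrier[OF A.module_axioms Is, symmetric])
 have m: "?\<pi> (x \<otimes>\<^sub>A y) = ?\<pi> x \<otimes>\<^sub>?B ?\<pi> y" if "x \<in>. A" "y \<in>. A" for x y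
  using A.quot_ideal(2)[OF I that] by simp
 have one: "?\<pi> \<one>\<^sub>A = \<one>\<^sub>?B" by (simp add: quot_one[OF A.module_axioms Is])
 interpret s: alg_surj K A ?S ?B ?T ?\<pi>
  by unfold_locales (simp_all add: \<pi> m one surj)
 interpret s0: alg_surj K A "{}" ?B "{}" ?\<pi>
  by unfold_locales (simp_all add: \<pi> m one surj)
 obtain x0 where x0: "x0 \<in> Omega_deg K A ?S 2" "\<omega> = DR_class K A ?S x0"
  using assms(8) unfolding bisymplectic_def DR_deg_def by blast
 \<comment> \<open>The separability element reaches \<open>B\<close> either directly or through
   \<open>A\<close>; \<Delta> of \<open>A\<close> and \<Delta> of \<open>B\<close> correspond
   because both ways agree.\<close>
 have fe: "tmap K A {} ?B {} ?\<pi> ?eA = ?eB"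
 proof -
  interpret hA: alg_hom K R "{}" A "{}" \<eta> by (rule hA)
  interpret hB: alg_hom K R "{}" ?B "{}" "?\<pi> \<circ> \<eta>" by (rule hB)
  have "e \<in>. tsq K R {}" using assms(6) by (simp add: symmetric_separability_element_def)
  then show ?thesis
   by (rule hA.A.tsq_ext[OF lin_comp[OF hA.tm_linear s0.tm_linear] hB.tm_linear nB.A2.tsq_module, rotated])
     (simp add: hA.tm_tens hB.tm_tens s0.tm_tens hA.f_simps)
 qed
 have x0c: "x0 \<in>. (Omega K A ?S)" by (rule nA.Om.Tdeg_closed[OF x0(1)])
 have "DR_iota K A ?S (Delta K A ?eA) \<omega> = Omega_d K A ?S (fn K A ?S w)"
  using assms(9,10) unfolding is_moment_class_def by simp
 then have mom: "iota_dd K A ?S (Delta K A ?eA) x0 = one_form K A ?S (univ_der K A ?S w)"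
  using w by (simp add: x0(2) nA.DR_iota_cl[OF nA.Delta_DDer x0c] nA.d_fn)
 interpret r: reduction K A ?S ?eA ?B ?T ?eB ?\<pi> \<omega> x0 w
 proof unfold_locales
  show "?\<pi> w = \<zero>\<^sub>?B" using \<pi>0[OF w] A.genideal_self'[OF w] by simp
  show "a \<in> lin_span K A {x \<otimes>\<^sub>A w \<otimes>\<^sub>A y | x y. x \<in>. A \<and> y \<in>. A}"
   if "a \<in>. A" "?\<pi> a = \<zero>\<^sub>?B" for a using that A.genideal_span[OF w] by (simp add: \<pi>0)
 qed (use fe assms(8) x0 w mom in simp_all)
 have k: "carrier (Kcx K ?B ?T ?eB 1) = nB.KC (Suc 0)" unfolding r.Kcx_1 by simp
 show ?thesis
  unfolding Let_def k
  using r.Hop_induced r.Hop_unique r.Hop_hamilton r.contr_Hop r.nat_map_lie r.smooth_bij r.Hop_contr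
  by (intro exI[of _ r.Hop] conjI allI impI ballI)
qed

end
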